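(* Let $0<\beta<2$, $p:=2/\beta-1$, and let $\phi:\mathbb{C}\to(-\infty,\infty]$ be a lower semi-continuous function of strictly super logarithmic growth, with $\{\phi<\infty\}$ not polar, satisfying the regularity assumption: there is a neighborhood $U$ of the support $S_\phi$ of the equilibrium measure $\mu_\phi$ such that $\phi\in C^5(U)$, $S_\phi$ is a domain with $C^1$-boundary, and $\Delta\phi>0$ on $S_\phi$. Consider the $N$-particle Coulomb gas in $\mathbb{C}$ at inverse temperature $\beta$ with exterior potential $V=N\phi$. Suppose that $A_\phi$ and $C_\phi$ are real constants (depending only on $\phi$ and $\beta$) such that for all $N\ge1$ and all $u\in H^1(\mathbb{C})$, with $U_N:=\frac1N\sum_{i=1}^N u(z_i)$, $$\frac{1}{\beta N^{2}}\log\mathbb{E}\left(e^{-\beta N^{2}U_N}\right)\leq-\mathcal{F}(\phi+u)+\mathcal{F}(\phi)+N^{-1}\left(-A_{\phi}E_{0}(\mu_{\phi+u})+C_{\phi}\right).$$ Then $A_{\phi}\leq p$.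
   Context: $d\lambda$ is Lebesgue measure on $\mathbb{C}=\mathbb{R}^2$, $\psi_0(z):=\log(1+|z|^2)$. A function $\phi$ has strictly super logarithmic growth if $\phi\ge(1+\epsilon)\psi_0-C$ for some constants $\epsilon>0$ and $C$. The $N$-particle Coulomb gas at inverse temperature $\beta$ with exterior potential $V$ is $\mathbb{C}^N$ with the probability measure proportional to $\prod_{i<j}|z_i-z_j|^{2\beta}\prod_ie^{-\beta V(z_i)}d\lambda^{\otimes N}$; $\mathbb{E}$ is its expectation. $H^1(\mathbb{C})$ is the space of $u\in L^2_{loc}(\mathbb{C})$ with distributional gradient $\nabla u\in L^2(\mathbb{C},d\lambda)$; convergence in the $H^1$-topology means convergence in $L^2_{loc}$ together with $L^2$-convergence of gradients. $E_0(\mu):=-\frac12\int\log|z-w|^2\mu\otimes\mu$ for probability measures with $\int\psi_0\mu<\infty$. For a probability measure $\mu$ on $\mathbb{C}$, $E_\phi(\mu):=-\frac12\int(\log|z-w|^2-\psi_0(z)-\psi_0(w))\mu\otimes\mu+\int(\phi-\psi_0)\mu$ (equal to $E_0(\mu)+\int\phi\mu$ if $\mu$ has compact support). If $E_\phi(\mu)<\infty$ and $u\in H^1(\mathbb{C})$, $\int u\,\mu$ denotes the value at $u$ of the unique extension of $v\mapsto\int v\mu$ from $C_c^\infty(\mathbb{C})$ to $H^1(\mathbb{C})$ continuous for the $H^1$-topology. $\mathcal{F}(\phi+u):=\inf_\mu(E_\phi(\mu)+\int u\mu)$ over $\mu$ with $E_\phi(\mu)<\infty$, with unique minimizer $\mu_{\phi+u}$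 (equilibrium measure). A closed set is here called a domain with $C^1$-boundary if it is the closure of a domain with $C^1$-boundary. *)

theory Defs
  imports "HOL-Probability.Probability"
begin

section \<open>Differentiability classes\<close>

text \<open>Only meant for open \<open>S\<close>: all partial derivatives up to order \<open>k\<close> exist and are continuous.\<close>

primrec Ck_on :: "nat \<Rightarrow> complex set \<Rightarrow> (complex \<Rightarrow> real) \<Rightarrow> bool" where
  "Ck_on 0 S f \<longleftrightarrow> continuous_on S f"
| "Ck_on (Suc k) S f \<longleftrightarrow> (\<forall>z\<in>S. f differentiable (at z)) \<and>
     (\<forall>e\<in>Basis. Ck_on k S (\<lambda>z. frechet_derivative f (at z) e))"

definition laplacian :: "(complex \<Rightarrow> real) \<Rightarrow> complex \<Rightarrow> real" where
  "laplacian f z =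
     (\<Sum>e\<in>Basis. frechet_derivative (\<lambda>w. frechet_derivative f (at w) e) (at z) e)"

definition test_function :: "(complex \<Rightarrow> real) \<Rightarrow> bool" where
  "test_function f \<longleftrightarrow> (\<forall>k. Ck_on k UNIV f) \<and> (\<exists>R. \<forall>z. norm z > R \<longrightarrow> f z = 0)"

text \<open>After a rotation by \<open>\<omega>\<close> and a translation, \<open>D\<close> is locally the region strictly above the
  graph of a \<open>C\<^sup>1\<close> function.\<close>

definition C1_boundary_domain :: "complex set \<Rightarrow> bool" where
  "C1_boundary_domain D \<longleftrightarrow> open D \<and> connected D \<and> D \<noteq> {} \<and>
     (\<forall>p\<in>frontier D. \<exists>\<omega> r \<gamma>. norm \<omega> = 1 \<and> r > 0 \<and> (\<gamma> :: real \<Rightarrow> real) C1_differentiable_on UNIV \<and>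
        D \<inter> ball p r = {z \<in> ball p r. Im (cnj \<omega> * (z - p)) > \<gamma> (Re (cnj \<omega> * (z - p)))})"

definition C1_boundary_closed_domain :: "complex set \<Rightarrow> bool" where
  "C1_boundary_closed_domain S \<longleftrightarrow> (\<exists>D. C1_boundary_domain D \<and> S = closure D)"

section \<open>The space \<open>H\<^sup>1\<close>\<close>

text \<open>Elements are represented by Borel functions, every Lebesgue class having a Borel
  representative; they are not quotiented by equality almost everywhere. The gradient is a vector field
  on \<open>\<real>\<^sup>2\<close>, i.e. a complex-valued function.\<close>

definition L2loc :: "(complex \<Rightarrow> real) \<Rightarrow> bool" where
  "L2loc u \<longleftrightarrow> u \<in> borel_measurable borel \<and>
     (\<forall>R. set_integrable lborel (cball 0 R) (\<lambda>z. (u z)\<^sup>2))"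

definition L2_weak_gradient :: "(complex \<Rightarrow> real) \<Rightarrow> (complex \<Rightarrow> complex) \<Rightarrow> bool" where
  "L2_weak_gradient u g \<longleftrightarrow> g \<in> borel_measurable borel \<and> integrable lborel (\<lambda>z. (norm (g z))\<^sup>2) \<and>
     (\<forall>f. test_function f \<longrightarrow> (\<forall>e\<in>Basis.
        (LINT z|lborel. u z * frechet_derivative f (at z) e) =
        - (LINT z|lborel. (g z \<bullet> e) * f z)))"

definition H1 :: "(complex \<Rightarrow> real) set" where
  "H1 = {u. L2loc u \<and> (\<exists>g. L2_weak_gradient u g)}"

definition H1_tendsto :: "(nat \<Rightarrow> complex \<Rightarrow> real) \<Rightarrow> (complex \<Rightarrow> real) \<Rightarrow> bool" where
  "H1_tendsto v u \<longleftrightarrow>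
     (\<forall>R. (\<lambda>n. LINT z:cball 0 R|lborel. (v n z - u z)\<^sup>2) \<longlonglongrightarrow> 0) \<and>
     (\<exists>g. (\<forall>n. L2_weak_gradient (\<lambda>z. v n z - u z) (g n)) \<and>
          (\<lambda>n. LINT z|lborel. (norm (g n z))\<^sup>2) \<longlonglongrightarrow> 0)"

text \<open>The \<open>H\<^sup>1\<close>-topology is metrizable, so continuity is sequential continuity.\<close>

definition H1_continuous :: "((complex \<Rightarrow> real) \<Rightarrow> real) \<Rightarrow> bool" where
  "H1_continuous T \<longleftrightarrow> (\<forall>v u. (\<forall>n. v n \<in> H1) \<longrightarrow> u \<in> H1 \<longrightarrow> H1_tendsto v u \<longrightarrow>
     (\<lambda>n. T (v n)) \<longlonglongrightarrow> T u)"

text \<open>The pairing of \<open>\<mu>\<close> with \<open>u \<in> H\<^sup>1\<close>. A functional on \<open>H1\<close> is represented by an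
  element of \<^term>\<open>extensional H1\<close> to make the continuous extension unique as a HOL function.\<close>

definition pairing :: "complex measure \<Rightarrow> (complex \<Rightarrow> real) \<Rightarrow> real" where
  "pairing \<mu> u = (THE T. T \<in> extensional H1 \<and> H1_continuous T \<and>
      (\<forall>v. test_function v \<longrightarrow> T v = (LINT z|\<mu>. v z))) u"

section \<open>Energies and equilibrium measures\<close>

definition log_ereal :: "ereal \<Rightarrow> ereal" where
  "log_ereal x = (if x \<le> 0 then -\<infinity> else if x = \<infinity> then \<infinity> else ereal (ln (real_of_ereal x)))"

text \<open>The integral of an extended real function, meaningful when the positive or the negative
  part has finite integral.\<close>

definition ereal_integral :: "'a measure \<Rightarrow> ('a \<Rightarrow> ereal) \<Rightarrow> ereal" where
  "ereal_integral M f =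
     enn2ereal (\<integral>\<^sup>+ x. e2ennreal (f x) \<partial>M) - enn2ereal (\<integral>\<^sup>+ x. e2ennreal (- f x) \<partial>M)"

definition psi0 :: "complex \<Rightarrow> real" where
  "psi0 z = ln (1 + (norm z)\<^sup>2)"

definition borel_prob :: "complex measure \<Rightarrow> bool" where
  "borel_prob \<mu> \<longleftrightarrow> prob_space \<mu> \<and> sets \<mu> = sets borel"

definition measure_support :: "complex measure \<Rightarrow> complex set" where
  "measure_support \<mu> = {z. \<forall>W. open W \<longrightarrow> z \<in> W \<longrightarrow> emeasure \<mu> W > 0}"

definition log_energy :: "complex measure \<Rightarrow> ereal" where
  "log_energy \<mu> = ereal (- 1/2) *
     ereal_integral (\<mu> \<Otimes>\<^sub>M \<mu>) (\<lambda>(z, w). log_ereal (ereal ((norm (z - w))\<^sup>2)))"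

definition weighted_energy :: "(complex \<Rightarrow> ereal) \<Rightarrow> complex measure \<Rightarrow> ereal" where
  "weighted_energy \<phi> \<mu> =
     ereal (- 1/2) * ereal_integral (\<mu> \<Otimes>\<^sub>M \<mu>)
       (\<lambda>(z, w). log_ereal (ereal ((norm (z - w))\<^sup>2)) - ereal (psi0 z) - ereal (psi0 w))
     + ereal_integral \<mu> (\<lambda>z. \<phi> z - ereal (psi0 z))"

definition finite_energy_measures :: "(complex \<Rightarrow> ereal) \<Rightarrow> complex measure set" where
  "finite_energy_measures \<phi> = {\<mu>. borel_prob \<mu> \<and> weighted_energy \<phi> \<mu> < \<infinity>}"

text \<open>\<open>free_energy \<phi> u\<close> and \<open>equilibrium_measure \<phi> u\<close> stand for \<open>\<F>(\<phi> + u)\<close> and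
  \<open>\<mu>\<close> with index \<open>\<phi> + u\<close>; both are defined through the pair \<open>(\<phi>, u)\<close>.
  The unperturbed case is \<open>u = 0\<close>.\<close>

definition free_energy :: "(complex \<Rightarrow> ereal) \<Rightarrow> (complex \<Rightarrow> real) \<Rightarrow> ereal" where
  "free_energy \<phi> u =
     (INF \<mu>\<in>finite_energy_measures \<phi>. weighted_energy \<phi> \<mu> + ereal (pairing \<mu> u))"

definition equilibrium_measure :: "(complex \<Rightarrow> ereal) \<Rightarrow> (complex \<Rightarrow> real) \<Rightarrow> complex measure" where
  "equilibrium_measure \<phi> u = (THE \<mu>. \<mu> \<in> finite_energy_measures \<phi> \<and>
     weighted_energy \<phi> \<mu> + ereal (pairing \<mu> u) = free_energy \<phi> u)"

section \<open>Exterior potentials\<close>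

definition lower_semicontinuous :: "(complex \<Rightarrow> ereal) \<Rightarrow> bool" where
  "lower_semicontinuous f \<longleftrightarrow> (\<forall>t. open {z. f z > t})"

definition strictly_super_log_growth :: "(complex \<Rightarrow> ereal) \<Rightarrow> bool" where
  "strictly_super_log_growth \<phi> \<longleftrightarrow>
     (\<exists>\<epsilon>>0. \<exists>C. \<forall>z. \<phi> z \<ge> ereal ((1 + \<epsilon>) * psi0 z - C))"

text \<open>Polar in the sense of logarithmic potential theory: the set supports no compactly supported
  probability measure of finite energy.\<close>

definition polar :: "complex set \<Rightarrow> bool" where
  "polar P \<longleftrightarrow> (\<forall>\<mu>. borel_prob \<mu> \<longrightarrow> compact (measure_support \<mu>) \<longrightarrow>
     measure_support \<mu> \<subseteq> P \<longrightarrow> log_energy \<mu> = \<infinity>)"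

definition regularity_assumption :: "(complex \<Rightarrow> ereal) \<Rightarrow> bool" where
  "regularity_assumption \<phi> \<longleftrightarrow>
     (let S = measure_support (equilibrium_measure \<phi> (\<lambda>_. 0)) in
      \<exists>U. open U \<and> S \<subseteq> U \<and>
        (\<forall>z\<in>U. \<phi> z < \<infinity>) \<and> Ck_on 5 U (\<lambda>z. real_of_ereal (\<phi> z)) \<and>
        C1_boundary_closed_domain S \<and>
        (\<forall>z\<in>S. laplacian (\<lambda>w. real_of_ereal (\<phi> w)) z > 0))"

section \<open>The Coulomb gas\<close>

definition boltzmann_factor :: "real \<Rightarrow> ereal \<Rightarrow> real" where
  "boltzmann_factor \<beta> v = (if v = \<infinity> then 0 else exp (- \<beta> * real_of_ereal v))"

text \<open>Configurations are functions on \<open>{..<N}\<close>, with the \<open>N\<close>-fold product of Lebesgue measure.\<close>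

definition gas_weight :: "nat \<Rightarrow> real \<Rightarrow> (complex \<Rightarrow> ereal) \<Rightarrow> (nat \<Rightarrow> complex) \<Rightarrow> real" where
  "gas_weight N \<beta> V z =
     (\<Prod>j<N. \<Prod>i<j. norm (z i - z j) powr (2 * \<beta>)) * (\<Prod>i<N. boltzmann_factor \<beta> (V (z i)))"

definition partition_function :: "nat \<Rightarrow> real \<Rightarrow> (complex \<Rightarrow> ereal) \<Rightarrow> ennreal" where
  "partition_function N \<beta> V = (\<integral>\<^sup>+ z. ennreal (gas_weight N \<beta> V z) \<partial>(\<Pi>\<^sub>M i\<in>{..<N}. lborel))"

definition coulomb_gas :: "nat \<Rightarrow> real \<Rightarrow> (complex \<Rightarrow> ereal) \<Rightarrow> (nat \<Rightarrow> complex) measure" where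
  "coulomb_gas N \<beta> V = density (\<Pi>\<^sub>M i\<in>{..<N}. lborel)
     (\<lambda>z. ennreal (gas_weight N \<beta> V z) / partition_function N \<beta> V)"

definition linear_statistic :: "nat \<Rightarrow> (complex \<Rightarrow> real) \<Rightarrow> (nat \<Rightarrow> complex) \<Rightarrow> real" where
  "linear_statistic N u z = 1 / real N * (\<Sum>i<N. u (z i))"

definition laplace_transform :: "nat \<Rightarrow> real \<Rightarrow> (complex \<Rightarrow> ereal) \<Rightarrow> (complex \<Rightarrow> real) \<Rightarrow> ennreal" where
  "laplace_transform N \<beta> V u =
     (\<integral>\<^sup>+ z. ennreal (exp (- \<beta> * (real N)\<^sup>2 * linear_statistic N u z)) \<partial>(coulomb_gas N \<beta> V))"

end

theory Submission
  imports Defs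
begin

text \<open>
  The hypothesis is tested on potentials that concentrate the gas. Fix a disk inside the set where
  \<open>\<phi>\<close> is \<open>C\<^sup>5\<close>; for small \<open>r\<close> a compactly supported \<open>C\<^sup>2\<close> perturbation \<open>u\<^sub>r\<close> makes \<open>\<phi> + u\<^sub>r\<close>
  agree near the center, up to a constant, with the logarithmic potential of a radial density \<open>\<mu>\<^sub>r\<close> on
  the concentric disk of radius \<open>r\<close>, and dominate it everywhere. Completing the square in the positive definite logarithmic
  energy then shows that \<open>\<mu>\<^sub>r\<close> is the equilibrium measure and gives \<open>\<F>(\<phi> + u\<^sub>r) = ln r + O(1)\<close> and
  \<open>E\<^sub>0(\<mu>\<^sub>r) = ln (1/r) + O(1)\<close>. Restricting the gas to \<open>N\<close> separated disks of radius comparable to \<open>r\<close>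
  bounds the left-hand side of the hypothesis below by \<open>(1 + 1/N - 2/(\<beta> N)) ln (1/r) - O(1)\<close>.
  Fixing \<open>N\<close> large enough for the gas to be normalizable and letting \<open>r\<close> tend to \<open>0\<close> yields
  \<open>1 + 1/N - 2/(\<beta> N) \<le> 1 - A/N\<close>, which is the claim. Positivity of the energy comes from writing the
  logarithm as a mixture of Gaussian kernels, each of which is positive definite.
\<close>


section \<open>Differentiability classes and a smooth bump\<close>

text \<open>\<open>pairing\<close> is a definite description over functionals continuous on
  \<open>H1\<close>, so \<open>free_energy\<close> is opaque until that description is shown to be
  well defined. This takes two things. Test functions must be dense in \<open>H1\<close>; constants
  have zero gradient and must be approximated too, which works in the plane because logarithmic
  cutoffs have vanishing Dirichlet energy. And integration against a measure of finite energy must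
  be controlled by the gradient; this bound is read off from the same positivity of the energy that
  identifies the minimizer. The disk density falls to 0 at the rim instead of being uniform. Its
  potential is then C^2 with an explicit radial formula, so the perturbation is C^2 and has a
  continuous Laplacian. The two terms of order 1/N that decide the theorem have separate origins:
  the gas has N(N-1) ordered pairs where the energy functional counts N^2, which gives 1/N, and N
  disks of area of order r^2 have volume of order r^(2N), which gives -2/(\<beta> N). Everything
  else is of leading order and cancels against \<F>, or stays bounded as r tends to 0.\<close>

lemma Ck_on_cong:
  assumes "open S" "\<And>z. z \<in> S \<Longrightarrow> f z = g z"
  shows "Ck_on k S f \<longleftrightarrow> Ck_on k S g"
  using assms(2)
proof (induction k arbitrary: f g)
  case 0
  then show ?case by (simp cong: continuous_on_cong)
next
  case (Suc k)
  have fd: "frechet_derivative f (at z) = frechet_derivative g (at z)" if "z \<in> S" "f differentiable (at z)" for z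
    by (rule frechet_derivative_transform_within_open[OF that(2) \<open>open S\<close> that(1)]) (use Suc.prems in auto)
  have di: "f differentiable (at z) \<longleftrightarrow> g differentiable (at z)" if "z \<in> S" for z
    using has_derivative_transform_within_open[OF _ \<open>open S\<close> that] Suc.prems
    unfolding differentiable_def by metis
  have "Ck_on k S (\<lambda>z. frechet_derivative f (at z) e) = Ck_on k S (\<lambda>z. frechet_derivative g (at z) e)"
    if "\<forall>z\<in>S. f differentiable (at z)" for e
    using fd that by (intro Suc.IH) auto
  then show ?case using di by auto
qed

text \<open>Any explicit derivative \<open>D\<close> may be supplied here, so that regularity proofs
  never have to evaluate \<open>frechet_derivative\<close>.\<close>

lemma Ck_on_SucI:
  assumes "open S" "\<And>z. z \<in> S \<Longrightarrow> (f has_derivative D z) (at z)"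
    and "\<And>e. e \<in> Basis \<Longrightarrow> Ck_on k S (\<lambda>z. D z e)"
  shows "Ck_on (Suc k) S f"
proof -
  have "frechet_derivative f (at z) = D z" if "z \<in> S" for z
    using assms(2)[OF that] frechet_derivative_at by metis
  then have "Ck_on k S (\<lambda>z. frechet_derivative f (at z) e)" if "e \<in> Basis" for e
    using Ck_on_cong[OF assms(1), of "\<lambda>z. frechet_derivative f (at z) e" "\<lambda>z. D z e" k] assms(3)[OF that]
    by simp
  then show ?thesis using assms(2) by (auto simp: differentiable_def)
qed

lemma Ck_on_Suc_has_derivative:
  assumes "Ck_on (Suc k) S f" "z \<in> S"
  shows "(f has_derivative frechet_derivative f (at z)) (at z)"
  using assms frechet_derivative_works by auto

lemma Ck_on_imp_continuous_on: "Ck_on k S f \<Longrightarrow> continuous_on S f"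
  by (cases k) (auto intro!: continuous_at_imp_continuous_on differentiable_imp_continuous_within)

lemma Ck_on_Suc_imp: "Ck_on (Suc k) S f \<Longrightarrow> Ck_on k S f"
proof (induction k arbitrary: f)
  case 0
  then show ?case using Ck_on_imp_continuous_on[of "Suc 0"] by simp
next
  case (Suc k)
  have "Ck_on (Suc k) S (\<lambda>z. frechet_derivative f (at z) e)" if "e \<in> Basis" for e
    using Suc.prems that by (simp only: Ck_on.simps(2)[of "Suc k"])
  then have "Ck_on k S (\<lambda>z. frechet_derivative f (at z) e)" if "e \<in> Basis" for e
    using Suc.IH that by blast
  then show ?case using Suc.prems by simp
qed

lemma Ck_on_mono: "Ck_on k S f \<Longrightarrow> j \<le> k \<Longrightarrow> Ck_on j S f"
proof (induction k)
  case 0 then show ?case by simp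
next
  case (Suc k) then show ?case using Ck_on_Suc_imp le_Suc_eq by metis
qed

lemma Ck_on_subset: "Ck_on k S f \<Longrightarrow> T \<subseteq> S \<Longrightarrow> Ck_on k T f"
  by (induction k arbitrary: f) (auto intro: continuous_on_subset)

lemma Ck_on_Un:
  assumes "open S" "open T"
  shows "Ck_on k S f \<Longrightarrow> Ck_on k T f \<Longrightarrow> Ck_on k (S \<union> T) f"
  using assms by (induction k arbitrary: f) (auto intro: continuous_on_open_Un)

lemma Ck_on_const: "Ck_on k S (\<lambda>_. c)"
  by (induction k arbitrary: c) auto

lemma Ck_on_add:
  assumes "open S" shows "Ck_on k S f \<Longrightarrow> Ck_on k S g \<Longrightarrow> Ck_on k S (\<lambda>z. f z + g z)"
proof (induction k arbitrary: f g)
  case 0 then show ?case by (simp add: continuous_on_add)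
next
  case (Suc k)
  show ?case
  proof (rule Ck_on_SucI[OF assms])
    fix z assume "z \<in> S"
    then show "((\<lambda>z. f z + g z) has_derivative
        (\<lambda>e. frechet_derivative f (at z) e + frechet_derivative g (at z) e)) (at z)"
      by (intro has_derivative_add Ck_on_Suc_has_derivative[OF Suc.prems(1)]
           Ck_on_Suc_has_derivative[OF Suc.prems(2)])
  next
    fix e :: complex assume "e \<in> Basis"
    then show "Ck_on k S (\<lambda>z. frechet_derivative f (at z) e + frechet_derivative g (at z) e)"
      using Suc by simp
  qed
qed

lemma Ck_on_mult:
  assumes "open S" shows "Ck_on k S f \<Longrightarrow> Ck_on k S g \<Longrightarrow> Ck_on k S (\<lambda>z. f z * g z)"
proof (induction k arbitrary: f g)
  case 0 then show ?case by (simp add: continuous_on_mult)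
next
  case (Suc k)
  show ?case
  proof (rule Ck_on_SucI[OF assms])
    fix z assume "z \<in> S"
    then show "((\<lambda>z. f z * g z) has_derivative
        (\<lambda>e. f z * frechet_derivative g (at z) e + frechet_derivative f (at z) e * g z)) (at z)"
      by (intro has_derivative_mult Ck_on_Suc_has_derivative[OF Suc.prems(1)]
           Ck_on_Suc_has_derivative[OF Suc.prems(2)])
  next
    fix e :: complex assume "e \<in> Basis"
    then show "Ck_on k S (\<lambda>z. f z * frechet_derivative g (at z) e + frechet_derivative f (at z) e * g z)"
      using Suc Ck_on_Suc_imp[OF Suc.prems(1)] Ck_on_Suc_imp[OF Suc.prems(2)]
      by (intro Ck_on_add Suc.IH assms) auto
  qed
qed

lemma Ck_on_cmult: "open S \<Longrightarrow> Ck_on k S f \<Longrightarrow> Ck_on k S (\<lambda>z. c * f z)"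
  by (intro Ck_on_mult Ck_on_const)

lemma Ck_on_diff: "open S \<Longrightarrow> Ck_on k S f \<Longrightarrow> Ck_on k S g \<Longrightarrow> Ck_on k S (\<lambda>z. f z - g z)"
  using Ck_on_add[of S k f "\<lambda>z. (-1) * g z"] Ck_on_cmult[of S k g "-1"] by simp

lemma Ck_on_inverse:
  assumes S: "open S" and nz: "\<And>z. z \<in> S \<Longrightarrow> f z \<noteq> 0"
  shows "Ck_on k S f \<Longrightarrow> Ck_on k S (\<lambda>z. inverse (f z))"
proof (induction k)
  case 0 then show ?case using nz by (auto intro!: continuous_intros)
next
  case (Suc k)
  show ?case
  proof (rule Ck_on_SucI[OF S])
    fix z assume "z \<in> S"
    then show "((\<lambda>w. inverse (f w)) has_derivative
       (\<lambda>e. (-1) * (inverse (f z) * frechet_derivative f (at z) e * inverse (f z)))) (at z)"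
      using Deriv.has_derivative_inverse[OF nz Ck_on_Suc_has_derivative[OF Suc.prems]] by simp
  next
    fix e :: complex assume "e \<in> Basis"
    then show "Ck_on k S (\<lambda>z. (-1) * (inverse (f z) * frechet_derivative f (at z) e * inverse (f z)))"
      using Suc Ck_on_Suc_imp[OF Suc.prems] by (intro Ck_on_mult Ck_on_const S) auto
  qed
qed

lemma Ck_on_inner: "Ck_on k S (\<lambda>z. (z - a) \<bullet> e)" if "open S"
proof (cases k)
  case 0 then show ?thesis by (auto intro!: continuous_intros)
next
  case (Suc j)
  show ?thesis unfolding Suc
    by (rule Ck_on_SucI[OF that, where D="\<lambda>z h. h \<bullet> e"]) (auto intro!: derivative_eq_intros Ck_on_const)
qed

lemma norm_power2_has_derivative:
  "((\<lambda>z. (norm (z - a))\<^sup>2) has_derivative (\<lambda>h. 2 * ((z - a) \<bullet> h))) (at z)" for z a :: complex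
  unfolding power2_norm_eq_inner by (auto intro!: derivative_eq_intros simp: inner_commute)

lemma Ck_on_norm_power2: "Ck_on k S (\<lambda>z. (norm (z - a))\<^sup>2)" if "open S"
proof (cases k)
  case 0 then show ?thesis by (auto intro!: continuous_intros)
next
  case (Suc j)
  show ?thesis unfolding Suc
    by (rule Ck_on_SucI[OF that norm_power2_has_derivative]) (intro Ck_on_cmult Ck_on_inner that)
qed

lemma psi0_has_derivative:
  "(psi0 has_derivative (\<lambda>h. 2 * (z \<bullet> h) * inverse (1 + (norm z)\<^sup>2))) (at z)"
proof -
  have "1 + (norm z)\<^sup>2 > 0" by (simp add: add_pos_nonneg)
  moreover have "((\<lambda>w. 1 + (norm w)\<^sup>2) has_derivative (\<lambda>h. 2 * (z \<bullet> h))) (at z)"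
    using has_derivative_add[OF has_derivative_const norm_power2_has_derivative[of 0 z], of 1] by simp
  ultimately show ?thesis unfolding psi0_def[abs_def] by (rule has_derivative_ln)
qed

lemma Ck_on_psi0: "Ck_on k UNIV psi0"
proof (cases k)
  case 0
  then show ?thesis unfolding psi0_def[abs_def]
    by (auto intro!: continuous_intros simp: add_nonneg_eq_0_iff)
next
  case (Suc j)
  have nz: "1 + (norm z)\<^sup>2 \<noteq> 0" for z :: complex by (metis add_pos_nonneg less_irrefl zero_less_one zero_le_power2)
  have "Ck_on j UNIV (\<lambda>z. (norm (z::complex))\<^sup>2)" "Ck_on j UNIV (\<lambda>z. z \<bullet> e)" for e
    using Ck_on_norm_power2[of UNIV j 0] Ck_on_inner[of UNIV j 0 e] by simp_all
  then show ?thesis unfolding Suc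
    by (intro Ck_on_SucI[OF _ psi0_has_derivative] Ck_on_mult Ck_on_inverse Ck_on_add Ck_on_const nz) auto
qed

section \<open>A smooth function that is flat at 0, and cutoffs built from it\<close>

definition flat_exp :: "nat \<Rightarrow> real \<Rightarrow> real" where
  "flat_exp n x = (if x \<le> 0 then 0 else exp (- inverse x) * inverse x ^ n)"

text \<open>With y = 1/x the limit from the right is that of y^n / exp y at infinity. For exponent
  \<open>Suc n\<close> the function is also the difference quotient of \<open>flat_exp n\<close> at
  0, whence the name.\<close>

lemma flat_exp_quot_tendsto_0: "((\<lambda>x. flat_exp n x) \<longlongrightarrow> 0) (at 0)"
proof -
  have 1: "((\<lambda>x::real. exp (- inverse x) * inverse x ^ n) \<longlongrightarrow> 0) (at_right 0)"
  proof -
    have "((\<lambda>y::real. y ^ n / exp y) \<longlongrightarrow> 0) at_top" by (rule tendsto_power_div_exp_0)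
    from filterlim_compose[OF this filterlim_inverse_at_top_right]
    show ?thesis by (simp add: exp_minus divide_inverse mult.commute)
  qed
  have "(flat_exp n \<longlongrightarrow> 0) (at_right 0)"
    by (rule filterlim_cong[THEN iffD1, OF refl refl _ 1]) (auto simp: flat_exp_def eventually_at_filter)
  moreover have "(flat_exp n \<longlongrightarrow> 0) (at_left 0)"
    by (rule filterlim_cong[THEN iffD1, OF refl refl _ tendsto_const]) (auto simp: flat_exp_def eventually_at_filter)
  ultimately show ?thesis by (simp add: filterlim_at_split)
qed

text \<open>The powers of 1/x are part of the definition so that the family is closed under
  differentiation. Smoothness of every member then follows by one induction that generalises over
  \<open>n\<close>.\<close>

lemma flat_exp_DERIV:
  "(flat_exp n has_real_derivative (flat_exp (n+2) x - real n * flat_exp (n+1) x)) (at x)"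
proof -
  consider "x < 0" | "x > 0" | "x = 0" by linarith
  then show ?thesis
  proof cases
    case 1
    have "((\<lambda>_. 0::real) has_real_derivative 0) (at x)" by simp
    then have "(flat_exp n has_real_derivative 0) (at x)"
      by (rule has_field_derivative_transform_within_open[of _ _ _ "{..<0}"]) (use 1 in \<open>auto simp: flat_exp_def\<close>)
    then show ?thesis using 1 by (simp add: flat_exp_def)
  next
    case 2
    let ?y = "inverse x"
    have i: "(inverse has_real_derivative - (?y ^ 2)) (at x)"
      using DERIV_inverse[of x] 2 by (simp add: numeral_2_eq_2)
    have e: "((\<lambda>x. exp (- inverse x)) has_real_derivative exp (- ?y) * - (- (?y ^ 2))) (at x)"
      by (rule DERIV_fun_exp[OF DERIV_minus[OF i]])
    have p: "((\<lambda>x. inverse x ^ n) has_real_derivative of_nat n * (- (?y ^ 2) * ?y ^ (n - Suc 0))) (at x)"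
      by (rule DERIV_power[OF i])
    have "real n * (?y ^ 2 * ?y ^ (n - Suc 0)) = real n * ?y ^ (n + 1)"
      by (cases n) (auto simp: power2_eq_square)
    then have eq: "exp (- ?y) * - (- (?y ^ 2)) * ?y ^ n + of_nat n * (- (?y ^ 2) * ?y ^ (n - Suc 0)) * exp (- ?y)
       = exp (- ?y) * ?y ^ (n + 2) - real n * (exp (- ?y) * ?y ^ (n + 1))"
    proof -
      have "of_nat n * (- (?y ^ 2) * ?y ^ (n - Suc 0)) * exp (- ?y) = - (real n * (?y ^ 2 * ?y ^ (n - Suc 0))) * exp (- ?y)"
        by simp
      also have "\<dots> = - (real n * ?y ^ (n + 1)) * exp (- ?y)" by (simp only: \<open>real n * (?y ^ 2 * ?y ^ (n - Suc 0)) = real n * ?y ^ (n + 1)\<close>)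
      finally have K: "of_nat n * (- (?y ^ 2) * ?y ^ (n - Suc 0)) * exp (- ?y) = - (real n * ?y ^ (n + 1)) * exp (- ?y)" .
      have "E * - (- y2) * yn + - (N * (yn * y)) * E = E * (yn * y2) - N * (E * (yn * y))" for E y2 yn y N :: real
        by (simp add: algebra_simps)
      then show ?thesis unfolding K power_add power_one_right .
    qed
    have "((\<lambda>x. exp (- inverse x) * inverse x ^ n) has_real_derivative
       (exp (- ?y) * ?y ^ (n + 2) - real n * (exp (- ?y) * ?y ^ (n + 1)))) (at x)"
      using DERIV_mult[OF e p] unfolding eq .
    then have "(flat_exp n has_real_derivative (exp (- ?y) * ?y ^ (n + 2) - real n * (exp (- ?y) * ?y ^ (n + 1)))) (at x)"
      by (rule has_field_derivative_transform_within_open[of _ _ _ "{0<..}"]) (use 2 in \<open>auto simp: flat_exp_def\<close>)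
    then show ?thesis using 2 by (simp add: flat_exp_def)
  next
    case 3
    have "((\<lambda>h. (flat_exp n h - flat_exp n 0) / (h - 0)) \<longlongrightarrow> 0) (at 0)"
      by (rule filterlim_cong[THEN iffD1, OF refl refl _ flat_exp_quot_tendsto_0[of "Suc n"]])
         (auto simp: flat_exp_def eventually_at_filter divide_inverse)
    then show ?thesis using 3 by (simp add: has_field_derivative_iff flat_exp_def)
  qed
qed

lemma Ck_on_flat_exp:
  assumes S: "open S"
  shows "Ck_on k S f \<Longrightarrow> Ck_on k S (\<lambda>z. flat_exp n (f z))"
proof (induction k arbitrary: n)
  case 0
  have "continuous_on UNIV (flat_exp n)"
    using flat_exp_DERIV by (meson DERIV_isCont continuous_at_imp_continuous_on)
  then show ?case using 0 by (auto intro: continuous_on_compose2)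
next
  case (Suc k)
  show ?case
  proof (rule Ck_on_SucI[OF S])
    fix z assume z: "z \<in> S"
    show "((\<lambda>w. flat_exp n (f w)) has_derivative
      (\<lambda>e. frechet_derivative f (at z) e * (flat_exp (n+2) (f z) - real n * flat_exp (n+1) (f z)))) (at z)"
      using has_derivative_compose[OF Ck_on_Suc_has_derivative[OF Suc.prems z] flat_exp_DERIV[of n "f z", unfolded has_field_derivative_def]]
      by (simp add: mult.commute)
  next
    fix e :: complex assume "e \<in> Basis"
    then show "Ck_on k S (\<lambda>z. frechet_derivative f (at z) e * (flat_exp (n+2) (f z) - real n * flat_exp (n+1) (f z)))"
      using Suc Ck_on_Suc_imp[OF Suc.prems] by (intro Ck_on_mult Ck_on_diff Ck_on_cmult S) auto
  qed
qed

lemma flat_exp_nonneg: "flat_exp n x \<ge> 0" by (simp add: flat_exp_def)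
lemma flat_exp_pos: "x > 0 \<Longrightarrow> flat_exp n x > 0" by (simp add: flat_exp_def)
lemma flat_exp_0: "x \<le> 0 \<Longrightarrow> flat_exp n x = 0" by (simp add: flat_exp_def)

text \<open>The usual quotient a/(a+b) of two flat functions: a vanishes outside radius R, b
  vanishes inside radius R/2, and since these regions are disjoint the denominator is positive
  everywhere.\<close>

definition smooth_step :: "complex \<Rightarrow> real \<Rightarrow> complex \<Rightarrow> real" where
  "smooth_step a R z =
     flat_exp 0 (R\<^sup>2 - (norm (z - a))\<^sup>2) *
     inverse (flat_exp 0 (R\<^sup>2 - (norm (z - a))\<^sup>2) + flat_exp 0 ((norm (z - a))\<^sup>2 - (R/2)\<^sup>2))"

lemma smooth_step:
  assumes "R > 0"
  shows "Ck_on k UNIV (smooth_step a R)"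
    and "norm (z - a) \<le> R / 2 \<Longrightarrow> smooth_step a R z = 1"
    and "norm (z - a) \<ge> R \<Longrightarrow> smooth_step a R z = 0"
    and "0 \<le> smooth_step a R z" "smooth_step a R z \<le> 1"
proof -
  have pos: "flat_exp 0 (R\<^sup>2 - (norm (z - a))\<^sup>2) + flat_exp 0 ((norm (z - a))\<^sup>2 - (R/2)\<^sup>2) > 0" for z
  proof (cases "norm (z - a) < R")
    case True
    then have "(norm (z - a))\<^sup>2 < R\<^sup>2" by (simp add: power_strict_mono)
    then show ?thesis by (simp add: flat_exp_pos flat_exp_nonneg add_pos_nonneg)
  next
    case False
    then have "(norm (z - a))\<^sup>2 > (R/2)\<^sup>2" using assms by (intro power_strict_mono) auto
    then show ?thesis by (simp add: flat_exp_pos flat_exp_nonneg add_nonneg_pos)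
  qed
  show "Ck_on k UNIV (smooth_step a R)" unfolding smooth_step_def[abs_def]
    using pos by (intro Ck_on_mult Ck_on_inverse Ck_on_add Ck_on_flat_exp Ck_on_diff Ck_on_const Ck_on_norm_power2)
      (auto simp: less_le)
  show "norm (z - a) \<le> R / 2 \<Longrightarrow> smooth_step a R z = 1"
  proof -
    assume "norm (z - a) \<le> R / 2"
    then have "(norm (z - a))\<^sup>2 \<le> (R/2)\<^sup>2" by (intro power_mono) auto
    then have "flat_exp 0 ((norm (z - a))\<^sup>2 - (R/2)\<^sup>2) = 0" by (simp add: flat_exp_0)
    then show ?thesis using pos[of z] by (simp add: smooth_step_def)
  qed
  show "norm (z - a) \<ge> R \<Longrightarrow> smooth_step a R z = 0"
  proof -
    assume "norm (z - a) \<ge> R"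
    then have "(norm (z - a))\<^sup>2 \<ge> R\<^sup>2" using assms by (intro power_mono) auto
    then show ?thesis by (simp add: smooth_step_def flat_exp_0)
  qed
  show "0 \<le> smooth_step a R z" "smooth_step a R z \<le> 1"
    using pos[of z] flat_exp_nonneg[of 0]
    by (auto simp: smooth_step_def divide_inverse[symmetric] divide_le_eq_1)
qed

section \<open>Integration in the plane\<close>

lemma nn_integral_complex_affine:
  fixes f :: "complex \<Rightarrow> ennreal" and c :: real
  assumes [measurable]: "f \<in> borel_measurable borel" and "c \<noteq> 0"
  shows "(\<integral>\<^sup>+z. f z \<partial>lborel) = ennreal (c\<^sup>2) * (\<integral>\<^sup>+z. f (t + c *\<^sub>R z) \<partial>lborel)"
  by (subst lborel_affine[OF \<open>c \<noteq> 0\<close>, of t])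
     (simp add: nn_integral_density nn_integral_distr nn_integral_cmult ennreal_power)

lemma integrable_complex_affine:
  fixes f :: "complex \<Rightarrow> 'b::{banach, second_countable_topology}" and c :: real
  assumes f: "integrable lborel f" and c: "c \<noteq> 0"
  shows "integrable lborel (\<lambda>z. f (t + c *\<^sub>R z))"
proof -
  have [measurable]: "f \<in> borel_measurable borel" using f by auto
  have "(\<integral>\<^sup>+z. ennreal (norm (f z)) \<partial>lborel) < \<infinity>"
    using f unfolding integrable_iff_bounded by auto
  then have "ennreal (c\<^sup>2) * (\<integral>\<^sup>+z. ennreal (norm (f (t + c *\<^sub>R z))) \<partial>lborel) < \<infinity>"
    using nn_integral_complex_affine[of "\<lambda>z. ennreal (norm (f z))" c t] c by simp
  then have "(\<integral>\<^sup>+z. ennreal (norm (f (t + c *\<^sub>R z))) \<partial>lborel) < \<infinity>"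
    using c by (auto simp: ennreal_mult_less_top)
  then show ?thesis unfolding integrable_iff_bounded by auto
qed

lemma integral_complex_affine:
  fixes f :: "complex \<Rightarrow> real" and c :: real
  assumes [measurable]: "f \<in> borel_measurable borel" and c: "c \<noteq> 0"
  shows "(LINT z|lborel. f z) = c\<^sup>2 * (LINT z|lborel. f (t + c *\<^sub>R z))"
  by (subst lborel_affine[OF \<open>c \<noteq> 0\<close>, of t])
     (simp add: integral_density integral_distr)

lemma integral_reflect:
  fixes f :: "complex \<Rightarrow> real"
  assumes [measurable]: "f \<in> borel_measurable borel"
  shows "(LINT w|lborel. f (z - w)) = (LINT w|lborel. f w)"
  using integral_complex_affine[of f "-1" z] by simp

lemma integrable_reflect:
  fixes f :: "complex \<Rightarrow> real"
  assumes "integrable lborel f"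
  shows "integrable lborel (\<lambda>w. f (z - w))"
  using integrable_complex_affine[OF assms, of "-1" z] by simp

lemma integral_translate:
  fixes f :: "complex \<Rightarrow> real"
  assumes [measurable]: "f \<in> borel_measurable borel"
  shows "(LINT w|lborel. f (z + w)) = (LINT w|lborel. f w)"
  using integral_complex_affine[of f 1 z] by simp

lemma integrable_translate:
  fixes f :: "complex \<Rightarrow> real"
  assumes "integrable lborel f"
  shows "integrable lborel (\<lambda>w. f (z + w))"
  using integrable_complex_affine[OF assms, of 1 z] by simp

lemma nn_integral_translate:
  fixes f :: "complex \<Rightarrow> ennreal"
  assumes [measurable]: "f \<in> borel_measurable borel"
  shows "(\<integral>\<^sup>+w. f (z + w) \<partial>lborel) = (\<integral>\<^sup>+w. f w \<partial>lborel)"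
  using nn_integral_complex_affine[of f 1 z] by simp

text \<open>A disk of squared radius a has area \<pi> a, so in the variable |z|^2 planar Lebesgue
  measure becomes a constant multiple of length on the half line. This takes the place of polar
  coordinates for all radial integrals below.\<close>

lemma distr_norm_power2:
  "distr lborel borel (\<lambda>z::complex. (norm z)\<^sup>2) = density lborel (\<lambda>s. ennreal pi * indicator {0..} s)"
proof (rule measure_eqI_generator_eq[of "range (\<lambda>a. {..a})" UNIV _ _ "\<lambda>n. {..real n}"])
  show "Int_stable (range (\<lambda>a::real. {..a}))"
    by (auto simp: Int_stable_def)
  show "emeasure (distr lborel borel (\<lambda>z::complex. (norm z)\<^sup>2)) X =
        emeasure (density lborel (\<lambda>s. ennreal pi * indicator {0..} s)) X"
    if XE: "X \<in> range (\<lambda>a::real. {..a})" for X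
  proof -
    obtain a :: real where X: "X = {..a}" using XE by blast
    have "emeasure (distr lborel borel (\<lambda>z::complex. (norm z)\<^sup>2)) X = emeasure lborel {z::complex. (norm z)\<^sup>2 \<le> a}"
      by (auto simp: X emeasure_distr intro!: arg_cong[where f="emeasure lborel"])
    also have "\<dots> = ennreal (pi * max 0 a)"
    proof (cases "a \<ge> 0")
      case True
      have "{z::complex. (norm z)\<^sup>2 \<le> a} = cball 0 (sqrt a)"
        using True by (auto simp: real_le_rsqrt) (metis norm_ge_zero power_mono real_sqrt_pow2)
      then show ?thesis using True emeasure_cball[of "sqrt a" "0::complex"] by (simp add: unit_ball_vol_2)
    next
      case False
      then have "{z::complex. (norm z)\<^sup>2 \<le> a} = {}" by (auto simp: not_le intro: less_le_trans)
      then show ?thesis using False by simp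
    qed
    also have "\<dots> = emeasure (density lborel (\<lambda>s. ennreal pi * indicator {0..} s)) X"
    proof -
      have "emeasure (density lborel (\<lambda>s. ennreal pi * indicator {0..} s)) X =
        (\<integral>\<^sup>+s. ennreal pi * indicator {0..a} s \<partial>lborel)"
        by (auto simp: X emeasure_density intro!: nn_integral_cong split: split_indicator)
      also have "\<dots> = ennreal (pi * max 0 a)"
        by (cases "a \<ge> 0") (auto simp: nn_integral_cmult ennreal_mult)
      finally show ?thesis ..
    qed
    finally show ?thesis .
  qed
  show "emeasure (distr lborel borel (\<lambda>z::complex. (norm z)\<^sup>2)) {..real n} \<noteq> \<infinity>" for n
  proof -
    have "{z::complex. (norm z)\<^sup>2 \<le> real n} \<subseteq> cball 0 (sqrt (real n))" by (auto simp: real_le_rsqrt)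
    then have "emeasure lborel {z::complex. (norm z)\<^sup>2 \<le> real n} \<le> emeasure lborel (cball (0::complex) (sqrt (real n)))"
      by (intro emeasure_mono) auto
    also have "\<dots> < \<infinity>" using emeasure_cball[of "sqrt n" "0::complex"] by simp
    finally show ?thesis
      by (auto simp: emeasure_distr vimage_def)
  qed
  show "(\<Union>i. {..real i}) = UNIV" using real_arch_simple by auto
qed (auto simp: borel_eq_atMost)

lemma nn_integral_radial:
  fixes f :: "real \<Rightarrow> ennreal"
  assumes [measurable]: "f \<in> borel_measurable borel"
  shows "(\<integral>\<^sup>+z. f ((norm (z::complex))\<^sup>2) \<partial>lborel) = ennreal pi * (\<integral>\<^sup>+s. f s * indicator {0..} s \<partial>lborel)"
proof -
  have "(\<integral>\<^sup>+z. f ((norm (z::complex))\<^sup>2) \<partial>lborel) = (\<integral>\<^sup>+s. f s \<partial>distr lborel borel (\<lambda>z::complex. (norm z)\<^sup>2))"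
    by (simp add: nn_integral_distr)
  also have "\<dots> = (\<integral>\<^sup>+s. ennreal pi * (f s * indicator {0..} s) \<partial>lborel)"
    unfolding distr_norm_power2 by (subst nn_integral_density) (auto simp: mult_ac)
  also have "\<dots> = ennreal pi * (\<integral>\<^sup>+s. f s * indicator {0..} s \<partial>lborel)"
    by (rule nn_integral_cmult) auto
  finally show ?thesis .
qed

lemma nn_integral_gaussian:
  assumes "t > 0"
  shows "(\<integral>\<^sup>+z. ennreal (exp (- t * (norm (z - y :: complex))\<^sup>2)) \<partial>lborel) = ennreal (pi / t)"
proof -
  have "(\<integral>\<^sup>+z. ennreal (exp (- t * (norm (z - y :: complex))\<^sup>2)) \<partial>lborel)
      = (\<integral>\<^sup>+z. ennreal (exp (- t * (norm (z :: complex))\<^sup>2)) \<partial>lborel)"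
    using nn_integral_translate[of "\<lambda>z. ennreal (exp (- t * (norm (z :: complex))\<^sup>2))" "-y"] by simp
  also have "\<dots> = ennreal pi * (\<integral>\<^sup>+s. ennreal (exp (- t * s)) * indicator {0..} s \<partial>lborel)"
    by (rule nn_integral_radial) auto
  also have "(\<integral>\<^sup>+s. ennreal (exp (- t * s)) * indicator {0..} s \<partial>lborel) = ennreal (0 - (- exp (- t * 0) / t))"
  proof (rule nn_integral_FTC_atLeast)
    show "((\<lambda>s. - exp (- t * s) / t) has_real_derivative exp (- t * x)) (at x)" for x
      using assms by (auto intro!: derivative_eq_intros)
    have "((\<lambda>s. exp (- t * s)) \<longlongrightarrow> 0) at_top"
      using assms by (intro filterlim_compose[OF exp_at_bot]) (rule filterlim_tendsto_neg_mult_at_bot[OF tendsto_const _ filterlim_ident], simp)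
    from tendsto_divide[OF tendsto_minus[OF this] tendsto_const[of t]]
    show "((\<lambda>s. - exp (- t * s) / t) \<longlongrightarrow> 0) at_top" using assms by simp
  qed auto
  finally show ?thesis by (simp add: ennreal_mult'[symmetric])
qed

text \<open>By the parallelogram law around the midpoint of z and w, a Gaussian kernel is, up to a
  factor, the composition of a narrower Gaussian kernel with itself. Kernels of this form are
  positive definite, since the quadratic form becomes the integral of a square.\<close>

lemma nn_integral_gaussian_prod:
  assumes "t > 0"
  shows "(\<integral>\<^sup>+y. ennreal (exp (- 2 * t * (norm (z - y :: complex))\<^sup>2) * exp (- 2 * t * (norm (w - y))\<^sup>2)) \<partial>lborel)
     = ennreal (pi / (4 * t) * exp (- t * (norm (z - w))\<^sup>2))"
proof -
  have eq: "(norm (z - y))\<^sup>2 + (norm (w - y))\<^sup>2 = 2 * (norm (y - (z + w) / 2))\<^sup>2 + (norm (z - w))\<^sup>2 / 2" for y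
    unfolding cmod_power2 by (simp add: power2_eq_square field_simps)
  have "exp (- 2 * t * (norm (z - y))\<^sup>2) * exp (- 2 * t * (norm (w - y))\<^sup>2)
      = exp (- t * (norm (z - w))\<^sup>2) * exp (- (4 * t) * (norm (y - (z + w) / 2))\<^sup>2)" for y
  proof -
    have "- 2 * t * (norm (z - y))\<^sup>2 + (- 2 * t * (norm (w - y))\<^sup>2) = - 2 * t * ((norm (z - y))\<^sup>2 + (norm (w - y))\<^sup>2)"
      by (simp add: algebra_simps)
    also have "\<dots> = - t * (norm (z - w))\<^sup>2 + (- (4 * t) * (norm (y - (z + w) / 2))\<^sup>2)"
      unfolding eq by (simp add: algebra_simps)
    finally show ?thesis by (simp add: exp_add[symmetric])
  qed
  then have "(\<integral>\<^sup>+y. ennreal (exp (- 2 * t * (norm (z - y :: complex))\<^sup>2) * exp (- 2 * t * (norm (w - y))\<^sup>2)) \<partial>lborel)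
     = (\<integral>\<^sup>+y. ennreal (exp (- t * (norm (z - w))\<^sup>2)) * ennreal (exp (- (4 * t) * (norm (y - (z + w) / 2))\<^sup>2)) \<partial>lborel)"
    by (simp add: ennreal_mult')
  also have "\<dots> = ennreal (exp (- t * (norm (z - w))\<^sup>2)) * ennreal (pi / (4 * t))"
    using assms nn_integral_gaussian[of "4 * t" "(z + w) / 2"] by (simp add: nn_integral_cmult)
  also have "\<dots> = ennreal (pi / (4 * t) * exp (- t * (norm (z - w))\<^sup>2))"
    using assms by (subst ennreal_mult'[symmetric]) (auto simp: mult.commute)
  finally show ?thesis .
qed

section \<open>Compactly supported functions and integration by parts\<close>

lemma integrable_csupp:
  fixes f :: "complex \<Rightarrow> real"
  assumes "continuous_on UNIV f" "\<And>z. norm z > R \<Longrightarrow> f z = 0"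
  shows "integrable lborel f"
proof -
  have "integrable lborel (\<lambda>x. indicator (cball 0 R) x *\<^sub>R f x)"
    by (rule borel_integrable_compact) (use assms in \<open>auto intro: continuous_on_subset\<close>)
  moreover have "(\<lambda>x. indicator (cball 0 R) x *\<^sub>R f x) = f"
    using assms(2) by (auto simp: indicator_def fun_eq_iff not_le)
  ultimately show ?thesis by simp
qed

lemma bounded_csupp:
  fixes f :: "complex \<Rightarrow> real"
  assumes "continuous_on UNIV f" "\<And>z. norm z > R \<Longrightarrow> f z = 0"
  shows "\<exists>B>0. \<forall>z. \<bar>f z\<bar> \<le> B"
proof -
  have "bounded (f ` cball 0 R)"
    by (intro compact_imp_bounded compact_continuous_image) (use assms in \<open>auto intro: continuous_on_subset\<close>)
  then obtain B where "\<forall>y\<in>f ` cball 0 R. norm y \<le> B" unfolding bounded_iff by blast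
  then have B: "\<And>z. z \<in> cball 0 R \<Longrightarrow> \<bar>f z\<bar> \<le> B" by auto
  have "\<bar>f z\<bar> \<le> max B 1" for z
    using B[of z] assms(2)[of z] by (cases "norm z \<le> R") auto
  then show ?thesis by (intro exI[of _ "max B 1"]) auto
qed

lemma bounded_times_integrable:
  fixes f g :: "'a \<Rightarrow> real"
  assumes "integrable M f" "g \<in> borel_measurable M" "\<And>x. \<bar>g x\<bar> \<le> B"
  shows "integrable M (\<lambda>x. f x * g x)" "integrable M (\<lambda>x. g x * f x)"
proof -
  show "integrable M (\<lambda>x. f x * g x)"
  proof (rule Bochner_Integration.integrable_bound[of _ "\<lambda>x. B * f x"])
    show "AE x in M. norm (f x * g x) \<le> norm (B * f x)"
    proof (rule AE_I2)
      fix x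
      have "\<bar>g x\<bar> \<le> \<bar>B\<bar>" using assms(3)[of x] by linarith
      then show "norm (f x * g x) \<le> norm (B * f x)"
        by (simp add: abs_mult) (metis abs_ge_zero mult.commute mult_left_mono)
    qed
  qed (use assms in auto)
  then show "integrable M (\<lambda>x. g x * f x)" by (simp add: mult.commute)
qed

lemma frechet_derivative_csupp:
  fixes f :: "complex \<Rightarrow> real"
  assumes "\<And>z. norm z > R \<Longrightarrow> f z = 0" "norm z > R"
  shows "frechet_derivative f (at z) e = 0"
proof -
  have "open {z::complex. norm z > R}" by (intro open_Collect_less continuous_intros)
  moreover have "((\<lambda>_. 0::real) has_derivative (\<lambda>_. 0)) (at z)" by simp
  ultimately have "(f has_derivative (\<lambda>_. 0)) (at z)"
    using has_derivative_transform_within_open[of "\<lambda>_. 0" "\<lambda>_. 0" z UNIV "{z. norm z > R}" f] assms by auto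
  then show ?thesis using frechet_derivative_at by metis
qed

lemma Ck1_directional:
  assumes "Ck_on (Suc 0) UNIV f" "e \<in> Basis"
  shows "continuous_on UNIV (\<lambda>z. frechet_derivative f (at z) e)"
    and "(f has_derivative frechet_derivative f (at z)) (at z)"
    and "continuous_on UNIV f"
  using assms Ck_on_Suc_has_derivative[OF assms(1)] Ck_on_imp_continuous_on[OF assms(1)] by auto

lemma difference_quotient_bound:
  fixes f :: "complex \<Rightarrow> real"
  assumes f: "Ck_on (Suc 0) UNIV f" and B: "\<And>z. \<bar>frechet_derivative f (at z) e\<bar> \<le> B" and h: "h > 0"
  shows "\<bar>f (z + h *\<^sub>R e) - f z\<bar> \<le> h * B"
proof -
  have *: "((\<lambda>s. f (z + s *\<^sub>R e)) has_real_derivative frechet_derivative f (at (z + s *\<^sub>R e)) e) (at s)" for s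
  proof -
    have fd: "(f has_derivative frechet_derivative f (at (z + s *\<^sub>R e))) (at (z + s *\<^sub>R e))"
      using Ck_on_Suc_has_derivative[OF f] by auto
    have "((\<lambda>s. z + s *\<^sub>R e) has_derivative (\<lambda>s. s *\<^sub>R e)) (at s)"
      by (auto intro!: derivative_eq_intros)
    from has_derivative_compose[OF this fd] show ?thesis
      unfolding has_field_derivative_def
      by (rule has_derivative_eq_rhs) (simp add: linear_scale[OF has_derivative_linear[OF fd]] fun_eq_iff mult.commute)
  qed
  from MVT2[OF h *] obtain s where
    s: "f (z + h *\<^sub>R e) - f (z + 0 *\<^sub>R e) = (h - 0) * frechet_derivative f (at (z + s *\<^sub>R e)) e" by blast
  have "f (z + h *\<^sub>R e) - f z = h * frechet_derivative f (at (z + s *\<^sub>R e)) e" using s by simp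
  moreover have "\<bar>h * frechet_derivative f (at (z + s *\<^sub>R e)) e\<bar> \<le> h * B"
    unfolding abs_mult using B[of "z + s *\<^sub>R e"] h by (simp add: mult_left_mono)
  ultimately show ?thesis by simp
qed

text \<open>Translation invariance makes every difference quotient integrate to 0. With steps of
  length at most 1 the quotients are bounded by \<open>B\<close> and supported in the ball of radius
  R + 1, so dominated convergence passes this to the derivative.\<close>

lemma integral_frechet_derivative_csupp:
  fixes f :: "complex \<Rightarrow> real"
  assumes f: "Ck_on (Suc 0) UNIV f" and supp: "\<And>z. norm z > R \<Longrightarrow> f z = 0" and e: "e \<in> Basis"
  shows "(LINT z|lborel. frechet_derivative f (at z) e) = 0"
proof -
  let ?D = "\<lambda>z. frechet_derivative f (at z) e"
  note c1 = Ck1_directional[OF f e]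
  have supp': "\<And>z. norm z > R \<Longrightarrow> ?D z = 0" using frechet_derivative_csupp[OF supp] by auto
  obtain B where B: "B > 0" "\<And>z. \<bar>?D z\<bar> \<le> B" using bounded_csupp[OF c1(1) supp'] by auto
  have fi: "integrable lborel f" using integrable_csupp[OF c1(3) supp] by auto
  have [measurable]: "f \<in> borel_measurable borel" "?D \<in> borel_measurable borel"
    using c1 by (auto intro: borel_measurable_continuous_onI)
  let ?h = "\<lambda>n. inverse (real (Suc n))"
  let ?q = "\<lambda>n z. (f (z + ?h n *\<^sub>R e) - f z) / ?h n"
  have ne: "norm e = 1" using e by auto
  have "(\<lambda>n. LINT z|lborel. ?q n z) \<longlonglongrightarrow> (LINT z|lborel. ?D z)"
  proof (rule integral_dominated_convergence[where w="\<lambda>z. B * indicator (cball 0 (R + 1)) z"])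
    show "integrable lborel (\<lambda>z::complex. B * indicator (cball 0 (R + 1)) z)"
    proof -
      have "emeasure lborel (cball (0::complex) (R + 1)) < \<infinity>" by (rule emeasure_bounded_finite) simp
      then have "integrable lborel (indicat_real (cball (0::complex) (R + 1)))" by (intro integrable_real_indicator) simp_all
      then show ?thesis by (rule integrable_mult_right)
    qed
    show "AE z in lborel. (\<lambda>n. ?q n z) \<longlonglongrightarrow> ?D z"
    proof (rule AE_I2)
      fix z
      have fd: "(f has_derivative frechet_derivative f (at z)) (at z)" by (rule c1(2))
      have "((\<lambda>s. z + s *\<^sub>R e) has_derivative (\<lambda>s. s *\<^sub>R e)) (at 0)"
        by (auto intro!: derivative_eq_intros)
      from has_derivative_compose[OF this, of f "frechet_derivative f (at z)"] fd
      have "((\<lambda>s. f (z + s *\<^sub>R e)) has_derivative (\<lambda>s. frechet_derivative f (at z) (s *\<^sub>R e))) (at 0)"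
        by simp
      then have "((\<lambda>s. f (z + s *\<^sub>R e)) has_real_derivative ?D z) (at 0)"
        unfolding has_field_derivative_def
        by (rule has_derivative_eq_rhs) (simp add: linear_scale[OF has_derivative_linear[OF fd]] fun_eq_iff mult.commute)
      then have "((\<lambda>s. (f (z + s *\<^sub>R e) - f z) / s) \<longlongrightarrow> ?D z) (at 0)"
        by (simp add: has_field_derivative_iff)
      moreover have "filterlim ?h (at 0) sequentially"
        using LIMSEQ_inverse_real_of_nat by (auto simp: filterlim_at)
      ultimately show "(\<lambda>n. ?q n z) \<longlonglongrightarrow> ?D z" by (rule filterlim_compose)
    qed
    show "AE z in lborel. norm (?q n z) \<le> B * indicator (cball 0 (R + 1)) z" for n
    proof (rule AE_I2)
      fix z
      have hp: "?h n > 0" "?h n \<le> 1" by (auto simp: field_simps)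
      show "norm (?q n z) \<le> B * indicator (cball 0 (R + 1)) z"
      proof (cases "norm z \<le> R + 1")
        case True
        have "\<bar>f (z + ?h n *\<^sub>R e) - f z\<bar> \<le> ?h n * B"
          using difference_quotient_bound[OF f B(2) hp(1)] .
        then have "\<bar>f (z + ?h n *\<^sub>R e) - f z\<bar> / ?h n \<le> B" using hp by (subst pos_divide_le_eq) (auto simp: mult.commute)
        then show ?thesis using True hp by (simp add: abs_divide)
      next
        case False
        have "norm z \<le> norm (z + ?h n *\<^sub>R e) + norm (?h n *\<^sub>R e)"
          using norm_triangle_ineq4[of "z + ?h n *\<^sub>R e" "?h n *\<^sub>R e"] by simp
        then have "norm (z + ?h n *\<^sub>R e) > R" using False hp ne by simp
        then show ?thesis using False supp by simp
      qed
    qed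
  qed simp_all
  moreover have "(LINT z|lborel. ?q n z) = 0" for n
  proof -
    have "integrable lborel (\<lambda>z. f (z + ?h n *\<^sub>R e))"
      using integrable_translate[OF fi, of "?h n *\<^sub>R e"] by (simp add: add.commute)
    moreover have "(LINT z|lborel. f (z + ?h n *\<^sub>R e)) = (LINT z|lborel. f z)"
      using integral_translate[of f "?h n *\<^sub>R e"] by (simp add: add.commute)
    ultimately show ?thesis using fi by simp
  qed
  ultimately show ?thesis by (simp add: LIMSEQ_const_iff)
qed

lemma frechet_derivative_mult:
  fixes f g :: "complex \<Rightarrow> real"
  assumes "f differentiable (at z)" "g differentiable (at z)"
  shows "frechet_derivative (\<lambda>z. f z * g z) (at z) e =
     f z * frechet_derivative g (at z) e + frechet_derivative f (at z) e * g z"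
proof -
  have "((\<lambda>z. f z * g z) has_derivative (\<lambda>h. f z * frechet_derivative g (at z) h + frechet_derivative f (at z) h * g z)) (at z)"
    using assms by (intro has_derivative_mult) (auto simp: frechet_derivative_works[symmetric])
  from frechet_derivative_at[OF this, symmetric] show ?thesis by simp
qed

lemma frechet_derivative_diff:
  fixes f g :: "complex \<Rightarrow> real"
  assumes "f differentiable (at z)" "g differentiable (at z)"
  shows "frechet_derivative (\<lambda>z. f z - g z) (at z) e =
     frechet_derivative f (at z) e - frechet_derivative g (at z) e"
proof -
  have "((\<lambda>z. f z - g z) has_derivative (\<lambda>h. frechet_derivative f (at z) h - frechet_derivative g (at z) h)) (at z)"
    using assms by (intro has_derivative_diff) (auto simp: frechet_derivative_works[symmetric])
  from frechet_derivative_at[OF this, symmetric] show ?thesis by simp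
qed

text \<open>The product inherits the compact support of \<open>f\<close>, so its derivative
  integrates to 0; the product rule then splits that integral.\<close>

lemma integration_by_parts_csupp:
  fixes f g :: "complex \<Rightarrow> real"
  assumes f: "Ck_on (Suc 0) UNIV f" and g: "Ck_on (Suc 0) UNIV g"
    and supp: "\<And>z. norm z > R \<Longrightarrow> f z = 0" and e: "e \<in> Basis"
  shows "(LINT z|lborel. frechet_derivative f (at z) e * g z) = - (LINT z|lborel. f z * frechet_derivative g (at z) e)"
proof -
  note cf = Ck1_directional[OF f e] and cg = Ck1_directional[OF g e]
  have fg: "Ck_on (Suc 0) UNIV (\<lambda>z. f z * g z)" using f g by (intro Ck_on_mult) auto
  have i1: "integrable lborel (\<lambda>z. frechet_derivative f (at z) e * g z)"
    by (rule integrable_csupp[of _ R]) (auto intro!: continuous_intros cf cg simp: frechet_derivative_csupp[of R f, OF supp])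
  have i2: "integrable lborel (\<lambda>z. f z * frechet_derivative g (at z) e)"
    by (rule integrable_csupp[of _ R]) (auto intro!: continuous_intros cf cg simp: supp)
  have "0 = (LINT z|lborel. frechet_derivative (\<lambda>z. f z * g z) (at z) e)"
    using integral_frechet_derivative_csupp[OF fg _ e, of R] supp by simp
  also have "\<dots> = (LINT z|lborel. f z * frechet_derivative g (at z) e + frechet_derivative f (at z) e * g z)"
    using cf(2) cg(2) by (intro Bochner_Integration.integral_cong refl frechet_derivative_mult) (auto simp: differentiable_def)
  also have "\<dots> = (LINT z|lborel. f z * frechet_derivative g (at z) e) + (LINT z|lborel. frechet_derivative f (at z) e * g z)"
    using i1 i2 by simp
  finally show ?thesis by simp
qed

section \<open>Mollification\<close>

definition loc_int :: "(complex \<Rightarrow> real) \<Rightarrow> bool" where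
  "loc_int u \<longleftrightarrow> u \<in> borel_measurable borel \<and> (\<forall>R. integrable lborel (\<lambda>z. indicator (cball 0 R) z * u z))"

definition sq_int :: "(complex \<Rightarrow> real) \<Rightarrow> bool" where
  "sq_int f \<longleftrightarrow> f \<in> borel_measurable borel \<and> integrable lborel (\<lambda>z. (f z)\<^sup>2)"

definition conv :: "(complex \<Rightarrow> real) \<Rightarrow> (complex \<Rightarrow> real) \<Rightarrow> complex \<Rightarrow> real" where
  "conv u k z = (LINT w|lborel. u w * k (z - w))"

lemma integrable_indicator_cball: "integrable lborel (indicat_real (cball (z::complex) R))"
proof -
  have "emeasure lborel (cball z R) < \<infinity>" by (rule emeasure_bounded_finite) simp
  then show ?thesis by (intro integrable_real_indicator) simp_all
qed

lemma loc_int_L2loc: "L2loc u \<Longrightarrow> loc_int u"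
  unfolding loc_int_def
proof (intro conjI allI)
  assume u: "L2loc u"
  then have u1: "u \<in> borel_measurable borel" by (simp add: L2loc_def)
  then show "u \<in> borel_measurable borel" .
  fix R
  have "integrable lborel (\<lambda>z. indicator (cball 0 R) z * (u z)\<^sup>2)"
    using u by (simp add: L2loc_def set_integrable_def)
  then have i: "integrable lborel (\<lambda>z. indicator (cball 0 R) z + indicator (cball 0 R) z * (u z)\<^sup>2)"
    by (intro Bochner_Integration.integrable_add integrable_indicator_cball)
  show "integrable lborel (\<lambda>z. indicator (cball 0 R) z * u z)"
  proof (rule Bochner_Integration.integrable_bound[OF i])
    have "\<bar>x\<bar> \<le> 1 + x\<^sup>2" for x :: real
    proof -
      have "0 \<le> x\<^sup>2 + 1 - 2 * \<bar>x\<bar>" using zero_le_power2[of "\<bar>x\<bar> - 1"] by (simp add: power2_diff)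
      then show ?thesis using abs_ge_zero[of x] by linarith
    qed
    then show "AE z in lborel. norm (indicator (cball 0 R) z * u z) \<le> norm (indicator (cball 0 R) z + indicator (cball 0 R) z * (u z)\<^sup>2)"
      by (auto split: split_indicator intro!: AE_I2)
    show "(\<lambda>z. indicator (cball 0 R) z * u z) \<in> borel_measurable lborel"
      using u1 by (intro borel_measurable_times borel_measurable_indicator) auto
  qed
qed

lemma L2loc_sq_int: "sq_int f \<Longrightarrow> L2loc f"
  unfolding L2loc_def sq_int_def set_integrable_def
proof (intro conjI allI, simp)
  fix R assume f: "f \<in> borel_measurable borel \<and> integrable lborel (\<lambda>z. (f z)\<^sup>2)"
  then show "integrable lborel (\<lambda>x. indicat_real (cball 0 R) x *\<^sub>R (f x)\<^sup>2)"
    by (intro integrable_mult_indicator) auto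
qed

lemma L2loc_continuous:
  fixes u :: "complex \<Rightarrow> real"
  assumes "continuous_on UNIV u" shows "L2loc u"
  unfolding L2loc_def set_integrable_def
proof (intro conjI allI)
  show "u \<in> borel_measurable borel" using assms by (rule borel_measurable_continuous_onI)
  show "integrable lborel (\<lambda>x. indicat_real (cball 0 R) x *\<^sub>R (u x)\<^sup>2)" for R
    by (rule borel_integrable_compact) (use assms in \<open>auto intro!: continuous_intros intro: continuous_on_subset\<close>)
qed

lemma loc_int_times_csupp:
  assumes u: "loc_int u" and k: "continuous_on UNIV k" "\<And>z. norm z > R \<Longrightarrow> k z = 0"
  shows "integrable lborel (\<lambda>w. u w * k w)"
proof -
  obtain B where B: "\<And>z. \<bar>k z\<bar> \<le> B" using bounded_csupp[OF k] by blast
  have "integrable lborel (\<lambda>w. (indicator (cball 0 R) w * u w) * k w)"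
    using u B k(1) by (intro bounded_times_integrable(1)[where B=B and f="\<lambda>w. indicator (cball 0 R) w * u w" and g=k]) (auto simp: loc_int_def intro: borel_measurable_continuous_onI)
  moreover have "(\<lambda>w. (indicator (cball 0 R) w * u w) * k w) = (\<lambda>w. u w * k w)"
    using k(2) by (auto simp: fun_eq_iff indicator_def not_le)
  ultimately show ?thesis by simp
qed

lemma csupp_reflect:
  fixes k :: "complex \<Rightarrow> real"
  assumes k: "continuous_on UNIV k" "\<And>z. norm z > R \<Longrightarrow> k z = 0"
  shows "continuous_on UNIV (\<lambda>w. k (z - w))" "norm w > norm z + R \<Longrightarrow> k (z - w) = 0"
proof -
  show "continuous_on UNIV (\<lambda>w. k (z - w))"
    by (rule continuous_on_compose2[OF k(1)]) (auto intro!: continuous_intros)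
  assume "norm w > norm z + R"
  then have "norm (z - w) > R" using norm_triangle_ineq2[of w z] by (simp add: norm_minus_commute)
  then show "k (z - w) = 0" by (rule k(2))
qed

lemma integrable_conv:
  assumes u: "loc_int u" and k: "continuous_on UNIV k" "\<And>z. norm z > R \<Longrightarrow> k z = 0"
  shows "integrable lborel (\<lambda>w. u w * k (z - w))"
  using loc_int_times_csupp[OF u csupp_reflect[OF k]] .

lemma frechet_derivative_Basis_expand:
  fixes k :: "complex \<Rightarrow> real"
  assumes "(k has_derivative D) (at z)"
  shows "D h = (\<Sum>e\<in>Basis. (h \<bullet> e) * D e)"
proof -
  have l: "linear D" using has_derivative_linear[OF assms] .
  have "D h = D (\<Sum>e\<in>Basis. (h \<bullet> e) *\<^sub>R e)" by (simp add: euclidean_representation)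
  also have "\<dots> = (\<Sum>e\<in>Basis. (h \<bullet> e) * D e)" by (simp add: linear_sum[OF l] linear_scale[OF l])
  finally show ?thesis .
qed

text \<open>A single constant controls both the increment of \<open>k\<close> and its linear part.
  Together they dominate the remainder quotient when a convolution is differentiated under the
  integral sign.\<close>

lemma C1_csupp_lipschitz:
  fixes k :: "complex \<Rightarrow> real"
  assumes k: "Ck_on (Suc 0) UNIV k" "\<And>z. norm z > R \<Longrightarrow> k z = 0"
  shows "\<exists>B\<ge>0. (\<forall>x h. \<bar>k (x + h) - k x\<bar> \<le> B * norm h) \<and>
    (\<forall>x h. \<bar>frechet_derivative k (at x) h\<bar> \<le> B * norm h)"
proof -
  have "\<exists>B>0. \<forall>z. \<bar>frechet_derivative k (at z) e\<bar> \<le> B" if eB: "e \<in> Basis" for e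
    by (rule bounded_csupp[OF Ck1_directional(1)[OF k(1) eB], of R]) (rule frechet_derivative_csupp[of R k, OF k(2)])
  then have "\<exists>B. \<forall>e\<in>Basis. B e > 0 \<and> (\<forall>z. \<bar>frechet_derivative k (at z) e\<bar> \<le> B e)" by (intro bchoice) auto
  then obtain B where B: "\<And>e z. e \<in> Basis \<Longrightarrow> \<bar>frechet_derivative k (at z) e\<bar> \<le> B e" "\<And>e. e \<in> Basis \<Longrightarrow> B e > 0"
    by auto
  have fd: "(k has_derivative frechet_derivative k (at z)) (at z)" for z
    using Ck_on_Suc_has_derivative[OF k(1)] by simp
  let ?B = "\<Sum>e\<in>Basis. B e"
  have bd: "\<bar>frechet_derivative k (at x) h\<bar> \<le> ?B * norm h" for x h
  proof -
    have "\<bar>frechet_derivative k (at x) h\<bar> \<le> (\<Sum>e\<in>Basis. \<bar>(h \<bullet> e) * frechet_derivative k (at x) e\<bar>)"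
      by (subst frechet_derivative_Basis_expand[OF fd]) (rule sum_abs)
    also have "\<dots> \<le> (\<Sum>e\<in>Basis. norm h * B e)"
      by (intro sum_mono) (auto simp: abs_mult intro!: mult_mono B Basis_le_norm)
    finally show ?thesis by (simp add: sum_distrib_left mult.commute)
  qed
  have "norm (k (x + h) - k x) \<le> ?B * norm ((x + h) - x)" for x h
  proof (rule differentiable_bound[of UNIV k "\<lambda>z. frechet_derivative k (at z)"])
    show "onorm (frechet_derivative k (at x)) \<le> ?B" for x
      by (rule onorm_le) (use bd in auto)
  qed (use fd in auto)
  moreover have "?B \<ge> 0" by (intro sum_nonneg less_imp_le B)
  ultimately show ?thesis using bd by (intro exI[of _ ?B]) auto
qed

text \<open>Differentiation under the integral sign. The limit is taken along an arbitrary sequence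
  X tending to z; the remainder quotient of \<open>k\<close> is bounded by 2B and tends to 0
  pointwise, so dominated convergence applies with a multiple of |u| on a ball.\<close>

lemma conv_has_derivative:
  assumes u: "loc_int u" and k: "Ck_on (Suc 0) UNIV k" "\<And>z. norm z > R \<Longrightarrow> k z = 0"
  shows "(conv u k has_derivative (\<lambda>h. \<Sum>e\<in>Basis. (h \<bullet> e) * conv u (\<lambda>z. frechet_derivative k (at z) e) z)) (at z)"
    (is "(_ has_derivative ?D) _")
proof -
  obtain B where B: "\<And>x h. \<bar>k (x + h) - k x\<bar> \<le> B * norm h" "B \<ge> 0"
    "\<And>x h. \<bar>frechet_derivative k (at x) h\<bar> \<le> B * norm h"
    using C1_csupp_lipschitz[OF k] by blast
  note kc = Ck1_directional[OF k(1)]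
  have kcont: "continuous_on UNIV k" using Ck_on_imp_continuous_on[OF k(1)] .
  have [measurable]: "u \<in> borel_measurable borel" "k \<in> borel_measurable borel"
    using u kcont by (auto simp: loc_int_def intro: borel_measurable_continuous_onI)
  have mD[measurable]: "(\<lambda>z. frechet_derivative k (at z) e) \<in> borel_measurable borel" if "e \<in> Basis" for e
    using kc(1)[OF that] by (rule borel_measurable_continuous_onI)
  have iD: "integrable lborel (\<lambda>w. u w * frechet_derivative k (at (z - w)) e)" if "e \<in> Basis" for e
    by (rule integrable_conv[OF u kc(1)[OF that]]) (rule frechet_derivative_csupp[OF k(2)])
  have ik: "integrable lborel (\<lambda>w. u w * k (y - w))" for y
    by (rule integrable_conv[OF u kcont k(2)])
  have fd: "(k has_derivative frechet_derivative k (at x)) (at x)" for x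
    using Ck_on_Suc_has_derivative[OF k(1)] by simp
  have ex: "u w * frechet_derivative k (at (z - w)) h = (\<Sum>e\<in>Basis. (h \<bullet> e) * (u w * frechet_derivative k (at (z - w)) e))" for w h
  proof -
    have "u w * frechet_derivative k (at (z - w)) h = u w * (\<Sum>e\<in>Basis. (h \<bullet> e) * frechet_derivative k (at (z - w)) e)"
      by (rule arg_cong[OF frechet_derivative_Basis_expand[OF fd]])
    also have "\<dots> = (\<Sum>e\<in>Basis. (h \<bullet> e) * (u w * frechet_derivative k (at (z - w)) e))"
      unfolding sum_distrib_left by (intro sum.cong refl) (rule mult.left_commute)
    finally show ?thesis .
  qed
  have Deq: "?D h = (LINT w|lborel. u w * frechet_derivative k (at (z - w)) h)" for h
    unfolding ex[of _ h] conv_def by (subst Bochner_Integration.integral_sum) (use iD in auto)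
  have iDh: "integrable lborel (\<lambda>w. u w * frechet_derivative k (at (z - w)) h)" for h
    unfolding ex[of _ h] by (intro Bochner_Integration.integrable_sum integrable_mult_right iD)
  have bl: "bounded_linear ?D"
    by (intro bounded_linear_sum bounded_linear_mult_left[THEN bounded_linear_compose] bounded_linear_inner_left)
  show ?thesis unfolding has_derivative_within
  proof (intro conjI bl, unfold tendsto_at_iff_sequentially, intro allI impI)
    fix X :: "nat \<Rightarrow> complex" assume X: "\<forall>i. X i \<in> UNIV - {z}" "X \<longlonglongrightarrow> z"
    let ?h = "\<lambda>i. X i - z"
    let ?q = "\<lambda>i w. (1 / norm (?h i)) *\<^sub>R (k (X i - w) - (k (z - w) + frechet_derivative k (at (z - w)) (?h i)))"
    have hnz: "norm (?h i) > 0" for i using X(1) by auto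
    have qle: "\<bar>?q i w\<bar> \<le> 2 * B" for i w
    proof -
      have "\<bar>k (X i - w) - k (z - w)\<bar> \<le> B * norm (?h i)"
        using B(1)[of "z - w" "?h i"] by simp
      then have "\<bar>k (X i - w) - (k (z - w) + frechet_derivative k (at (z - w)) (?h i))\<bar> \<le> 2 * B * norm (?h i)"
        using B(3)[of "z - w" "?h i"] by linarith
      then have "\<bar>k (X i - w) - (k (z - w) + frechet_derivative k (at (z - w)) (?h i))\<bar> / norm (?h i) \<le> 2 * B"
        using hnz[of i] by (subst pos_divide_le_eq)
      moreover have "\<bar>(1 / n) *\<^sub>R x\<bar> = \<bar>x\<bar> / n" if "n > 0" for n x :: real
        using that by (simp add: abs_mult)
      ultimately show ?thesis using hnz[of i] by (simp only:)
    qed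
    \<comment> \<open>Convergent increments are bounded, so one ball of radius |z| + R + M contains
      the supports of all the integrands at once.\<close>
    obtain M where M: "\<And>i. norm (?h i) \<le> M"
    proof -
      have "(\<lambda>i. ?h i) \<longlonglongrightarrow> 0" using X(2) by (simp add: LIM_zero)
      then have "Bseq ?h" by (intro convergent_imp_Bseq convergentI)
      then show ?thesis using that by (auto simp: Bseq_def)
    qed
    have Rb: "?q i w = 0" if "norm w > norm z + R + M" for i w
    proof -
      have "norm (X i) \<le> norm z + M" using M[of i] norm_triangle_ineq2[of "X i" z] by linarith
      moreover have "M \<ge> 0" using M[of i] norm_ge_zero[of "?h i"] by linarith
      ultimately have "norm (X i - w) > R" "norm (z - w) > R"
        using that norm_triangle_ineq2[of w "X i"] norm_triangle_ineq2[of w z] by (simp_all add: norm_minus_commute)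
      then show ?thesis using k(2) frechet_derivative_csupp[of R k, OF k(2)] by simp
    qed
    have alg: "x * (n *\<^sub>R (a - (b + c))) = n * (x * a - (x * b + x * c))" for x n a b c :: real
      by (simp add: algebra_simps)
    have int_q: "integrable lborel (\<lambda>w. u w * ?q i w)" for i
    proof -
      have "integrable lborel (\<lambda>w. (1 / norm (?h i)) * (u w * k (X i - w) - (u w * k (z - w) + u w * frechet_derivative k (at (z - w)) (?h i))))"
        by (intro integrable_mult_right Bochner_Integration.integrable_diff Bochner_Integration.integrable_add ik iDh)
      then show ?thesis unfolding alg .
    qed
    have eq: "(1 / norm (X i - z)) *\<^sub>R (conv u k (X i) - (conv u k z + ?D (X i - z))) = (LINT w|lborel. u w * ?q i w)" for i
    proof -
      have "(LINT w|lborel. u w * ?q i w) = (LINT w|lborel. (1 / norm (?h i)) * (u w * k (X i - w) - (u w * k (z - w) + u w * frechet_derivative k (at (z - w)) (?h i))))"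
        unfolding alg ..
      also have "\<dots> = (1 / norm (?h i)) * (conv u k (X i) - (conv u k z + ?D (X i - z)))"
        unfolding Deq conv_def[of u k] integral_mult_right_zero
          Bochner_Integration.integral_diff[OF ik Bochner_Integration.integrable_add[OF ik iDh]]
          Bochner_Integration.integral_add[OF ik iDh] ..
      finally show ?thesis unfolding real_scaleR_def by (rule sym)
    qed
    have conv: "(\<lambda>i. LINT w|lborel. u w * ?q i w) \<longlonglongrightarrow> (LINT w|lborel. u w * 0)"
    proof (rule integral_dominated_convergence[where w="\<lambda>w. 2 * B * \<bar>indicator (cball 0 (norm z + R + M)) w * u w\<bar>"])
      show "integrable lborel (\<lambda>w. 2 * B * \<bar>indicator (cball 0 (norm z + R + M)) w * u w\<bar>)"
        using u unfolding loc_int_def by (intro integrable_mult_right integrable_abs) blast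
      show "AE w in lborel. (\<lambda>i. u w * ?q i w) \<longlonglongrightarrow> u w * 0"
      proof (intro AE_I2 tendsto_mult tendsto_const)
        fix w
        have lim: "((\<lambda>y. (1 / norm (y - (z - w))) *\<^sub>R (k y - (k (z - w) + frechet_derivative k (at (z - w)) (y - (z - w))))) \<longlongrightarrow> 0) (at (z - w))"
          using fd[of "z - w"] unfolding has_derivative_within by blast
        have X1: "\<forall>i. X i - w \<in> UNIV - {z - w}" using X(1) by auto
        have X2: "(\<lambda>i. X i - w) \<longlonglongrightarrow> z - w" using X(2) by (intro tendsto_intros)
        have "((\<lambda>y. (1 / norm (y - (z - w))) *\<^sub>R (k y - (k (z - w) + frechet_derivative k (at (z - w)) (y - (z - w))))) \<circ> (\<lambda>i. X i - w)) \<longlonglongrightarrow> 0"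
          by (rule lim[unfolded tendsto_at_iff_sequentially, rule_format, OF X1[rule_format] X2])
        then show "(\<lambda>i. ?q i w) \<longlonglongrightarrow> 0" by (simp add: o_def)
      qed
      show "AE w in lborel. norm (u w * ?q i w) \<le> 2 * B * \<bar>indicator (cball 0 (norm z + R + M)) w * u w\<bar>" for i
      proof (rule AE_I2)
        fix w
        show "norm (u w * ?q i w) \<le> 2 * B * \<bar>indicator (cball 0 (norm z + R + M)) w * u w\<bar>"
        proof (cases "norm w \<le> norm z + R + M")
          case True
          have "\<bar>u w\<bar> * \<bar>?q i w\<bar> \<le> \<bar>u w\<bar> * (2 * B)" by (intro mult_left_mono qle) auto
          moreover have "\<bar>indicator (cball 0 (norm z + R + M)) w * u w\<bar> = \<bar>u w\<bar>" using True by simp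
          ultimately show ?thesis unfolding real_norm_def abs_mult[of "u w" "?q i w"] by (simp only: mult.commute)
        next
          case False
          then have "?q i w = 0" by (intro Rb) simp
          then have "norm (u w * ?q i w) = 0" by (simp only: mult_zero_right norm_zero)
          moreover have "0 \<le> 2 * B * \<bar>indicator (cball 0 (norm z + R + M)) w * u w\<bar>" using B(2) by simp
          ultimately show ?thesis by (simp only:)
        qed
      qed
      show "(\<lambda>w. u w * ?q i w) \<in> borel_measurable lborel" for i
        using int_q[of i] by (rule borel_measurable_integrable)
    qed simp
    show "((\<lambda>y. (1 / norm (y - z)) *\<^sub>R (conv u k y - (conv u k z + ?D (y - z)))) \<circ> X) \<longlonglongrightarrow> 0"
    proof -
      have "(LINT w|lborel. u w * 0) = 0" by simp
      then show ?thesis unfolding o_def eq using conv by (simp only:)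
    qed
  qed
qed


section \<open>Smooth functions, test functions and their convolutions\<close>

definition smooth :: "(complex \<Rightarrow> real) \<Rightarrow> bool" where
  "smooth f \<longleftrightarrow> (\<forall>k. Ck_on k UNIV f)"

lemma test_function_iff: "test_function f \<longleftrightarrow> smooth f \<and> (\<exists>R. \<forall>z. norm z > R \<longrightarrow> f z = 0)"
  by (simp add: test_function_def smooth_def)

lemma smooth_Ck: "smooth f \<Longrightarrow> Ck_on k UNIV f" by (simp add: smooth_def)

lemma smooth_frechet_derivative:
  assumes "smooth f" "e \<in> Basis"
  shows "smooth (\<lambda>z. frechet_derivative f (at z) e)"
  unfolding smooth_def
proof
  fix k
  have "Ck_on (Suc k) UNIV f" using smooth_Ck[OF assms(1)] .
  with assms(2) show "Ck_on k UNIV (\<lambda>z. frechet_derivative f (at z) e)" by simp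
qed

lemma smooth_continuous: "smooth f \<Longrightarrow> continuous_on UNIV f"
  using smooth_Ck Ck_on_imp_continuous_on by blast

lemma test_function_frechet_derivative:
  assumes "test_function f" "e \<in> Basis"
  shows "test_function (\<lambda>z. frechet_derivative f (at z) e)"
proof -
  obtain R where f: "smooth f" "\<And>z. norm z > R \<Longrightarrow> f z = 0" using assms by (auto simp: test_function_iff)
  then have "\<forall>z. norm z > R \<longrightarrow> frechet_derivative f (at z) e = 0"
    using frechet_derivative_csupp[of R f] by simp
  then show ?thesis using smooth_frechet_derivative[OF f(1) assms(2)] unfolding test_function_iff by blast
qed

lemma frechet_derivative_conv:
  assumes "loc_int u" "Ck_on (Suc 0) UNIV k" "\<And>z. norm z > R \<Longrightarrow> k z = 0" "e \<in> Basis"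
  shows "frechet_derivative (conv u k) (at z) e = conv u (\<lambda>z. frechet_derivative k (at z) e) z"
proof -
  have "frechet_derivative (conv u k) (at z) e = (\<Sum>e'\<in>Basis. (e \<bullet> e') * conv u (\<lambda>z. frechet_derivative k (at z) e') z)"
    by (rule fun_cong[OF frechet_derivative_at[OF conv_has_derivative[OF assms(1-3)], symmetric]])
  also have "\<dots> = (\<Sum>e'\<in>Basis. if e' = e then conv u (\<lambda>z. frechet_derivative k (at z) e') z else 0)"
    using assms(4) by (intro sum.cong) (auto simp: inner_Basis)
  finally show ?thesis using assms(4) by simp
qed

text \<open>All derivatives fall on the kernel, hence the induction generalises over
  \<open>k\<close> while \<open>u\<close> stays fixed.\<close>

lemma smooth_conv:
  assumes u: "loc_int u" and k: "test_function k"
  shows "smooth (conv u k)"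
proof -
  obtain R where "smooth k" "\<And>z. norm z > R \<Longrightarrow> k z = 0" using k by (auto simp: test_function_iff)
  then have "Ck_on n UNIV (conv u k)" for n
  proof (induction n arbitrary: k)
    case 0
    have "(conv u k has_derivative (\<lambda>h. \<Sum>e\<in>Basis. (h \<bullet> e) * conv u (\<lambda>z. frechet_derivative k (at z) e) z)) (at z)" for z
      by (rule conv_has_derivative[OF u smooth_Ck[OF 0(1)] 0(2)])
    then show ?case by (auto intro!: continuous_at_imp_continuous_on has_derivative_continuous)
  next
    case (Suc n)
    have "(conv u k has_derivative (\<lambda>h. \<Sum>e\<in>Basis. (h \<bullet> e) * conv u (\<lambda>z. frechet_derivative k (at z) e) z)) (at z)" for z
      by (rule conv_has_derivative[OF u smooth_Ck[OF Suc.prems(1)] Suc.prems(2)])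
    moreover have "Ck_on n UNIV (\<lambda>z. frechet_derivative (conv u k) (at z) e)" if eB: "e \<in> Basis" for e
    proof -
      have "(\<lambda>z. frechet_derivative (conv u k) (at z) e) = conv u (\<lambda>z. frechet_derivative k (at z) e)"
        by (rule ext) (rule frechet_derivative_conv[OF u smooth_Ck[OF Suc.prems(1)] Suc.prems(2) eB])
      moreover have "Ck_on n UNIV (conv u (\<lambda>z. frechet_derivative k (at z) e))"
        by (rule Suc.IH) (auto intro: smooth_frechet_derivative[OF Suc.prems(1) eB] frechet_derivative_csupp[of R k, OF Suc.prems(2)])
      ultimately show ?thesis by simp
    qed
    ultimately show ?case by (auto simp: differentiable_def)
  qed
  then show ?thesis by (simp add: smooth_def)
qed

lemma frechet_derivative_reflect:
  fixes k :: "complex \<Rightarrow> real"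
  assumes "k differentiable (at (z - w))"
  shows "((\<lambda>w. k (z - w)) has_derivative (\<lambda>h. - frechet_derivative k (at (z - w)) h)) (at w)"
proof -
  have fd: "(k has_derivative frechet_derivative k (at (z - w))) (at (z - w))"
    using assms frechet_derivative_works by blast
  have "((\<lambda>w. z - w) has_derivative (\<lambda>h. - h)) (at w)" by (auto intro!: derivative_eq_intros)
  from has_derivative_compose[OF this fd] show ?thesis
    by (rule has_derivative_eq_rhs) (simp add: linear_neg[OF has_derivative_linear[OF fd]])
qed

lemma Ck_on_reflect: "Ck_on n UNIV k \<Longrightarrow> Ck_on n UNIV (\<lambda>w. k (z - w))"
proof (induction n arbitrary: k)
  case 0
  then show ?case by (auto intro!: continuous_on_compose2[of UNIV k] continuous_intros)
next
  case (Suc n)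
  show ?case
  proof (rule Ck_on_SucI)
    show "((\<lambda>w. k (z - w)) has_derivative (\<lambda>h. - frechet_derivative k (at (z - w)) h)) (at w)" for w
      by (rule frechet_derivative_reflect) (use Suc.prems in auto)
    fix e :: complex assume "e \<in> Basis"
    then have "Ck_on n UNIV (\<lambda>w. frechet_derivative k (at w) e)" using Suc.prems by simp
    from Ck_on_cmult[OF _ Suc.IH[OF this], of "-1"]
    show "Ck_on n UNIV (\<lambda>w. - frechet_derivative k (at (z - w)) e)" by simp
  qed simp
qed

lemma test_function_reflect:
  assumes "test_function k" shows "test_function (\<lambda>w. k (z - w))"
proof -
  obtain R where k: "smooth k" "\<And>z. norm z > R \<Longrightarrow> k z = 0" using assms by (auto simp: test_function_iff)
  have "smooth (\<lambda>w. k (z - w))" using k(1) by (simp add: smooth_def Ck_on_reflect)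
  then show ?thesis using csupp_reflect(2)[OF smooth_continuous[OF k(1)] k(2)]
    unfolding test_function_iff by blast
qed

text \<open>For fixed z the reflected kernel w -> k(z - w) is itself a test function. The sign
  produced by the reflection cancels the one in the definition of the weak gradient.\<close>

lemma conv_weak_gradient:
  assumes u: "loc_int u" and g: "L2_weak_gradient u g" and k: "test_function k" and e: "e \<in> Basis"
  shows "frechet_derivative (conv u k) (at z) e = conv (\<lambda>w. g w \<bullet> e) k z"
proof -
  obtain R where k': "smooth k" "\<And>z. norm z > R \<Longrightarrow> k z = 0" using k by (auto simp: test_function_iff)
  have "k differentiable (at y)" for y using smooth_Ck[OF k'(1), of "Suc 0"] by simp
  then have r: "((\<lambda>w. k (z - w)) has_derivative (\<lambda>h. - frechet_derivative k (at (z - w)) h)) (at w)" for w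
    by (rule frechet_derivative_reflect)
  have d: "frechet_derivative (\<lambda>w. k (z - w)) (at w) e = - frechet_derivative k (at (z - w)) e" for w
    by (rule fun_cong[OF frechet_derivative_at[OF r, symmetric]])
  have "(LINT w|lborel. u w * frechet_derivative (\<lambda>w. k (z - w)) (at w) e) =
        - (LINT w|lborel. (g w \<bullet> e) * k (z - w))"
    by (rule g[unfolded L2_weak_gradient_def, THEN conjunct2, THEN conjunct2, rule_format, OF test_function_reflect[OF k] e])
  then have "conv u (\<lambda>z. frechet_derivative k (at z) e) z = conv (\<lambda>w. g w \<bullet> e) k z"
    unfolding conv_def d by simp
  then show ?thesis
    using frechet_derivative_conv[OF u smooth_Ck[OF k'(1)] k'(2) e] by simp
qed

section \<open>Approximation and mollification in L^2\<close>

lemma sum_sq_le2: "(a + b)\<^sup>2 \<le> 2 * a\<^sup>2 + 2 * b\<^sup>2" for a b :: real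
  using zero_le_power2[of "a - b"] by (simp add: power2_sum power2_diff)

lemma sq_int_add: "sq_int f \<Longrightarrow> sq_int g \<Longrightarrow> sq_int (\<lambda>z. f z + g z)"
  and integral_sq_add_le: "sq_int f \<Longrightarrow> sq_int g \<Longrightarrow>
    (LINT z|lborel. (f z + g z)\<^sup>2) \<le> 2 * (LINT z|lborel. (f z)\<^sup>2) + 2 * (LINT z|lborel. (g z)\<^sup>2)"
proof -
  assume f: "sq_int f" and g: "sq_int g"
  have m: "f \<in> borel_measurable borel" "g \<in> borel_measurable borel" using f g by (auto simp: sq_int_def)
  have i: "integrable lborel (\<lambda>z. 2 * (f z)\<^sup>2 + 2 * (g z)\<^sup>2)"
    using f g by (intro Bochner_Integration.integrable_add integrable_mult_right) (auto simp: sq_int_def)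
  have "integrable lborel (\<lambda>z. (f z + g z)\<^sup>2)"
  proof (rule Bochner_Integration.integrable_bound[OF i])
    show "AE z in lborel. norm ((f z + g z)\<^sup>2) \<le> norm (2 * (f z)\<^sup>2 + 2 * (g z)\<^sup>2)"
      using sum_sq_le2 by (intro AE_I2) simp
  qed (use m in simp)
  then show s: "sq_int (\<lambda>z. f z + g z)" using m by (simp add: sq_int_def)
  have "(LINT z|lborel. (f z + g z)\<^sup>2) \<le> (LINT z|lborel. 2 * (f z)\<^sup>2 + 2 * (g z)\<^sup>2)"
    using s i by (intro integral_mono) (auto simp: sq_int_def sum_sq_le2)
  also have "\<dots> = 2 * (LINT z|lborel. (f z)\<^sup>2) + 2 * (LINT z|lborel. (g z)\<^sup>2)"
    using f g by (simp add: sq_int_def)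
  finally show "(LINT z|lborel. (f z + g z)\<^sup>2) \<le> 2 * (LINT z|lborel. (f z)\<^sup>2) + 2 * (LINT z|lborel. (g z)\<^sup>2)" .
qed

lemma sq_int_minus: "sq_int f \<Longrightarrow> sq_int (\<lambda>z. - f z)"
  by (simp add: sq_int_def)

lemma sq_int_diff: "sq_int f \<Longrightarrow> sq_int g \<Longrightarrow> sq_int (\<lambda>z. f z - g z)"
  using sq_int_add[of f "\<lambda>z. - g z"] sq_int_minus[of g] by simp

lemma sq_int_csupp:
  assumes "continuous_on UNIV f" "\<And>z. norm z > R \<Longrightarrow> f z = 0"
  shows "sq_int f"
  unfolding sq_int_def
proof
  show "f \<in> borel_measurable borel" using assms(1) by (rule borel_measurable_continuous_onI)
  show "integrable lborel (\<lambda>z. (f z)\<^sup>2)"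
    by (rule integrable_csupp[of _ R]) (use assms in \<open>auto intro!: continuous_intros\<close>)
qed

lemma norm_sq_le: "\<bar>x\<bar> \<le> \<bar>y\<bar> \<Longrightarrow> norm (x\<^sup>2) \<le> y\<^sup>2" for x y :: real
  by (simp add: abs_le_square_iff)

text \<open>\<open>f\<close> is first truncated in value and in space by \<open>?c n\<close> and
  \<open>?\<chi> n\<close>. Continuous functions converging to \<open>f\<close> almost everywhere
  are then passed through the same truncation, which makes them uniformly bounded on a fixed ball,
  so that dominated convergence upgrades pointwise to L^2 convergence.\<close>

lemma sq_int_approx:
  assumes f: "sq_int f" and eps: "\<epsilon> > 0"
  shows "\<exists>g R. continuous_on UNIV g \<and> (\<forall>z. norm z > R \<longrightarrow> g z = 0) \<and> (LINT z|lborel. (f z - g z)\<^sup>2) < \<epsilon>"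
proof -
  have fm[measurable]: "f \<in> borel_measurable borel" and fi: "integrable lborel (\<lambda>z. (f z)\<^sup>2)"
    using f by (auto simp: sq_int_def)
  let ?c = "\<lambda>n x. max (- real n) (min (real n) x)"
  let ?\<chi> = "\<lambda>n. smooth_step 0 (2 * (real n + 1))"
  let ?f = "\<lambda>n z. ?\<chi> n z * ?c n (f z)"
  note st = smooth_step[of "2 * (real n + 1)" for n]
  have chic: "continuous_on UNIV (?\<chi> n)" for n
    by (rule Ck_on_imp_continuous_on[OF st(1)]) simp
  have chim[measurable]: "?\<chi> n \<in> borel_measurable borel" for n
    using chic by (rule borel_measurable_continuous_onI)
  have chi01: "0 \<le> ?\<chi> n z" "?\<chi> n z \<le> 1" for n z using st(4,5)[of n] by auto
  have "(\<lambda>n. LINT z|lborel. (f z - ?f n z)\<^sup>2) \<longlonglongrightarrow> (LINT z|(lborel::complex measure). (0::real))"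
  proof (rule integral_dominated_convergence[where w="\<lambda>z. (f z)\<^sup>2"])
    show "AE z in lborel. (\<lambda>n. (f z - ?f n z)\<^sup>2) \<longlonglongrightarrow> 0"
    proof (rule AE_I2, rule tendsto_eventually)
      fix z :: complex
      obtain N where N: "max \<bar>f z\<bar> (norm z) \<le> real N" using real_arch_simple by blast
      show "\<forall>\<^sub>F n in sequentially. (f z - ?f n z)\<^sup>2 = 0"
      proof (rule eventually_sequentiallyI[of N])
        fix n assume "N \<le> n"
        then have n: "\<bar>f z\<bar> \<le> real n" "norm z \<le> real n" using N by linarith+
        then have "?\<chi> n z = 1" using st(2)[of n z 0] by simp
        moreover have "?c n (f z) = f z" using n(1) by (simp add: abs_le_iff)
        ultimately show "(f z - ?f n z)\<^sup>2 = 0" by simp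
      qed
    qed
    show "AE z in lborel. norm ((f z - ?f n z)\<^sup>2) \<le> (f z)\<^sup>2" for n
    proof (rule AE_I2)
      fix z
      have "\<bar>x - a * ?c n x\<bar> \<le> \<bar>x\<bar>" if "0 \<le> a" "a \<le> 1" for a x :: real
      proof (cases "x \<ge> 0")
        case True
        then have "0 \<le> ?c n x" "?c n x \<le> x" by auto
        then have "0 \<le> a * ?c n x" "a * ?c n x \<le> 1 * x" using that by (simp, intro mult_mono, auto)
        then show ?thesis using True by linarith
      next
        case False
        then have c: "?c n x \<le> 0" "x \<le> ?c n x" by auto
        then have "a * ?c n x \<le> 0" using that by (simp add: mult_nonneg_nonpos)
        moreover have "1 * x \<le> a * ?c n x"
        proof -
          have "a * (- ?c n x) \<le> 1 * (- x)" using c that by (intro mult_mono) auto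
          then show ?thesis by simp
        qed
        ultimately show ?thesis using False by linarith
      qed
      from this[OF chi01] show "norm ((f z - ?f n z)\<^sup>2) \<le> (f z)\<^sup>2"
        by (simp add: abs_le_square_iff)
    qed
    show "(\<lambda>z. (f z - ?f n z)\<^sup>2) \<in> borel_measurable lborel" for n by measurable
  qed (use fi in \<open>simp_all\<close>)
  then have "(\<lambda>n. LINT z|lborel. (f z - ?f n z)\<^sup>2) \<longlonglongrightarrow> 0" by simp
  then have "\<forall>\<^sub>F n in sequentially. (LINT z|lborel. (f z - ?f n z)\<^sup>2) < \<epsilon> / 4"
    using eps by (intro order_tendstoD) auto
  then obtain n where n: "(LINT z|lborel. (f z - ?f n z)\<^sup>2) < \<epsilon> / 4"
    by (auto simp: eventually_sequentially)
  \<comment> \<open>The notion \<open>measurable_on\<close> supplies the pointwise approximation by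
    continuous functions, outside a negligible set.\<close>
  have "f \<in> borel_measurable lebesgue" by (simp add: measurable_completion)
  then have "f measurable_on UNIV" by (rule lebesgue_measurable_imp_measurable_on) simp
  then obtain N F where N: "negligible N" and F: "\<And>m. continuous_on UNIV (F m)" "\<And>x. x \<notin> N \<Longrightarrow> (\<lambda>m. F m x) \<longlonglongrightarrow> f x"
    unfolding measurable_on_def by auto
  have Fm[measurable]: "F m \<in> borel_measurable borel" for m using F(1) by (rule borel_measurable_continuous_onI)
  let ?g = "\<lambda>m z. ?\<chi> n z * ?c n (F m z)"
  have "AE x in lebesgue. x \<notin> N" using N by (simp add: negligible_iff_null_sets AE_not_in)
  then have AEN: "AE x in lborel. x \<notin> N" by (simp only: AE_completion_iff)
  have "(\<lambda>m. LINT z|lborel. (?f n z - ?g m z)\<^sup>2) \<longlonglongrightarrow> (LINT z|(lborel::complex measure). (0::real))"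
  proof (rule integral_dominated_convergence[where w="\<lambda>z. (2 * real n)\<^sup>2 * indicator (cball 0 (2 * (real n + 1))) z"])
    show "integrable lborel (\<lambda>z::complex. (2 * real n)\<^sup>2 * indicator (cball 0 (2 * (real n + 1))) z)"
      by (intro integrable_mult_right integrable_indicator_cball)
    show "AE z in lborel. (\<lambda>m. (?f n z - ?g m z)\<^sup>2) \<longlonglongrightarrow> 0"
      using AEN
    proof (rule AE_mp, intro AE_I2 impI)
      fix z assume "z \<notin> N"
      then have "(\<lambda>m. (?f n z - ?g m z)\<^sup>2) \<longlonglongrightarrow> (?f n z - ?f n z)\<^sup>2"
        by (intro tendsto_intros F(2))
      then show "(\<lambda>m. (?f n z - ?g m z)\<^sup>2) \<longlonglongrightarrow> 0" by simp
    qed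
    show "AE z in lborel. norm ((?f n z - ?g m z)\<^sup>2) \<le> (2 * real n)\<^sup>2 * indicator (cball 0 (2 * (real n + 1))) z" for m
    proof (rule AE_I2)
      fix z :: complex
      show "norm ((?f n z - ?g m z)\<^sup>2) \<le> (2 * real n)\<^sup>2 * indicator (cball 0 (2 * (real n + 1))) z"
      proof (cases "norm z \<le> 2 * (real n + 1)")
        case True
        have "\<bar>?c n x\<bar> \<le> real n" for x by auto
        then have "\<bar>?\<chi> n z * ?c n x\<bar> \<le> 1 * real n" for x
          unfolding abs_mult using chi01[of n z] by (intro mult_mono) auto
        moreover have "\<bar>a - b\<bar> \<le> \<bar>2 * r\<bar>" if "\<bar>a\<bar> \<le> 1 * r" "\<bar>b\<bar> \<le> 1 * r" for a b r :: real
          using that by linarith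
        ultimately have *: "\<bar>?f n z - ?g m z\<bar> \<le> \<bar>2 * real n\<bar>" by blast
        have i: "indicator (cball 0 (2 * (real n + 1))) z = (1::real)" using True by simp
        show ?thesis unfolding i mult_1_right by (rule norm_sq_le[OF *])
      next
        case False
        then have "?\<chi> n z = 0" using st(3)[of n z 0] by simp
        then show ?thesis by simp
      qed
    qed
    show "(\<lambda>z. (?f n z - ?g m z)\<^sup>2) \<in> borel_measurable lborel" for m by measurable
  qed simp
  then have "(\<lambda>m. LINT z|lborel. (?f n z - ?g m z)\<^sup>2) \<longlonglongrightarrow> 0" by simp
  then have "\<forall>\<^sub>F m in sequentially. (LINT z|lborel. (?f n z - ?g m z)\<^sup>2) < \<epsilon> / 4"
    using eps by (intro order_tendstoD) auto
  then obtain m where m: "(LINT z|lborel. (?f n z - ?g m z)\<^sup>2) < \<epsilon> / 4"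
    unfolding eventually_sequentially by blast
  have gc: "continuous_on UNIV (?g m)" using chic F(1) by (intro continuous_intros)
  have gs: "norm z > 2 * (real n + 1) \<Longrightarrow> ?g m z = 0" for z
    using st(3)[of n z 0] by simp
  have sf: "sq_int (?f n)"
  proof -
    have "integrable lborel (\<lambda>z. (?f n z)\<^sup>2)"
    proof (rule Bochner_Integration.integrable_bound[OF fi])
      have "\<bar>?\<chi> n z * ?c n (f z)\<bar> \<le> 1 * \<bar>f z\<bar>" for z
        unfolding abs_mult using chi01[of n z] by (intro mult_mono) auto
      then show "AE z in lborel. norm ((?f n z)\<^sup>2) \<le> norm ((f z)\<^sup>2)"
        by (intro AE_I2) (simp only: mult_1 real_norm_def abs_le_square_iff abs_power2)
      show "(\<lambda>z. (?f n z)\<^sup>2) \<in> borel_measurable lborel" by measurable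
    qed
    moreover have "?f n \<in> borel_measurable borel" by measurable
    ultimately show ?thesis unfolding sq_int_def by blast
  qed
  have "(LINT z|lborel. (f z - ?g m z)\<^sup>2) = (LINT z|lborel. ((f z - ?f n z) + (?f n z - ?g m z))\<^sup>2)" by simp
  also have "\<dots> \<le> 2 * (LINT z|lborel. (f z - ?f n z)\<^sup>2) + 2 * (LINT z|lborel. (?f n z - ?g m z)\<^sup>2)"
    by (intro integral_sq_add_le sq_int_diff f sf sq_int_csupp[OF gc gs])
  also have "\<dots> < \<epsilon>" using n m by linarith
  finally have fin: "(LINT z|lborel. (f z - ?g m z)\<^sup>2) < \<epsilon>" .
  show ?thesis by (intro exI[of _ "?g m"] exI[of _ "2 * (real n + 1)"] conjI allI impI gc gs fin)
qed

lemma sq_int_reflect: "sq_int f \<Longrightarrow> sq_int (\<lambda>z. f (c + z))"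
  unfolding sq_int_def using integrable_translate[of "\<lambda>z. (f z)\<^sup>2" c] measurable_compose[of "\<lambda>z. c + z" borel borel f borel] by simp

lemma uniform_csupp:
  fixes g :: "complex \<Rightarrow> real"
  assumes g: "continuous_on UNIV g" "\<And>z. norm z > R \<Longrightarrow> g z = 0" and "\<eta> > 0"
  shows "\<exists>\<delta>>0. \<delta> \<le> 1 \<and> (\<forall>h z. norm h < \<delta> \<longrightarrow> \<bar>g (h + z) - g z\<bar> < \<eta>)"
proof -
  have "uniformly_continuous_on (cball 0 (R + 2)) g"
    by (intro compact_uniformly_continuous) (use g in \<open>auto intro: continuous_on_subset\<close>)
  then have "\<exists>d>0. \<forall>x\<in>cball 0 (R + 2). \<forall>y\<in>cball 0 (R + 2). dist y x < d \<longrightarrow> dist (g y) (g x) < \<eta>"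
    unfolding uniformly_continuous_on_def using \<open>\<eta> > 0\<close> by (elim allE[of _ \<eta>]) simp
  then obtain d where d0: "d > 0" and d1: "\<forall>x\<in>cball 0 (R + 2). \<forall>y\<in>cball 0 (R + 2). dist y x < d \<longrightarrow> dist (g y) (g x) < \<eta>"
    by (elim exE conjE)
  note d = d0 d1[rule_format]
  show ?thesis
  proof (intro exI[of _ "min d 1"] conjI allI impI)
    fix h z :: complex assume h: "norm h < min d 1"
    show "\<bar>g (h + z) - g z\<bar> < \<eta>"
    proof (cases "norm z \<le> R + 1")
      case True
      have "norm (h + z) \<le> R + 2" using norm_triangle_ineq[of h z] h True by simp
      then have "h + z \<in> cball 0 (R + 2)" "z \<in> cball 0 (R + 2)" using True by simp_all
      moreover have "dist (h + z) z < d" using h by (simp add: dist_norm)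
      ultimately have "dist (g (h + z)) (g z) < \<eta>" by (intro d(2))
      then show ?thesis by (simp add: dist_real_def)
    next
      case False
      have "norm z \<le> norm (h + z) + norm h" using norm_triangle_ineq4[of "h + z" h] by simp
      then have "norm (h + z) > R" using False h by simp
      then show ?thesis using False g(2) \<open>\<eta> > 0\<close> by simp
    qed
  qed (use d0 in simp_all)
qed

text \<open>Continuity of translation in L^2: compare both \<open>f\<close> and its translate with a
  continuous compactly supported \<open>g\<close>, for which translation is uniformly
  continuous.\<close>

lemma sq_int_translation:
  assumes f: "sq_int f" and eps: "\<epsilon> > 0"
  shows "\<exists>\<delta>>0. \<forall>h. norm h < \<delta> \<longrightarrow> (LINT z|lborel. (f (h + z) - f z)\<^sup>2) \<le> \<epsilon>"
proof -
  obtain g R where g: "continuous_on UNIV g" "\<And>z. norm z > R \<Longrightarrow> g z = 0" "(LINT z|lborel. (f z - g z)\<^sup>2) < \<epsilon> / 16"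
    using sq_int_approx[OF f, of "\<epsilon> / 16"] eps by auto
  have gs: "sq_int g" using sq_int_csupp[OF g(1,2)] .
  define V where "V = measure lborel (cball (0::complex) (R + 1))"
  have V: "V \<ge> 0" by (simp add: V_def)
  \<comment> \<open>Chosen so that the square, integrated over the ball of measure \<open>V\<close>,
    is at most \<epsilon>/8; \<open>V + 1\<close> avoids a division by zero. With two uses of
    (a+b)^2 \<le> 2a^2 + 2b^2 the total is at most 2/16 + 4/8 + 4/16 of \<epsilon>.\<close>
  let ?\<eta> = "sqrt (\<epsilon> / (8 * (V + 1)))"
  have eta: "?\<eta> > 0" using eps V by simp
  obtain \<delta> where \<delta>: "\<delta> > 0" "\<delta> \<le> 1" "\<And>h z. norm h < \<delta> \<Longrightarrow> \<bar>g (h + z) - g z\<bar> < ?\<eta>"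
    using uniform_csupp[OF g(1,2) eta] by blast
  show ?thesis
  proof (intro exI[of _ \<delta>] conjI allI impI \<delta>(1))
    fix h :: complex assume h: "norm h < \<delta>"
    let ?d = "\<lambda>z. f z - g z"
    have ds: "sq_int ?d" using sq_int_diff[OF f gs] .
    have gd: "sq_int (\<lambda>z. g (h + z) - g z)" using sq_int_diff[OF sq_int_reflect[OF gs] gs] .
    have 1: "(LINT z|lborel. (g (h + z) - g z)\<^sup>2) \<le> \<epsilon> / 8"
    proof -
      have "(LINT z|lborel. (g (h + z) - g z)\<^sup>2) \<le> (LINT z|lborel. (\<epsilon> / (8 * (V + 1))) * indicator (cball 0 (R + 1)) (z::complex))"
      proof (rule integral_mono)
        show "integrable lborel (\<lambda>z. (g (h + z) - g z)\<^sup>2)" using gd by (simp add: sq_int_def)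
        show "integrable lborel (\<lambda>z::complex. (\<epsilon> / (8 * (V + 1))) * indicator (cball 0 (R + 1)) z)"
          by (intro integrable_mult_right integrable_indicator_cball)
        fix z :: complex
        show "(g (h + z) - g z)\<^sup>2 \<le> (\<epsilon> / (8 * (V + 1))) * indicator (cball 0 (R + 1)) z"
        proof (cases "norm z \<le> R + 1")
          case True
          have "\<bar>g (h + z) - g z\<bar>\<^sup>2 \<le> ?\<eta>\<^sup>2" using \<delta>(3)[OF h, of z] by (intro power_mono) auto
          also have "?\<eta>\<^sup>2 = \<epsilon> / (8 * (V + 1))" using eps V by simp
          finally show ?thesis using True by simp
        next
          case False
          have "norm z \<le> norm (h + z) + norm h" using norm_triangle_ineq4[of "h + z" h] by simp
          then have "norm (h + z) > R" using False h \<delta>(2) by simp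
          then show ?thesis using False g(2) by simp
        qed
      qed
      also have "\<dots> = (\<epsilon> / (8 * (V + 1))) * V" by (simp add: V_def)
      also have "\<dots> = \<epsilon> / 8 * (V / (V + 1))" by simp
      also have "\<dots> \<le> \<epsilon> / 8 * 1" using eps V by (intro mult_left_mono) auto
      finally show ?thesis by simp
    qed
    have 2: "(LINT z|lborel. (?d (h + z))\<^sup>2) = (LINT z|lborel. (?d z)\<^sup>2)"
      by (rule integral_translate[of "\<lambda>z. (?d z)\<^sup>2" h]) (use ds in \<open>auto simp: sq_int_def intro!: borel_measurable_power\<close>)
    have s3: "sq_int (\<lambda>z. (g (h + z) - g z) + (- ?d z))" by (rule sq_int_add[OF gd sq_int_minus[OF ds]])
    have 3: "(LINT z|lborel. ((g (h + z) - g z) + (- ?d z))\<^sup>2) \<le> 2 * (LINT z|lborel. (g (h + z) - g z)\<^sup>2) + 2 * (LINT z|lborel. (- ?d z)\<^sup>2)"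
      by (rule integral_sq_add_le[OF gd sq_int_minus[OF ds]])
    have "(LINT z|lborel. (f (h + z) - f z)\<^sup>2) = (LINT z|lborel. (?d (h + z) + ((g (h + z) - g z) + (- ?d z)))\<^sup>2)"
      by (intro Bochner_Integration.integral_cong) auto
    also have "\<dots> \<le> 2 * (LINT z|lborel. (?d (h + z))\<^sup>2) + 2 * (LINT z|lborel. ((g (h + z) - g z) + (- ?d z))\<^sup>2)"
      by (rule integral_sq_add_le[OF sq_int_reflect[OF ds] s3])
    also have "\<dots> \<le> \<epsilon>" using 1 2 3 g(3) eps unfolding power2_minus by linarith
    finally show "(LINT z|lborel. (f (h + z) - f z)\<^sup>2) \<le> \<epsilon>" .
  qed
qed

definition moll :: "nat \<Rightarrow> complex \<Rightarrow> real" where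
  "moll n z = flat_exp 0 ((1 / real (Suc n))\<^sup>2 - (norm z)\<^sup>2) /
     (LINT w|lborel. flat_exp 0 ((1 / real (Suc n))\<^sup>2 - (norm (w::complex))\<^sup>2))"

lemma moll:
  shows "test_function (moll n)" "\<And>z. norm z > 1 / real (Suc n) \<Longrightarrow> moll n z = 0"
    "\<And>z. moll n z \<ge> 0" "(LINT z|lborel. moll n z) = 1"
proof -
  define r where "r = 1 / real (Suc n)"
  have r: "r > 0" by (simp add: r_def)
  let ?b = "\<lambda>z::complex. flat_exp 0 (r\<^sup>2 - (norm z)\<^sup>2)"
  let ?I = "LINT w|lborel. ?b w"
  have meq: "moll n = (\<lambda>z. ?b z / ?I)" by (simp add: moll_def r_def fun_eq_iff)
  have ck: "Ck_on k UNIV ?b" for k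
    using Ck_on_norm_power2[of UNIV k 0] by (intro Ck_on_flat_exp Ck_on_diff Ck_on_const) auto
  have cont: "continuous_on UNIV ?b" using ck[of 0] by simp
  have supp: "norm z > r \<Longrightarrow> ?b z = 0" for z
    using r by (intro flat_exp_0) (auto intro!: power_mono)
  have bi: "integrable lborel ?b" using integrable_csupp[OF cont supp] by auto
  have "?I > 0"
  proof -
    \<comment> \<open>On the concentric ball of half the radius the argument of the bump is at least
      r^2 - (r/2)^2 = 3/4 r^2, so \<open>c\<close> is a lower bound there and the normalising
      integral is positive.\<close>
    define c where "c = exp (- inverse (3 / 4 * r\<^sup>2))"
    have "(LINT w|lborel. c * indicator (cball (0::complex) (r / 2)) w) \<le> ?I"
    proof (rule integral_mono[OF _ bi])
      show "integrable lborel (\<lambda>w. c * indicator (cball (0::complex) (r / 2)) w)"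
        by (intro integrable_mult_right integrable_indicator_cball)
      fix w :: complex
      show "c * indicator (cball (0::complex) (r / 2)) w \<le> ?b w"
      proof (cases "norm w \<le> r / 2")
        case True
        then have "(norm w)\<^sup>2 \<le> (r / 2)\<^sup>2" by (intro power_mono) auto
        then have q: "3 / 4 * r\<^sup>2 \<le> r\<^sup>2 - (norm w)\<^sup>2" by (simp add: power2_eq_square)
        have p: "0 < 3 / 4 * r\<^sup>2" using r by simp
        have "r\<^sup>2 - (norm w)\<^sup>2 > 0" using q p by linarith
        moreover note le_imp_inverse_le[OF q p]
        ultimately have "c \<le> ?b w" unfolding c_def flat_exp_def by simp
        then show ?thesis using True by simp
      next
        case False then show ?thesis by (simp add: flat_exp_nonneg)
      qed
    qed
    moreover have "(LINT w|lborel. c * indicator (cball (0::complex) (r / 2)) w) = c * measure lborel (cball (0::complex) (r / 2))" by simp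
    moreover have "measure lborel (cball (0::complex) (r / 2)) > 0"
      using r content_cball[of "r / 2" "0::complex"] by (simp add: unit_ball_vol_2)
    moreover have "c > 0" by (simp add: c_def)
    ultimately have "0 < (LINT w|lborel. c * indicator (cball (0::complex) (r / 2)) w)"
      by (simp only: mult_pos_pos)
    then show ?thesis using \<open>(LINT w|lborel. c * indicator (cball (0::complex) (r / 2)) w) \<le> ?I\<close> by linarith
  qed
  note I = this
  show "\<And>z. norm z > 1 / real (Suc n) \<Longrightarrow> moll n z = 0" unfolding meq using supp by (simp add: r_def)
  show "test_function (moll n)"
  proof -
    have "Ck_on k UNIV (\<lambda>z. (1 / ?I) * ?b z)" for k by (intro Ck_on_cmult ck) simp
    then have "smooth (moll n)" unfolding meq smooth_def by simp
    moreover have "\<forall>z. norm z > r \<longrightarrow> moll n z = 0" unfolding meq using supp by simp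
    ultimately show ?thesis unfolding test_function_iff by blast
  qed
  show "\<And>z. moll n z \<ge> 0" unfolding meq using I flat_exp_nonneg by simp
  show "(LINT z|lborel. moll n z) = 1" unfolding meq using I by simp
qed

lemma conv_reflect:
  assumes "f \<in> borel_measurable borel" "k \<in> borel_measurable borel"
  shows "conv f k z = (LINT w|lborel. f (z - w) * k w)"
  unfolding conv_def using integral_reflect[of "\<lambda>w. f w * k (z - w)" z] assms by simp

text \<open>Jensen's inequality for the probability density \<open>k\<close>: the integral of (f(z -
  w) - c)^2 k(w) is a quadratic polynomial in c, and it is nonnegative at the mean c = conv f k
  z.\<close>

lemma conv_minus_sq_le:
  assumes f: "sq_int f" and k: "test_function k" "\<And>z. k z \<ge> 0" "(LINT z|lborel. k z) = 1"
  shows "integrable lborel (\<lambda>w. (f (z - w) - f z)\<^sup>2 * k w)"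
    "(conv f k z - f z)\<^sup>2 \<le> (LINT w|lborel. (f (z - w) - f z)\<^sup>2 * k w)"
proof -
  obtain R where k': "smooth k" "\<And>z. norm z > R \<Longrightarrow> k z = 0" using k(1) by (auto simp: test_function_iff)
  have kc: "continuous_on UNIV k" using smooth_continuous[OF k'(1)] .
  have [measurable]: "f \<in> borel_measurable borel" "k \<in> borel_measurable borel"
    using f kc by (auto simp: sq_int_def intro: borel_measurable_continuous_onI)
  obtain B where B: "\<And>z. \<bar>k z\<bar> \<le> B" using bounded_csupp[OF kc k'(2)] by blast
  have ki: "integrable lborel k" using integrable_csupp[OF kc k'(2)] .
  have i2: "integrable lborel (\<lambda>w. (f (z - w))\<^sup>2 * k w)"
    by (rule bounded_times_integrable(1)[OF _ _ B]) (use f integrable_reflect[of "\<lambda>w. (f w)\<^sup>2" z] in \<open>auto simp: sq_int_def\<close>)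
  have i1: "integrable lborel (\<lambda>w. f (z - w) * k w)"
  proof -
    have "integrable lborel (\<lambda>w. f w * k (z - w))"
      by (rule integrable_conv[OF loc_int_L2loc[OF L2loc_sq_int[OF f]] kc k'(2)])
    from integrable_reflect[OF this, of z] show ?thesis by simp
  qed
  have e: "(f (z - w) - c)\<^sup>2 * k w = (f (z - w))\<^sup>2 * k w - (2 * c) * (f (z - w) * k w) + c\<^sup>2 * k w" for c w
    by (simp add: power2_diff algebra_simps)
  have i3: "integrable lborel (\<lambda>w. (f (z - w) - c)\<^sup>2 * k w)" for c
    unfolding e by (intro Bochner_Integration.integrable_add Bochner_Integration.integrable_diff integrable_mult_right i1 i2 ki)
  then show "integrable lborel (\<lambda>w. (f (z - w) - f z)\<^sup>2 * k w)" .
  have v: "(LINT w|lborel. (f (z - w) - c)\<^sup>2 * k w) = (LINT w|lborel. (f (z - w))\<^sup>2 * k w) - (2 * c) * conv f k z + c\<^sup>2" for c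
    unfolding e conv_reflect[OF \<open>f \<in> borel_measurable borel\<close> \<open>k \<in> borel_measurable borel\<close>] using i1 i2 ki k(3) by simp
  have "0 \<le> (LINT w|lborel. (f (z - w) - conv f k z)\<^sup>2 * k w)"
    using k(2) by (intro integral_nonneg_AE AE_I2) simp
  then show "(conv f k z - f z)\<^sup>2 \<le> (LINT w|lborel. (f (z - w) - f z)\<^sup>2 * k w)"
    unfolding v by (simp add: power2_diff power2_eq_square algebra_simps)
qed

text \<open>After Jensen's inequality and Tonelli the L^2 error is an average, with weight
  \<open>k\<close>, of squared translation errors, and only shifts shorter than \<delta> carry
  weight.\<close>

lemma conv_minus_L2:
  assumes f: "sq_int f" and k: "test_function k" "\<And>z. k z \<ge> 0" "(LINT z|lborel. k z) = 1"
    and d: "\<And>h. norm h \<ge> \<delta> \<Longrightarrow> k h = 0" "\<And>h. norm h < \<delta> \<Longrightarrow> (LINT z|lborel. (f (h + z) - f z)\<^sup>2) \<le> \<epsilon>" and eps: "\<epsilon> \<ge> 0"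
  shows "sq_int (\<lambda>z. conv f k z - f z)" "(LINT z|lborel. (conv f k z - f z)\<^sup>2) \<le> \<epsilon>"
proof -
  obtain R where k': "smooth k" "\<And>z. norm z > R \<Longrightarrow> k z = 0" using k(1) by (auto simp: test_function_iff)
  have kc: "continuous_on UNIV k" using smooth_continuous[OF k'(1)] .
  have cc: "continuous_on UNIV (conv f k)"
    using smooth_conv[OF loc_int_L2loc[OF L2loc_sq_int[OF f]] k(1)] by (rule smooth_continuous)
  have [measurable]: "f \<in> borel_measurable borel" "k \<in> borel_measurable borel" "conv f k \<in> borel_measurable borel"
    using f kc cc by (auto simp: sq_int_def intro: borel_measurable_continuous_onI)
  have ki: "integrable lborel k" using integrable_csupp[OF kc k'(2)] .
  have "(\<integral>\<^sup>+z. ennreal ((conv f k z - f z)\<^sup>2) \<partial>lborel) \<le> (\<integral>\<^sup>+z. (\<integral>\<^sup>+w. ennreal ((f (z - w) - f z)\<^sup>2 * k w) \<partial>lborel) \<partial>lborel)"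
  proof (rule nn_integral_mono)
    fix z
    have "(\<integral>\<^sup>+w. ennreal ((f (z - w) - f z)\<^sup>2 * k w) \<partial>lborel) = ennreal (LINT w|lborel. (f (z - w) - f z)\<^sup>2 * k w)"
      by (rule nn_integral_eq_integral[OF conv_minus_sq_le(1)[OF f k]]) (use k(2) in simp)
    then show "ennreal ((conv f k z - f z)\<^sup>2) \<le> (\<integral>\<^sup>+w. ennreal ((f (z - w) - f z)\<^sup>2 * k w) \<partial>lborel)"
      using conv_minus_sq_le(2)[OF f k, of z] by (simp add: ennreal_leI)
  qed
  also have "\<dots> = (\<integral>\<^sup>+w. (\<integral>\<^sup>+z. ennreal ((f (z - w) - f z)\<^sup>2 * k w) \<partial>lborel) \<partial>lborel)"
    by (rule lborel_pair.Fubini'[symmetric]) simp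
  also have "\<dots> \<le> (\<integral>\<^sup>+w. ennreal (k w) * ennreal \<epsilon> \<partial>lborel)"
  proof (rule nn_integral_mono)
    fix w
    show "(\<integral>\<^sup>+z. ennreal ((f (z - w) - f z)\<^sup>2 * k w) \<partial>lborel) \<le> ennreal (k w) * ennreal \<epsilon>"
    proof (cases "norm w < \<delta>")
      case True
      have si: "sq_int (\<lambda>z. f (- w + z) - f z)" by (rule sq_int_diff[OF sq_int_reflect[OF f] f])
      have "(\<integral>\<^sup>+z. ennreal ((f (- w + z) - f z)\<^sup>2) \<partial>lborel) = ennreal (LINT z|lborel. (f (- w + z) - f z)\<^sup>2)"
        by (rule nn_integral_eq_integral) (use si in \<open>auto simp: sq_int_def\<close>)
      also have "\<dots> \<le> ennreal \<epsilon>" using d(2)[of "- w"] True by (simp add: ennreal_leI)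
      finally have *: "(\<integral>\<^sup>+z. ennreal ((f (z - w) - f z)\<^sup>2) \<partial>lborel) \<le> ennreal \<epsilon>" by simp
      have "(\<integral>\<^sup>+z. ennreal ((f (z - w) - f z)\<^sup>2 * k w) \<partial>lborel) = (\<integral>\<^sup>+z. ennreal (k w) * ennreal ((f (z - w) - f z)\<^sup>2) \<partial>lborel)"
        using k(2) by (simp add: ennreal_mult' mult.commute)
      also have "\<dots> = ennreal (k w) * (\<integral>\<^sup>+z. ennreal ((f (z - w) - f z)\<^sup>2) \<partial>lborel)"
        by (rule nn_integral_cmult) simp
      finally show ?thesis using * by (simp add: mult_left_mono)
    next
      case False
      then show ?thesis using d(1) by simp
    qed
  qed
  also have "\<dots> = ennreal \<epsilon>"
  proof -
    have "(\<integral>\<^sup>+w. ennreal (k w) \<partial>lborel) = ennreal 1" using nn_integral_eq_integral[OF ki] k by simp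
    then show ?thesis by (simp add: nn_integral_multc)
  qed
  finally have *: "(\<integral>\<^sup>+z. ennreal ((conv f k z - f z)\<^sup>2) \<partial>lborel) \<le> ennreal \<epsilon>" .
  then have "integrable lborel (\<lambda>z. (conv f k z - f z)\<^sup>2)"
    by (intro integrableI_bounded) (auto intro: le_less_trans)
  then show "sq_int (\<lambda>z. conv f k z - f z)" by (simp add: sq_int_def)
  show "(LINT z|lborel. (conv f k z - f z)\<^sup>2) \<le> \<epsilon>"
    by (rule integral_real_bounded) (use * eps in auto)
qed

text \<open>Square integrability is claimed only eventually because it comes out of the error bound,
  which starts to hold once the radius of the mollifier is below the translation modulus
  \<delta>.\<close>

lemma moll_L2:
  assumes f: "sq_int f"
  shows "\<forall>\<^sub>F n in sequentially. sq_int (\<lambda>z. conv f (moll n) z - f z)"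
    "(\<lambda>n. LINT z|lborel. (conv f (moll n) z - f z)\<^sup>2) \<longlonglongrightarrow> 0"
proof -
  have ev: "\<forall>\<^sub>F n in sequentially. sq_int (\<lambda>z. conv f (moll n) z - f z) \<and> (LINT z|lborel. (conv f (moll n) z - f z)\<^sup>2) \<le> \<epsilon>"
    if eps: "\<epsilon> > 0" for \<epsilon>
  proof -
    obtain \<delta> where \<delta>: "\<delta> > 0" "\<And>h. norm h < \<delta> \<Longrightarrow> (LINT z|lborel. (f (h + z) - f z)\<^sup>2) \<le> \<epsilon>"
      using sq_int_translation[OF f eps] by blast
    have "\<forall>\<^sub>F n in sequentially. 1 / real (Suc n) < \<delta>"
      using order_tendstoD(2)[OF LIMSEQ_inverse_real_of_nat \<delta>(1)] by (simp add: inverse_eq_divide)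
    then show ?thesis
    proof (rule eventually_mono)
      fix n assume n: "1 / real (Suc n) < \<delta>"
      have s: "moll n h = 0" if "norm h \<ge> \<delta>" for h by (rule moll(2)) (use n that in linarith)
      note c = conv_minus_L2[OF f moll(1)[of n] moll(3)[of n] moll(4)[of n] s \<delta>(2) less_imp_le[OF eps]]
      show "sq_int (\<lambda>z. conv f (moll n) z - f z) \<and> (LINT z|lborel. (conv f (moll n) z - f z)\<^sup>2) \<le> \<epsilon>"
        by (rule conjI[OF c])
    qed
  qed
  show "\<forall>\<^sub>F n in sequentially. sq_int (\<lambda>z. conv f (moll n) z - f z)"
    by (rule eventually_mono[OF ev[OF zero_less_one]]) (rule conjunct1)
  show "(\<lambda>n. LINT z|lborel. (conv f (moll n) z - f z)\<^sup>2) \<longlonglongrightarrow> 0"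
  proof (rule tendstoI)
    fix e :: real assume "e > 0"
    then have "e / 2 > 0" by simp
    from ev[OF this] show "\<forall>\<^sub>F n in sequentially. dist (LINT z|lborel. (conv f (moll n) z - f z)\<^sup>2) 0 < e"
    proof (rule eventually_mono)
      fix n assume *: "sq_int (\<lambda>z. conv f (moll n) z - f z) \<and> (LINT z|lborel. (conv f (moll n) z - f z)\<^sup>2) \<le> e / 2"
      have "0 \<le> (LINT z|lborel. (conv f (moll n) z - f z)\<^sup>2)" by (rule Bochner_Integration.integral_nonneg) (rule zero_le_power2)
      with * \<open>e > 0\<close> show "dist (LINT z|lborel. (conv f (moll n) z - f z)\<^sup>2) 0 < e" unfolding dist_real_def by linarith
    qed
  qed
qed

section \<open>Weak gradients and the space H1\<close>

lemma smooth_measurable: "smooth f \<Longrightarrow> f \<in> borel_measurable borel"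
  by (rule borel_measurable_continuous_onI[OF smooth_continuous])

lemma smooth_has_derivative: "smooth f \<Longrightarrow> (f has_derivative frechet_derivative f (at z)) (at z)"
  using Ck_on_Suc_has_derivative[OF smooth_Ck] by simp

lemma smooth_differentiable: "smooth f \<Longrightarrow> f differentiable (at z)"
  using smooth_has_derivative unfolding differentiable_def by blast

definition cgrad :: "(complex \<Rightarrow> real) \<Rightarrow> complex \<Rightarrow> complex" where
  "cgrad f z = (\<Sum>e\<in>Basis. frechet_derivative f (at z) e *\<^sub>R e)"

lemma cgrad_inner: "e \<in> Basis \<Longrightarrow> cgrad f z \<bullet> e = frechet_derivative f (at z) e"
  unfolding cgrad_def by (rule inner_sum_left_Basis)

lemma norm_sq_Basis: "(norm (x::complex))\<^sup>2 = (\<Sum>e\<in>Basis. (x \<bullet> e)\<^sup>2)"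
  by (subst power2_norm_eq_inner, subst euclidean_inner) (simp only: power2_eq_square)

lemma vec_measurable:
  fixes g :: "complex \<Rightarrow> complex"
  assumes "\<And>e. e \<in> Basis \<Longrightarrow> (\<lambda>z. g z \<bullet> e) \<in> borel_measurable borel"
  shows "g \<in> borel_measurable borel"
proof -
  have "(\<lambda>z. \<Sum>e\<in>Basis. (g z \<bullet> e) *\<^sub>R e) \<in> borel_measurable borel"
    by (intro borel_measurable_sum borel_measurable_scaleR assms borel_measurable_const)
  then show ?thesis by (simp only: euclidean_representation)
qed

lemma vec_L2:
  fixes g :: "complex \<Rightarrow> complex"
  assumes "\<And>e. e \<in> Basis \<Longrightarrow> sq_int (\<lambda>z. g z \<bullet> e)"
  shows "g \<in> borel_measurable borel" "integrable lborel (\<lambda>z. (norm (g z))\<^sup>2)"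
    "(LINT z|lborel. (norm (g z))\<^sup>2) = (\<Sum>e\<in>Basis. LINT z|lborel. (g z \<bullet> e)\<^sup>2)"
proof -
  show "g \<in> borel_measurable borel" by (rule vec_measurable) (use assms in \<open>auto simp: sq_int_def\<close>)
  have i: "\<And>e. e \<in> Basis \<Longrightarrow> integrable lborel (\<lambda>z. (g z \<bullet> e)\<^sup>2)" using assms by (auto simp: sq_int_def)
  show "integrable lborel (\<lambda>z. (norm (g z))\<^sup>2)"
    unfolding norm_sq_Basis by (rule Bochner_Integration.integrable_sum[OF i])
  show "(LINT z|lborel. (norm (g z))\<^sup>2) = (\<Sum>e\<in>Basis. LINT z|lborel. (g z \<bullet> e)\<^sup>2)"
    unfolding norm_sq_Basis by (rule Bochner_Integration.integral_sum[OF i])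
qed

lemma L2_weak_gradientD:
  assumes "L2_weak_gradient u g"
  shows "e \<in> Basis \<Longrightarrow> sq_int (\<lambda>z. g z \<bullet> e)"
    "test_function f \<Longrightarrow> e \<in> Basis \<Longrightarrow>
      (LINT z|lborel. u z * frechet_derivative f (at z) e) = - (LINT z|lborel. (g z \<bullet> e) * f z)"
proof -
  have g: "g \<in> borel_measurable borel" "integrable lborel (\<lambda>z. (norm (g z))\<^sup>2)"
    using assms unfolding L2_weak_gradient_def by blast+
  show "sq_int (\<lambda>z. g z \<bullet> e)" if "e \<in> Basis"
    unfolding sq_int_def
  proof
    show m: "(\<lambda>z. g z \<bullet> e) \<in> borel_measurable borel" using g(1) by (intro borel_measurable_inner borel_measurable_const)
    show "integrable lborel (\<lambda>z. (g z \<bullet> e)\<^sup>2)"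
    proof (rule Bochner_Integration.integrable_bound[OF g(2)])
      show "(\<lambda>z. (g z \<bullet> e)\<^sup>2) \<in> borel_measurable lborel" using borel_measurable_power[OF m] by simp
      have "norm ((x \<bullet> e)\<^sup>2) \<le> norm ((norm x)\<^sup>2)" for x :: complex
        using Basis_le_norm[OF that, of x] by (simp add: abs_le_square_iff[symmetric])
      then show "AE z in lborel. norm ((g z \<bullet> e)\<^sup>2) \<le> norm ((norm (g z))\<^sup>2)" by (intro AE_I2)
    qed
  qed
  show "test_function f \<Longrightarrow> e \<in> Basis \<Longrightarrow>
      (LINT z|lborel. u z * frechet_derivative f (at z) e) = - (LINT z|lborel. (g z \<bullet> e) * f z)"
    using assms unfolding L2_weak_gradient_def by blast
qed

lemma L2_weak_gradientI:
  assumes "\<And>e. e \<in> Basis \<Longrightarrow> sq_int (\<lambda>z. g z \<bullet> e)"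
    "\<And>f e. test_function f \<Longrightarrow> e \<in> Basis \<Longrightarrow>
      (LINT z|lborel. u z * frechet_derivative f (at z) e) = - (LINT z|lborel. (g z \<bullet> e) * f z)"
  shows "L2_weak_gradient u g"
  unfolding L2_weak_gradient_def using vec_L2[of g, OF assms(1)] assms(2) by (intro conjI allI impI ballI)

lemma test_function_csupp:
  assumes "test_function f" "e \<in> Basis"
  shows "\<exists>R. continuous_on UNIV f \<and> (\<forall>z. norm z > R \<longrightarrow> f z = 0) \<and>
    continuous_on UNIV (\<lambda>z. frechet_derivative f (at z) e) \<and> (\<forall>z. norm z > R \<longrightarrow> frechet_derivative f (at z) e = 0)"
proof -
  obtain R where f: "smooth f" "\<forall>z. norm z > R \<longrightarrow> f z = 0" using assms(1) unfolding test_function_iff by (elim conjE exE)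
  have "\<forall>z. norm z > R \<longrightarrow> frechet_derivative f (at z) e = 0"
    by (intro allI impI, rule frechet_derivative_csupp[OF f(2)[rule_format]])
  then show ?thesis using smooth_continuous[OF f(1)] smooth_continuous[OF smooth_frechet_derivative[OF f(1) assms(2)]] f(2)
    by (intro exI[of _ R] conjI)
qed

lemma L2_weak_gradient_diff:
  assumes u: "L2_weak_gradient u g" "loc_int u" and v: "L2_weak_gradient v h" "loc_int v"
  shows "L2_weak_gradient (\<lambda>z. u z - v z) (\<lambda>z. g z - h z)"
proof (rule L2_weak_gradientI)
  fix e :: complex assume e: "e \<in> Basis"
  show "sq_int (\<lambda>z. (g z - h z) \<bullet> e)"
    unfolding inner_diff_left by (intro sq_int_diff L2_weak_gradientD(1)[OF u(1) e] L2_weak_gradientD(1)[OF v(1) e])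
  fix f assume f: "test_function f"
  obtain R where R: "continuous_on UNIV f" "\<forall>z. norm z > R \<longrightarrow> f z = 0"
    "continuous_on UNIV (\<lambda>z. frechet_derivative f (at z) e)" "\<forall>z. norm z > R \<longrightarrow> frechet_derivative f (at z) e = 0"
    using test_function_csupp[OF f e] by blast
  have i: "integrable lborel (\<lambda>z. u z * frechet_derivative f (at z) e)" "integrable lborel (\<lambda>z. v z * frechet_derivative f (at z) e)"
    by (rule loc_int_times_csupp[OF u(2) R(3)], rule R(4)[rule_format], assumption)
       (rule loc_int_times_csupp[OF v(2) R(3)], rule R(4)[rule_format])
  have lg: "loc_int (\<lambda>z. g z \<bullet> e)" "loc_int (\<lambda>z. h z \<bullet> e)"
    using loc_int_L2loc[OF L2loc_sq_int[OF L2_weak_gradientD(1)[OF u(1) e]]]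
          loc_int_L2loc[OF L2loc_sq_int[OF L2_weak_gradientD(1)[OF v(1) e]]] .
  have j: "integrable lborel (\<lambda>z. (g z \<bullet> e) * f z)" "integrable lborel (\<lambda>z. (h z \<bullet> e) * f z)"
    by (rule loc_int_times_csupp[OF lg(1) R(1)], rule R(2)[rule_format], assumption)
       (rule loc_int_times_csupp[OF lg(2) R(1)], rule R(2)[rule_format])
  show "(LINT z|lborel. (u z - v z) * frechet_derivative f (at z) e) = - (LINT z|lborel. ((g z - h z) \<bullet> e) * f z)"
    unfolding inner_diff_left left_diff_distrib Bochner_Integration.integral_diff[OF i] Bochner_Integration.integral_diff[OF j]
      L2_weak_gradientD(2)[OF u(1) f e] L2_weak_gradientD(2)[OF v(1) f e] by simp
qed

lemma L2_weak_gradient_C1: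
  assumes f: "Ck_on (Suc 0) UNIV f" and s: "\<And>e. e \<in> Basis \<Longrightarrow> sq_int (\<lambda>z. frechet_derivative f (at z) e)"
  shows "L2_weak_gradient f (cgrad f)"
proof (rule L2_weak_gradientI)
  fix e :: complex assume e: "e \<in> Basis"
  show "sq_int (\<lambda>z. cgrad f z \<bullet> e)" unfolding cgrad_inner[OF e] by (rule s[OF e])
  fix t assume t: "test_function t"
  obtain R where R: "smooth t" "\<forall>z. norm z > R \<longrightarrow> t z = 0" using t unfolding test_function_iff by (elim conjE exE)
  have "(LINT z|lborel. frechet_derivative t (at z) e * f z) = - (LINT z|lborel. t z * frechet_derivative f (at z) e)"
    by (rule integration_by_parts_csupp[OF smooth_Ck[OF R(1)] f R(2)[rule_format] e])
  then show "(LINT z|lborel. f z * frechet_derivative t (at z) e) = - (LINT z|lborel. (cgrad f z \<bullet> e) * t z)"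
    unfolding cgrad_inner[OF e] by (simp only: mult.commute)
qed

lemma L2loc_cut: "L2loc u \<Longrightarrow> sq_int (\<lambda>z. indicator (cball 0 R) z * u z)"
  and set_integral_cball_sq: "(LINT z:cball 0 R|lborel. (u z)\<^sup>2) = (LINT z|lborel. (indicator (cball 0 R) z * u z)\<^sup>2)"
proof -
  have eq: "indicat_real (cball 0 R) z *\<^sub>R (u z)\<^sup>2 = (indicator (cball 0 R) z * u z)\<^sup>2" for z
    by (simp split: split_indicator)
  show "(LINT z:cball 0 R|lborel. (u z)\<^sup>2) = (LINT z|lborel. (indicator (cball 0 R) z * u z)\<^sup>2)"
    unfolding set_lebesgue_integral_def eq ..
  assume u: "L2loc u"
  then have "u \<in> borel_measurable borel" "integrable lborel (\<lambda>z. indicat_real (cball 0 R) z *\<^sub>R (u z)\<^sup>2)"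
    unfolding L2loc_def set_integrable_def by blast+
  then show "sq_int (\<lambda>z. indicator (cball 0 R) z * u z)"
    unfolding sq_int_def eq by (intro conjI borel_measurable_times borel_measurable_indicator) auto
qed

lemma L2loc_diff: "L2loc u \<Longrightarrow> L2loc v \<Longrightarrow> L2loc (\<lambda>z. u z - v z)"
proof -
  assume u: "L2loc u" and v: "L2loc v"
  have eq: "indicat_real (cball 0 R) z *\<^sub>R (u z - v z)\<^sup>2 = (indicator (cball 0 R) z * u z - indicator (cball 0 R) z * v z)\<^sup>2" for R z
    by (simp split: split_indicator)
  show ?thesis unfolding L2loc_def set_integrable_def eq
    using sq_int_diff[OF L2loc_cut[OF u] L2loc_cut[OF v]] u v by (auto simp: sq_int_def L2loc_def)
qed

lemma set_integral_cball_mono: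
  assumes "L2loc u" "R \<le> R'"
  shows "(LINT z:cball 0 R|lborel. (u z)\<^sup>2) \<le> (LINT z:cball 0 R'|lborel. (u z)\<^sup>2)"
  unfolding set_integral_cball_sq
proof (rule integral_mono)
  show "integrable lborel (\<lambda>z. (indicator (cball 0 R) z * u z)\<^sup>2)" "integrable lborel (\<lambda>z. (indicator (cball 0 R') z * u z)\<^sup>2)"
    using L2loc_cut[OF assms(1)] by (auto simp: sq_int_def)
  show "(indicator (cball 0 R) z * u z)\<^sup>2 \<le> (indicator (cball 0 R') z * u z)\<^sup>2" for z
    using assms(2) by (auto split: split_indicator)
qed

text \<open>A quantitative neighbourhood for the \<open>H1\<close>-topology: local L^2 distance on
  one ball together with gradient distance. The tolerance bounds squared norms, so going through an
  intermediate function costs a factor 4.\<close>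

definition H1_near :: "real \<Rightarrow> real \<Rightarrow> (complex \<Rightarrow> real) \<Rightarrow> (complex \<Rightarrow> real) \<Rightarrow> bool" where
  "H1_near R \<epsilon> u v \<longleftrightarrow> (LINT z:cball 0 R|lborel. (u z - v z)\<^sup>2) < \<epsilon> \<and>
     (\<exists>g. L2_weak_gradient (\<lambda>z. u z - v z) g \<and> (LINT z|lborel. (norm (g z))\<^sup>2) < \<epsilon>)"

lemma H1_near_triangle:
  assumes "H1_near R \<epsilon> u v" "H1_near R \<epsilon> w v" "L2loc u" "L2loc v" "L2loc w"
  shows "H1_near R (4 * \<epsilon>) u w"
proof -
  obtain g h where g: "L2_weak_gradient (\<lambda>z. u z - v z) g" "(LINT z|lborel. (norm (g z))\<^sup>2) < \<epsilon>"
    and h: "L2_weak_gradient (\<lambda>z. w z - v z) h" "(LINT z|lborel. (norm (h z))\<^sup>2) < \<epsilon>"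
    using assms(1,2) unfolding H1_near_def by blast
  have luv: "L2loc (\<lambda>z. u z - v z)" "L2loc (\<lambda>z. w z - v z)" using assms by (auto intro: L2loc_diff)
  have gh: "L2_weak_gradient (\<lambda>z. u z - w z) (\<lambda>z. g z - h z)"
    using L2_weak_gradient_diff[OF g(1) loc_int_L2loc[OF luv(1)] h(1) loc_int_L2loc[OF luv(2)]] by simp
  have "(LINT z|lborel. (norm (g z - h z))\<^sup>2) \<le> (LINT z|lborel. 2 * (norm (g z))\<^sup>2 + 2 * (norm (h z))\<^sup>2)"
  proof (rule integral_mono)
    show "integrable lborel (\<lambda>z. (norm (g z - h z))\<^sup>2)" using gh unfolding L2_weak_gradient_def by blast
    show "integrable lborel (\<lambda>z. 2 * (norm (g z))\<^sup>2 + 2 * (norm (h z))\<^sup>2)"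
      using g h unfolding L2_weak_gradient_def by (intro Bochner_Integration.integrable_add integrable_mult_right) blast+
    show "(norm (g z - h z))\<^sup>2 \<le> 2 * (norm (g z))\<^sup>2 + 2 * (norm (h z))\<^sup>2" for z
    proof -
      have "(norm (g z - h z))\<^sup>2 \<le> (norm (g z) + norm (h z))\<^sup>2" by (intro power_mono norm_triangle_ineq4) simp
      then show ?thesis using sum_sq_le2[of "norm (g z)" "norm (h z)"] by linarith
    qed
  qed
  also have "\<dots> = 2 * (LINT z|lborel. (norm (g z))\<^sup>2) + 2 * (LINT z|lborel. (norm (h z))\<^sup>2)"
    using g h unfolding L2_weak_gradient_def by simp
  finally have 1: "(LINT z|lborel. (norm (g z - h z))\<^sup>2) < 4 * \<epsilon>" using g(2) h(2) by linarith
  let ?i = "\<lambda>z. indicator (cball (0::complex) R) z :: real"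
  have c: "sq_int (\<lambda>z. ?i z * (u z - v z))" "sq_int (\<lambda>z. ?i z * (w z - v z))"
    using L2loc_cut[OF luv(1)] L2loc_cut[OF luv(2)] .
  have "(LINT z:cball 0 R|lborel. (u z - w z)\<^sup>2) = (LINT z|lborel. (?i z * (u z - v z) + - (?i z * (w z - v z)))\<^sup>2)"
    unfolding set_integral_cball_sq by (intro Bochner_Integration.integral_cong refl arg_cong[where f="\<lambda>x. x\<^sup>2"]) (simp add: algebra_simps)
  also have "\<dots> \<le> 2 * (LINT z|lborel. (?i z * (u z - v z))\<^sup>2) + 2 * (LINT z|lborel. (- (?i z * (w z - v z)))\<^sup>2)"
    by (rule integral_sq_add_le[OF c(1) sq_int_minus[OF c(2)]])
  also have "\<dots> < 4 * \<epsilon>"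
    using assms(1,2) unfolding H1_near_def set_integral_cball_sq power2_minus by linarith
  finally show ?thesis using 1 gh unfolding H1_near_def by blast
qed

text \<open>Letting the radius grow with n covers every fixed ball eventually, so one sequence of
  neighbourhoods gives local L^2 convergence on all balls.\<close>

lemma H1_near_tendsto:
  assumes "\<And>n. H1_near (real n) (1 / real (Suc n)) (v n) u" "\<And>n. L2loc (v n)" "L2loc u"
  shows "H1_tendsto v u"
proof -
  have lim: "(\<lambda>n. 1 / real (Suc n)) \<longlonglongrightarrow> 0" using LIMSEQ_inverse_real_of_nat by (simp add: inverse_eq_divide)
  have "\<exists>g. \<forall>n. L2_weak_gradient (\<lambda>z. v n z - u z) (g n) \<and> (LINT z|lborel. (norm (g n z))\<^sup>2) < 1 / real (Suc n)"
    using assms(1) unfolding H1_near_def by (intro choice allI) blast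
  then obtain g where g: "\<And>n. L2_weak_gradient (\<lambda>z. v n z - u z) (g n)" "\<And>n. (LINT z|lborel. (norm (g n z))\<^sup>2) < 1 / real (Suc n)"
    by blast
  have "(\<lambda>n. LINT z|lborel. (norm (g n z))\<^sup>2) \<longlonglongrightarrow> 0"
  proof (rule tendsto_sandwich[OF _ _ tendsto_const lim])
    show "\<forall>\<^sub>F n in sequentially. 0 \<le> (LINT z|lborel. (norm (g n z))\<^sup>2)"
      by (intro always_eventually allI Bochner_Integration.integral_nonneg) simp
    show "\<forall>\<^sub>F n in sequentially. (LINT z|lborel. (norm (g n z))\<^sup>2) \<le> 1 / real (Suc n)"
      by (intro always_eventually allI less_imp_le g(2))
  qed
  moreover have "(\<lambda>n. LINT z:cball 0 R|lborel. (v n z - u z)\<^sup>2) \<longlonglongrightarrow> 0" for R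
  proof (rule tendsto_sandwich[OF _ _ tendsto_const lim])
    show "\<forall>\<^sub>F n in sequentially. 0 \<le> (LINT z:cball 0 R|lborel. (v n z - u z)\<^sup>2)"
      unfolding set_integral_cball_sq by (intro always_eventually allI Bochner_Integration.integral_nonneg) simp
    obtain N where N: "R \<le> real N" using real_arch_simple by blast
    show "\<forall>\<^sub>F n in sequentially. (LINT z:cball 0 R|lborel. (v n z - u z)\<^sup>2) \<le> 1 / real (Suc n)"
    proof (rule eventually_sequentiallyI[of N])
      fix n assume "N \<le> n"
      then have "R \<le> real n" using N by linarith
      from set_integral_cball_mono[OF L2loc_diff[OF assms(2)[of n] assms(3)] this] assms(1)[of n]
      show "(LINT z:cball 0 R|lborel. (v n z - u z)\<^sup>2) \<le> 1 / real (Suc n)" unfolding H1_near_def by linarith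
    qed
  qed
  ultimately show ?thesis unfolding H1_tendsto_def using g(1) by blast
qed

lemma H1_tendsto_near:
  assumes "H1_tendsto v u" "\<epsilon> > 0"
  shows "\<forall>\<^sub>F n in sequentially. H1_near R \<epsilon> (v n) u"
proof -
  obtain g where g: "\<And>n. L2_weak_gradient (\<lambda>z. v n z - u z) (g n)" "(\<lambda>n. LINT z|lborel. (norm (g n z))\<^sup>2) \<longlonglongrightarrow> 0"
    using assms(1) unfolding H1_tendsto_def by blast
  have l: "(\<lambda>n. LINT z:cball 0 R|lborel. (v n z - u z)\<^sup>2) \<longlonglongrightarrow> 0"
    using assms(1) unfolding H1_tendsto_def by blast
  show ?thesis
    using order_tendstoD(2)[OF g(2) assms(2)] order_tendstoD(2)[OF l assms(2)]
  proof eventually_elim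
    case (elim n)
    then show ?case using g(1)[of n] unfolding H1_near_def by blast
  qed
qed

text \<open>The mollifiers have radius at most 1, so values on the ball of radius R see only the
  ball of radius R + 1. This reduces local L^2 statements to square integrable functions.\<close>

lemma conv_moll_eq_cut:
  assumes "norm z \<le> R"
  shows "conv u (moll n) z = conv (\<lambda>w. indicator (cball 0 (R + 1)) w * u w) (moll n) z"
  unfolding conv_def
proof (intro Bochner_Integration.integral_cong refl)
  fix w :: complex
  show "u w * moll n (z - w) = indicator (cball 0 (R + 1)) w * u w * moll n (z - w)"
  proof (cases "norm w \<le> R + 1")
    case True then show ?thesis by simp
  next
    case False
    then have "norm (z - w) > 1" using norm_triangle_ineq2[of w z] assms by (simp add: norm_minus_commute)
    moreover have "1 / real (Suc n) \<le> 1" by simp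
    ultimately have "norm (z - w) > 1 / real (Suc n)" by linarith
    then show ?thesis by (simp only: moll(2) mult_zero_right)
  qed
qed

lemma moll_L2loc:
  assumes u: "L2loc u"
  shows "(\<lambda>n. LINT z:cball 0 R|lborel. (conv u (moll n) z - u z)\<^sup>2) \<longlonglongrightarrow> 0"
proof -
  let ?w = "\<lambda>w. indicator (cball 0 (R + 1)) w * u w"
  have w: "sq_int ?w" using L2loc_cut[OF u] .
  show ?thesis
  proof (rule tendsto_sandwich[OF _ _ tendsto_const moll_L2(2)[OF w]])
    show "\<forall>\<^sub>F n in sequentially. 0 \<le> (LINT z:cball 0 R|lborel. (conv u (moll n) z - u z)\<^sup>2)"
      unfolding set_integral_cball_sq by (intro always_eventually allI Bochner_Integration.integral_nonneg) simp
    show "\<forall>\<^sub>F n in sequentially. (LINT z:cball 0 R|lborel. (conv u (moll n) z - u z)\<^sup>2) \<le> (LINT z|lborel. (conv ?w (moll n) z - ?w z)\<^sup>2)"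
      using moll_L2(1)[OF w]
    proof (rule eventually_mono)
      fix n assume s: "sq_int (\<lambda>z. conv ?w (moll n) z - ?w z)"
      have cL: "L2loc (conv u (moll n))"
        by (rule L2loc_continuous[OF smooth_continuous[OF smooth_conv[OF loc_int_L2loc[OF u] moll(1)]]])
      show "(LINT z:cball 0 R|lborel. (conv u (moll n) z - u z)\<^sup>2) \<le> (LINT z|lborel. (conv ?w (moll n) z - ?w z)\<^sup>2)"
        unfolding set_integral_cball_sq
      proof (rule integral_mono)
        show "integrable lborel (\<lambda>z. (indicator (cball 0 R) z * (conv u (moll n) z - u z))\<^sup>2)"
          using L2loc_cut[OF L2loc_diff[OF cL u]] by (auto simp: sq_int_def)
        show "integrable lborel (\<lambda>z. (conv ?w (moll n) z - ?w z)\<^sup>2)" using s by (auto simp: sq_int_def)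
        fix z :: complex
        show "(indicator (cball 0 R) z * (conv u (moll n) z - u z))\<^sup>2 \<le> (conv ?w (moll n) z - ?w z)\<^sup>2"
        proof (cases "norm z \<le> R")
          case True
          then have "?w z = u z" by simp
          then show ?thesis using True conv_moll_eq_cut[OF True, of u n] by simp
        next
          case False then show ?thesis by simp
        qed
      qed
    qed
  qed
qed

text \<open>The gradient of the mollification is the mollification of the weak gradient, so its
  convergence is the L^2 result applied to each component. The bound \<epsilon>/4 for each of the
  two components keeps the sum below \<epsilon>.\<close>

lemma conv_moll_H1:
  assumes u: "L2loc u" and g: "L2_weak_gradient u g" and eps: "\<epsilon> > 0"
  shows "\<forall>\<^sub>F n in sequentially. smooth (conv u (moll n)) \<and> H1_near R \<epsilon> (conv u (moll n)) u \<and>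
     (\<forall>e\<in>Basis. sq_int (\<lambda>z. frechet_derivative (conv u (moll n)) (at z) e))"
proof -
  have fd: "frechet_derivative (conv u (moll n)) (at z) e = conv (\<lambda>w. g w \<bullet> e) (moll n) z" if "e \<in> Basis" for n z e
    by (rule conv_weak_gradient[OF loc_int_L2loc[OF u] g moll(1) that])
  have sm: "smooth (conv u (moll n))" for n by (rule smooth_conv[OF loc_int_L2loc[OF u] moll(1)])
  have "\<forall>e\<in>Basis. \<forall>\<^sub>F n in sequentially. sq_int (\<lambda>z. conv (\<lambda>w. g w \<bullet> e) (moll n) z - g z \<bullet> e) \<and>
      (LINT z|lborel. (conv (\<lambda>w. g w \<bullet> e) (moll n) z - g z \<bullet> e)\<^sup>2) < \<epsilon> / 4"
  proof
    fix e :: complex assume e: "e \<in> Basis"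
    note s = L2_weak_gradientD(1)[OF g e]
    have "\<epsilon> / 4 > 0" using eps by simp
    from moll_L2(1)[OF s] order_tendstoD(2)[OF moll_L2(2)[OF s] this]
    show "\<forall>\<^sub>F n in sequentially. sq_int (\<lambda>z. conv (\<lambda>w. g w \<bullet> e) (moll n) z - g z \<bullet> e) \<and>
      (LINT z|lborel. (conv (\<lambda>w. g w \<bullet> e) (moll n) z - g z \<bullet> e)\<^sup>2) < \<epsilon> / 4"
      by (rule eventually_conj)
  qed
  then have "\<forall>\<^sub>F n in sequentially. \<forall>e\<in>Basis. sq_int (\<lambda>z. conv (\<lambda>w. g w \<bullet> e) (moll n) z - g z \<bullet> e) \<and>
      (LINT z|lborel. (conv (\<lambda>w. g w \<bullet> e) (moll n) z - g z \<bullet> e)\<^sup>2) < \<epsilon> / 4"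
    by (rule eventually_ball_finite[OF finite_Basis])
  with order_tendstoD(2)[OF moll_L2loc[OF u] eps, of R] show ?thesis
  proof eventually_elim
    case (elim n)
    let ?c = "conv u (moll n)"
    have s: "sq_int (\<lambda>z. frechet_derivative ?c (at z) e)" if "e \<in> Basis" for e
    proof -
      have "sq_int (\<lambda>z. (conv (\<lambda>w. g w \<bullet> e) (moll n) z - g z \<bullet> e) + g z \<bullet> e)"
        using elim(2) that by (intro sq_int_add L2_weak_gradientD(1)[OF g]) auto
      then show ?thesis unfolding fd[OF that] by simp
    qed
    have wg: "L2_weak_gradient (\<lambda>z. ?c z - u z) (\<lambda>z. cgrad ?c z - g z)"
      by (rule L2_weak_gradient_diff[OF L2_weak_gradient_C1[OF smooth_Ck[OF sm] s] loc_int_L2loc[OF L2loc_continuous[OF smooth_continuous[OF sm]]] g loc_int_L2loc[OF u]])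
    have "(LINT z|lborel. (norm (cgrad ?c z - g z))\<^sup>2) = (\<Sum>e\<in>Basis. LINT z|lborel. ((cgrad ?c z - g z) \<bullet> e)\<^sup>2)"
      by (rule vec_L2(3)[OF L2_weak_gradientD(1)[OF wg]])
    also have "\<dots> = (\<Sum>e\<in>Basis. LINT z|lborel. (conv (\<lambda>w. g w \<bullet> e) (moll n) z - g z \<bullet> e)\<^sup>2)"
      by (intro sum.cong refl) (simp only: inner_diff_left cgrad_inner fd)
    also have "\<dots> \<le> (\<Sum>e\<in>(Basis::complex set). \<epsilon> / 4)" using elim(2) by (intro sum_mono less_imp_le) blast
    also have "\<dots> < \<epsilon>" using eps by simp
    finally have "H1_near R \<epsilon> ?c u" unfolding H1_near_def using wg elim(1) by blast
    then show ?case using sm s by blast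
  qed
qed

text \<open>The error is an average of increments of \<open>u\<close> over shifts shorter than
  \<delta>. Uniform closeness is what allows integrals against an arbitrary probability measure to
  be compared later.\<close>

lemma moll_uniform:
  assumes u: "continuous_on UNIV u" "\<And>z. norm z > R \<Longrightarrow> u z = 0" and eps: "\<epsilon> > 0"
  shows "\<forall>\<^sub>F n in sequentially. \<forall>z. \<bar>conv u (moll n) z - u z\<bar> \<le> \<epsilon>"
proof -
  obtain \<delta> where \<delta>: "\<delta> > 0" "\<And>h z. norm h < \<delta> \<Longrightarrow> \<bar>u (h + z) - u z\<bar> < \<epsilon>"
    using uniform_csupp[OF u eps] by blast
  have li: "loc_int u" by (rule loc_int_L2loc[OF L2loc_continuous[OF u(1)]])
  have "\<forall>\<^sub>F n in sequentially. 1 / real (Suc n) < \<delta>"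
    using order_tendstoD(2)[OF LIMSEQ_inverse_real_of_nat \<delta>(1)] by (simp add: inverse_eq_divide)
  then show ?thesis
  proof (rule eventually_mono, intro allI)
    fix n z assume n: "1 / real (Suc n) < \<delta>"
    have mc: "continuous_on UNIV (moll n)" using moll(1)[of n] by (auto simp: test_function_iff smooth_continuous)
    have [measurable]: "u \<in> borel_measurable borel" "moll n \<in> borel_measurable borel"
      using u(1) mc by (auto intro: borel_measurable_continuous_onI)
    have mi: "integrable lborel (moll n)" by (rule integrable_csupp[OF mc moll(2)])
    have i1: "integrable lborel (\<lambda>w. u (z - w) * moll n w)"
    proof -
      have "integrable lborel (\<lambda>w. u w * moll n (z - w))" by (rule integrable_conv[OF li mc moll(2)])
      from integrable_reflect[OF this, of z] show ?thesis by simp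
    qed
    have i2: "integrable lborel (\<lambda>w. (u (z - w) - u z) * moll n w)"
      unfolding left_diff_distrib by (intro Bochner_Integration.integrable_diff i1 integrable_mult_right mi)
    have "conv u (moll n) z - u z = (LINT w|lborel. (u (z - w) - u z) * moll n w)"
      unfolding left_diff_distrib conv_reflect[OF \<open>u \<in> borel_measurable borel\<close> \<open>moll n \<in> borel_measurable borel\<close>]
      using i1 mi moll(4)[of n] by simp
    also have "\<bar>\<dots>\<bar> \<le> (LINT w|lborel. \<epsilon> * moll n w)"
    proof (rule integral_abs_bound[THEN order_trans], rule integral_mono)
      show "integrable lborel (\<lambda>w. \<bar>(u (z - w) - u z) * moll n w\<bar>)" by (rule integrable_abs[OF i2])
      show "integrable lborel (\<lambda>w. \<epsilon> * moll n w)" by (rule integrable_mult_right[OF mi])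
      fix w
      show "\<bar>(u (z - w) - u z) * moll n w\<bar> \<le> \<epsilon> * moll n w"
      proof (cases "norm w < \<delta>")
        case True
        then have "\<bar>u (z - w) - u z\<bar> \<le> \<epsilon>" using \<delta>(2)[of "- w" z] by simp
        then show ?thesis using moll(3)[of n w] by (simp add: abs_mult mult_right_mono)
      next
        case False
        then have "moll n w = 0" using n by (intro moll(2)) linarith
        then show ?thesis by simp
      qed
    qed
    also have "\<dots> = \<epsilon>" using moll(4)[of n] by simp
    finally show "\<bar>conv u (moll n) z - u z\<bar> \<le> \<epsilon>" .
  qed
qed

lemma test_function_conv:
  assumes u: "continuous_on UNIV u" "\<And>z. norm z > R \<Longrightarrow> u z = 0"
  shows "test_function (conv u (moll n))"
proof -
  have "smooth (conv u (moll n))" by (rule smooth_conv[OF loc_int_L2loc[OF L2loc_continuous[OF u(1)]] moll(1)])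
  moreover have "conv u (moll n) z = 0" if "norm z > R + 1" for z
  proof -
    have "u w * moll n (z - w) = 0" for w
    proof (cases "norm w > R")
      case True then show ?thesis using u(2) by simp
    next
      case False
      have "1 / real (Suc n) \<le> 1" by simp
      moreover have "norm (z - w) > 1" using norm_triangle_ineq2[of z w] False that by linarith
      ultimately have "norm (z - w) > 1 / real (Suc n)" by linarith
      then show ?thesis by (simp only: moll(2) mult_zero_right)
    qed
    then have "(\<lambda>w. u w * moll n (z - w)) = (\<lambda>w. 0)" by (intro ext)
    then show ?thesis unfolding conv_def by (simp only: Bochner_Integration.integral_zero)
  qed
  ultimately show ?thesis unfolding test_function_iff by blast
qed

section \<open>Density of test functions in H1: logarithmic cutoff and truncation\<close>

lemma flat_exp_0_le: "x \<le> 1 \<Longrightarrow> flat_exp 0 x \<le> exp (- 1)"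
proof -
  assume x: "x \<le> 1"
  show ?thesis
  proof (cases "x > 0")
    case True
    then have "1 \<le> inverse x" using x by (simp add: one_le_inverse)
    then show ?thesis using True by (simp add: flat_exp_def)
  next
    case False then show ?thesis by (simp add: flat_exp_def)
  qed
qed

lemma flat_exp_2_le: "flat_exp 2 x \<le> 2"
proof (cases "x > 0")
  case True
  let ?y = "inverse x"
  have y: "?y > 0" using True by simp
  have "1 + ?y + ?y\<^sup>2 / 2 \<le> exp ?y" using exp_lower_Taylor_quadratic[of ?y] y by simp
  then have "?y\<^sup>2 \<le> 2 * exp ?y" using y by linarith
  then have "?y\<^sup>2 * exp (- ?y) \<le> 2 * exp ?y * exp (- ?y)" by (intro mult_right_mono) auto
  moreover have "2 * exp ?y * exp (- ?y) = 2" using exp_minus_inverse[of ?y] by (simp only: mult.assoc)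
  ultimately have "?y\<^sup>2 * exp (- ?y) \<le> 2" by linarith
  then show ?thesis using True by (simp add: flat_exp_def mult.commute)
next
  case False then show ?thesis by (simp add: flat_exp_def)
qed

text \<open>A cutoff on the logarithmic scale \<open>psi0\<close>, not on the scale of |z|: in the
  plane its Dirichlet energy is of order 1/s, so it can reach infinity at no cost. The factor
  \<open>exp 1\<close> normalises the value at the origin to 1; elsewhere 1 is attained only in the
  limit of large s.\<close>

definition log_cutoff :: "real \<Rightarrow> complex \<Rightarrow> real" where
  "log_cutoff s z = exp 1 * flat_exp 0 (1 - (psi0 z / s)\<^sup>2)"

lemma psi0_nonneg: "psi0 z \<ge> 0" by (simp add: psi0_def)

lemma psi0_less_imp: "psi0 z < s \<Longrightarrow> (norm z)\<^sup>2 \<le> exp s - 1"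
proof -
  assume "psi0 z < s"
  then have "exp (psi0 z) \<le> exp s" by simp
  moreover have "exp (psi0 z) = 1 + (norm z)\<^sup>2" unfolding psi0_def by (rule exp_ln) (simp add: add_pos_nonneg)
  ultimately show ?thesis by linarith
qed

lemma log_cutoff_eq_0: "s > 0 \<Longrightarrow> psi0 z \<ge> s \<Longrightarrow> flat_exp n (1 - (psi0 z / s)\<^sup>2) = 0"
  by (intro flat_exp_0) (simp add: divide_le_eq power2_eq_square mult_mono)

text \<open>The constant in the derivative bound: the chain rule gives exp 1 times
  \<open>flat_exp 2\<close>, which is at most 2, times 2 (psi0 z / s), which is at most 2, times 2
  (z \<bullet> e) / ((1 + |z|^2) s). Squaring yields 16 * 4 = 64, and (z \<bullet> e)^2 cancels one
  of the two factors 1 + |z|^2.\<close>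

lemma log_cutoff:
  assumes s: "s > 0"
  shows "smooth (log_cutoff s)" "0 \<le> log_cutoff s z" "log_cutoff s z \<le> 1"
    "norm z > exp s \<Longrightarrow> log_cutoff s z = 0"
    "e \<in> Basis \<Longrightarrow> (frechet_derivative (log_cutoff s) (at z) e)\<^sup>2 \<le>
       64 * (exp 1)\<^sup>2 / s\<^sup>2 * (inverse (1 + (norm z)\<^sup>2) * indicator {..exp s - 1} ((norm z)\<^sup>2))"
proof -
  have eq: "log_cutoff s = (\<lambda>z. exp 1 * flat_exp 0 (1 - (inverse s * psi0 z) * (inverse s * psi0 z)))"
    by (simp add: log_cutoff_def fun_eq_iff divide_inverse power2_eq_square mult_ac)
  show sm: "smooth (log_cutoff s)" unfolding smooth_def eq
    by (intro allI Ck_on_cmult Ck_on_flat_exp Ck_on_diff Ck_on_const Ck_on_mult Ck_on_psi0 open_UNIV)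
  show "0 \<le> log_cutoff s z" by (simp add: log_cutoff_def flat_exp_nonneg)
  have "flat_exp 0 (1 - (psi0 z / s)\<^sup>2) \<le> exp (- 1)" by (rule flat_exp_0_le) simp
  then have "exp 1 * flat_exp 0 (1 - (psi0 z / s)\<^sup>2) \<le> exp 1 * exp (- 1)" by (intro mult_left_mono) auto
  then show "log_cutoff s z \<le> 1" by (simp add: log_cutoff_def exp_minus)
  show "norm z > exp s \<Longrightarrow> log_cutoff s z = 0"
  proof -
    assume z: "norm z > exp s"
    have "psi0 z \<ge> s"
    proof (rule ccontr)
      assume "\<not> psi0 z \<ge> s"
      then have "(norm z)\<^sup>2 \<le> exp s - 1" by (intro psi0_less_imp) simp
      moreover have "norm z * 1 \<le> norm z * norm z" using z s by (intro mult_left_mono) (auto intro: order_trans[OF _ less_imp_le[OF z]])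
      ultimately show False using z by (simp add: power2_eq_square)
    qed
    then show ?thesis by (simp add: log_cutoff_def log_cutoff_eq_0[OF s])
  qed
  assume e: "e \<in> Basis"
  let ?x = "1 - (psi0 z / s)\<^sup>2"
  let ?d = "2 * (z \<bullet> e) * inverse (1 + (norm z)\<^sup>2)"
  have D: "frechet_derivative (log_cutoff s) (at z) e = exp 1 * (flat_exp 2 ?x * (- (2 * (psi0 z / s) * (?d / s))))"
  proof -
    let ?X = "\<lambda>h. 2 * (z \<bullet> h) * inverse (1 + (norm z)\<^sup>2)"
    have d: "((\<lambda>z. psi0 z / s) has_derivative (\<lambda>h. ?X h / s)) (at z)"
      unfolding divide_inverse by (rule has_derivative_mult_left[OF psi0_has_derivative])
    have "((\<lambda>z. 1 - (psi0 z / s) * (psi0 z / s)) has_derivative (\<lambda>h. 0 - ((psi0 z / s) * (?X h / s) + (?X h / s) * (psi0 z / s)))) (at z)"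
      by (rule has_derivative_diff[OF has_derivative_const has_derivative_mult[OF d d]])
    moreover have "0 - (P * X + X * P) = - (2 * P * X)" for P X :: real by (simp add: algebra_simps)
    ultimately have inner: "((\<lambda>z. 1 - (psi0 z / s)\<^sup>2) has_derivative (\<lambda>h. - (2 * (psi0 z / s) * (?X h / s)))) (at z)"
      by (simp only: power2_eq_square)
    have "(flat_exp 0 has_derivative (*) (flat_exp 2 ?x)) (at ?x)"
      using flat_exp_DERIV[of 0 ?x] unfolding has_field_derivative_def by (simp add: numeral_2_eq_2)
    from has_derivative_mult_right[OF has_derivative_compose[OF inner this], of "exp 1"]
    have "(log_cutoff s has_derivative (\<lambda>h. exp 1 * (flat_exp 2 ?x * - (2 * (psi0 z / s) * ((2 * (z \<bullet> h) * inverse (1 + (norm z)\<^sup>2)) / s))))) (at z)"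
      unfolding log_cutoff_def[abs_def] .
    from fun_cong[OF frechet_derivative_at[OF this, symmetric], of e] show ?thesis .
  qed
  show "(frechet_derivative (log_cutoff s) (at z) e)\<^sup>2 \<le>
       64 * (exp 1)\<^sup>2 / s\<^sup>2 * (inverse (1 + (norm z)\<^sup>2) * indicator {..exp s - 1} ((norm z)\<^sup>2))"
  proof (cases "psi0 z < s")
    case False
    then have "flat_exp 2 ?x = 0" by (intro log_cutoff_eq_0 s) simp
    then show ?thesis unfolding D by simp
  next
    case True
    let ?q = "inverse (1 + (norm z)\<^sup>2)"
    have q: "?q > 0" by (simp add: add_pos_nonneg)
    have "(z \<bullet> e)\<^sup>2 \<le> (norm z)\<^sup>2" using Basis_le_norm[OF e, of z] by (simp add: abs_le_square_iff[symmetric])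
    then have "(z \<bullet> e)\<^sup>2 * ?q \<le> (1 + (norm z)\<^sup>2) * ?q" using q by (intro mult_right_mono) auto
    also have "(1 + (norm z)\<^sup>2) * ?q = 1" by (rule right_inverse) (use zero_le_power2[of "norm z"] in linarith)
    finally have zq: "(z \<bullet> e)\<^sup>2 * ?q * ?q \<le> 1 * ?q" using q by (intro mult_right_mono) auto
    have f: "(flat_exp 2 ?x)\<^sup>2 \<le> 2\<^sup>2" by (intro power_mono flat_exp_2_le flat_exp_nonneg)
    have p: "(psi0 z / s)\<^sup>2 \<le> 1\<^sup>2" using True s psi0_nonneg[of z] by (intro power_mono) auto
    have "(exp 1 * (F * (- (2 * P * ((2 * Z * Q) / s)))))\<^sup>2 = 16 * (exp 1)\<^sup>2 / s\<^sup>2 * (F\<^sup>2 * P\<^sup>2 * (Z\<^sup>2 * Q * Q))" for F P Z Q :: real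
      by (simp add: power2_eq_square)
    then have "(frechet_derivative (log_cutoff s) (at z) e)\<^sup>2 = 16 * (exp 1)\<^sup>2 / s\<^sup>2 * ((flat_exp 2 ?x)\<^sup>2 * (psi0 z / s)\<^sup>2 * ((z \<bullet> e)\<^sup>2 * ?q * ?q))"
      unfolding D .
    also have "\<dots> \<le> 16 * (exp 1)\<^sup>2 / s\<^sup>2 * (2\<^sup>2 * 1\<^sup>2 * (1 * ?q))"
      using q by (intro mult_left_mono mult_mono f p zq) auto
    finally show ?thesis using psi0_less_imp[OF True] by simp
  qed
qed

lemma log_cutoff_tendsto_1: "((\<lambda>s. log_cutoff s z) \<longlongrightarrow> 1) at_top"
proof -
  have "((\<lambda>s. psi0 z / s) \<longlongrightarrow> 0) at_top" by (rule real_tendsto_divide_at_top[OF tendsto_const filterlim_ident])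
  then have "((\<lambda>s. 1 - (psi0 z / s)\<^sup>2) \<longlongrightarrow> 1 - 0\<^sup>2) at_top" by (intro tendsto_intros)
  moreover have "isCont (flat_exp 0) 1" by (rule DERIV_isCont[OF flat_exp_DERIV])
  ultimately have "((\<lambda>s. flat_exp 0 (1 - (psi0 z / s)\<^sup>2)) \<longlongrightarrow> flat_exp 0 1) at_top"
    using isCont_tendsto_compose[of 1 "flat_exp 0" "\<lambda>s. 1 - (psi0 z / s)\<^sup>2" at_top] by simp
  then have "((\<lambda>s. exp 1 * flat_exp 0 (1 - (psi0 z / s)\<^sup>2)) \<longlongrightarrow> exp 1 * flat_exp 0 1) at_top"
    by (intro tendsto_mult tendsto_const)
  then show ?thesis by (simp add: log_cutoff_def flat_exp_def exp_minus)
qed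

text \<open>In the variable |z|^2 the integrand is 1/(1 + x) on [0, exp s - 1], whose integral is ln
  (exp s) = s. Against the prefactor 1/s^2 of the gradient bound this leaves energy of order
  1/s.\<close>

lemma integral_log_cutoff_bound:
  assumes s: "s > 0"
  shows "integrable lborel (\<lambda>z::complex. inverse (1 + (norm z)\<^sup>2) * indicator {..exp s - 1} ((norm z)\<^sup>2))"
    "(LINT z::complex|lborel. inverse (1 + (norm z)\<^sup>2) * indicator {..exp s - 1} ((norm z)\<^sup>2)) = pi * s"
proof -
  have fm: "(\<lambda>x. inverse (1 + x) * indicator {..exp s - 1} x :: real) \<in> borel_measurable borel" by measurable
  have "(\<integral>\<^sup>+z. ennreal (inverse (1 + (norm (z::complex))\<^sup>2) * indicator {..exp s - 1} ((norm z)\<^sup>2)) \<partial>lborel) =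
    ennreal pi * (\<integral>\<^sup>+x. ennreal (inverse (1 + x) * indicator {..exp s - 1} x) * indicator {0..} x \<partial>lborel)"
    by (rule nn_integral_radial) (use fm in simp)
  also have "(\<integral>\<^sup>+x. ennreal (inverse (1 + x) * indicator {..exp s - 1} x) * indicator {0..} x \<partial>lborel) =
    (\<integral>\<^sup>+x. ennreal (inverse (1 + x)) * indicator {0..exp s - 1} x \<partial>lborel)"
    by (intro nn_integral_cong) (simp split: split_indicator)
  also have "\<dots> = ennreal (ln (1 + (exp s - 1)) - ln (1 + 0))"
  proof (rule nn_integral_FTC_Icc)
    fix x assume x: "x \<in> {0..exp s - 1}"
    then have "1 + x > 0" by simp
    have "((\<lambda>x. 1 + x) has_real_derivative 0 + 1) (at x)"
      by (rule DERIV_add[OF DERIV_const DERIV_ident])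
    from DERIV_chain2[OF DERIV_ln[OF \<open>1 + x > 0\<close>] this]
    show "((\<lambda>x. ln (1 + x)) has_real_derivative inverse (1 + x)) (at x)" by simp
    show "0 \<le> inverse (1 + x)" using \<open>1 + x > 0\<close> by simp
  qed (use s in simp_all)
  finally have *: "(\<integral>\<^sup>+z. ennreal (inverse (1 + (norm (z::complex))\<^sup>2) * indicator {..exp s - 1} ((norm z)\<^sup>2)) \<partial>lborel) = ennreal (pi * s)"
    using s by (simp add: ennreal_mult'[symmetric])
  have nn: "0 \<le> inverse (1 + (norm (z::complex))\<^sup>2) * indicator {..exp s - 1} ((norm z)\<^sup>2)" for z :: complex
    by simp
  show "integrable lborel (\<lambda>z::complex. inverse (1 + (norm z)\<^sup>2) * indicator {..exp s - 1} ((norm z)\<^sup>2))"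
  proof (rule integrableI_nonneg)
    show "(\<lambda>z::complex. inverse (1 + (norm z)\<^sup>2) * indicator {..exp s - 1} ((norm z)\<^sup>2)) \<in> borel_measurable lborel" by measurable
    show "AE z in lborel. 0 \<le> inverse (1 + (norm (z::complex))\<^sup>2) * indicator {..exp s - 1} ((norm z)\<^sup>2)" by (intro AE_I2 nn)
  qed (simp only: *, simp)
  show "(LINT z::complex|lborel. inverse (1 + (norm z)\<^sup>2) * indicator {..exp s - 1} ((norm z)\<^sup>2)) = pi * s"
  proof (rule integral_eq_nn_integral[THEN trans])
    show "(\<lambda>z::complex. inverse (1 + (norm z)\<^sup>2) * indicator {..exp s - 1} ((norm z)\<^sup>2)) \<in> borel_measurable lborel" by measurable
    show "AE z in lborel. 0 \<le> inverse (1 + (norm (z::complex))\<^sup>2) * indicator {..exp s - 1} ((norm z)\<^sup>2)" by (intro AE_I2 nn)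
    show "enn2real (\<integral>\<^sup>+z. ennreal (inverse (1 + (norm (z::complex))\<^sup>2) * indicator {..exp s - 1} ((norm z)\<^sup>2)) \<partial>lborel) = pi * s"
      unfolding * using s by simp
  qed
qed

text \<open>The map x -> x / (1 + c x^2) is a smooth truncation: its size is at most of order
  c^(-1/2), its derivative is at most 1 in absolute value, and it tends to the identity as c tends
  to 0.\<close>

lemma truncation_has_derivative:
  fixes m :: "complex \<Rightarrow> real" and c :: real
  assumes "(m has_derivative D) (at z)" "c \<ge> 0"
  shows "((\<lambda>z. m z * inverse (1 + c * (m z * m z))) has_derivative
     (\<lambda>h. D h * ((1 - c * (m z)\<^sup>2) * (inverse (1 + c * (m z)\<^sup>2))\<^sup>2))) (at z)"
proof -
  let ?q = "\<lambda>z. 1 + c * (m z * m z)"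
  have "c * (m z * m z) \<ge> 0" by (intro mult_nonneg_nonneg assms(2) zero_le_square)
  then have nz: "?q z \<noteq> 0" by linarith
  have "(?q has_derivative (\<lambda>h. 2 * c * m z * D h)) (at z)"
    using assms(1) by (auto intro!: derivative_eq_intros)
  from has_derivative_mult[OF assms(1) Deriv.has_derivative_inverse[OF nz this]]
  show ?thesis
  proof (rule has_derivative_eq_rhs, intro ext)
    fix h
    have a: "x * - (i * (2 * c * x * d) * i) + d * i = d * ((1 - c * x\<^sup>2) * i\<^sup>2)" if "i * (1 + c * (x * x)) = 1" for x d i :: real
    proof -
      have "d * i = d * i * (i * (1 + c * (x * x)))" using that by simp
      then show ?thesis by (simp add: power2_eq_square algebra_simps)
    qed
    have "inverse (?q z) * ?q z = 1" using nz by simp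
    from a[OF this, of "D h"] show "m z * - (inverse (?q z) * (2 * c * m z * D h) * inverse (?q z)) + D h * inverse (?q z)
       = D h * ((1 - c * (m z)\<^sup>2) * (inverse (1 + c * (m z)\<^sup>2))\<^sup>2)"
      by (simp only: power2_eq_square)
  qed
qed

lemma truncation_bounds:
  fixes x c :: real
  assumes "c > 0"
  shows "\<bar>(1 - c * x\<^sup>2) * (inverse (1 + c * x\<^sup>2))\<^sup>2\<bar> \<le> 1"
    "(x * inverse (1 + c * (x * x)))\<^sup>2 \<le> inverse (4 * c)"
    "0 \<le> inverse (1 + c * (x * x))" "inverse (1 + c * (x * x)) \<le> 1"
proof -
  let ?y = "c * x\<^sup>2"
  have y: "?y \<ge> 0" using assms by simp
  have i: "0 < inverse (1 + ?y)" "inverse (1 + ?y) \<le> 1" using y by (auto intro!: inverse_le_1_iff[THEN iffD2])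
  have "\<bar>1 - ?y\<bar> * (inverse (1 + ?y))\<^sup>2 \<le> (1 + ?y) * (inverse (1 + ?y))\<^sup>2"
    using y by (intro mult_right_mono) auto
  also have "\<dots> = (1 + ?y) * inverse (1 + ?y) * inverse (1 + ?y)" by (simp add: power2_eq_square)
  also have "(1 + ?y) * inverse (1 + ?y) = 1" using y by (intro right_inverse) linarith
  finally show "\<bar>(1 - ?y) * (inverse (1 + ?y))\<^sup>2\<bar> \<le> 1" using i by (simp add: abs_mult)
  show "0 \<le> inverse (1 + c * (x * x))" "inverse (1 + c * (x * x)) \<le> 1" using i by (simp_all add: power2_eq_square)
  have "4 * ?y \<le> (1 + ?y)\<^sup>2" using zero_le_power2[of "1 - ?y"] by (simp add: power2_diff power2_sum)
  then have "4 * ?y * (inverse (1 + ?y))\<^sup>2 \<le> (1 + ?y)\<^sup>2 * (inverse (1 + ?y))\<^sup>2" by (intro mult_right_mono) auto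
  also have "(1 + ?y)\<^sup>2 * (inverse (1 + ?y))\<^sup>2 = 1"
    unfolding power_mult_distrib[symmetric] \<open>(1 + ?y) * inverse (1 + ?y) = 1\<close> by simp
  finally have "4 * c * (x * inverse (1 + c * x\<^sup>2))\<^sup>2 \<le> 1" by (simp add: power_mult_distrib mult_ac)
  then have "(x * inverse (1 + c * x\<^sup>2))\<^sup>2 \<le> 1 / (4 * c)" using assms by (subst pos_le_divide_eq) (auto simp: mult.commute)
  then show "(x * inverse (1 + c * (x * x)))\<^sup>2 \<le> inverse (4 * c)" by (simp add: inverse_eq_divide power2_eq_square)
qed

text \<open>Only the gradient of \<open>m\<close> is square integrable; \<open>m\<close> itself may
  grow, so multiplying by a cutoff would leave an uncontrolled term \<open>m\<close> times the
  gradient of the cutoff. Truncating \<open>m\<close> in height first makes that term explicitly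
  bounded.\<close>

lemma smooth_approx_test_function:
  assumes m: "smooth m" "\<And>e. e \<in> Basis \<Longrightarrow> sq_int (\<lambda>z. frechet_derivative m (at z) e)" and eps: "\<epsilon> > 0"
  shows "\<exists>v. test_function v \<and> H1_near R \<epsilon> v m"
proof -
  define s where "s n = real (Suc n)" for n
  \<comment> \<open>The square of the term with the gradient of the cutoff integrates to at most
    (1/(4c)) (64 (exp 1)^2 / s^2) \<pi> s, which is a constant over c s. With c = s^(-1/2) this is a
    constant times c and tends to 0, while the truncation still relaxes to the identity.\<close>
  define c where "c n = 1 / sqrt (s n)" for n
  have s: "s n > 0" and c: "c n > 0" for n by (auto simp: s_def c_def)
  have s_top: "filterlim s at_top sequentially"
    unfolding s_def[abs_def] by (rule filterlim_compose[OF filterlim_real_sequentially filterlim_Suc])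
  have c_0: "c \<longlonglongrightarrow> 0" unfolding c_def[abs_def]
    by (rule real_tendsto_divide_at_top[OF tendsto_const filterlim_compose[OF sqrt_at_top s_top]])
  define \<tau> where "\<tau> n z = m z * inverse (1 + c n * (m z * m z))" for n z
  define q where "q n z = (1 - c n * (m z)\<^sup>2) * (inverse (1 + c n * (m z)\<^sup>2))\<^sup>2" for n z
  define v where "v n z = log_cutoff (s n) z * \<tau> n z" for n z
  have nz: "1 + c n * (m z * m z) \<noteq> 0" for n z
  proof -
    have "c n * (m z * m z) \<ge> 0" by (intro mult_nonneg_nonneg less_imp_le[OF c] zero_le_square)
    then show ?thesis by linarith
  qed
  have sm\<tau>: "smooth (\<tau> n)" for n unfolding smooth_def \<tau>_def[abs_def]
    by (intro allI Ck_on_mult Ck_on_inverse Ck_on_add Ck_on_const smooth_Ck[OF m(1)] open_UNIV nz)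
  have sml: "smooth (log_cutoff (s n))" for n by (rule log_cutoff(1)[OF s])
  have smv: "smooth (v n)" for n unfolding smooth_def v_def[abs_def]
    by (intro allI Ck_on_mult smooth_Ck[OF sm\<tau>] smooth_Ck[OF sml] open_UNIV)
  have vz: "\<forall>z. norm z > exp (s n) \<longrightarrow> v n z = 0" for n
    unfolding v_def using log_cutoff(4)[OF s] by simp
  have tv: "test_function (v n)" for n unfolding test_function_iff using smv vz by blast
  have tau_D: "frechet_derivative (\<tau> n) (at z) e = frechet_derivative m (at z) e * q n z" for n z e
    unfolding \<tau>_def[abs_def] q_def
    by (rule fun_cong[OF frechet_derivative_at[OF truncation_has_derivative[OF smooth_has_derivative[OF m(1)] less_imp_le[OF c]], symmetric]])
  \<comment> \<open>The gradient error splits into a part that converges to 0 under domination by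
    the gradient of \<open>m\<close> (\<open>A\<close>), and the part with the gradient of the
    cutoff (\<open>B\<close>), which is estimated outright.\<close>
  have v_D: "frechet_derivative (v n) (at z) e - frechet_derivative m (at z) e =
     (log_cutoff (s n) z * q n z - 1) * frechet_derivative m (at z) e + \<tau> n z * frechet_derivative (log_cutoff (s n)) (at z) e" for n z e
    unfolding v_def[abs_def] frechet_derivative_mult[OF smooth_differentiable[OF sml] smooth_differentiable[OF sm\<tau>]] tau_D
    by (simp add: algebra_simps)
  have qb: "\<bar>q n z\<bar> \<le> 1" for n z unfolding q_def by (rule truncation_bounds(1)[OF c])
  have lq: "\<bar>log_cutoff (s n) z * q n z - 1\<bar> \<le> \<bar>2\<bar>" for n z
  proof -
    have "\<bar>log_cutoff (s n) z * q n z\<bar> \<le> 1 * 1" unfolding abs_mult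
      using log_cutoff(2,3)[OF s, of n z] qb by (intro mult_mono) auto
    then show ?thesis by linarith
  qed
  have qm[measurable]: "q n \<in> borel_measurable borel" for n
    using smooth_measurable[OF m(1)] unfolding q_def[abs_def] by measurable
  have lm[measurable]: "log_cutoff (s n) \<in> borel_measurable borel" for n by (rule smooth_measurable[OF sml])
  have taum[measurable]: "\<tau> n \<in> borel_measurable borel" for n by (rule smooth_measurable[OF sm\<tau>])
  have ld: "(\<lambda>z. frechet_derivative (log_cutoff (s n)) (at z) e) \<in> borel_measurable borel" if "e \<in> Basis" for n e
    by (rule smooth_measurable[OF smooth_frechet_derivative[OF sml that]])
  have lim_l: "(\<lambda>n. log_cutoff (s n) z) \<longlonglongrightarrow> 1" for z
    by (rule filterlim_compose[OF log_cutoff_tendsto_1 s_top])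
  have lim_q: "(\<lambda>n. q n z) \<longlonglongrightarrow> 1" for z
  proof -
    have "(\<lambda>n. q n z) \<longlonglongrightarrow> (1 - 0 * (m z)\<^sup>2) * (inverse (1 + 0 * (m z)\<^sup>2))\<^sup>2"
      unfolding q_def by (intro tendsto_intros c_0) simp
    then show ?thesis by simp
  qed
  have A: "sq_int (\<lambda>z. (log_cutoff (s n) z * q n z - 1) * frechet_derivative m (at z) e)" if e: "e \<in> Basis" for n e
  proof -
    have i: "integrable lborel (\<lambda>z. 4 * (frechet_derivative m (at z) e)\<^sup>2)" using m(2)[OF e] by (auto simp: sq_int_def)
    have mm: "(\<lambda>z. (log_cutoff (s n) z * q n z - 1) * frechet_derivative m (at z) e) \<in> borel_measurable borel"
      using m(2)[OF e] by (intro borel_measurable_times borel_measurable_diff lm qm borel_measurable_const) (simp add: sq_int_def)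
    have "integrable lborel (\<lambda>z. ((log_cutoff (s n) z * q n z - 1) * frechet_derivative m (at z) e)\<^sup>2)"
    proof (rule Bochner_Integration.integrable_bound[OF i])
      show "(\<lambda>z. ((log_cutoff (s n) z * q n z - 1) * frechet_derivative m (at z) e)\<^sup>2) \<in> borel_measurable lborel"
        using borel_measurable_power[OF mm] by simp
      have "norm (((log_cutoff (s n) z * q n z - 1) * d)\<^sup>2) \<le> norm (4 * d\<^sup>2)" for z d
        using norm_sq_le[OF lq[of n z]] by (simp add: power_mult_distrib mult_right_mono)
      then show "AE z in lborel. norm (((log_cutoff (s n) z * q n z - 1) * frechet_derivative m (at z) e)\<^sup>2) \<le> norm (4 * (frechet_derivative m (at z) e)\<^sup>2)"
        by (intro AE_I2)
    qed
    then show ?thesis using mm by (simp only: sq_int_def)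
  qed
  have A_lim: "(\<lambda>n. LINT z|lborel. ((log_cutoff (s n) z * q n z - 1) * frechet_derivative m (at z) e)\<^sup>2) \<longlonglongrightarrow> (LINT z|(lborel::complex measure). (0::real))" if e: "e \<in> Basis" for e
  proof (rule integral_dominated_convergence[where w="\<lambda>z. 4 * (frechet_derivative m (at z) e)\<^sup>2"])
    show "integrable lborel (\<lambda>z. 4 * (frechet_derivative m (at z) e)\<^sup>2)" using m(2)[OF e] by (auto simp: sq_int_def)
    show "(\<lambda>z. ((log_cutoff (s n) z * q n z - 1) * frechet_derivative m (at z) e)\<^sup>2) \<in> borel_measurable lborel" for n
      using A[OF e, of n] unfolding sq_int_def by (intro borel_measurable_integrable) blast
    have "norm (((log_cutoff (s n) z * q n z - 1) * d)\<^sup>2) \<le> 4 * d\<^sup>2" for n z d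
      using norm_sq_le[OF lq[of n z]] by (simp add: power_mult_distrib mult_right_mono)
    then show "AE z in lborel. norm (((log_cutoff (s n) z * q n z - 1) * frechet_derivative m (at z) e)\<^sup>2) \<le> 4 * (frechet_derivative m (at z) e)\<^sup>2" for n
      by (intro AE_I2)
    show "AE z in lborel. (\<lambda>n. ((log_cutoff (s n) z * q n z - 1) * frechet_derivative m (at z) e)\<^sup>2) \<longlonglongrightarrow> 0"
    proof (intro AE_I2)
      fix z
      have "(\<lambda>n. ((log_cutoff (s n) z * q n z - 1) * frechet_derivative m (at z) e)\<^sup>2) \<longlonglongrightarrow> ((1 * 1 - 1) * frechet_derivative m (at z) e)\<^sup>2"
        by (intro tendsto_intros lim_l lim_q)
      then show "(\<lambda>n. ((log_cutoff (s n) z * q n z - 1) * frechet_derivative m (at z) e)\<^sup>2) \<longlonglongrightarrow> 0" by simp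
    qed
  qed simp
  let ?h = "\<lambda>n z::complex. inverse (1 + (norm z)\<^sup>2) * indicator {..exp (s n) - 1} ((norm z)\<^sup>2)"
  let ?C = "\<lambda>n. inverse (4 * c n) * (64 * (exp 1)\<^sup>2 / (s n)\<^sup>2)"
  have Bb: "(\<tau> n z * frechet_derivative (log_cutoff (s n)) (at z) e)\<^sup>2 \<le> ?C n * ?h n z" if e: "e \<in> Basis" for n z e
  proof -
    have "(\<tau> n z * frechet_derivative (log_cutoff (s n)) (at z) e)\<^sup>2 = (\<tau> n z)\<^sup>2 * (frechet_derivative (log_cutoff (s n)) (at z) e)\<^sup>2"
      by (rule power_mult_distrib)
    also have "\<dots> \<le> inverse (4 * c n) * (64 * (exp 1)\<^sup>2 / (s n)\<^sup>2 * ?h n z)"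
    proof (intro mult_mono log_cutoff(5)[OF s e] zero_le_power2)
      show "(\<tau> n z)\<^sup>2 \<le> inverse (4 * c n)" unfolding \<tau>_def by (rule truncation_bounds(2)[OF c])
      show "0 \<le> inverse (4 * c n)" using c[of n] by (intro inverse_nonnegative_iff_nonnegative[THEN iffD2]) linarith
    qed
    finally show ?thesis by (simp only: mult.assoc)
  qed
  have Bi: "integrable lborel (\<lambda>z. ?C n * ?h n z)" for n
    by (intro integrable_mult_right integral_log_cutoff_bound(1)[OF s])
  have B: "sq_int (\<lambda>z. \<tau> n z * frechet_derivative (log_cutoff (s n)) (at z) e)" if e: "e \<in> Basis" for n e
  proof -
    have mm: "(\<lambda>z. \<tau> n z * frechet_derivative (log_cutoff (s n)) (at z) e) \<in> borel_measurable borel"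
      by (intro borel_measurable_times taum ld e)
    have "integrable lborel (\<lambda>z. (\<tau> n z * frechet_derivative (log_cutoff (s n)) (at z) e)\<^sup>2)"
    proof (rule Bochner_Integration.integrable_bound[OF Bi[of n]])
      show "(\<lambda>z. (\<tau> n z * frechet_derivative (log_cutoff (s n)) (at z) e)\<^sup>2) \<in> borel_measurable lborel"
        using borel_measurable_power[OF mm] by simp
      show "AE z in lborel. norm ((\<tau> n z * frechet_derivative (log_cutoff (s n)) (at z) e)\<^sup>2) \<le> norm (?C n * ?h n z)"
        by (intro AE_I2, unfold real_norm_def abs_power2) (rule order_trans[OF Bb[OF e] abs_ge_self])
    qed
    then show ?thesis using mm by (simp only: sq_int_def)
  qed
  have B_le: "(LINT z|lborel. (\<tau> n z * frechet_derivative (log_cutoff (s n)) (at z) e)\<^sup>2) \<le> 16 * pi * (exp 1)\<^sup>2 * c n" if e: "e \<in> Basis" for n e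
  proof -
    have "(LINT z|lborel. (\<tau> n z * frechet_derivative (log_cutoff (s n)) (at z) e)\<^sup>2) \<le> (LINT z|lborel. ?C n * ?h n z)"
      using B[OF e, of n] by (intro integral_mono Bi Bb[OF e]) (simp add: sq_int_def)
    also have "\<dots> = ?C n * (pi * s n)" unfolding integral_mult_right_zero integral_log_cutoff_bound(2)[OF s] ..
    also have "\<dots> = 16 * pi * (exp 1)\<^sup>2 * c n"
    proof -
      have "c n * c n * s n = 1" using s[of n] by (simp add: c_def)
      then have "inverse (c n) * inverse (s n) = c n" using s[of n] c[of n] by (simp add: field_simps)
      then show ?thesis using s[of n] c[of n] by (simp add: field_simps power2_eq_square)
    qed
    finally show ?thesis .
  qed
  have D_lim: "\<forall>e\<in>Basis. \<forall>\<^sub>F n in sequentially. (LINT z|lborel. (frechet_derivative (v n) (at z) e - frechet_derivative m (at z) e)\<^sup>2) < \<epsilon> / 4"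
  proof
    fix e :: complex assume e: "e \<in> Basis"
    have "(\<lambda>n. 2 * (LINT z|lborel. ((log_cutoff (s n) z * q n z - 1) * frechet_derivative m (at z) e)\<^sup>2) + 2 * (16 * pi * (exp 1)\<^sup>2 * c n)) \<longlonglongrightarrow>
       2 * (LINT z|(lborel::complex measure). (0::real)) + 2 * (16 * pi * (exp 1)\<^sup>2 * 0)"
      by (intro tendsto_intros A_lim e c_0)
    then have "\<forall>\<^sub>F n in sequentially. 2 * (LINT z|lborel. ((log_cutoff (s n) z * q n z - 1) * frechet_derivative m (at z) e)\<^sup>2) + 2 * (16 * pi * (exp 1)\<^sup>2 * c n) < \<epsilon> / 4"
      by (rule order_tendstoD(2)) (use eps in simp)
    then show "\<forall>\<^sub>F n in sequentially. (LINT z|lborel. (frechet_derivative (v n) (at z) e - frechet_derivative m (at z) e)\<^sup>2) < \<epsilon> / 4"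
    proof (rule eventually_mono)
      fix n assume *: "2 * (LINT z|lborel. ((log_cutoff (s n) z * q n z - 1) * frechet_derivative m (at z) e)\<^sup>2) + 2 * (16 * pi * (exp 1)\<^sup>2 * c n) < \<epsilon> / 4"
      show "(LINT z|lborel. (frechet_derivative (v n) (at z) e - frechet_derivative m (at z) e)\<^sup>2) < \<epsilon> / 4"
        unfolding v_D using integral_sq_add_le[OF A[OF e] B[OF e], of n n] B_le[OF e, of n] * by linarith
    qed
  qed
  have vm: "\<bar>v n z - m z\<bar> \<le> \<bar>m z\<bar>" for n z
  proof -
    let ?a = "log_cutoff (s n) z * inverse (1 + c n * (m z * m z))"
    have a0: "0 \<le> ?a" by (rule mult_nonneg_nonneg[OF log_cutoff(2)[OF s] truncation_bounds(3)[OF c]])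
    have "?a \<le> 1 * 1" by (intro mult_mono log_cutoff(3)[OF s] truncation_bounds(3,4)[OF c] zero_le_one)
    then have a: "\<bar>?a - 1\<bar> \<le> 1" using a0 by (simp only: abs_le_iff) linarith
    have "v n z - m z = (?a - 1) * m z" by (simp add: v_def \<tau>_def algebra_simps)
    then have "\<bar>v n z - m z\<bar> = \<bar>?a - 1\<bar> * \<bar>m z\<bar>" by (simp only: abs_mult)
    also have "\<dots> \<le> 1 * \<bar>m z\<bar>" by (rule mult_right_mono[OF a abs_ge_zero])
    finally show ?thesis by simp
  qed
  let ?i = "\<lambda>z. indicator (cball (0::complex) R) z :: real"
  have mL: "L2loc m" "L2loc (v n)" for n by (rule L2loc_continuous[OF smooth_continuous] m(1) smv)+
  have L_lim: "(\<lambda>n. LINT z|lborel. (?i z * (v n z - m z))\<^sup>2) \<longlonglongrightarrow> (LINT z|(lborel::complex measure). (0::real))"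
  proof (rule integral_dominated_convergence[where w="\<lambda>z. (?i z * m z)\<^sup>2"])
    show "integrable lborel (\<lambda>z. (?i z * m z)\<^sup>2)" using L2loc_cut[OF mL(1)] by (simp add: sq_int_def)
    show "(\<lambda>z. (?i z * (v n z - m z))\<^sup>2) \<in> borel_measurable lborel" for n
      using L2loc_cut[OF L2loc_diff[OF mL(2)[of n] mL(1)], of R] unfolding sq_int_def by (intro borel_measurable_integrable) blast
    have "\<bar>?i z * (v n z - m z)\<bar> \<le> \<bar>?i z * m z\<bar>" for n z
      unfolding abs_mult by (intro mult_left_mono vm) simp
    then show "AE z in lborel. norm ((?i z * (v n z - m z))\<^sup>2) \<le> (?i z * m z)\<^sup>2" for n
      by (intro AE_I2 norm_sq_le)
    show "AE z in lborel. (\<lambda>n. (?i z * (v n z - m z))\<^sup>2) \<longlonglongrightarrow> 0"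
    proof (intro AE_I2)
      fix z
      have "(\<lambda>n. (?i z * (v n z - m z))\<^sup>2) \<longlonglongrightarrow> (?i z * (1 * (m z * inverse (1 + 0 * (m z * m z))) - m z))\<^sup>2"
        unfolding v_def \<tau>_def by (intro tendsto_intros lim_l c_0) simp
      then show "(\<lambda>n. (?i z * (v n z - m z))\<^sup>2) \<longlonglongrightarrow> 0" by simp
    qed
  qed simp
  then have L_ev: "\<forall>\<^sub>F n in sequentially. (LINT z:cball 0 R|lborel. (v n z - m z)\<^sup>2) < \<epsilon>"
    unfolding set_integral_cball_sq using order_tendstoD(2)[of _ "LINT z|(lborel::complex measure). (0::real)" sequentially \<epsilon>] eps by simp
  have "\<forall>\<^sub>F n in sequentially. H1_near R \<epsilon> (v n) m"
    using L_ev eventually_ball_finite[OF finite_Basis D_lim]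
  proof eventually_elim
    case (elim n)
    have s1: "sq_int (\<lambda>z. frechet_derivative (v n) (at z) e)" if e: "e \<in> Basis" for e
      by (rule sq_int_csupp[OF smooth_continuous[OF smooth_frechet_derivative[OF smv e]], of "exp (s n)"])
         (rule frechet_derivative_csupp[OF vz[rule_format]])
    have wg: "L2_weak_gradient (\<lambda>z. v n z - m z) (\<lambda>z. cgrad (v n) z - cgrad m z)"
      by (rule L2_weak_gradient_diff[OF L2_weak_gradient_C1[OF smooth_Ck[OF smv] s1] loc_int_L2loc[OF mL(2)]
           L2_weak_gradient_C1[OF smooth_Ck[OF m(1)] m(2)] loc_int_L2loc[OF mL(1)]])
    have "(LINT z|lborel. (norm (cgrad (v n) z - cgrad m z))\<^sup>2) = (\<Sum>e\<in>Basis. LINT z|lborel. ((cgrad (v n) z - cgrad m z) \<bullet> e)\<^sup>2)"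
      by (rule vec_L2(3)[OF L2_weak_gradientD(1)[OF wg]])
    also have "\<dots> = (\<Sum>e\<in>Basis. LINT z|lborel. (frechet_derivative (v n) (at z) e - frechet_derivative m (at z) e)\<^sup>2)"
      by (intro sum.cong refl) (simp only: inner_diff_left cgrad_inner)
    also have "\<dots> \<le> (\<Sum>e\<in>(Basis::complex set). \<epsilon> / 4)" using elim(2) by (intro sum_mono less_imp_le) blast
    also have "\<dots> < \<epsilon>" using eps by simp
    finally show ?case unfolding H1_near_def using wg elim(1) by blast
  qed
  then obtain n where "H1_near R \<epsilon> (v n) m" unfolding eventually_sequentially by blast
  then show ?thesis using tv by blast
qed

lemma test_function_L2loc: "test_function v \<Longrightarrow> L2loc v"
  unfolding test_function_iff by (intro L2loc_continuous smooth_continuous) blast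

lemma H1_L2loc: "u \<in> H1 \<Longrightarrow> L2loc u" by (simp add: H1_def)

lemma H1_near_sym: 
  assumes "H1_near R \<epsilon> u v" shows "H1_near R \<epsilon> v u"
proof -
  obtain g where g: "L2_weak_gradient (\<lambda>z. u z - v z) g" "(LINT z|lborel. (norm (g z))\<^sup>2) < \<epsilon>"
    using assms unfolding H1_near_def by blast
  have "L2_weak_gradient (\<lambda>z. v z - u z) (\<lambda>z. - g z)"
  proof (rule L2_weak_gradientI)
    fix e :: complex assume e: "e \<in> Basis"
    show "sq_int (\<lambda>z. (- g z) \<bullet> e)" unfolding inner_minus_left by (rule sq_int_minus[OF L2_weak_gradientD(1)[OF g(1) e]])
    fix f assume f: "test_function f"
    have eq: "(v z - u z) * x = - ((u z - v z) * x)" "(- g z \<bullet> e) * x = - ((g z \<bullet> e) * x)" for z x by (simp_all add: algebra_simps)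
    show "(LINT z|lborel. (v z - u z) * frechet_derivative f (at z) e) = - (LINT z|lborel. (- g z \<bullet> e) * f z)"
      unfolding eq integral_minus L2_weak_gradientD(2)[OF g(1) f e] ..
  qed
  moreover have "(LINT z|lborel. (norm (- g z))\<^sup>2) < \<epsilon>" using g(2) by simp
  moreover have "(LINT z:cball 0 R|lborel. (v z - u z)\<^sup>2) < \<epsilon>"
    using assms unfolding H1_near_def by (simp add: power2_commute)
  ultimately show ?thesis unfolding H1_near_def by blast
qed

text \<open>Mollification gives a smooth function with square integrable derivatives, and truncation
  with cutoff then gives compact support. Each step is allowed \<epsilon>/4 because of the factor 4
  in \<open>H1_near_triangle\<close>.\<close>

lemma H1_approx_test_function:
  assumes u: "u \<in> H1" and eps: "\<epsilon> > 0"
  shows "\<exists>v. test_function v \<and> H1_near R \<epsilon> v u"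
proof -
  obtain g where L: "L2loc u" and g: "L2_weak_gradient u g" using u unfolding H1_def by blast
  have e4: "\<epsilon> / 4 > 0" using eps by simp
  obtain n where n: "smooth (conv u (moll n))" "H1_near R (\<epsilon> / 4) (conv u (moll n)) u"
     "\<And>e. e \<in> Basis \<Longrightarrow> sq_int (\<lambda>z. frechet_derivative (conv u (moll n)) (at z) e)"
    using conv_moll_H1[OF L g e4, of R] unfolding eventually_sequentially by blast
  obtain v where v: "test_function v" "H1_near R (\<epsilon> / 4) v (conv u (moll n))"
    using smooth_approx_test_function[OF n(1) n(3) e4] by blast
  have "H1_near R (4 * (\<epsilon> / 4)) v u"
    by (rule H1_near_triangle[OF v(2) H1_near_sym[OF n(2)] test_function_L2loc[OF v(1)] L2loc_continuous[OF smooth_continuous[OF n(1)]] L])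
  then show ?thesis using v(1) by auto
qed

section \<open>The logarithm as a mixture of Gaussians\<close>

lemma nn_integral_eq_imp_integral:
  fixes f :: "'a \<Rightarrow> real"
  assumes "f \<in> borel_measurable M" "\<And>x. 0 \<le> f x" "(\<integral>\<^sup>+x. ennreal (f x) \<partial>M) = ennreal c" "0 \<le> c"
  shows "integrable M f" "(LINT x|M. f x) = c"
proof -
  show "integrable M f"
    by (rule integrableI_nonneg[OF assms(1)]) (simp_all add: assms(2,3))
  show "(LINT x|M. f x) = c"
    by (rule integral_eq_nn_integral[THEN trans, OF assms(1)]) (simp_all add: assms(2,3,4))
qed

lemma integrable_pair_mult:
  fixes a :: "'a \<Rightarrow> real" and b :: "'b \<Rightarrow> real"
  assumes "sigma_finite_measure M" "sigma_finite_measure M'"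
    and a: "integrable M a" and b: "integrable M' b"
  shows "integrable (M \<Otimes>\<^sub>M M') (\<lambda>p. a (fst p) * b (snd p))"
    "(LINT p|(M \<Otimes>\<^sub>M M'). a (fst p) * b (snd p)) = (LINT z|M. a z) * (LINT w|M'. b w)"
proof -
  interpret pair_sigma_finite M M' using assms(1,2) by (simp add: pair_sigma_finite_def)
  have [measurable]: "a \<in> borel_measurable M" "b \<in> borel_measurable M'" using a b by auto
  show i: "integrable (M \<Otimes>\<^sub>M M') (\<lambda>p. a (fst p) * b (snd p))"
  proof (rule Fubini_integrable)
    show "integrable M (\<lambda>x. LINT y|M'. norm (a (fst (x, y)) * b (snd (x, y))))"
      using integrable_mult_left[OF integrable_abs[OF a], of "LINT y|M'. \<bar>b y\<bar>"] by (simp add: abs_mult)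
    show "AE x in M. integrable M' (\<lambda>y. a (fst (x, y)) * b (snd (x, y)))" using b by simp
  qed simp
  have "(LINT z|M. LINT w|M'. a z * b w) = (LINT p|(M \<Otimes>\<^sub>M M'). a (fst p) * b (snd p))"
    using integral_fst'[OF i] by simp
  then show "(LINT p|(M \<Otimes>\<^sub>M M'). a (fst p) * b (snd p)) = (LINT z|M. a z) * (LINT w|M'. b w)" by simp
qed

text \<open>The exponent carries 2t so that composing the kernel with itself produces exp (- t |z -
  w|^2), by \<open>nn_integral_gaussian_prod\<close>.\<close>

definition gauss :: "real \<Rightarrow> complex \<Rightarrow> complex \<Rightarrow> real" where
  "gauss t z y = exp (- 2 * t * (norm (z - y))\<^sup>2)"

lemma gauss_measurable[measurable]: "(\<lambda>p. gauss t (fst p) (snd p)) \<in> borel_measurable (borel \<Otimes>\<^sub>M borel)"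
  unfolding gauss_def by measurable

lemma gauss_bounds: "t \<ge> 0 \<Longrightarrow> 0 \<le> gauss t z y" "t \<ge> 0 \<Longrightarrow> gauss t z y \<le> 1"
  by (auto simp: gauss_def)

text \<open>Fubini applied to the composition identity: the bilinear form of exp (- t |z - w|^2) is
  an L^2 inner product of Gaussian averages, which for equal arguments becomes a square.\<close>

lemma gauss_pair:
  fixes f f' :: "complex \<Rightarrow> real"
  assumes M: "sigma_finite_measure M" "sets M = sets borel" "integrable M f"
    and M': "sigma_finite_measure M'" "sets M' = sets borel" "integrable M' f'" and t: "t > 0"
  shows "integrable lborel (\<lambda>y. (LINT z|M. gauss t z y * f z) * (LINT w|M'. gauss t w y * f' w))"
    "(LINT y|lborel. (LINT z|M. gauss t z y * f z) * (LINT w|M'. gauss t w y * f' w)) =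
      pi / (4 * t) * (LINT p|(M \<Otimes>\<^sub>M M'). exp (- t * (norm (fst p - snd p))\<^sup>2) * (f (fst p) * f' (snd p)))"
proof -
  interpret P: pair_sigma_finite M M' using M(1) M'(1) by (simp add: pair_sigma_finite_def)
  have sP: "sigma_finite_measure (M \<Otimes>\<^sub>M M')" by (rule P.sigma_finite_measure_axioms)
  interpret Q: pair_sigma_finite "M \<Otimes>\<^sub>M M'" "lborel :: complex measure"
    by (simp add: pair_sigma_finite_def sP sigma_finite_lborel)
  note [measurable_cong] = M(2) M'(2)
  have [measurable]: "f \<in> borel_measurable borel" "f' \<in> borel_measurable borel"
    using M(3) M'(3) measurable_cong_sets[OF M(2) refl] measurable_cong_sets[OF M'(2) refl] by auto
  let ?K = "\<lambda>q. gauss t (fst (fst q)) (snd q) * gauss t (snd (fst q)) (snd q) * (f (fst (fst q)) * f' (snd (fst q)))"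
  have Km: "?K \<in> borel_measurable ((M \<Otimes>\<^sub>M M') \<Otimes>\<^sub>M lborel)"
    unfolding gauss_def by measurable
  have ff: "integrable (M \<Otimes>\<^sub>M M') (\<lambda>p. f (fst p) * f' (snd p))"
    by (rule integrable_pair_mult(1)[OF M(1) M'(1) M(3) M'(3)])
  have nn: "(\<integral>\<^sup>+y. ennreal (gauss t z y * gauss t w y) \<partial>lborel) = ennreal (pi / (4 * t) * exp (- t * (norm (z - w))\<^sup>2))" for z w
    unfolding gauss_def by (rule nn_integral_gaussian_prod[OF t])
  have gi: "integrable lborel (\<lambda>y. gauss t z y * gauss t w y)" for z w
  proof (rule integrableI_nonneg)
    show "(\<lambda>y. gauss t z y * gauss t w y) \<in> borel_measurable lborel" unfolding gauss_def by measurable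
    show "AE y in lborel. 0 \<le> gauss t z y * gauss t w y" by (intro AE_I2) (simp add: gauss_def)
    show "(\<integral>\<^sup>+y. ennreal (gauss t z y * gauss t w y) \<partial>lborel) < \<infinity>" unfolding nn by simp
  qed
  have gv: "(LINT y|lborel. gauss t z y * gauss t w y) = pi / (4 * t) * exp (- t * (norm (z - w))\<^sup>2)" for z w
  proof (rule integral_eq_nn_integral[THEN trans])
    show "(\<lambda>y. gauss t z y * gauss t w y) \<in> borel_measurable lborel" unfolding gauss_def by measurable
    show "AE y in lborel. 0 \<le> gauss t z y * gauss t w y" by (intro AE_I2) (simp add: gauss_def)
    show "enn2real (\<integral>\<^sup>+y. ennreal (gauss t z y * gauss t w y) \<partial>lborel) = pi / (4 * t) * exp (- t * (norm (z - w))\<^sup>2)"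
      unfolding nn using t by simp
  qed
  let ?E = "\<lambda>p. exp (- t * (norm (fst p - snd p))\<^sup>2)"
  have Eb: "\<bar>?E p\<bar> \<le> 1" for p :: "complex \<times> complex" using t by simp
  have Em: "?E \<in> borel_measurable (M \<Otimes>\<^sub>M M')" by measurable
  have iE: "integrable (M \<Otimes>\<^sub>M M') (\<lambda>p. ?E p * (f (fst p) * f' (snd p)))"
    by (rule bounded_times_integrable(2)[OF ff Em Eb])
  have Keq: "(\<lambda>(p, y). ?K (p, y)) = ?K" by (rule ext, unfold split_beta fst_conv snd_conv, rule refl)
  have Ki: "integrable ((M \<Otimes>\<^sub>M M') \<Otimes>\<^sub>M lborel) ?K"
  proof (rule Q.Fubini_integrable[OF Km])
    have "(LINT y|lborel. norm (?K (p, y))) = pi / (4 * t) * \<bar>?E p * (f (fst p) * f' (snd p))\<bar>" for p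
    proof -
      have "(LINT y|lborel. norm (?K (p, y))) = (LINT y|lborel. \<bar>f (fst p) * f' (snd p)\<bar> * (gauss t (fst p) y * gauss t (snd p) y))"
        by (intro Bochner_Integration.integral_cong refl) (simp add: abs_mult gauss_def)
      also have "\<dots> = \<bar>f (fst p) * f' (snd p)\<bar> * (pi / (4 * t) * ?E p)" unfolding integral_mult_right_zero gv ..
      finally show ?thesis by (simp add: abs_mult)
    qed
    then show "integrable (M \<Otimes>\<^sub>M M') (\<lambda>p. LINT y|lborel. norm (?K (p, y)))"
      using integrable_mult_right[OF integrable_abs[OF iE], of "pi / (4 * t)"] by simp
    show "AE p in M \<Otimes>\<^sub>M M'. integrable lborel (\<lambda>y. ?K (p, y))"
      by (intro AE_I2, unfold fst_conv snd_conv) (rule integrable_mult_left[OF gi])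
  qed
  have inner: "(LINT p|(M \<Otimes>\<^sub>M M'). ?K (p, y)) = (LINT z|M. gauss t z y * f z) * (LINT w|M'. gauss t w y * f' w)" for y
  proof -
    have gm: "(\<lambda>z. gauss t z y) \<in> borel_measurable M" "(\<lambda>z. gauss t z y) \<in> borel_measurable M'"
      unfolding gauss_def by measurable
    have gb: "\<bar>gauss t z y\<bar> \<le> 1" for z using gauss_bounds[of t z y] t by simp
    have i: "integrable M (\<lambda>z. gauss t z y * f z)" "integrable M' (\<lambda>w. gauss t w y * f' w)"
      by (rule bounded_times_integrable(2)[OF M(3) gm(1) gb], rule bounded_times_integrable(2)[OF M'(3) gm(2) gb])
    have "(\<lambda>p. ?K (p, y)) = (\<lambda>p. (gauss t (fst p) y * f (fst p)) * (gauss t (snd p) y * f' (snd p)))"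
      by (rule ext) (simp add: mult_ac)
    then show ?thesis using integrable_pair_mult(2)[OF M(1) M'(1) i] by (simp only:)
  qed
  have "integrable lborel (\<lambda>y. LINT p|(M \<Otimes>\<^sub>M M'). ?K (p, y))"
    by (rule Q.integrable_snd[of "\<lambda>p y. ?K (p, y)"]) (unfold Keq, rule Ki)
  then show "integrable lborel (\<lambda>y. (LINT z|M. gauss t z y * f z) * (LINT w|M'. gauss t w y * f' w))"
    unfolding inner .
  have "(LINT y|lborel. LINT p|(M \<Otimes>\<^sub>M M'). ?K (p, y)) = (LINT p|(M \<Otimes>\<^sub>M M'). LINT y|lborel. ?K (p, y))"
    by (rule Q.Fubini_integral[of "\<lambda>p y. ?K (p, y)"]) (unfold Keq, rule Ki)
  also have "\<dots> = (LINT p|(M \<Otimes>\<^sub>M M'). pi / (4 * t) * (?E p * (f (fst p) * f' (snd p))))"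
    unfolding fst_conv snd_conv integral_mult_left_zero gv by (simp only: mult.assoc)
  also have "\<dots> = pi / (4 * t) * (LINT p|(M \<Otimes>\<^sub>M M'). ?E p * (f (fst p) * f' (snd p)))"
    by (rule integral_mult_right_zero)
  finally show "(LINT y|lborel. (LINT z|M. gauss t z y * f z) * (LINT w|M'. gauss t w y * f' w)) =
      pi / (4 * t) * (LINT p|(M \<Otimes>\<^sub>M M'). ?E p * (f (fst p) * f' (snd p)))"
    unfolding inner .
qed

text \<open>Frullani's integral: the difference quotient is the integral of exp (- t x) over x in
  [a, b]; Tonelli turns the integral over t into that of 1/x.\<close>

lemma frullani_nn:
  assumes "0 < a" "a \<le> b"
  shows "(\<integral>\<^sup>+t. ennreal ((exp (- t * a) - exp (- t * b)) / t) * indicator {0<..} t \<partial>lborel) = ennreal (ln b - ln a)"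
proof -
  have 1: "ennreal ((exp (- t * a) - exp (- t * b)) / t) = (\<integral>\<^sup>+x. ennreal (exp (- t * x)) * indicator {a..b} x \<partial>lborel)" if "t > 0" for t
  proof -
    have "(\<integral>\<^sup>+x. ennreal (exp (- t * x)) * indicator {a..b} x \<partial>lborel) = ennreal (- exp (- t * b) / t - (- exp (- t * a) / t))"
    proof (rule nn_integral_FTC_Icc)
      show "((\<lambda>x. - exp (- t * x) / t) has_real_derivative exp (- t * x)) (at x)" for x
        using that by (auto intro!: derivative_eq_intros)
    qed (use assms in auto)
    also have "- exp (- t * b) / t - (- exp (- t * a) / t) = (exp (- t * a) - exp (- t * b)) / t"
      using that by (simp add: diff_divide_distrib)
    finally show ?thesis by simp
  qed
  have 2: "(\<integral>\<^sup>+t. ennreal (exp (- t * x)) * indicator {0<..} t \<partial>lborel) = ennreal (1 / x)" if "x > 0" for x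
  proof -
    have "(\<integral>\<^sup>+t. ennreal (exp (- t * x)) * indicator {0<..} t \<partial>lborel) = (\<integral>\<^sup>+t. ennreal (exp (- t * x)) * indicator {0..} t \<partial>lborel)"
      by (rule nn_integral_cong_AE, rule AE_mp[OF AE_lborel_singleton[of 0]], rule AE_I2) (auto split: split_indicator)
    also have "\<dots> = ennreal (0 - (- exp (- 0 * x) / x))"
    proof (rule nn_integral_FTC_atLeast)
      show "((\<lambda>t. - exp (- t * x) / x) has_real_derivative exp (- t * x)) (at t)" for t
        using that by (auto intro!: derivative_eq_intros)
      have "((\<lambda>t. exp (- x * t)) \<longlongrightarrow> 0) at_top"
        using that by (intro filterlim_compose[OF exp_at_bot]) (rule filterlim_tendsto_neg_mult_at_bot[OF tendsto_const _ filterlim_ident], simp)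
      from tendsto_divide[OF tendsto_minus[OF this] tendsto_const[of x]]
      show "((\<lambda>t. - exp (- t * x) / x) \<longlongrightarrow> 0) at_top" using that by (simp add: mult.commute)
    qed auto
    finally show ?thesis by simp
  qed
  have "(\<integral>\<^sup>+t. ennreal ((exp (- t * a) - exp (- t * b)) / t) * indicator {0<..} t \<partial>lborel)
     = (\<integral>\<^sup>+t. (\<integral>\<^sup>+x. ennreal (exp (- t * x)) * indicator {a..b} x * indicator {0<..} t \<partial>lborel) \<partial>lborel)"
  proof (rule nn_integral_cong)
    fix t :: real
    show "ennreal ((exp (- t * a) - exp (- t * b)) / t) * indicator {0<..} t
      = (\<integral>\<^sup>+x. ennreal (exp (- t * x)) * indicator {a..b} x * indicator {0<..} t \<partial>lborel)"
    proof (cases "t > 0")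
      case True then show ?thesis using 1[OF True] by simp
    next
      case False then show ?thesis by simp
    qed
  qed
  also have "\<dots> = (\<integral>\<^sup>+x. (\<integral>\<^sup>+t. ennreal (exp (- t * x)) * indicator {a..b} x * indicator {0<..} t \<partial>lborel) \<partial>lborel)"
    by (rule lborel_pair.Fubini') measurable
  also have "\<dots> = (\<integral>\<^sup>+x. ennreal (1 / x) * indicator {a..b} x \<partial>lborel)"
  proof (rule nn_integral_cong)
    fix x :: real
    show "(\<integral>\<^sup>+t. ennreal (exp (- t * x)) * indicator {a..b} x * indicator {0<..} t \<partial>lborel) = ennreal (1 / x) * indicator {a..b} x"
      using 2[of x] assms by (auto split: split_indicator)
  qed
  also have "\<dots> = ennreal (ln b - ln a)"
  proof (rule nn_integral_FTC_Icc)
    show "(ln has_real_derivative 1 / x) (at x)" if "x \<in> {a..b}" for x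
      using that assms by (intro DERIV_ln_divide) auto
  qed (use assms in auto)
  finally show ?thesis .
qed

definition frull :: "real \<Rightarrow> real \<Rightarrow> real" where
  "frull t s = indicator {0<..} t * ((exp (- t * s) - exp (- t)) / t)"

lemma frull_measurable[measurable]: "(\<lambda>p. frull (fst p) (snd p)) \<in> borel_measurable (borel \<Otimes>\<^sub>M borel)"
  unfolding frull_def by measurable

text \<open>For fixed s the sign of \<open>frull t s\<close> does not depend on t, so the integral
  of the absolute value is again |ln s|. This is the bound that justifies Fubini when the formula is
  integrated against a pair of measures.\<close>

lemma frullani:
  assumes s: "s > 0"
  shows "integrable lborel (\<lambda>t. frull t s)" "(LINT t|lborel. frull t s) = - ln s"
    "(LINT t|lborel. \<bar>frull t s\<bar>) = \<bar>ln s\<bar>"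
proof -
  have m: "(\<lambda>t. frull t s) \<in> borel_measurable lborel" unfolding frull_def by measurable
  have "integrable lborel (\<lambda>t. frull t s) \<and> (LINT t|lborel. frull t s) = - ln s \<and> (LINT t|lborel. \<bar>frull t s\<bar>) = \<bar>ln s\<bar>"
  proof (cases "s \<le> 1")
    case True
    have nn: "frull t s \<ge> 0" for t
    proof (cases "t > 0")
      case t: True
      have "t * s \<le> t * 1" using t True by (intro mult_left_mono) auto
      then have "exp (- t) \<le> exp (- t * s)" by simp
      then show ?thesis using t unfolding frull_def by (intro mult_nonneg_nonneg divide_nonneg_pos) simp_all
    next
      case False then show ?thesis by (simp add: frull_def)
    qed
    have "(\<integral>\<^sup>+t. ennreal (frull t s) \<partial>lborel) = (\<integral>\<^sup>+t. ennreal ((exp (- t * s) - exp (- t * 1)) / t) * indicator {0<..} t \<partial>lborel)"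
    proof (rule nn_integral_cong)
      show "ennreal (frull t s) = ennreal ((exp (- t * s) - exp (- t * 1)) / t) * indicator {0<..} t" for t
        by (cases "t > 0") (simp_all add: frull_def)
    qed
    also have "\<dots> = ennreal (- ln s)" using frullani_nn[OF s True] by simp
    finally have v: "(\<integral>\<^sup>+t. ennreal (frull t s) \<partial>lborel) = ennreal (- ln s)" .
    have l: "- ln s \<ge> 0" using s True by simp
    note r = nn_integral_eq_imp_integral[OF m nn v l]
    have "\<bar>frull t s\<bar> = frull t s" for t by (rule abs_of_nonneg[OF nn])
    moreover have "\<bar>ln s\<bar> = - ln s" using l by linarith
    ultimately show ?thesis using r by (simp only:)
  next
    case False
    have nn: "- frull t s \<ge> 0" for t
    proof (cases "t > 0")
      case t: True
      have "t * 1 \<le> t * s" using t False by (intro mult_left_mono) auto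
      then have "exp (- t * s) - exp (- t) \<le> 0" by simp
      then have "(exp (- t * s) - exp (- t)) / t \<le> 0" by (rule divide_nonpos_pos[OF _ t])
      then show ?thesis using t by (simp add: frull_def)
    next
      case False then show ?thesis by (simp add: frull_def)
    qed
    have "(\<integral>\<^sup>+t. ennreal (- frull t s) \<partial>lborel) = (\<integral>\<^sup>+t. ennreal ((exp (- t * 1) - exp (- t * s)) / t) * indicator {0<..} t \<partial>lborel)"
    proof (rule nn_integral_cong)
      have "- ((a - b) / t) = (b - a) / t" for a b t :: real by (simp add: minus_divide_left)
      then show "ennreal (- frull t s) = ennreal ((exp (- t * 1) - exp (- t * s)) / t) * indicator {0<..} t" for t
        by (cases "t > 0") (simp_all add: frull_def)
    qed
    also have "\<dots> = ennreal (ln s)" using frullani_nn[of 1 s] False by simp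
    finally have v: "(\<integral>\<^sup>+t. ennreal (- frull t s) \<partial>lborel) = ennreal (ln s)" .
    have l: "ln s \<ge> 0" using False by simp
    have m': "(\<lambda>t. - frull t s) \<in> borel_measurable lborel" using m by simp
    note r = nn_integral_eq_imp_integral[OF m' nn v l]
    have "integrable lborel (\<lambda>t. frull t s)" using Bochner_Integration.integrable_minus[OF r(1)] by (simp only: minus_minus)
    moreover have "(LINT t|lborel. frull t s) = - ln s" using r(2) unfolding integral_minus by linarith
    moreover have "\<bar>frull t s\<bar> = - frull t s" for t using nn[of t] by linarith
    moreover have "\<bar>ln s\<bar> = ln s" using l by linarith
    ultimately show ?thesis using r(2) by (simp only:)
  qed
  then show "integrable lborel (\<lambda>t. frull t s)" "(LINT t|lborel. frull t s) = - ln s"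
    "(LINT t|lborel. \<bar>frull t s\<bar>) = \<bar>ln s\<bar>" by blast+
qed

text \<open>On the diagonal this takes a finite value where the logarithmic kernel is -\<infinity>.
  Results that need the true kernel therefore assume that almost every pair is off the
  diagonal.\<close>

definition lnsq :: "complex \<times> complex \<Rightarrow> real" where
  "lnsq p = ln ((norm (fst p - snd p))\<^sup>2)"

lemma lnsq_measurable[measurable]: "lnsq \<in> borel_measurable (borel \<Otimes>\<^sub>M borel)"
  unfolding lnsq_def[abs_def] by measurable

text \<open>Integrating Frullani's formula with s = |z - w|^2 over the pair measure. The term exp (-
  t) F stems from normalising the logarithm at s = 1; it depends on the total masses alone, so it
  drops out for differences of measures of equal mass.\<close>

lemma log_as_gauss_mixture:
  fixes f f' :: "complex \<Rightarrow> real"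
  assumes M: "sigma_finite_measure M" "sets M = sets borel" "integrable M f"
    and M': "sigma_finite_measure M'" "sets M' = sets borel" "integrable M' f'"
    and off: "AE p in M \<Otimes>\<^sub>M M'. fst p \<noteq> snd p"
    and int: "integrable (M \<Otimes>\<^sub>M M') (\<lambda>p. lnsq p * (f (fst p) * f' (snd p)))"
  defines "A \<equiv> (\<lambda>t. (LINT p|(M \<Otimes>\<^sub>M M'). exp (- t * (norm (fst p - snd p))\<^sup>2) * (f (fst p) * f' (snd p))))"
    and "F \<equiv> (LINT z|M. f z) * (LINT w|M'. f' w)"
  shows "integrable lborel (\<lambda>t. indicator {0<..} t * ((A t - exp (- t) * F) / t))"
    "(LINT t|lborel. indicator {0<..} t * ((A t - exp (- t) * F) / t)) = - (LINT p|(M \<Otimes>\<^sub>M M'). lnsq p * (f (fst p) * f' (snd p)))"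
proof -
  interpret P: pair_sigma_finite M M' using M(1) M'(1) by (simp add: pair_sigma_finite_def)
  have sP: "sigma_finite_measure (M \<Otimes>\<^sub>M M')" by (rule P.sigma_finite_measure_axioms)
  interpret Q: pair_sigma_finite "M \<Otimes>\<^sub>M M'" "lborel :: real measure"
    by (simp add: pair_sigma_finite_def sP sigma_finite_lborel)
  note [measurable_cong] = M(2) M'(2)
  have [measurable]: "f \<in> borel_measurable borel" "f' \<in> borel_measurable borel"
    using M(3) M'(3) measurable_cong_sets[OF M(2) refl] measurable_cong_sets[OF M'(2) refl] by auto
  let ?ff = "\<lambda>p. f (fst p) * f' (snd p)"
  let ?K = "\<lambda>q. frull (snd q) ((norm (fst (fst q) - snd (fst q)))\<^sup>2) * ?ff (fst q)"
  have Km: "?K \<in> borel_measurable ((M \<Otimes>\<^sub>M M') \<Otimes>\<^sub>M lborel)"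
    unfolding frull_def by measurable
  have ff: "integrable (M \<Otimes>\<^sub>M M') ?ff"
    by (rule integrable_pair_mult(1)[OF M(1) M'(1) M(3) M'(3)])
  have ffF: "(LINT p|(M \<Otimes>\<^sub>M M'). ?ff p) = F" unfolding F_def
    by (rule integrable_pair_mult(2)[OF M(1) M'(1) M(3) M'(3)])
  have pos: "(norm (fst p - snd p))\<^sup>2 > 0" if "fst p \<noteq> snd p" for p :: "complex \<times> complex" using that by simp
  have in1: "AE p in M \<Otimes>\<^sub>M M'. (LINT t|lborel. norm (?K (p, t))) = \<bar>lnsq p * ?ff p\<bar>"
    using off
  proof (rule AE_mp, intro AE_I2 impI)
    fix p :: "complex \<times> complex" assume "fst p \<noteq> snd p"
    have "(LINT t|lborel. norm (?K (p, t))) = (LINT t|lborel. \<bar>frull t ((norm (fst p - snd p))\<^sup>2)\<bar> * \<bar>?ff p\<bar>)"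
      by (simp add: abs_mult)
    then show "(LINT t|lborel. norm (?K (p, t))) = \<bar>lnsq p * ?ff p\<bar>"
      unfolding integral_mult_left_zero frullani(3)[OF pos[OF \<open>fst p \<noteq> snd p\<close>]] by (simp add: lnsq_def abs_mult)
  qed
  have Keq: "(\<lambda>(p, y). ?K (p, y)) = ?K" by (rule ext, unfold split_beta fst_conv snd_conv, rule refl)
  have Ki: "integrable ((M \<Otimes>\<^sub>M M') \<Otimes>\<^sub>M lborel) ?K"
  proof (rule Q.Fubini_integrable[OF Km])
    have nm: "(\<lambda>q. norm (?K q)) \<in> borel_measurable ((M \<Otimes>\<^sub>M M') \<Otimes>\<^sub>M lborel)"
      using measurable_compose[OF Km borel_measurable_norm] .
    have "(\<lambda>p. LINT t|lborel. norm (?K (p, t))) \<in> borel_measurable (M \<Otimes>\<^sub>M M')"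
      by (rule lborel.borel_measurable_lebesgue_integral) (use nm in \<open>simp add: case_prod_beta\<close>)
    then show "integrable (M \<Otimes>\<^sub>M M') (\<lambda>p. LINT t|lborel. norm (?K (p, t)))"
      using integrable_cong_AE[of _ "M \<Otimes>\<^sub>M M'", OF _ _ in1] integrable_abs[OF int] by (simp add: borel_measurable_integrable)
    show "AE p in M \<Otimes>\<^sub>M M'. integrable lborel (\<lambda>t. ?K (p, t))"
      using off
    proof (rule AE_mp, intro AE_I2 impI)
      fix p :: "complex \<times> complex" assume "fst p \<noteq> snd p"
      show "integrable lborel (\<lambda>t. ?K (p, t))"
        unfolding fst_conv snd_conv by (rule integrable_mult_left[OF frullani(1)[OF pos[OF \<open>fst p \<noteq> snd p\<close>]]])
    qed
  qed
  let ?E = "\<lambda>t p. exp (- t * (norm (fst p - snd p))\<^sup>2)"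
  have inner: "(LINT p|(M \<Otimes>\<^sub>M M'). ?K (p, t)) = indicator {0<..} t * ((A t - exp (- t) * F) / t)" for t
  proof (cases "t > 0")
    case True
    have Eb: "\<bar>?E t p\<bar> \<le> 1" for p :: "complex \<times> complex" using True by simp
    have Em: "?E t \<in> borel_measurable (M \<Otimes>\<^sub>M M')" by measurable
    have iE: "integrable (M \<Otimes>\<^sub>M M') (\<lambda>p. ?E t p * ?ff p)"
      by (rule bounded_times_integrable(2)[OF ff Em Eb])
    have "(LINT p|(M \<Otimes>\<^sub>M M'). ?K (p, t)) = (LINT p|(M \<Otimes>\<^sub>M M'). inverse t * (?E t p * ?ff p - exp (- t) * ?ff p))"
      using True by (intro Bochner_Integration.integral_cong refl) (simp add: frull_def divide_inverse algebra_simps)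
    also have "\<dots> = inverse t * (A t - exp (- t) * F)"
      unfolding integral_mult_right_zero Bochner_Integration.integral_diff[OF iE integrable_mult_right[OF ff]] ffF A_def ..
    finally show ?thesis using True by (simp add: divide_inverse mult.commute)
  next
    case False then show ?thesis by (simp add: frull_def)
  qed
  have "integrable lborel (\<lambda>t. LINT p|(M \<Otimes>\<^sub>M M'). ?K (p, t))"
    by (rule Q.integrable_snd[of "\<lambda>p y. ?K (p, y)"]) (unfold Keq, rule Ki)
  then show "integrable lborel (\<lambda>t. indicator {0<..} t * ((A t - exp (- t) * F) / t))" unfolding inner .
  have "(LINT t|lborel. LINT p|(M \<Otimes>\<^sub>M M'). ?K (p, t)) = (LINT p|(M \<Otimes>\<^sub>M M'). LINT t|lborel. ?K (p, t))"
    by (rule Q.Fubini_integral[of "\<lambda>p y. ?K (p, y)"]) (unfold Keq, rule Ki)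
  also have "\<dots> = (LINT p|(M \<Otimes>\<^sub>M M'). - (lnsq p * ?ff p))"
  proof (rule integral_cong_AE)
    show "(\<lambda>p. LINT t|lborel. ?K (p, t)) \<in> borel_measurable (M \<Otimes>\<^sub>M M')"
      by (rule lborel.borel_measurable_lebesgue_integral) (use Km in \<open>simp add: case_prod_beta\<close>)
    show "(\<lambda>p. - (lnsq p * ?ff p)) \<in> borel_measurable (M \<Otimes>\<^sub>M M')" using int by simp
    show "AE p in M \<Otimes>\<^sub>M M'. (LINT t|lborel. ?K (p, t)) = - (lnsq p * ?ff p)"
      using off
    proof (rule AE_mp, intro AE_I2 impI)
      fix p :: "complex \<times> complex" assume "fst p \<noteq> snd p"
      show "(LINT t|lborel. ?K (p, t)) = - (lnsq p * ?ff p)"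
        unfolding fst_conv snd_conv integral_mult_left_zero frullani(2)[OF pos[OF \<open>fst p \<noteq> snd p\<close>]] by (simp add: lnsq_def)
    qed
  qed
  finally show "(LINT t|lborel. indicator {0<..} t * ((A t - exp (- t) * F) / t)) = - (LINT p|(M \<Otimes>\<^sub>M M'). lnsq p * ?ff p)"
    unfolding inner by simp
qed

definition potential :: "(complex \<Rightarrow> real) \<Rightarrow> complex \<Rightarrow> real" where
  "potential f z = (LINT w|lborel. lnsq (z, w) * f w)"

lemma AE_off_diagonal_lborel:
  assumes "sigma_finite_measure M" "sets M = sets borel"
  shows "AE p in M \<Otimes>\<^sub>M (lborel :: complex measure). fst p \<noteq> snd p"
proof -
  interpret pair_sigma_finite M "lborel :: complex measure"
    using assms(1) by (simp add: pair_sigma_finite_def sigma_finite_lborel)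
  note [measurable_cong] = assms(2)
  have m: "{p \<in> space (M \<Otimes>\<^sub>M (lborel :: complex measure)). fst p \<noteq> snd p} \<in> sets (M \<Otimes>\<^sub>M lborel)" by measurable
  have "AE w in lborel. z \<noteq> w" for z :: complex
    by (rule AE_mp[OF AE_lborel_singleton[of z]]) (intro AE_I2, simp)
  then have "AE z in M. AE w in lborel. fst (z, w) \<noteq> snd (z, w)" by simp
  then show ?thesis by (rule AE_pair_measure[OF m])
qed

text \<open>\<open>D\<close> is the logarithmic energy of the signed measure \<mu> - f dz. Both
  masses are 1, so the exp (- t) terms of the three mixtures cancel, and what remains under the
  integral over t is a multiple of the squared L^2 distance of the Gaussian averages. Vanishing of
  \<open>D\<close> thus forces equal averages for almost every t.\<close>

lemma energy_nonneg:
  fixes f :: "complex \<Rightarrow> real" and \<mu> :: "complex measure"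
  assumes \<mu>: "prob_space \<mu>" "sets \<mu> = sets borel"
    and off: "AE p in \<mu> \<Otimes>\<^sub>M \<mu>. fst p \<noteq> snd p" and i1: "integrable (\<mu> \<Otimes>\<^sub>M \<mu>) lnsq"
    and f: "integrable lborel f" "(LINT z|lborel. f z) = 1"
    and i2: "integrable (\<mu> \<Otimes>\<^sub>M lborel) (\<lambda>p. lnsq p * f (snd p))"
    and i3: "integrable (lborel \<Otimes>\<^sub>M lborel) (\<lambda>p. lnsq p * (f (fst p) * f (snd p)))"
  defines "D \<equiv> - (LINT p|(\<mu> \<Otimes>\<^sub>M \<mu>). lnsq p) + 2 * (LINT p|(\<mu> \<Otimes>\<^sub>M lborel). lnsq p * f (snd p))
       - (LINT p|(lborel \<Otimes>\<^sub>M lborel). lnsq p * (f (fst p) * f (snd p)))"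
  shows "D \<ge> 0"
    "D = 0 \<Longrightarrow> AE t in lborel. t > 0 \<longrightarrow>
      (AE y in lborel. (LINT z|\<mu>. gauss t z y) = (LINT w|lborel. gauss t w y * f w))"
proof -
  interpret prob_space \<mu> by fact
  have s\<mu>: "sigma_finite_measure \<mu>" by (rule sigma_finite_measure_axioms)
  have one: "integrable \<mu> (\<lambda>_. 1::real)" by simp
  have o1: "(LINT z|\<mu>. (1::real)) = 1" using prob_space by simp
  have sl: "sets lborel = sets (borel :: complex measure)" by simp
  let ?A1 = "\<lambda>t. LINT p|(\<mu> \<Otimes>\<^sub>M \<mu>). exp (- t * (norm (fst p - snd p))\<^sup>2) * (1 * 1)"
  let ?A2 = "\<lambda>t. LINT p|(\<mu> \<Otimes>\<^sub>M lborel). exp (- t * (norm (fst p - snd p))\<^sup>2) * (1 * f (snd p))"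
  let ?A3 = "\<lambda>t. LINT p|(lborel \<Otimes>\<^sub>M lborel). exp (- t * (norm (fst p - snd p))\<^sup>2) * (f (fst p) * f (snd p))"
  have i1': "integrable (\<mu> \<Otimes>\<^sub>M \<mu>) (\<lambda>p. lnsq p * (1 * 1))" using i1 by (simp only: mult_1_right)
  have i2': "integrable (\<mu> \<Otimes>\<^sub>M lborel) (\<lambda>p. lnsq p * (1 * f (snd p)))" using i2 by (simp only: mult_1_left)
  note L1 = log_as_gauss_mixture[OF s\<mu> \<mu>(2) one s\<mu> \<mu>(2) one off i1', unfolded o1]
  note L2 = log_as_gauss_mixture[OF s\<mu> \<mu>(2) one sigma_finite_lborel sl f(1) AE_off_diagonal_lborel[OF s\<mu> \<mu>(2)] i2', unfolded o1 f(2)]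
  note L3 = log_as_gauss_mixture[OF sigma_finite_lborel sl f(1) sigma_finite_lborel sl f(1) AE_off_diagonal_lborel[OF sigma_finite_lborel sl] i3, unfolded f(2)]
  let ?T = "\<lambda>A t. indicator {0<..} t * ((A - exp (- t) * (1 * 1)) / t) :: real"
  let ?H = "\<lambda>t. ?T (?A1 t) t - 2 * ?T (?A2 t) t + ?T (?A3 t) t"
  have Hi: "integrable lborel ?H"
    by (intro Bochner_Integration.integrable_add Bochner_Integration.integrable_diff integrable_mult_right L1(1) L2(1) L3(1))
  have HD: "(LINT t|lborel. ?H t) = D"
    unfolding Bochner_Integration.integral_add[OF Bochner_Integration.integrable_diff[OF L1(1) integrable_mult_right[OF L2(1)]] L3(1)]
      Bochner_Integration.integral_diff[OF L1(1) integrable_mult_right[OF L2(1)]] integral_mult_right_zero L1(2) L2(2) L3(2) D_def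
    by (simp only: mult_1_left mult_1_right)
  let ?g = "\<lambda>t y. LINT z|\<mu>. gauss t z y" and ?h = "\<lambda>t y. LINT w|lborel. gauss t w y * f w"
  \<comment> \<open>The factor 1/t of the mixture is absorbed by the factor \<pi>/(4t) of
    \<open>gauss_pair\<close>, leaving 4/\<pi>.\<close>
  have sq: "integrable lborel (\<lambda>y. (?g t y - ?h t y)\<^sup>2) \<and> ?H t = 4 / pi * (LINT y|lborel. (?g t y - ?h t y)\<^sup>2)" if t: "t > 0" for t
  proof -
    note G1 = gauss_pair[OF s\<mu> \<mu>(2) one s\<mu> \<mu>(2) one t]
    note G2 = gauss_pair[OF s\<mu> \<mu>(2) one sigma_finite_lborel sl f(1) t]
    note G3 = gauss_pair[OF sigma_finite_lborel sl f(1) sigma_finite_lborel sl f(1) t]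
    have e: "(a - b)\<^sup>2 = a * a - 2 * (a * b) + b * b" for a b :: real by (simp add: power2_eq_square algebra_simps)
    note G1' = G1(1)[unfolded mult_1_right] and G2' = G2(1)[unfolded mult_1_right] and G3' = G3(1)
    have i: "integrable lborel (\<lambda>y. (?g t y - ?h t y)\<^sup>2)" unfolding e
      by (intro Bochner_Integration.integrable_add Bochner_Integration.integrable_diff integrable_mult_right G1' G2' G3')
    have "(LINT y|lborel. (?g t y - ?h t y)\<^sup>2) = (LINT y|lborel. ?g t y * ?g t y) - 2 * (LINT y|lborel. ?g t y * ?h t y) + (LINT y|lborel. ?h t y * ?h t y)"
      unfolding e Bochner_Integration.integral_add[OF Bochner_Integration.integrable_diff[OF G1' integrable_mult_right[OF G2']] G3']
        Bochner_Integration.integral_diff[OF G1' integrable_mult_right[OF G2']] integral_mult_right_zero ..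
    also have "\<dots> = pi / (4 * t) * ?A1 t - 2 * (pi / (4 * t) * ?A2 t) + pi / (4 * t) * ?A3 t"
      using G1(2) G2(2) G3(2) by (simp only: mult_1_right mult_1_left)
    finally have v: "(LINT y|lborel. (?g t y - ?h t y)\<^sup>2) = pi / (4 * t) * ?A1 t - 2 * (pi / (4 * t) * ?A2 t) + pi / (4 * t) * ?A3 t" .
    have "1 * ((a1 - x) / t) - 2 * (1 * ((a2 - x) / t)) + 1 * ((a3 - x) / t)
      = 4 / pi * (pi / (4 * t) * a1 - 2 * (pi / (4 * t) * a2) + pi / (4 * t) * a3)" for a1 a2 a3 x :: real
      using t by (simp add: field_simps)
    moreover have "indicator {0<..} t = (1::real)" using t by simp
    ultimately have "?H t = 4 / pi * (pi / (4 * t) * ?A1 t - 2 * (pi / (4 * t) * ?A2 t) + pi / (4 * t) * ?A3 t)" by (simp only:)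
    then show ?thesis using i v by (simp only:)
  qed
  have Hnn: "?H t \<ge> 0" for t
  proof (cases "t > 0")
    case True
    have "0 \<le> (LINT y|lborel. (?g t y - ?h t y)\<^sup>2)" by (intro Bochner_Integration.integral_nonneg zero_le_power2)
    then have "0 \<le> 4 / pi * (LINT y|lborel. (?g t y - ?h t y)\<^sup>2)" by (intro mult_nonneg_nonneg) simp_all
    then show ?thesis using sq[OF True] by (simp only:)
  next
    case False then show ?thesis by simp
  qed
  show "D \<ge> 0" unfolding HD[symmetric] by (intro Bochner_Integration.integral_nonneg Hnn)
  assume "D = 0"
  then have "(LINT t|lborel. ?H t) = 0" using HD by (simp only:)
  then have H0: "AE t in lborel. ?H t = 0"
    using integral_nonneg_eq_0_iff_AE[OF Hi AE_I2[OF Hnn]] by (simp only:)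
  show "AE t in lborel. t > 0 \<longrightarrow> (AE y in lborel. ?g t y = ?h t y)"
  proof (rule AE_mp[OF H0], rule AE_I2, rule impI, rule impI)
    fix t :: real assume H: "?H t = 0" and t: "t > 0"
    have "4 / pi * (LINT y|lborel. (?g t y - ?h t y)\<^sup>2) = 0" using H sq[OF t] by (simp only:)
    then have "(LINT y|lborel. (?g t y - ?h t y)\<^sup>2) = 0" by (simp only: mult_eq_0_iff) simp
    then have "AE y in lborel. (?g t y - ?h t y)\<^sup>2 = 0"
      using integral_nonneg_eq_0_iff_AE[OF conjunct1[OF sq[OF t]] AE_I2[OF zero_le_power2]] by (simp only:)
    then show "AE y in lborel. ?g t y = ?h t y"
      by (rule AE_mp) (intro AE_I2, simp)
  qed
qed

section \<open>A measure is determined by its Gaussian averages\<close>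

definition heat :: "real \<Rightarrow> (complex \<Rightarrow> real) \<Rightarrow> complex \<Rightarrow> real" where
  "heat t h z = (LINT y|lborel. 2 * t / pi * (h y * gauss t z y))"

lemma gaussian_integral:
  assumes "t > 0"
  shows "integrable lborel (\<lambda>y. exp (- t * (norm (y - z :: complex))\<^sup>2))"
    "(LINT y|lborel. exp (- t * (norm (y - z :: complex))\<^sup>2)) = pi / t"
proof -
  have m: "(\<lambda>y. exp (- t * (norm (y - z :: complex))\<^sup>2)) \<in> borel_measurable lborel" by measurable
  note r = nn_integral_eq_imp_integral[OF m _ nn_integral_gaussian[OF assms, of z]]
  show "integrable lborel (\<lambda>y. exp (- t * (norm (y - z :: complex))\<^sup>2))" by (rule r(1)) (use assms in simp_all)
  show "(LINT y|lborel. exp (- t * (norm (y - z :: complex))\<^sup>2)) = pi / t" by (rule r(2)) (use assms in simp_all)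
qed

lemma gauss_eq: "gauss t z y = exp (- (2 * t) * (norm (y - z))\<^sup>2)"
  by (simp add: gauss_def norm_minus_commute)

text \<open>The factor 2t/\<pi> normalises the kernel to mass 1, and large t means short time, so
  this is an approximate identity. Beyond distance \<delta> half of the exponent 2t supplies the
  decay exp (- \<delta>^2 t) and the other half keeps the bound integrable.\<close>

lemma heat_close:
  fixes h :: "complex \<Rightarrow> real"
  assumes h: "continuous_on UNIV h" "\<And>z. norm z > R \<Longrightarrow> h z = 0" and eps: "\<epsilon> > 0"
  shows "\<exists>t0. \<forall>t>t0. t > 0 \<longrightarrow> (\<forall>z. \<bar>heat t h z - h z\<bar> \<le> \<epsilon>)"
proof -
  obtain B where B: "B > 0" "\<forall>z. \<bar>h z\<bar> \<le> B" using bounded_csupp[OF h(1), of R] h(2) by blast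
  have e2: "\<epsilon> / 2 > 0" using eps by simp
  obtain \<delta> where \<delta>: "\<delta> > 0" "\<delta> \<le> 1" "\<forall>x z. norm x < \<delta> \<longrightarrow> \<bar>h (x + z) - h z\<bar> < \<epsilon> / 2"
    using uniform_csupp[OF h(1) _ e2, of R] h(2) by blast
  have hm: "h \<in> borel_measurable borel" using h(1) by (rule borel_measurable_continuous_onI)
  have "((\<lambda>t. 4 * B * exp (- (\<delta>\<^sup>2) * t)) \<longlongrightarrow> 4 * B * 0) at_top"
    using \<delta>(1) by (intro tendsto_mult tendsto_const filterlim_compose[OF exp_at_bot] filterlim_tendsto_neg_mult_at_bot[OF tendsto_const _ filterlim_ident]) simp
  then have "\<forall>\<^sub>F t in at_top. 4 * B * exp (- (\<delta>\<^sup>2) * t) < \<epsilon> / 2"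
    by (rule order_tendstoD(2)) (use e2 in simp)
  then obtain t0 where t0: "\<forall>t>t0. 4 * B * exp (- (\<delta>\<^sup>2) * t) < \<epsilon> / 2"
    unfolding eventually_at_top_dense by (elim exE)
  show ?thesis
  proof (intro exI[of _ t0] allI impI)
    fix t :: real and z :: complex assume t: "t > t0" "t > 0"
    have t2: "2 * t > 0" using t by simp
    note g2 = gaussian_integral[OF t2, of z] and g1 = gaussian_integral[OF t(2), of z]
    let ?G = "\<lambda>y. exp (- (2 * t) * (norm (y - z))\<^sup>2)" and ?G1 = "\<lambda>y. exp (- t * (norm (y - z))\<^sup>2)"
    have ig: "integrable lborel (\<lambda>y. h y * gauss t z y)"
      unfolding gauss_eq by (rule bounded_times_integrable(2)[OF g2(1), where B=B]) (use hm B(2) in simp_all)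
    have id: "integrable lborel (\<lambda>y. (h y - h z) * ?G y)"
      unfolding left_diff_distrib using ig[unfolded gauss_eq] by (intro Bochner_Integration.integrable_diff integrable_mult_right g2(1))
    have "heat t h z - h z = 2 * t / pi * (LINT y|lborel. (h y - h z) * ?G y)"
    proof -
      have "(LINT y|lborel. (h y - h z) * ?G y) = (LINT y|lborel. h y * ?G y) - h z * (pi / (2 * t))"
        unfolding left_diff_distrib Bochner_Integration.integral_diff[OF ig[unfolded gauss_eq] integrable_mult_right[OF g2(1)]]
          integral_mult_right_zero g2(2) ..
      moreover have "heat t h z = 2 * t / pi * (LINT y|lborel. h y * ?G y)"
        unfolding heat_def gauss_eq by (rule integral_mult_right_zero)
      moreover have "2 * t / pi * (I - c * (pi / (2 * t))) = 2 * t / pi * I - c" for I c :: real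
        using t(2) by (simp add: field_simps)
      ultimately show ?thesis by (simp only:)
    qed
    moreover have "\<bar>LINT y|lborel. (h y - h z) * ?G y\<bar> \<le> (LINT y|lborel. \<epsilon> / 2 * ?G y + 2 * B * exp (- (\<delta>\<^sup>2) * t) * ?G1 y)"
    proof (rule order_trans[OF integral_abs_bound], rule integral_mono)
      show "integrable lborel (\<lambda>y. \<bar>(h y - h z) * ?G y\<bar>)" by (rule integrable_abs[OF id])
      show "integrable lborel (\<lambda>y. \<epsilon> / 2 * ?G y + 2 * B * exp (- (\<delta>\<^sup>2) * t) * ?G1 y)"
        by (intro Bochner_Integration.integrable_add integrable_mult_right g1(1) g2(1))
      fix y
      have nn: "0 \<le> \<epsilon> / 2 * ?G y" "0 \<le> 2 * B * exp (- (\<delta>\<^sup>2) * t) * ?G1 y" using eps B(1) by simp_all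
      show "\<bar>(h y - h z) * ?G y\<bar> \<le> \<epsilon> / 2 * ?G y + 2 * B * exp (- (\<delta>\<^sup>2) * t) * ?G1 y"
      proof (cases "norm (y - z) < \<delta>")
        case True
        have "\<bar>h ((y - z) + z) - h z\<bar> < \<epsilon> / 2" using \<delta>(3) True by (elim allE impE)
        then have "\<bar>h y - h z\<bar> \<le> \<epsilon> / 2" by simp
        then have "\<bar>h y - h z\<bar> * ?G y \<le> \<epsilon> / 2 * ?G y" by (rule mult_right_mono) simp
        then show ?thesis using nn(2) unfolding abs_mult abs_exp_cancel by linarith
      next
        case False
        then have "\<delta>\<^sup>2 \<le> (norm (y - z))\<^sup>2" using \<delta>(1) by (intro power_mono) auto
        then have "t * \<delta>\<^sup>2 \<le> t * (norm (y - z))\<^sup>2" using t(2) by (intro mult_left_mono) auto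
        then have "?G y \<le> exp (- (\<delta>\<^sup>2) * t) * ?G1 y" unfolding exp_add[symmetric] by (simp add: mult.commute)
        moreover have "\<bar>h y - h z\<bar> \<le> 2 * B" using B(2)[rule_format, of y] B(2)[rule_format, of z] by linarith
        ultimately have "\<bar>h y - h z\<bar> * ?G y \<le> (2 * B) * (exp (- (\<delta>\<^sup>2) * t) * ?G1 y)" by (intro mult_mono) auto
        then show ?thesis using nn(1) unfolding abs_mult abs_exp_cancel mult.assoc by linarith
      qed
    qed
    moreover have "(LINT y|lborel. \<epsilon> / 2 * ?G y + 2 * B * exp (- (\<delta>\<^sup>2) * t) * ?G1 y) = \<epsilon> / 2 * (pi / (2 * t)) + 2 * B * exp (- (\<delta>\<^sup>2) * t) * (pi / t)"
      unfolding Bochner_Integration.integral_add[OF integrable_mult_right[OF g2(1)] integrable_mult_right[OF g1(1)]] integral_mult_right_zero g1(2) g2(2) ..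
    ultimately have "\<bar>heat t h z - h z\<bar> \<le> 2 * t / pi * (\<epsilon> / 2 * (pi / (2 * t)) + 2 * B * exp (- (\<delta>\<^sup>2) * t) * (pi / t))"
      using t(2) by (simp only: abs_mult) (intro mult_mono, simp_all)
    also have "\<dots> = \<epsilon> / 2 + 4 * B * exp (- (\<delta>\<^sup>2) * t)"
    proof -
      have "2 * t / pi * (\<epsilon> / 2 * (pi / (2 * t)) + 2 * B * X * (pi / t)) = \<epsilon> / 2 + 4 * B * X" for X
        using t(2) by (simp add: field_simps)
      then show ?thesis .
    qed
    also have "\<dots> \<le> \<epsilon>" using t0[rule_format, OF t(1)] by simp
    finally show "\<bar>heat t h z - h z\<bar> \<le> \<epsilon>" .
  qed
qed

text \<open>Fubini moves the smoothing from the test function to the measure, where the Gaussian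
  averages appear that the energy argument shows to be equal.\<close>

lemma integral_heat:
  fixes f h :: "complex \<Rightarrow> real"
  assumes M: "sigma_finite_measure M" "sets M = sets borel" "integrable M f"
    and h: "continuous_on UNIV h" "\<forall>z. norm z > R \<longrightarrow> h z = 0" and t: "t > 0"
  shows "integrable M (\<lambda>z. heat t h z * f z)"
    "(LINT z|M. heat t h z * f z) = (LINT y|lborel. 2 * t / pi * h y * (LINT z|M. gauss t z y * f z))"
proof -
  interpret pair_sigma_finite M "lborel :: complex measure"
    using M(1) by (simp add: pair_sigma_finite_def sigma_finite_lborel)
  note [measurable_cong] = M(2)
  have hi: "integrable lborel h" by (rule integrable_csupp[OF h(1)]) (rule h(2)[rule_format])
  have i0: "integrable (M \<Otimes>\<^sub>M lborel) (\<lambda>p. f (fst p) * h (snd p))"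
    by (rule integrable_pair_mult(1)[OF M(1) sigma_finite_lborel M(3) hi])
  have gm: "(\<lambda>p. gauss t (fst p) (snd p)) \<in> borel_measurable (M \<Otimes>\<^sub>M lborel)" unfolding gauss_def by measurable
  have gb: "\<bar>gauss t (fst p) (snd p)\<bar> \<le> 1" for p using t by (simp add: gauss_def)
  have i1: "integrable (M \<Otimes>\<^sub>M lborel) (\<lambda>p. 2 * t / pi * (gauss t (fst p) (snd p) * (f (fst p) * h (snd p))))"
    by (rule integrable_mult_right[OF bounded_times_integrable(2)[OF i0 gm gb]])
  have eq: "(\<lambda>(z, y). 2 * t / pi * (gauss t z y * (f z * h y))) = (\<lambda>p. 2 * t / pi * (gauss t (fst p) (snd p) * (f (fst p) * h (snd p))))"
    by (rule ext) (simp only: split_beta)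
  have i: "integrable (M \<Otimes>\<^sub>M lborel) (\<lambda>(z, y). 2 * t / pi * (gauss t z y * (f z * h y)))" unfolding eq by (rule i1)
  have e1: "(LINT y|lborel. 2 * t / pi * (gauss t z y * (f z * h y))) = heat t h z * f z" for z
  proof -
    have "(LINT y|lborel. 2 * t / pi * (gauss t z y * (f z * h y))) = (LINT y|lborel. 2 * t / pi * (h y * gauss t z y) * f z)"
      by (intro Bochner_Integration.integral_cong refl) (simp only: mult_ac)
    then show ?thesis unfolding integral_mult_left_zero heat_def .
  qed
  have e2: "(LINT z|M. 2 * t / pi * (gauss t z y * (f z * h y))) = 2 * t / pi * h y * (LINT z|M. gauss t z y * f z)" for y
  proof -
    have "(LINT z|M. 2 * t / pi * (gauss t z y * (f z * h y))) = (LINT z|M. 2 * t / pi * h y * (gauss t z y * f z))"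
      by (intro Bochner_Integration.integral_cong refl) (simp only: mult_ac)
    then show ?thesis by (simp only: integral_mult_right_zero)
  qed
  show "integrable M (\<lambda>z. heat t h z * f z)" using integrable_fst[OF i] unfolding e1 .
  show "(LINT z|M. heat t h z * f z) = (LINT y|lborel. 2 * t / pi * h y * (LINT z|M. gauss t z y * f z))"
    using Fubini_integral[OF i] unfolding e1 e2 by (rule sym)
qed

lemma AE_ex_greater:
  assumes "AE t in lborel. P (t::real)" shows "\<exists>t>n. P t"
proof (rule ccontr)
  assume n: "\<not> (\<exists>t>n. P t)"
  have "AE t in lborel. t \<notin> {n<..<n + 1}" using assms
    by (rule AE_mp) (intro AE_I2 impI notI, use n in auto)
  then have "{n<..<n + 1} \<in> null_sets lborel" by (subst AE_iff_null_sets) simp_all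
  then have "emeasure lborel {n<..<n + 1} = 0" by auto
  then show False by simp
qed

text \<open>Values of t at which the averages agree exist beyond any bound, so for compactly
  supported continuous \<open>h\<close> the integrals of \<open>heat t h\<close> agree for
  arbitrarily large t, and then those of \<open>h\<close>. Approximating indicators of boxes settles
  the measures themselves.\<close>

lemma gauss_determines_measure:
  fixes f :: "complex \<Rightarrow> real"
  assumes \<mu>: "prob_space \<mu>" "sets \<mu> = sets borel" and f: "integrable lborel f" "\<And>z. f z \<ge> 0"
    and AE: "AE t in lborel. t > 0 \<longrightarrow> (AE y in lborel. (LINT z|\<mu>. gauss t z y) = (LINT w|lborel. gauss t w y * f w))"
  shows "\<mu> = density lborel (\<lambda>z. ennreal (f z))"
proof -
  interpret prob_space \<mu> by fact
  have s\<mu>: "sigma_finite_measure \<mu>" by (rule sigma_finite_measure_axioms)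
  note [measurable_cong] = \<mu>(2)
  have fm[measurable]: "f \<in> borel_measurable borel" using f(1) by auto
  have one: "integrable \<mu> (\<lambda>_. 1::real)" by simp
  have sl: "sets lborel = sets (borel :: complex measure)" by simp
  have main: "(LINT z|\<mu>. h z) = (LINT z|lborel. h z * f z)" if h: "continuous_on UNIV h" "\<And>z. norm z > R \<Longrightarrow> h z = 0" for h :: "complex \<Rightarrow> real" and R
  proof -
    obtain B where B: "B > 0" "\<forall>z. \<bar>h z\<bar> \<le> B" using bounded_csupp[OF h(1), of R] h(2) by blast
    have hm[measurable]: "h \<in> borel_measurable borel" using h(1) by (rule borel_measurable_continuous_onI)
    have hi: "integrable \<mu> h" by (rule integrable_const_bound[where B=B]) (use B(2) in simp_all)
    have hf: "integrable lborel (\<lambda>z. h z * f z)" by (rule bounded_times_integrable(2)[OF f(1), where B=B]) (use B(2) in simp_all)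
    let ?F = "LINT z|lborel. f z"
    have F0: "?F \<ge> 0" by (intro Bochner_Integration.integral_nonneg f(2))
    have "\<bar>(LINT z|\<mu>. h z) - (LINT z|lborel. h z * f z)\<bar> \<le> e" if e: "e > 0" for e
    proof -
      \<comment> \<open>Replacing \<open>heat t h\<close> by \<open>h\<close> costs
        \<open>?e\<close> against the probability measure and \<open>?e * ?F\<close> against the
        density; the two add up to \<open>e\<close>.\<close>
      let ?e = "e / (1 + ?F)"
      have e': "?e > 0" using e F0 by simp
      obtain t0 where t0: "\<forall>t>t0. t > 0 \<longrightarrow> (\<forall>z. \<bar>heat t h z - h z\<bar> \<le> ?e)" using heat_close[OF h(1) _ e', of R] h(2) by blast
      obtain t where t: "t > max t0 0" and tA: "t > 0 \<longrightarrow> (AE y in lborel. (LINT z|\<mu>. gauss t z y) = (LINT w|lborel. gauss t w y * f w))"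
        using AE_ex_greater[OF AE, of "max t0 0"] by (elim exE conjE)
      have tp: "t > 0" "t > t0" using t by simp_all
      have c: "\<bar>heat t h z - h z\<bar> \<le> ?e" for z using t0 tp by simp
      have h2: "\<forall>z. norm z > R \<longrightarrow> h z = 0" using h(2) by blast
      note H1 = integral_heat[OF s\<mu> \<mu>(2) one h(1) h2 tp(1), unfolded mult_1_right]
      note H2 = integral_heat[OF sigma_finite_lborel sl f(1) h(1) h2 tp(1)]
      have "(LINT z|\<mu>. heat t h z) = (LINT z|lborel. heat t h z * f z)"
        unfolding H1(2) H2(2)
      proof (rule integral_cong_AE)
        have "AE y in lborel. (LINT z|\<mu>. gauss t z y) = (LINT w|lborel. gauss t w y * f w)" using tA tp(1) by simp
        then show "AE y in lborel. 2 * t / pi * h y * (LINT z|\<mu>. gauss t z y) = 2 * t / pi * h y * (LINT z|lborel. gauss t z y * f z)"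
          by (rule AE_mp) (intro AE_I2 impI, simp only:)
        have "(\<lambda>y. LINT z|\<mu>. gauss t z y) \<in> borel_measurable lborel" unfolding gauss_def by measurable
        then show "(\<lambda>y. 2 * t / pi * h y * (LINT z|\<mu>. gauss t z y)) \<in> borel_measurable lborel" by measurable
        have "(\<lambda>y. LINT z|lborel. gauss t z y * f z) \<in> borel_measurable lborel" unfolding gauss_def by measurable
        then show "(\<lambda>y. 2 * t / pi * h y * (LINT z|lborel. gauss t z y * f z)) \<in> borel_measurable lborel" by measurable
      qed
      moreover have "\<bar>(LINT z|\<mu>. heat t h z) - (LINT z|\<mu>. h z)\<bar> \<le> ?e"
      proof -
        have "\<bar>LINT z|\<mu>. heat t h z - h z\<bar> \<le> (LINT z|\<mu>. ?e)"
        proof (rule order_trans[OF integral_abs_bound], rule integral_mono)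
          show "integrable \<mu> (\<lambda>z. \<bar>heat t h z - h z\<bar>)" by (intro integrable_abs Bochner_Integration.integrable_diff H1(1) hi)
          show "integrable \<mu> (\<lambda>z. ?e)" by simp
        qed (rule c)
        moreover have "(LINT z|\<mu>. ?e) = ?e" using prob_space by simp
        ultimately show ?thesis unfolding Bochner_Integration.integral_diff[OF H1(1) hi] by (simp only:)
      qed
      moreover have "\<bar>(LINT z|lborel. heat t h z * f z) - (LINT z|lborel. h z * f z)\<bar> \<le> ?e * ?F"
      proof -
        have "\<bar>LINT z|lborel. heat t h z * f z - h z * f z\<bar> \<le> (LINT z|lborel. ?e * f z)"
        proof (rule order_trans[OF integral_abs_bound], rule integral_mono)
          show "integrable lborel (\<lambda>z. \<bar>heat t h z * f z - h z * f z\<bar>)"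
            by (intro integrable_abs Bochner_Integration.integrable_diff H2(1) hf)
          show "integrable lborel (\<lambda>z. ?e * f z)" by (rule integrable_mult_right[OF f(1)])
          show "\<bar>heat t h z * f z - h z * f z\<bar> \<le> ?e * f z" for z
          proof -
            have "\<bar>heat t h z - h z\<bar> * \<bar>f z\<bar> \<le> ?e * \<bar>f z\<bar>" by (rule mult_right_mono[OF c abs_ge_zero])
            then show ?thesis unfolding left_diff_distrib[symmetric] abs_mult abs_of_nonneg[OF f(2)] .
          qed
        qed
        then show ?thesis unfolding Bochner_Integration.integral_diff[OF H2(1) hf] integral_mult_right_zero .
      qed
      ultimately have "\<bar>(LINT z|\<mu>. h z) - (LINT z|lborel. h z * f z)\<bar> \<le> ?e + ?e * ?F" by linarith
      also have "?e + ?e * ?F = ?e * (1 + ?F)" by (simp only: distrib_left mult_1_right)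
      also have "\<dots> = e" using F0 by simp
      finally show ?thesis .
    qed
    note close = this
    have "\<bar>(LINT z|\<mu>. h z) - (LINT z|lborel. h z * f z)\<bar> \<le> 0"
    proof (rule field_le_epsilon)
      show "\<bar>(LINT z|\<mu>. h z) - (LINT z|lborel. h z * f z)\<bar> \<le> 0 + e" if "0 < e" for e
        unfolding add_0_left by (rule close[OF that])
    qed
    then show ?thesis by simp
  qed
  let ?\<nu> = "density lborel (\<lambda>z. ennreal (f z))"
  have box: "emeasure \<mu> (box a b) = emeasure ?\<nu> (box a b)" for a b :: complex
  proof -
    let ?C = "- box a b"
    have ne: "?C \<noteq> {}"
    proof
      assume E: "?C = {}"
      have "z \<in> box a b" for z
      proof (rule ccontr)
        assume "z \<notin> box a b"
        then have "z \<in> ?C" by simp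
        then show False unfolding E by (rule emptyE)
      qed
      then have "box a b = UNIV" by (intro equalityI subsetI UNIV_I)
      then have "bounded (UNIV :: complex set)" using bounded_box[of a b] by (simp only:)
      then show False using not_bounded_UNIV by blast
    qed
    have cl: "closed ?C" by (simp add: closed_def open_box)
    obtain R where R: "\<forall>x\<in>box a b. norm x \<le> R" using bounded_box[of a b] unfolding bounded_iff by (elim exE)
    \<comment> \<open>Continuous functions that increase to the indicator of the open box, built
      from the distance to its complement.\<close>
    define h where "h n z = min 1 (real n * infdist z ?C)" for n z
    have hc: "continuous_on UNIV (h n)" for n unfolding h_def
      by (intro continuous_on_min continuous_on_const continuous_on_mult continuous_on_infdist continuous_on_id)
    have h0: "h n z = 0" if "z \<notin> box a b" for n z using that by (simp add: h_def)
    have hs: "h n z = 0" if "norm z > R" for n z using R that by (intro h0) force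
    have hb: "\<bar>h n z\<bar> \<le> indicator (box a b) z" for n z
    proof (cases "z \<in> box a b")
      case True
      have "0 \<le> h n z" unfolding h_def by (simp add: infdist_nonneg)
      then show ?thesis using True unfolding h_def by simp
    next
      case False then show ?thesis by (simp add: h0)
    qed
    have hl: "(\<lambda>n. h n z) \<longlonglongrightarrow> indicator (box a b) z" for z
    proof (cases "z \<in> box a b")
      case True
      then have p: "infdist z ?C > 0" using infdist_pos_not_in_closed[OF cl ne] by simp
      obtain N where N: "1 / infdist z ?C \<le> real N" using real_arch_simple by blast
      have "\<forall>\<^sub>F n in sequentially. h n z = 1"
      proof (rule eventually_sequentiallyI[of N])
        fix n assume "N \<le> n"
        then have "1 / infdist z ?C \<le> real n" using N by linarith
        then have "1 \<le> real n * infdist z ?C" using p by (simp add: divide_le_eq)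
        then show "h n z = 1" unfolding h_def by simp
      qed
      then show ?thesis using True by (simp add: tendsto_eventually)
    next
      case False then show ?thesis by (simp add: h0)
    qed
    have hm: "h n \<in> borel_measurable borel" for n using hc by (rule borel_measurable_continuous_onI)
    have mainh: "(LINT z|\<mu>. h n z) = (LINT z|lborel. h n z * f z)" for n by (rule main[OF hc]) (rule hs)
    have l1: "(\<lambda>n. LINT z|\<mu>. h n z) \<longlonglongrightarrow> (LINT z|\<mu>. indicator (box a b) z)"
    proof (rule integral_dominated_convergence[where w="\<lambda>_. 1"])
      show "AE z in \<mu>. (\<lambda>n. h n z) \<longlonglongrightarrow> indicator (box a b) z" by (intro AE_I2 hl)
      have "norm (h n z) \<le> 1" for n z using hb[of n z] indicator_le_1[of "box a b" z] unfolding real_norm_def by (rule order_trans)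
      then show "AE z in \<mu>. norm (h n z) \<le> 1" for n by (intro AE_I2)
      show "h n \<in> borel_measurable \<mu>" for n using hm by simp
    qed simp_all
    have l2: "(\<lambda>n. LINT z|lborel. h n z * f z) \<longlonglongrightarrow> (LINT z|lborel. indicator (box a b) z * f z)"
    proof (rule integral_dominated_convergence[where w=f])
      show "AE z in lborel. (\<lambda>n. h n z * f z) \<longlonglongrightarrow> indicator (box a b) z * f z"
        by (intro AE_I2 tendsto_mult hl tendsto_const)
      have "norm (h n z * f z) \<le> f z" for n z
      proof -
        have "\<bar>h n z\<bar> * \<bar>f z\<bar> \<le> 1 * \<bar>f z\<bar>"
          by (rule mult_right_mono[OF order_trans[OF hb indicator_le_1] abs_ge_zero])
        then show ?thesis unfolding real_norm_def abs_mult abs_of_nonneg[OF f(2)] mult_1_left .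
      qed
      then show "AE z in lborel. norm (h n z * f z) \<le> f z" for n by (intro AE_I2)
      show "(\<lambda>z. h n z * f z) \<in> borel_measurable lborel" for n using hm by simp
    qed (use f(1) in simp_all)
    have "(LINT z|\<mu>. indicator (box a b) z) = (LINT z|lborel. indicator (box a b) z * f z)"
      using l1 l2 unfolding mainh by (rule LIMSEQ_unique)
    moreover have "(LINT z|\<mu>. indicator (box a b) z) = measure \<mu> (box a b)" using \<mu>(2) by simp
    moreover have "emeasure ?\<nu> (box a b) = ennreal (LINT z|lborel. indicator (box a b) z * f z)"
    proof -
      have "emeasure ?\<nu> (box a b) = (\<integral>\<^sup>+z. ennreal (indicator (box a b) z * f z) \<partial>lborel)"
      proof (subst emeasure_density)
        show "(\<integral>\<^sup>+z. ennreal (f z) * indicator (box a b) z \<partial>lborel) = (\<integral>\<^sup>+z. ennreal (indicator (box a b) z * f z) \<partial>lborel)"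
          by (rule nn_integral_cong) (simp split: split_indicator)
      qed simp_all
      also have "\<dots> = ennreal (LINT z|lborel. indicator (box a b) z * f z)"
      proof (rule nn_integral_eq_integral)
        show "integrable lborel (\<lambda>z. indicator (box a b) z * f z)"
          by (rule bounded_times_integrable(2)[OF f(1), where B=1]) (simp_all add: indicator_le_1)
        show "AE z in lborel. 0 \<le> indicator (box a b) z * f z"
          by (intro AE_I2 mult_nonneg_nonneg f(2)) simp
      qed
      finally show ?thesis .
    qed
    ultimately show ?thesis using emeasure_eq_measure[of "box a b"] by (simp only:)
  qed
  show ?thesis
  proof (rule measure_eqI_generator_eq)
    let ?E = "range (\<lambda>(a, b). box a b :: complex set)"
    show "Int_stable ?E" by (auto simp: Int_stable_def box_Int_box)
    show "?E \<subseteq> Pow UNIV" "sets \<mu> = sigma_sets UNIV ?E" "sets ?\<nu> = sigma_sets UNIV ?E"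
      by (simp_all add: borel_eq_box \<mu>(2))
    let ?A = "\<lambda>n::nat. box (- (real n *\<^sub>R One)) (real n *\<^sub>R One) :: complex set"
    show "range ?A \<subseteq> ?E" "(\<Union>i. ?A i) = UNIV" unfolding UN_box_eq_UNIV by auto
    show "emeasure \<mu> (?A i) \<noteq> \<infinity>" for i by (simp add: emeasure_eq_measure)
    show "emeasure \<mu> X = emeasure ?\<nu> X" if XE: "X \<in> ?E" for X
    proof -
      obtain a b where "X = box a b" using XE by (auto simp: image_iff split_beta)
      then show ?thesis using box[of a b] by (simp only:)
    qed
  qed
qed

section \<open>Logarithmic potentials\<close>

text \<open>The logarithmic singularity alone, cut off at distance 1. It is integrable over the
  plane, and what remains of the kernel is dominated by \<open>psi0\<close> in each
  variable.\<close>

definition ln_core :: "complex \<Rightarrow> real" where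
  "ln_core x = indicator {..1} ((norm x)\<^sup>2) * \<bar>ln ((norm x)\<^sup>2)\<bar>"

lemma abs_ln_le_sqrt:
  assumes "0 < s" "s \<le> 1" shows "\<bar>ln s\<bar> \<le> 2 / sqrt \<bar>s :: real\<bar>"
proof -
  have q: "sqrt s > 0" using assms by simp
  have "ln (1 / sqrt s) \<le> 1 / sqrt s - 1" using q by (intro ln_le_minus_one) simp
  moreover have "ln (1 / sqrt s) = - (ln s / 2)" using assms q by (simp add: ln_div ln_sqrt)
  moreover have "ln s \<le> 0" using assms by simp
  moreover have "2 / sqrt s = 2 * (1 / sqrt s)" by simp
  ultimately have "\<bar>ln s\<bar> \<le> 2 / sqrt s" by linarith
  then show ?thesis using assms by simp
qed

lemma ln_core_integrable: "integrable lborel ln_core"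
proof (rule integrableI_nonneg)
  show "ln_core \<in> borel_measurable lborel" unfolding ln_core_def[abs_def] by measurable
  show "AE x in lborel. 0 \<le> ln_core x" by (intro AE_I2) (simp add: ln_core_def)
  have "((\<lambda>s::real. 2 / sqrt \<bar>s\<bar>) has_integral (4 * sqrt 1 - 4 * sqrt 0)) {0..1}"
  proof (rule fundamental_theorem_of_calculus_interior)
    show "continuous_on {0..1} (\<lambda>s. 4 * sqrt s)" by (intro continuous_intros)
    fix x :: real assume x: "x \<in> {0<..<1}"
    then have "((\<lambda>s. 4 * sqrt s) has_real_derivative 2 / sqrt \<bar>x\<bar>) (at x)"
      by (auto intro!: derivative_eq_intros simp: field_simps)
    then show "((\<lambda>s. 4 * sqrt s) has_vector_derivative 2 / sqrt \<bar>x\<bar>) (at x)"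
      by (simp add: has_real_derivative_iff_has_vector_derivative)
  qed simp
  then have I: "(\<integral>\<^sup>+s. ennreal (indicator {0..1} s * (2 / sqrt \<bar>s\<bar>)) \<partial>lborel) = ennreal (4 * sqrt 1 - 4 * sqrt 0)"
    by (rule nn_integral_has_integral_lebesgue[rotated]) simp
  have "(\<integral>\<^sup>+x. ennreal (ln_core x) \<partial>lborel) = ennreal pi * (\<integral>\<^sup>+s. ennreal (indicator {..1} s * \<bar>ln s\<bar>) * indicator {0..} s \<partial>lborel)"
    unfolding ln_core_def by (rule nn_integral_radial) measurable
  also have "\<dots> \<le> ennreal pi * (\<integral>\<^sup>+s. ennreal (indicator {0..1} s * (2 / sqrt \<bar>s\<bar>)) \<partial>lborel)"
  proof (intro mult_left_mono nn_integral_mono)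
    fix s :: real
    consider "s = 0" | "0 < s \<and> s \<le> 1" | "s < 0 \<or> s > 1" by linarith
    then show "ennreal (indicator {..1} s * \<bar>ln s\<bar>) * indicator {0..} s \<le> ennreal (indicator {0..1} s * (2 / sqrt \<bar>s\<bar>))"
    proof cases
      case 2
      then have "ennreal \<bar>ln s\<bar> \<le> ennreal (2 / sqrt \<bar>s\<bar>)" by (intro ennreal_leI abs_ln_le_sqrt) auto
      then show ?thesis using 2 by simp
    qed (auto simp: indicator_def)
  qed simp
  also have "\<dots> < \<infinity>" unfolding I by (simp add: ennreal_mult_less_top)
  finally show "(\<integral>\<^sup>+x. ennreal (ln_core x) \<partial>lborel) < \<infinity>" .
qed

text \<open>After the triangle inequality this is (|z| |w| - 1)^2 \<ge> 0. It is the reason for the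
  weight \<open>psi0\<close>: subtracting it in each variable makes the logarithmic kernel
  nonpositive.\<close>

lemma norm_diff_sq_le: "(norm (z - w))\<^sup>2 \<le> (1 + (norm z)\<^sup>2) * (1 + (norm w)\<^sup>2)" for z w :: complex
proof -
  have "(norm (z - w))\<^sup>2 \<le> (norm z + norm w)\<^sup>2" by (intro power_mono norm_triangle_ineq4) simp
  also have "\<dots> \<le> (1 + (norm z)\<^sup>2) * (1 + (norm w)\<^sup>2)"
    using zero_le_power2[of "norm z * norm w - 1"] by (simp add: power2_eq_square algebra_simps)
  finally show ?thesis .
qed

lemma psi0_add: "psi0 z + psi0 w = ln ((1 + (norm z)\<^sup>2) * (1 + (norm w)\<^sup>2))"
  unfolding psi0_def by (rule ln_mult_pos[symmetric]) (simp_all add: add_pos_nonneg)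

lemma lnsq_le: "z \<noteq> w \<Longrightarrow> lnsq (z, w) \<le> psi0 z + psi0 w"
  unfolding lnsq_def psi0_add fst_conv snd_conv by (intro ln_mono norm_diff_sq_le) simp_all

lemma abs_lnsq_le: "\<bar>lnsq (z, w)\<bar> \<le> ln_core (z - w) + (psi0 z + psi0 w)"
proof (cases "(norm (z - w))\<^sup>2 \<le> 1")
  case True
  then show ?thesis using psi0_nonneg[of z] psi0_nonneg[of w] by (simp add: lnsq_def ln_core_def)
next
  case False
  then have "lnsq (z, w) \<ge> 0" "z \<noteq> w" by (auto simp: lnsq_def)
  then show ?thesis using lnsq_le[of z w] False by (simp add: ln_core_def)
qed

lemma psi0_measurable[measurable]: "psi0 \<in> borel_measurable borel"
  by (rule borel_measurable_continuous_onI[OF Ck_on_imp_continuous_on[OF Ck_on_psi0[of 0]]])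

lemma psi0_continuous: "continuous_on UNIV psi0"
  by (rule Ck_on_imp_continuous_on[OF Ck_on_psi0[of 0]])

locale csupp_density =
  fixes f :: "complex \<Rightarrow> real" and R :: real
  assumes cont: "continuous_on UNIV f" and supp: "\<forall>z. norm z > R \<longrightarrow> f z = 0"
begin

lemma measurable_f[measurable]: "f \<in> borel_measurable borel"
  using cont by (rule borel_measurable_continuous_onI)

lemma integrable_f: "integrable lborel f"
  by (rule integrable_csupp[OF cont]) (rule supp[rule_format])

lemma bounded_f: "\<exists>B>0. \<forall>z. \<bar>f z\<bar> \<le> B"
  by (rule bounded_csupp[OF cont]) (rule supp[rule_format])

lemma integrable_psi0_f: "integrable lborel (\<lambda>w. psi0 w * f w)"
  by (rule integrable_csupp[of _ R]) (intro continuous_intros psi0_continuous cont, simp add: supp[rule_format])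

lemma integrable_abs_psi0_f: "integrable lborel (\<lambda>w. psi0 w * \<bar>f w\<bar>)"
proof -
  have "(\<lambda>w. psi0 w * \<bar>f w\<bar>) = (\<lambda>w. \<bar>psi0 w * f w\<bar>)" using psi0_nonneg by (simp add: fun_eq_iff abs_mult)
  then show ?thesis using integrable_abs[OF integrable_psi0_f] by simp
qed

text \<open>The singular part contributes at most the sup norm of \<open>f\<close> times the
  integral of \<open>ln_core\<close>, uniformly in z, and the rest grows like \<open>psi0 z\<close>.
  Potentials are therefore integrable against every finite measure that integrates
  \<open>psi0\<close>.\<close>

lemma abs_bound:
  "\<exists>C\<ge>0. \<forall>z. integrable lborel (\<lambda>w. lnsq (z, w) * f w) \<and> (LINT w|lborel. \<bar>lnsq (z, w) * f w\<bar>) \<le> C * (1 + psi0 z)"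
proof -
  obtain B where B: "B > 0" "\<forall>z. \<bar>f z\<bar> \<le> B" using bounded_f by (elim exE conjE)
  let ?I = "LINT w|lborel. ln_core w" and ?J = "LINT w|lborel. \<bar>f w\<bar>" and ?L = "LINT w|lborel. psi0 w * \<bar>f w\<bar>"
  have lcm: "ln_core \<in> borel_measurable borel" using borel_measurable_integrable[OF ln_core_integrable] by simp
  have nn: "0 \<le> ?I" "0 \<le> ?J" "0 \<le> ?L"
    by (intro Bochner_Integration.integral_nonneg; simp add: ln_core_def psi0_nonneg)+
  show ?thesis
  proof (intro exI[of _ "B * ?I + ?J + ?L"] conjI allI)
    show "0 \<le> B * ?I + ?J + ?L" using nn B(1) by simp
    fix z
    let ?b = "\<lambda>w. B * ln_core (z - w) + (psi0 z * \<bar>f w\<bar> + psi0 w * \<bar>f w\<bar>)"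
    have ilc: "integrable lborel (\<lambda>w. ln_core (z - w))" by (rule integrable_reflect[OF ln_core_integrable])
    have bi: "integrable lborel ?b"
      by (intro Bochner_Integration.integrable_add integrable_mult_right ilc integrable_abs integrable_f integrable_abs_psi0_f)
    have le: "\<bar>lnsq (z, w) * f w\<bar> \<le> ?b w" for w
    proof -
      have "\<bar>lnsq (z, w)\<bar> * \<bar>f w\<bar> \<le> (ln_core (z - w) + (psi0 z + psi0 w)) * \<bar>f w\<bar>"
        by (rule mult_right_mono[OF abs_lnsq_le abs_ge_zero])
      also have "\<dots> = ln_core (z - w) * \<bar>f w\<bar> + (psi0 z * \<bar>f w\<bar> + psi0 w * \<bar>f w\<bar>)" by (simp add: algebra_simps)
      also have "ln_core (z - w) * \<bar>f w\<bar> \<le> ln_core (z - w) * B"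
        by (rule mult_left_mono) (use B(2) in \<open>simp_all add: ln_core_def\<close>)
      finally show ?thesis unfolding abs_mult by (simp add: mult.commute)
    qed
    have lz: "(\<lambda>w. lnsq (z, w)) \<in> borel_measurable borel" unfolding lnsq_def fst_conv snd_conv by measurable
    have m: "(\<lambda>w. lnsq (z, w) * f w) \<in> borel_measurable lborel"
      using borel_measurable_times[OF lz measurable_f] by simp
    show i: "integrable lborel (\<lambda>w. lnsq (z, w) * f w)"
    proof (rule Bochner_Integration.integrable_bound[OF bi m], rule AE_I2)
      show "norm (lnsq (z, w) * f w) \<le> norm (?b w)" for w
        unfolding real_norm_def by (rule order_trans[OF le abs_ge_self])
    qed
    have "(LINT w|lborel. \<bar>lnsq (z, w) * f w\<bar>) \<le> (LINT w|lborel. ?b w)"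
      by (rule integral_mono[OF integrable_abs[OF i] bi le])
    also have "\<dots> = B * ?I + (psi0 z * ?J + ?L)"
      unfolding Bochner_Integration.integral_add[OF integrable_mult_right[OF ilc] Bochner_Integration.integrable_add[OF integrable_mult_right[OF integrable_abs[OF integrable_f]] integrable_abs_psi0_f]]
        Bochner_Integration.integral_add[OF integrable_mult_right[OF integrable_abs[OF integrable_f]] integrable_abs_psi0_f]
        integral_mult_right_zero integral_reflect[OF lcm] ..
    also have "\<dots> \<le> (B * ?I + ?J + ?L) * (1 + psi0 z)"
    proof -
      have "0 \<le> (B * ?I + ?L) * psi0 z" using nn B(1) psi0_nonneg[of z] by simp
      then show ?thesis using nn by (simp add: algebra_simps)
    qed
    finally show "(LINT w|lborel. \<bar>lnsq (z, w) * f w\<bar>) \<le> (B * ?I + ?J + ?L) * (1 + psi0 z)" .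
  qed
qed

lemma potential_integrable: "integrable lborel (\<lambda>w. lnsq (z, w) * f w)"
  using abs_bound by blast

lemma pair_integrable:
  assumes M: "sigma_finite_measure M" "sets M = sets borel"
    and g: "integrable M g" "integrable M (\<lambda>z. psi0 z * g z)"
  shows "integrable (M \<Otimes>\<^sub>M lborel) (\<lambda>p. lnsq p * (g (fst p) * f (snd p)))"
    "integrable M (\<lambda>z. potential f z * g z)"
    "(LINT p|(M \<Otimes>\<^sub>M lborel). lnsq p * (g (fst p) * f (snd p))) = (LINT z|M. potential f z * g z)"
proof -
  interpret pair_sigma_finite M "lborel :: complex measure"
    using M(1) by (simp add: pair_sigma_finite_def sigma_finite_lborel)
  note [measurable_cong] = M(2)
  have [measurable]: "g \<in> borel_measurable borel" using g(1) measurable_cong_sets[OF M(2) refl] by auto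
  obtain C where C: "C \<ge> 0" "\<And>z. (LINT w|lborel. \<bar>lnsq (z, w) * f w\<bar>) \<le> C * (1 + psi0 z)"
    using abs_bound by blast
  let ?F = "\<lambda>p. lnsq p * (g (fst p) * f (snd p))"
  have Fm[measurable]: "?F \<in> borel_measurable (M \<Otimes>\<^sub>M lborel)" unfolding lnsq_def by measurable
  have eq: "(\<lambda>w. ?F (z, w)) = (\<lambda>w. g z * (lnsq (z, w) * f w))" for z by (simp add: fun_eq_iff)
  have neq: "(\<lambda>w. norm (?F (z, w))) = (\<lambda>w. \<bar>g z\<bar> * \<bar>lnsq (z, w) * f w\<bar>)" for z by (simp add: fun_eq_iff abs_mult)
  show i: "integrable (M \<Otimes>\<^sub>M lborel) ?F"
  proof (rule Fubini_integrable[OF Fm])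
    have bi: "integrable M (\<lambda>z. C * (\<bar>g z\<bar> + \<bar>psi0 z * g z\<bar>))"
      by (intro integrable_mult_right Bochner_Integration.integrable_add integrable_abs g)
    show "integrable M (\<lambda>z. LINT w|lborel. norm (?F (z, w)))"
    proof (rule Bochner_Integration.integrable_bound[OF bi], measurable, rule AE_I2)
      fix z
      have "0 \<le> (LINT w|lborel. norm (?F (z, w)))" by (intro Bochner_Integration.integral_nonneg norm_ge_zero)
      moreover have "(LINT w|lborel. norm (?F (z, w))) \<le> \<bar>g z\<bar> * (C * (1 + psi0 z))"
        unfolding neq integral_mult_right_zero by (rule mult_left_mono[OF C(2) abs_ge_zero])
      moreover have "\<bar>g z\<bar> * (C * (1 + psi0 z)) = C * (\<bar>g z\<bar> + \<bar>psi0 z * g z\<bar>)"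
        using psi0_nonneg[of z] by (simp add: abs_mult algebra_simps)
      ultimately show "norm (LINT w|lborel. norm (?F (z, w))) \<le> norm (C * (\<bar>g z\<bar> + \<bar>psi0 z * g z\<bar>))"
        unfolding real_norm_def by linarith
    qed
    show "AE z in M. integrable lborel (\<lambda>w. ?F (z, w))"
      unfolding eq by (rule AE_I2) (rule integrable_mult_right[OF potential_integrable])
  qed
  have v: "(LINT w|lborel. ?F (z, w)) = potential f z * g z" for z
    unfolding eq integral_mult_right_zero potential_def by (rule mult.commute)
  show "integrable M (\<lambda>z. potential f z * g z)" using integrable_fst'[OF i] unfolding v .
  show "(LINT p|(M \<Otimes>\<^sub>M lborel). ?F p) = (LINT z|M. potential f z * g z)" using integral_fst'[OF i] unfolding v by (rule sym)
qed

end

section \<open>Green's identities and the logarithmic potential of a Laplacian\<close>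

lemma Ck2_laplacian_csupp:
  assumes v: "Ck_on 2 UNIV v" "\<forall>z. norm z > R \<longrightarrow> v z = 0"
  shows "csupp_density (laplacian v) R"
    "e \<in> Basis \<Longrightarrow> Ck_on (Suc 0) UNIV (\<lambda>z. frechet_derivative v (at z) e)"
    "e \<in> Basis \<Longrightarrow> \<forall>z. norm z > R \<longrightarrow> frechet_derivative v (at z) e = 0"
proof -
  have v2: "Ck_on (Suc (Suc 0)) UNIV v" using v(1) by (simp only: numeral_2_eq_2)
  show d1: "Ck_on (Suc 0) UNIV (\<lambda>z. frechet_derivative v (at z) e)" if "e \<in> Basis" for e
    using v2[unfolded Ck_on.simps(2)[of "Suc 0"]] that by blast
  show s1: "\<forall>z. norm z > R \<longrightarrow> frechet_derivative v (at z) e = 0" for e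
    by (intro allI impI) (rule frechet_derivative_csupp[OF v(2)[rule_format]])
  show "csupp_density (laplacian v) R"
  proof
    show "continuous_on UNIV (laplacian v)" unfolding laplacian_def[abs_def]
      by (intro continuous_on_sum) (rule Ck1_directional(1)[OF d1])
    show "\<forall>z. norm z > R \<longrightarrow> laplacian v z = 0"
      unfolding laplacian_def by (intro allI impI sum.neutral ballI) (rule frechet_derivative_csupp[OF s1[rule_format]])
  qed
qed

lemma laplacian_by_parts:
  assumes v: "Ck_on 2 UNIV v" "\<forall>z. norm z > R \<longrightarrow> v z = 0" and g: "Ck_on (Suc 0) UNIV g"
  shows "(LINT z|lborel. laplacian v z * g z) =
     - (LINT z|lborel. (\<Sum>e\<in>Basis. frechet_derivative v (at z) e * frechet_derivative g (at z) e))"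
proof -
  note d = Ck2_laplacian_csupp[OF v]
  have i1: "integrable lborel (\<lambda>z. frechet_derivative (\<lambda>w. frechet_derivative v (at w) e) (at z) e * g z)" if e: "e \<in> Basis" for e
    by (rule integrable_csupp[of _ R])
       (intro continuous_intros Ck1_directional(1)[OF d(2)[OF e] e] Ck1_directional(3)[OF g e],
        simp add: frechet_derivative_csupp[of R, OF d(3)[OF e, rule_format]])
  have i2: "integrable lborel (\<lambda>z. frechet_derivative v (at z) e * frechet_derivative g (at z) e)" if e: "e \<in> Basis" for e
    by (rule integrable_csupp[of _ R])
       (intro continuous_intros Ck1_directional(3)[OF d(2)[OF e] e] Ck1_directional(1)[OF g e],
        simp add: d(3)[OF e, rule_format])
  have "(LINT z|lborel. laplacian v z * g z) = (\<Sum>e\<in>Basis. LINT z|lborel. frechet_derivative (\<lambda>w. frechet_derivative v (at w) e) (at z) e * g z)"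
    unfolding laplacian_def sum_distrib_right by (rule Bochner_Integration.integral_sum[OF i1])
  also have "\<dots> = (\<Sum>e\<in>Basis. - (LINT z|lborel. frechet_derivative v (at z) e * frechet_derivative g (at z) e))"
    by (intro sum.cong refl, rule integration_by_parts_csupp[OF d(2) g]) (auto intro: d(3)[rule_format])
  also have "\<dots> = - (LINT z|lborel. (\<Sum>e\<in>Basis. frechet_derivative v (at z) e * frechet_derivative g (at z) e))"
    unfolding sum_negf by (subst Bochner_Integration.integral_sum[OF i2]) simp_all
  finally show ?thesis .
qed

text \<open>Green's second identity by two integrations by parts. Compact support of one factor
  leaves no boundary terms, so \<open>g\<close> may be a regularised logarithm.\<close>

lemma laplacian_symmetric:
  assumes v: "Ck_on 2 UNIV v" "\<forall>z. norm z > R \<longrightarrow> v z = 0" and g: "Ck_on 2 UNIV g"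
  shows "(LINT z|lborel. laplacian v z * g z) = (LINT z|lborel. v z * laplacian g z)"
proof -
  note d = Ck2_laplacian_csupp[OF v]
  have g2: "Ck_on (Suc (Suc 0)) UNIV g" using g by (simp only: numeral_2_eq_2)
  have g1: "Ck_on (Suc 0) UNIV (\<lambda>z. frechet_derivative g (at z) e)" if "e \<in> Basis" for e
    using g2[unfolded Ck_on.simps(2)[of "Suc 0"]] that by blast
  have v1: "Ck_on (Suc 0) UNIV v" using v(1) by (rule Ck_on_mono) simp
  have i2: "integrable lborel (\<lambda>z. frechet_derivative v (at z) e * frechet_derivative g (at z) e)" if e: "e \<in> Basis" for e
    by (rule integrable_csupp[of _ R])
       (intro continuous_intros Ck1_directional(3)[OF d(2)[OF e] e] Ck1_directional(3)[OF g1[OF e] e],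
        simp add: d(3)[OF e, rule_format])
  have i3: "integrable lborel (\<lambda>z. v z * frechet_derivative (\<lambda>w. frechet_derivative g (at w) e) (at z) e)" if e: "e \<in> Basis" for e
    by (rule integrable_csupp[of _ R])
       (intro continuous_intros Ck1_directional(3)[OF v1 e] Ck1_directional(1)[OF g1[OF e] e],
        simp add: v(2)[rule_format])
  have "(LINT z|lborel. laplacian v z * g z) = - (LINT z|lborel. (\<Sum>e\<in>Basis. frechet_derivative v (at z) e * frechet_derivative g (at z) e))"
    by (rule laplacian_by_parts[OF v]) (rule Ck_on_mono[OF g], simp)
  also have "\<dots> = (\<Sum>e\<in>Basis. - (LINT z|lborel. frechet_derivative v (at z) e * frechet_derivative g (at z) e))"
    unfolding sum_negf by (subst Bochner_Integration.integral_sum[OF i2]) simp_all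
  also have "\<dots> = (\<Sum>e\<in>Basis. LINT z|lborel. v z * frechet_derivative (\<lambda>w. frechet_derivative g (at w) e) (at z) e)"
  proof (rule sum.cong[OF refl])
    fix e :: complex assume e: "e \<in> Basis"
    have "(LINT z|lborel. frechet_derivative v (at z) e * frechet_derivative g (at z) e)
       = - (LINT z|lborel. v z * frechet_derivative (\<lambda>w. frechet_derivative g (at w) e) (at z) e)"
      by (rule integration_by_parts_csupp[OF v1 g1[OF e] _ e]) (rule v(2)[rule_format])
    then show "- (LINT z|lborel. frechet_derivative v (at z) e * frechet_derivative g (at z) e)
       = (LINT z|lborel. v z * frechet_derivative (\<lambda>w. frechet_derivative g (at w) e) (at z) e)" by simp
  qed
  also have "\<dots> = (LINT z|lborel. v z * laplacian g z)"
    unfolding laplacian_def sum_distrib_left by (rule Bochner_Integration.integral_sum[OF i3, symmetric])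
  finally show ?thesis .
qed

text \<open>The integrand is the Laplacian of ln (1 + |x|^2). Its mass 4\<pi> is the constant in the
  fundamental solution, for the kernel log |z|^2 = 2 log |z|.\<close>

lemma inverse_sq_kernel:
  "integrable lborel (\<lambda>x::complex. 4 * (inverse (1 + (norm x)\<^sup>2))\<^sup>2)"
  "(LINT x::complex|lborel. 4 * (inverse (1 + (norm x)\<^sup>2))\<^sup>2) = 4 * pi"
proof -
  have m: "(\<lambda>x::complex. 4 * (inverse (1 + (norm x)\<^sup>2))\<^sup>2) \<in> borel_measurable lborel" by measurable
  have "(\<integral>\<^sup>+x. ennreal (4 * (inverse (1 + (norm (x::complex))\<^sup>2))\<^sup>2) \<partial>lborel) =
     ennreal pi * (\<integral>\<^sup>+s. ennreal (4 * (inverse (1 + s))\<^sup>2) * indicator {0..} s \<partial>lborel)"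
    by (rule nn_integral_radial) measurable
  also have "(\<integral>\<^sup>+s. ennreal (4 * (inverse (1 + s))\<^sup>2) * indicator {0..} s \<partial>lborel) = ennreal (0 - (- 4 * inverse (1 + 0)))"
  proof (rule nn_integral_FTC_atLeast)
    fix x :: real assume "0 \<le> x"
    then have "1 + x \<noteq> 0" by simp
    then show "((\<lambda>s. - 4 * inverse (1 + s)) has_real_derivative 4 * (inverse (1 + x))\<^sup>2) (at x)"
      by (auto intro!: derivative_eq_intros simp: power2_eq_square)
  next
    have "filterlim (\<lambda>s::real. 1 + s) at_top at_top" by (rule filterlim_tendsto_add_at_top[OF tendsto_const filterlim_ident])
    from tendsto_mult[OF tendsto_const[of "- 4"] filterlim_compose[OF tendsto_inverse_0_at_top[OF filterlim_ident] this]]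
    show "((\<lambda>s::real. - 4 * inverse (1 + s)) \<longlongrightarrow> 0) at_top" by simp
  qed auto
  also have "ennreal pi * ennreal (0 - (- 4 * inverse (1 + 0))) = ennreal (4 * pi)"
    by (subst ennreal_mult'[symmetric]) (simp_all add: mult.commute)
  finally have v: "(\<integral>\<^sup>+x. ennreal (4 * (inverse (1 + (norm (x::complex))\<^sup>2))\<^sup>2) \<partial>lborel) = ennreal (4 * pi)" .
  note r = nn_integral_eq_imp_integral[OF m _ v]
  show "integrable lborel (\<lambda>x::complex. 4 * (inverse (1 + (norm x)\<^sup>2))\<^sup>2)" by (rule r(1)) simp_all
  show "(LINT x::complex|lborel. 4 * (inverse (1 + (norm x)\<^sup>2))\<^sup>2) = 4 * pi" by (rule r(2)) simp_all
qed

lemma log_reg: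
  assumes "\<epsilon> > 0"
  shows "Ck_on 2 UNIV (\<lambda>w. ln (\<epsilon> + (norm (w - z))\<^sup>2))"
    "laplacian (\<lambda>w. ln (\<epsilon> + (norm (w - z))\<^sup>2)) w = 4 * \<epsilon> * (inverse (\<epsilon> + (norm (w - z))\<^sup>2))\<^sup>2"
proof -
  let ?N = "\<lambda>w. \<epsilon> + (norm (w - z))\<^sup>2"
  have pos: "?N w > 0" for w using assms by (simp add: add_pos_nonneg)
  have dN: "(?N has_derivative (\<lambda>h. 2 * ((w - z) \<bullet> h))) (at w)" for w
    using has_derivative_add[OF has_derivative_const norm_power2_has_derivative[of z w], of \<epsilon>] by simp
  have d1: "((\<lambda>w. ln (?N w)) has_derivative (\<lambda>h. 2 * ((w - z) \<bullet> h) * inverse (?N w))) (at w)" for w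
    by (rule has_derivative_ln[OF pos dN])
  have ckN: "Ck_on k UNIV ?N" for k by (intro Ck_on_add Ck_on_const Ck_on_norm_power2 open_UNIV)
  have "Ck_on (Suc (Suc 0)) UNIV (\<lambda>w. ln (?N w))"
    by (rule Ck_on_SucI[OF open_UNIV d1])
       (intro Ck_on_mult Ck_on_const Ck_on_inner Ck_on_inverse ckN open_UNIV less_imp_neq[OF pos, symmetric])
  then show "Ck_on 2 UNIV (\<lambda>w. ln (?N w))" by (simp only: numeral_2_eq_2)
  have f1: "frechet_derivative (\<lambda>w. ln (?N w)) (at w) e = 2 * ((w - z) \<bullet> e) * inverse (?N w)" for w e
    by (rule fun_cong[OF frechet_derivative_at[OF d1, symmetric]])
  have d2: "((\<lambda>w. 2 * ((w - z) \<bullet> e) * inverse (?N w)) has_derivative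
     (\<lambda>h. 2 * ((w - z) \<bullet> e) * - (inverse (?N w) * (2 * ((w - z) \<bullet> h)) * inverse (?N w)) + 2 * (h \<bullet> e) * inverse (?N w))) (at w)" for e
  proof -
    have i: "((\<lambda>w. 2 * ((w - z) \<bullet> e)) has_derivative (\<lambda>h. 2 * (h \<bullet> e))) (at w)"
      by (auto intro!: derivative_eq_intros)
    show ?thesis by (rule has_derivative_mult[OF i Deriv.has_derivative_inverse[OF less_imp_neq[OF pos, symmetric] dN]])
  qed
  have f2: "frechet_derivative (\<lambda>w. frechet_derivative (\<lambda>w. ln (?N w)) (at w) e) (at w) e =
     2 * ((w - z) \<bullet> e) * - (inverse (?N w) * (2 * ((w - z) \<bullet> e)) * inverse (?N w)) + 2 * (e \<bullet> e) * inverse (?N w)" for e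
    unfolding f1 by (rule fun_cong[OF frechet_derivative_at[OF d2, symmetric]])
  have "laplacian (\<lambda>w. ln (?N w)) w = (\<Sum>e\<in>Basis. - 4 * (inverse (?N w))\<^sup>2 * ((w - z) \<bullet> e)\<^sup>2 + 2 * inverse (?N w))"
    unfolding laplacian_def f2 by (intro sum.cong refl) (simp add: power2_eq_square inner_Basis)
  also have "\<dots> = - 4 * (inverse (?N w))\<^sup>2 * (norm (w - z))\<^sup>2 + 4 * inverse (?N w)"
    unfolding norm_sq_Basis[of "w - z"] sum.distrib sum_distrib_left[symmetric] by simp
  also have "\<dots> = 4 * \<epsilon> * (inverse (?N w))\<^sup>2"
  proof -
    have "inverse (?N w) = (inverse (?N w))\<^sup>2 * ?N w" using pos[of w] by (simp add: power2_eq_square)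
    moreover have "- 4 * (i\<^sup>2) * n + 4 * (i\<^sup>2 * (\<epsilon> + n)) = 4 * \<epsilon> * i\<^sup>2" for i n :: real by (simp add: algebra_simps)
    ultimately show ?thesis by metis
  qed
  finally show "laplacian (\<lambda>w. ln (?N w)) w = 4 * \<epsilon> * (inverse (?N w))\<^sup>2" .
qed

text \<open>The kernel is regularised to ln (\<epsilon> + |w - z|^2), the Laplacian is moved onto
  it, and rescaling by the square root of \<epsilon> turns the result into an approximate identity
  of mass 4\<pi>. Dominated convergence handles both sides as \<epsilon> tends to 0.\<close>

lemma potential_laplacian:
  assumes v: "Ck_on 2 UNIV v" "\<forall>z. norm z > R \<longrightarrow> v z = 0"
  shows "potential (laplacian v) z = 4 * pi * v z"
proof -
  interpret csupp_density "laplacian v" R by (rule Ck2_laplacian_csupp(1)[OF v])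
  have vc: "continuous_on UNIV v" by (rule Ck_on_imp_continuous_on[OF v(1)])
  have vm[measurable]: "v \<in> borel_measurable borel" using vc by (rule borel_measurable_continuous_onI)
  obtain B where B: "B > 0" "\<forall>z. \<bar>v z\<bar> \<le> B"
    using bounded_csupp[OF vc, of R] v(2) by blast
  \<comment> \<open>A perfect square, so that the change of scale is 1/(n+1) without roots.\<close>
  define \<epsilon> where "\<epsilon> n = (1 / real (Suc n))\<^sup>2" for n
  have e: "\<epsilon> n > 0" "\<epsilon> n \<le> 1" for n by (simp_all add: \<epsilon>_def power_le_one)
  have e0: "\<epsilon> \<longlonglongrightarrow> 0" unfolding \<epsilon>_def[abs_def]
    using tendsto_power[OF LIMSEQ_inverse_real_of_nat, of 2] by (simp add: inverse_eq_divide)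
  let ?G = "\<lambda>n w. ln (\<epsilon> n + (norm (w - z))\<^sup>2)"
  have step: "(LINT w|lborel. laplacian v w * ?G n w) = (LINT x|lborel. v (z + (1 / real (Suc n)) *\<^sub>R x) * (4 * (inverse (1 + (norm x)\<^sup>2))\<^sup>2))" for n
  proof -
    let ?r = "1 / real (Suc n)"
    have r: "?r \<noteq> 0" by simp
    have "(LINT w|lborel. laplacian v w * ?G n w) = (LINT w|lborel. v w * (4 * \<epsilon> n * (inverse (\<epsilon> n + (norm (w - z))\<^sup>2))\<^sup>2))"
      unfolding laplacian_symmetric[OF v log_reg(1)[OF e(1)]] log_reg(2)[OF e(1)] ..
    also have "\<dots> = ?r\<^sup>2 * (LINT x|lborel. v (z + ?r *\<^sub>R x) * (4 * \<epsilon> n * (inverse (\<epsilon> n + (norm ((z + ?r *\<^sub>R x) - z))\<^sup>2))\<^sup>2))"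
      by (rule integral_complex_affine[OF _ r]) measurable
    also have "\<dots> = (LINT x|lborel. ?r\<^sup>2 * (v (z + ?r *\<^sub>R x) * (4 * \<epsilon> n * (inverse (\<epsilon> n + (norm ((z + ?r *\<^sub>R x) - z))\<^sup>2))\<^sup>2)))"
      by (rule integral_mult_right_zero[symmetric])
    also have "\<dots> = (LINT x|lborel. v (z + ?r *\<^sub>R x) * (4 * (inverse (1 + (norm x)\<^sup>2))\<^sup>2))"
    proof (intro Bochner_Integration.integral_cong refl)
      fix x :: complex
      have n: "\<epsilon> n + (norm ((z + ?r *\<^sub>R x) - z))\<^sup>2 = \<epsilon> n * (1 + (norm x)\<^sup>2)"
        by (simp add: \<epsilon>_def power_mult_distrib power_divide distrib_left add_divide_distrib del: of_nat_Suc)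
      have "E * (V * (4 * E * (I * Y)\<^sup>2)) = V * (4 * Y\<^sup>2) * ((E * I) * (E * I))" for E V I Y :: real
        by (simp add: power2_eq_square)
      moreover have "\<epsilon> n * inverse (\<epsilon> n) = 1" using e(1)[of n] by simp
      ultimately have "\<epsilon> n * (V * (4 * \<epsilon> n * (inverse (\<epsilon> n) * Y)\<^sup>2)) = V * (4 * Y\<^sup>2)" for V Y
        by (simp only: mult_1_right)
      then show "?r\<^sup>2 * (v (z + ?r *\<^sub>R x) * (4 * \<epsilon> n * (inverse (\<epsilon> n + (norm ((z + ?r *\<^sub>R x) - z))\<^sup>2))\<^sup>2))
        = v (z + ?r *\<^sub>R x) * (4 * (inverse (1 + (norm x)\<^sup>2))\<^sup>2)"
        unfolding n inverse_mult_distrib unfolding \<epsilon>_def .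
    qed
    finally show ?thesis .
  qed
  have r0: "(\<lambda>n. 1 / real (Suc n)) \<longlonglongrightarrow> 0" using LIMSEQ_inverse_real_of_nat by (simp add: inverse_eq_divide)
  have lim0: "(\<lambda>n. LINT x|lborel. v (z + (1 / real (Suc n)) *\<^sub>R x) * (4 * (inverse (1 + (norm x)\<^sup>2))\<^sup>2)) \<longlonglongrightarrow> (LINT x|lborel. v z * (4 * (inverse (1 + (norm (x::complex))\<^sup>2))\<^sup>2))"
  proof (rule integral_dominated_convergence[where w="\<lambda>x. B * (4 * (inverse (1 + (norm x)\<^sup>2))\<^sup>2)"])
    show "integrable lborel (\<lambda>x::complex. B * (4 * (inverse (1 + (norm x)\<^sup>2))\<^sup>2))" by (rule integrable_mult_right[OF inverse_sq_kernel(1)])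
    show "AE x in lborel. (\<lambda>n. v (z + (1 / real (Suc n)) *\<^sub>R x) * (4 * (inverse (1 + (norm x)\<^sup>2))\<^sup>2)) \<longlonglongrightarrow> v z * (4 * (inverse (1 + (norm (x::complex))\<^sup>2))\<^sup>2)"
    proof (intro AE_I2 tendsto_mult tendsto_const)
      fix x :: complex
      have "(\<lambda>n. z + (1 / real (Suc n)) *\<^sub>R x) \<longlonglongrightarrow> z + 0 *\<^sub>R x" by (intro tendsto_add tendsto_const tendsto_scaleR r0)
      then have l: "(\<lambda>n. z + (1 / real (Suc n)) *\<^sub>R x) \<longlonglongrightarrow> z" by simp
      have "isCont v z" using vc by (simp add: continuous_on_eq_continuous_at)
      from isCont_tendsto_compose[OF this l]
      show "(\<lambda>n. v (z + (1 / real (Suc n)) *\<^sub>R x)) \<longlonglongrightarrow> v z" .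
    qed
    show "AE x in lborel. norm (v (z + (1 / real (Suc n)) *\<^sub>R x) * (4 * (inverse (1 + (norm x)\<^sup>2))\<^sup>2)) \<le> B * (4 * (inverse (1 + (norm (x::complex))\<^sup>2))\<^sup>2)" for n
    proof (rule AE_I2)
      fix x :: complex
      have "\<bar>v (z + (1 / real (Suc n)) *\<^sub>R x)\<bar> * (4 * (inverse (1 + (norm x)\<^sup>2))\<^sup>2) \<le> B * (4 * (inverse (1 + (norm x)\<^sup>2))\<^sup>2)"
        by (rule mult_right_mono[OF B(2)[rule_format]]) simp
      moreover have "norm (V * (4 * X\<^sup>2)) = \<bar>V\<bar> * (4 * X\<^sup>2)" for V X :: real by (simp add: abs_mult)
      ultimately show "norm (v (z + (1 / real (Suc n)) *\<^sub>R x) * (4 * (inverse (1 + (norm x)\<^sup>2))\<^sup>2)) \<le> B * (4 * (inverse (1 + (norm x)\<^sup>2))\<^sup>2)"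
        by (simp only:)
    qed
  qed measurable
  have lim1: "(\<lambda>n. LINT w|lborel. laplacian v w * ?G n w) \<longlonglongrightarrow> v z * (4 * pi)"
  proof -
    have "(LINT x|lborel. v z * (4 * (inverse (1 + (norm (x::complex))\<^sup>2))\<^sup>2)) = v z * (LINT x|lborel. 4 * (inverse (1 + (norm (x::complex))\<^sup>2))\<^sup>2)"
      by (rule integral_mult_right_zero)
    then have e: "(LINT x|lborel. v z * (4 * (inverse (1 + (norm (x::complex))\<^sup>2))\<^sup>2)) = v z * (4 * pi)"
      unfolding inverse_sq_kernel(2) .
    show ?thesis using lim0 unfolding step e .
  qed
  have "(\<lambda>n. LINT w|lborel. laplacian v w * ?G n w) \<longlonglongrightarrow> (LINT w|lborel. laplacian v w * lnsq (z, w))"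
  proof (rule integral_dominated_convergence[where w="\<lambda>w. \<bar>lnsq (z, w) * laplacian v w\<bar> + \<bar>ln (1 + (norm (w - z))\<^sup>2) * laplacian v w\<bar>"])
    have "integrable lborel (\<lambda>w. ln (1 + (norm (w - z))\<^sup>2) * laplacian v w)"
    proof (rule integrable_csupp[of _ R])
      show "continuous_on UNIV (\<lambda>w. ln (1 + (norm (w - z))\<^sup>2) * laplacian v w)"
        by (intro continuous_on_mult cont Ck_on_imp_continuous_on[OF log_reg(1)[of 1]]) simp
    qed (simp add: supp)
    then show "integrable lborel (\<lambda>w. \<bar>lnsq (z, w) * laplacian v w\<bar> + \<bar>ln (1 + (norm (w - z))\<^sup>2) * laplacian v w\<bar>)"
      by (intro Bochner_Integration.integrable_add integrable_abs potential_integrable)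
    show "AE w in lborel. (\<lambda>n. laplacian v w * ?G n w) \<longlonglongrightarrow> laplacian v w * lnsq (z, w)"
    proof (rule AE_mp[OF AE_lborel_singleton[of z]], rule AE_I2, rule impI)
      fix w assume w: "w \<noteq> z"
      then have p: "(norm (w - z))\<^sup>2 > 0" by simp
      have "(\<lambda>n. \<epsilon> n + (norm (w - z))\<^sup>2) \<longlonglongrightarrow> 0 + (norm (w - z))\<^sup>2" by (intro tendsto_add e0 tendsto_const)
      then have "(\<lambda>n. ?G n w) \<longlonglongrightarrow> ln ((norm (w - z))\<^sup>2)" using p by (intro tendsto_ln) simp_all
      then have "(\<lambda>n. laplacian v w * ?G n w) \<longlonglongrightarrow> laplacian v w * ln ((norm (w - z))\<^sup>2)" by (intro tendsto_mult tendsto_const)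
      then show "(\<lambda>n. laplacian v w * ?G n w) \<longlonglongrightarrow> laplacian v w * lnsq (z, w)" by (simp add: lnsq_def norm_minus_commute)
    qed
    show "AE w in lborel. norm (laplacian v w * ?G n w) \<le> \<bar>lnsq (z, w) * laplacian v w\<bar> + \<bar>ln (1 + (norm (w - z))\<^sup>2) * laplacian v w\<bar>" for n
    proof (rule AE_mp[OF AE_lborel_singleton[of z]], rule AE_I2, rule impI)
      fix w assume w: "w \<noteq> z"
      let ?x = "(norm (w - z))\<^sup>2"
      have p: "?x > 0" using w by simp
      have G: "\<bar>ln (\<epsilon> n + ?x)\<bar> \<le> \<bar>ln ?x\<bar> + \<bar>ln (1 + ?x)\<bar>"
      proof -
        have "ln ?x \<le> ln (\<epsilon> n + ?x)" using p e(1)[of n] by (intro ln_mono) linarith+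
        moreover have "ln (\<epsilon> n + ?x) \<le> ln (1 + ?x)" using p e[of n] by (intro ln_mono) linarith+
        ultimately show ?thesis by linarith
      qed
      have "\<bar>laplacian v w\<bar> * \<bar>ln (\<epsilon> n + ?x)\<bar> \<le> \<bar>laplacian v w\<bar> * (\<bar>ln ?x\<bar> + \<bar>ln (1 + ?x)\<bar>)"
        by (rule mult_left_mono[OF G abs_ge_zero])
      then show "norm (laplacian v w * ?G n w) \<le> \<bar>lnsq (z, w) * laplacian v w\<bar> + \<bar>ln (1 + (norm (w - z))\<^sup>2) * laplacian v w\<bar>"
        unfolding real_norm_def abs_mult lnsq_def fst_conv snd_conv norm_minus_commute[of z w] distrib_left
          mult.commute[of "\<bar>laplacian v w\<bar>" "\<bar>ln ?x\<bar>"] mult.commute[of "\<bar>laplacian v w\<bar>" "\<bar>ln (1 + ?x)\<bar>"] .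
    qed
  qed measurable
  with lim1 have "v z * (4 * pi) = (LINT w|lborel. laplacian v w * lnsq (z, w))" by (rule LIMSEQ_unique)
  then show ?thesis unfolding potential_def by (simp only: mult_ac)
qed

section \<open>Potential of a disk density\<close>

lemma DERIV_glue:
  fixes g h :: "real \<Rightarrow> real"
  assumes "(g has_real_derivative D) (at x)" "(h has_real_derivative D) (at x)" "g x = h x"
  shows "((\<lambda>s. if s \<le> x then g s else h s) has_real_derivative D) (at x)"
proof -
  let ?f = "\<lambda>s. if s \<le> x then g s else h s"
  have g: "((\<lambda>y. (g y - g x) / (y - x)) \<longlongrightarrow> D) (at_left x)"
    using assms(1) by (simp add: has_field_derivative_iff filterlim_at_split)
  have h: "((\<lambda>y. (h y - h x) / (y - x)) \<longlongrightarrow> D) (at_right x)"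
    using assms(2) by (simp add: has_field_derivative_iff filterlim_at_split)
  have "((\<lambda>y. (?f y - ?f x) / (y - x)) \<longlongrightarrow> D) (at_left x)"
    by (rule filterlim_cong[THEN iffD1, OF refl refl _ g]) (auto simp: eventually_at_filter)
  moreover have "((\<lambda>y. (?f y - ?f x) / (y - x)) \<longlongrightarrow> D) (at_right x)"
    by (rule filterlim_cong[THEN iffD1, OF refl refl _ h]) (auto simp: eventually_at_filter assms(3))
  ultimately show ?thesis by (simp only: has_field_derivative_iff filterlim_at_split)
qed

text \<open>The quadratic branch matches ln at s = 1 in value (0), first derivative (1) and second
  derivative (-1), so the glued function is C^2. As a function of s = |z|^2 it has Laplacian 4 (s
  eta')', which is 8 (1 - s) inside the unit disk and 0 outside.\<close>

definition eta :: "real \<Rightarrow> real" where "eta s = (if s \<le> 1 then 2 * s - s\<^sup>2 / 2 - 3 / 2 else ln s)"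
definition eta1 :: "real \<Rightarrow> real" where "eta1 s = (if s \<le> 1 then 2 - s else inverse s)"
definition eta2 :: "real \<Rightarrow> real" where "eta2 s = (if s \<le> 1 then - 1 else - (inverse s)\<^sup>2)"

lemma DERIV_if_le:
  fixes g h :: "real \<Rightarrow> real"
  assumes g: "\<And>s. (g has_real_derivative g' s) (at s)" and h: "\<And>s. s \<ge> x \<Longrightarrow> (h has_real_derivative h' s) (at s)"
    and "g x = h x" "g' x = h' x"
  shows "((\<lambda>s. if s \<le> x then g s else h s) has_real_derivative (if s \<le> x then g' s else h' s)) (at s)"
proof -
  consider "s < x" | "s = x" | "s > x" by linarith
  then show ?thesis
  proof cases
    case 1
    have "((\<lambda>s. if s \<le> x then g s else h s) has_real_derivative g' s) (at s)"
      by (rule has_field_derivative_transform_within_open[OF g open_lessThan[of x]]) (use 1 in auto)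
    then show ?thesis using 1 by simp
  next
    case 2
    have "((\<lambda>s. if s \<le> x then g s else h s) has_real_derivative g' x) (at x)"
      by (rule DERIV_glue[where g=g and h=h, OF g[of x] _ assms(3)]) (use h[of x] assms(4) in simp)
    then show ?thesis using 2 by simp
  next
    case 3
    have "((\<lambda>s. if s \<le> x then g s else h s) has_real_derivative h' s) (at s)"
      by (rule has_field_derivative_transform_within_open[OF h open_greaterThan[of x]]) (use 3 in auto)
    then show ?thesis using 3 by simp
  qed
qed

lemma DERIV_eta: "(eta has_real_derivative eta1 s) (at s)"
  unfolding eta_def[abs_def] eta1_def
proof (rule DERIV_if_le)
  show "((\<lambda>s. 2 * s - s\<^sup>2 / 2 - 3 / 2) has_real_derivative 2 - s) (at s)" for s :: real
    by (auto intro!: derivative_eq_intros)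
  show "(ln has_real_derivative inverse s) (at s)" if "s \<ge> 1" for s :: real
    using that by (intro DERIV_ln) simp
qed simp_all

lemma DERIV_eta1: "(eta1 has_real_derivative eta2 s) (at s)"
  unfolding eta1_def[abs_def] eta2_def
proof (rule DERIV_if_le)
  show "((\<lambda>s. 2 - s) has_real_derivative - 1) (at s)" for s :: real
    by (auto intro!: derivative_eq_intros)
  show "(inverse has_real_derivative - (inverse s)\<^sup>2) (at s)" if "s \<ge> 1" for s :: real
    using that DERIV_inverse[of s] by (simp add: numeral_2_eq_2)
qed simp_all

lemma continuous_eta2: "continuous_on UNIV eta2"
proof -
  have e: "eta2 s = - (inverse (max 1 s))\<^sup>2" for s by (simp add: eta2_def max_def)
  show ?thesis unfolding e[abs_def] by (intro continuous_intros) (auto simp: max_def)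
qed

text \<open>The additive term makes this equal to log |z - a|^2 outside the disk, for every
  r.\<close>

definition disk_pot :: "complex \<Rightarrow> real \<Rightarrow> complex \<Rightarrow> real" where
  "disk_pot a r z = eta ((norm (z - a))\<^sup>2 / r\<^sup>2) + ln (r\<^sup>2)"

text \<open>A paraboloid of mass 1. It vanishes continuously at the rim, as it must to be the
  Laplacian of a C^2 function.\<close>

definition disk_dens :: "complex \<Rightarrow> real \<Rightarrow> complex \<Rightarrow> real" where
  "disk_dens a r z = 2 / (pi * r\<^sup>2) * max 0 (1 - (norm (z - a))\<^sup>2 / r\<^sup>2)"

lemma disk_pot_C2:
  assumes r: "r > 0"
  shows "Ck_on 2 UNIV (disk_pot a r)" "laplacian (disk_pot a r) z = 4 * pi * disk_dens a r z"
proof -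
  define k where "k = inverse (r\<^sup>2)"
  have k: "k > 0" using r by (simp add: k_def)
  let ?N = "\<lambda>z. (norm (z - a))\<^sup>2 / r\<^sup>2"
  have dN: "(?N has_derivative (\<lambda>h. 2 * k * ((z - a) \<bullet> h))) (at z)" for z
    using has_derivative_mult_left[OF norm_power2_has_derivative[of a z], of k]
    by (simp add: divide_inverse k_def mult_ac)
  have d1: "(disk_pot a r has_derivative (\<lambda>h. 2 * k * ((z - a) \<bullet> h) * eta1 (?N z))) (at z)" for z
    unfolding disk_pot_def[abs_def]
    using has_derivative_add[OF has_derivative_compose[OF dN DERIV_eta[unfolded has_field_derivative_def]] has_derivative_const]
    by (simp add: mult.commute)
  have f1: "frechet_derivative (disk_pot a r) (at z) e = 2 * k * ((z - a) \<bullet> e) * eta1 (?N z)" for z e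
    by (rule fun_cong[OF frechet_derivative_at[OF d1, symmetric]])
  have d2: "((\<lambda>z. 2 * k * ((z - a) \<bullet> e) * eta1 (?N z)) has_derivative
     (\<lambda>h. 2 * k * ((z - a) \<bullet> e) * (eta2 (?N z) * (2 * k * ((z - a) \<bullet> h))) + 2 * k * (h \<bullet> e) * eta1 (?N z))) (at z)" for e z
  proof -
    have i: "((\<lambda>z. 2 * k * ((z - a) \<bullet> e)) has_derivative (\<lambda>h. 2 * k * (h \<bullet> e))) (at z)"
      by (auto intro!: derivative_eq_intros)
    show ?thesis
      by (rule has_derivative_mult[OF i has_derivative_compose[OF dN DERIV_eta1[unfolded has_field_derivative_def]]])
  qed
  have f2: "frechet_derivative (\<lambda>w. frechet_derivative (disk_pot a r) (at w) e) (at z) h =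
     2 * k * ((z - a) \<bullet> e) * (eta2 (?N z) * (2 * k * ((z - a) \<bullet> h))) + 2 * k * (h \<bullet> e) * eta1 (?N z)" for e h
    unfolding f1 by (rule fun_cong[OF frechet_derivative_at[OF d2, symmetric]])
  have c1: "continuous_on UNIV eta1" using DERIV_eta1 by (intro continuous_at_imp_continuous_on ballI DERIV_isCont)
  have cN: "continuous_on UNIV ?N" using r by (intro continuous_intros) simp
  have "Ck_on (Suc (Suc 0)) UNIV (disk_pot a r)"
  proof (rule Ck_on_SucI[OF open_UNIV d1], rule Ck_on_SucI[OF open_UNIV d2])
    fix e h :: complex
    show "Ck_on 0 UNIV (\<lambda>z. 2 * k * ((z - a) \<bullet> e) * (eta2 (?N z) * (2 * k * ((z - a) \<bullet> h))) + 2 * k * (h \<bullet> e) * eta1 (?N z))"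
      unfolding Ck_on.simps
      by (intro continuous_intros continuous_on_compose2[OF continuous_eta2 cN] continuous_on_compose2[OF c1 cN]) (simp_all add: r less_imp_neq[symmetric])
  qed
  then show "Ck_on 2 UNIV (disk_pot a r)" by (simp only: numeral_2_eq_2)
  have "laplacian (disk_pot a r) z = (\<Sum>e\<in>Basis. 4 * k\<^sup>2 * eta2 (?N z) * ((z - a) \<bullet> e)\<^sup>2 + 2 * k * eta1 (?N z))"
    unfolding laplacian_def f2 by (intro sum.cong refl) (simp add: power2_eq_square inner_Basis)
  also have "\<dots> = 4 * k\<^sup>2 * eta2 (?N z) * (norm (z - a))\<^sup>2 + 4 * k * eta1 (?N z)"
    unfolding norm_sq_Basis[of "z - a"] sum.distrib sum_distrib_left[symmetric] by simp
  also have "\<dots> = 4 * k * (?N z * eta2 (?N z) + eta1 (?N z))"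
    by (simp add: divide_inverse k_def power2_eq_square algebra_simps)
  \<comment> \<open>Inside the disk s (-1) + (2 - s) = 2 (1 - s); outside, - s / s^2 + 1/s =
    0.\<close>
  also have "?N z * eta2 (?N z) + eta1 (?N z) = 2 * max 0 (1 - ?N z)"
    by (simp add: eta1_def eta2_def max_def power2_eq_square)
  finally show "laplacian (disk_pot a r) z = 4 * pi * disk_dens a r z"
    by (simp add: disk_dens_def k_def divide_inverse)
qed

lemma disk_dens_csupp: "r > 0 \<Longrightarrow> csupp_density (disk_dens a r) (norm a + r)"
proof
  assume r: "r > 0"
  show "continuous_on UNIV (disk_dens a r)" unfolding disk_dens_def[abs_def]
    using r by (intro continuous_intros) simp
  show "\<forall>z. norm z > norm a + r \<longrightarrow> disk_dens a r z = 0"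
  proof (intro allI impI)
    fix z :: complex assume "norm z > norm a + r"
    then have "norm (z - a) > r" using norm_triangle_ineq2[of z a] by linarith
    then have "(norm (z - a))\<^sup>2 \<ge> r\<^sup>2" using r by (intro power_mono) auto
    then have "1 \<le> (norm (z - a))\<^sup>2 / r\<^sup>2" using r by simp
    then show "disk_dens a r z = 0" by (simp add: disk_dens_def)
  qed
qed

lemma disk_dens_nonneg: "disk_dens a r z \<ge> 0" by (simp add: disk_dens_def)

lemma disk_dens_outside: "r > 0 \<Longrightarrow> norm (z - a) \<ge> r \<Longrightarrow> disk_dens a r z = 0"
proof -
  assume r: "r > 0" and "norm (z - a) \<ge> r"
  then have "(norm (z - a))\<^sup>2 \<ge> r\<^sup>2" by (intro power_mono) auto
  then have "1 \<le> (norm (z - a))\<^sup>2 / r\<^sup>2" using r by simp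
  then show "disk_dens a r z = 0" by (simp add: disk_dens_def)
qed

lemma integral_disk_dens: "r > 0 \<Longrightarrow> (LINT z|lborel. disk_dens a r z) = 1"
proof -
  assume r: "r > 0"
  interpret csupp_density "disk_dens a r" "norm a + r" by (rule disk_dens_csupp[OF r])
  let ?g = "\<lambda>s. 2 / (pi * r\<^sup>2) * max 0 (1 - s / r\<^sup>2)"
  have "(\<integral>\<^sup>+z. ennreal (disk_dens a r z) \<partial>lborel) = (\<integral>\<^sup>+z. ennreal (?g ((norm (z::complex))\<^sup>2)) \<partial>lborel)"
    using nn_integral_translate[of "\<lambda>z. ennreal (?g ((norm (z::complex))\<^sup>2))" "- a"] by (simp add: disk_dens_def)
  also have "\<dots> = ennreal pi * (\<integral>\<^sup>+s. ennreal (?g s) * indicator {0..} s \<partial>lborel)"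
    by (rule nn_integral_radial) measurable
  also have "(\<integral>\<^sup>+s. ennreal (?g s) * indicator {0..} s \<partial>lborel) = (\<integral>\<^sup>+s. ennreal (2 / (pi * r\<^sup>2) * (1 - s / r\<^sup>2)) * indicator {0..r\<^sup>2} s \<partial>lborel)"
  proof (rule nn_integral_cong)
    fix s :: real
    show "ennreal (?g s) * indicator {0..} s = ennreal (2 / (pi * r\<^sup>2) * (1 - s / r\<^sup>2)) * indicator {0..r\<^sup>2} s"
    proof (cases "s \<le> r\<^sup>2")
      case True
      then have "s / r\<^sup>2 \<le> 1" using r by simp
      then show ?thesis using True by (simp split: split_indicator)
    next
      case False
      then have "s / r\<^sup>2 \<ge> 1" using r by simp
      then show ?thesis using False by (simp split: split_indicator)
    qed
  qed
  also have "\<dots> = ennreal (2 / (pi * r\<^sup>2) * (r\<^sup>2 - (r\<^sup>2)\<^sup>2 / (2 * r\<^sup>2)) - 2 / (pi * r\<^sup>2) * (0 - 0\<^sup>2 / (2 * r\<^sup>2)))"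
  proof (rule nn_integral_FTC_Icc)
    show "((\<lambda>s. 2 / (pi * r\<^sup>2) * (s - s\<^sup>2 / (2 * r\<^sup>2))) has_real_derivative 2 / (pi * r\<^sup>2) * (1 - s / r\<^sup>2)) (at s)" for s
      using r by (auto intro!: derivative_eq_intros simp: field_simps)
    show "0 \<le> 2 / (pi * r\<^sup>2) * (1 - s / r\<^sup>2)" if "s \<in> {0..r\<^sup>2}" for s
      using that r by (intro mult_nonneg_nonneg) simp_all
  qed simp_all
  also have "2 / (pi * r\<^sup>2) * (r\<^sup>2 - (r\<^sup>2)\<^sup>2 / (2 * r\<^sup>2)) - 2 / (pi * r\<^sup>2) * (0 - 0\<^sup>2 / (2 * r\<^sup>2)) = 1 / pi"
    using r by (simp add: field_simps power2_eq_square)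
  also have "ennreal pi * ennreal (1 / pi) = ennreal 1" by (subst ennreal_mult'[symmetric]) simp_all
  finally have v: "(\<integral>\<^sup>+z. ennreal (disk_dens a r z) \<partial>lborel) = ennreal 1" .
  show ?thesis by (rule nn_integral_eq_imp_integral(2)[OF _ disk_dens_nonneg v]) simp_all
qed

text \<open>\<open>disk_pot\<close> is not compactly supported, so
  \<open>potential_laplacian\<close> does not apply to it. Differences for two radii are, because
  both functions equal log |z - a|^2 outside the larger disk.\<close>

lemma potential_disk_diff:
  assumes "r > 0" "q > 0"
  shows "potential (disk_dens a r) z - disk_pot a r z = potential (disk_dens a q) z - disk_pot a q z"
proof -
  let ?v = "\<lambda>z. disk_pot a r z - disk_pot a q z"
  have v: "Ck_on 2 UNIV ?v" by (intro Ck_on_diff disk_pot_C2(1) assms open_UNIV)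
  have s: "\<forall>z. norm z > norm a + max r q \<longrightarrow> ?v z = 0"
  proof (intro allI impI)
    fix z :: complex assume "norm z > norm a + max r q"
    then have n: "norm (z - a) > r" "norm (z - a) > q" using norm_triangle_ineq2[of z a] by linarith+
    have "disk_pot a t z = ln ((norm (z - a))\<^sup>2)" if "t > 0" "norm (z - a) > t" for t
    proof -
      have "t\<^sup>2 < (norm (z - a))\<^sup>2" using that by (intro power_strict_mono) auto
      then have "1 < (norm (z - a))\<^sup>2 / t\<^sup>2" using that by simp
      moreover have "(norm (z - a))\<^sup>2 > 0" using that by auto
      ultimately show ?thesis using that by (simp add: disk_pot_def eta_def ln_div)
    qed
    then show "?v z = 0" using n assms by simp
  qed
  have l: "laplacian ?v w = 4 * pi * (disk_dens a r w - disk_dens a q w)" for w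
  proof -
    have ck: "Ck_on (Suc (Suc 0)) UNIV (disk_pot a t)" if "t > 0" for t using disk_pot_C2(1)[OF that] by (simp only: numeral_2_eq_2)
    have d0: "disk_pot a t differentiable (at z)" if "t > 0" for t z
      using ck[OF that] by simp
    have d1: "(\<lambda>w. frechet_derivative (disk_pot a t) (at w) e) differentiable (at z)" if "t > 0" "e \<in> Basis" for t e z
      using ck[OF that(1)] that(2) by simp
    have e1: "frechet_derivative ?v (at w) e = frechet_derivative (disk_pot a r) (at w) e - frechet_derivative (disk_pot a q) (at w) e" for w e
      by (rule frechet_derivative_diff[OF d0 d0]) (rule assms)+
    have "laplacian ?v w = laplacian (disk_pot a r) w - laplacian (disk_pot a q) w"
      unfolding laplacian_def e1 sum_subtractf[symmetric]
      by (intro sum.cong refl frechet_derivative_diff d1 assms)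
    then show ?thesis unfolding disk_pot_C2(2)[OF assms(1)] disk_pot_C2(2)[OF assms(2)] right_diff_distrib .
  qed
  interpret r: csupp_density "disk_dens a r" "norm a + r" by (rule disk_dens_csupp[OF assms(1)])
  interpret q: csupp_density "disk_dens a q" "norm a + q" by (rule disk_dens_csupp[OF assms(2)])
  have "4 * pi * ?v z = potential (laplacian ?v) z" using potential_laplacian[OF v s] by (rule sym)
  also have "\<dots> = (LINT w|lborel. 4 * pi * (lnsq (z, w) * disk_dens a r w - lnsq (z, w) * disk_dens a q w))"
    unfolding potential_def l by (intro Bochner_Integration.integral_cong refl) (simp add: algebra_simps)
  also have "\<dots> = 4 * pi * (potential (disk_dens a r) z - potential (disk_dens a q) z)"
    unfolding integral_mult_right_zero Bochner_Integration.integral_diff[OF r.potential_integrable q.potential_integrable] potential_def ..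
  finally have "4 * pi * ?v z = 4 * pi * (potential (disk_dens a r) z - potential (disk_dens a q) z)" .
  then have "?v z = potential (disk_dens a r) z - potential (disk_dens a q) z" by simp
  then show ?thesis by linarith
qed

lemma potential_disk_scale:
  assumes r: "r > 0"
  shows "potential (disk_dens a r) (a + r *\<^sub>R x) = potential (disk_dens 0 1) x + ln (r\<^sup>2)"
proof -
  interpret r: csupp_density "disk_dens a r" "norm a + r" by (rule disk_dens_csupp[OF r])
  interpret o: csupp_density "disk_dens 0 1" "norm (0::complex) + 1" by (rule disk_dens_csupp) simp
  have r0: "r \<noteq> 0" using r by simp
  have lz: "(\<lambda>w. lnsq (z, w)) \<in> borel_measurable borel" for z unfolding lnsq_def fst_conv snd_conv by measurable
  have m: "(\<lambda>w. lnsq (a + r *\<^sub>R x, w) * disk_dens a r w) \<in> borel_measurable borel"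
    by (rule borel_measurable_times[OF lz r.measurable_f])
  have "potential (disk_dens a r) (a + r *\<^sub>R x) = r\<^sup>2 * (LINT y|lborel. lnsq (a + r *\<^sub>R x, a + r *\<^sub>R y) * disk_dens a r (a + r *\<^sub>R y))"
    unfolding potential_def by (rule integral_complex_affine[OF m r0])
  also have "\<dots> = (LINT y|lborel. r\<^sup>2 * (lnsq (a + r *\<^sub>R x, a + r *\<^sub>R y) * disk_dens a r (a + r *\<^sub>R y)))"
    by (rule integral_mult_right_zero[symmetric])
  also have "\<dots> = (LINT y|lborel. lnsq (x, y) * disk_dens 0 1 y + ln (r\<^sup>2) * disk_dens 0 1 y)"
  proof (rule integral_cong_AE)
    show "AE y in lborel. r\<^sup>2 * (lnsq (a + r *\<^sub>R x, a + r *\<^sub>R y) * disk_dens a r (a + r *\<^sub>R y)) = lnsq (x, y) * disk_dens 0 1 y + ln (r\<^sup>2) * disk_dens 0 1 y"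
    proof (rule AE_mp[OF AE_lborel_singleton[of x]], rule AE_I2, rule impI)
      fix y assume y: "y \<noteq> x"
      have "norm ((a + r *\<^sub>R x) - (a + r *\<^sub>R y)) = r * norm (x - y)"
        using r by (simp add: scaleR_diff_right[symmetric])
      then have l: "lnsq (a + r *\<^sub>R x, a + r *\<^sub>R y) = ln (r\<^sup>2) + lnsq (x, y)"
        using y r by (simp add: lnsq_def power_mult_distrib ln_mult_pos)
      have d: "r\<^sup>2 * disk_dens a r (a + r *\<^sub>R y) = disk_dens 0 1 y"
        using r by (simp add: disk_dens_def power_mult_distrib)
      have "r\<^sup>2 * (lnsq (a + r *\<^sub>R x, a + r *\<^sub>R y) * disk_dens a r (a + r *\<^sub>R y)) = (ln (r\<^sup>2) + lnsq (x, y)) * (r\<^sup>2 * disk_dens a r (a + r *\<^sub>R y))"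
        unfolding l by (simp only: mult_ac)
      then show "r\<^sup>2 * (lnsq (a + r *\<^sub>R x, a + r *\<^sub>R y) * disk_dens a r (a + r *\<^sub>R y)) = lnsq (x, y) * disk_dens 0 1 y + ln (r\<^sup>2) * disk_dens 0 1 y"
        unfolding d distrib_right by linarith
    qed
    show "(\<lambda>y. lnsq (x, y) * disk_dens 0 1 y + ln (r\<^sup>2) * disk_dens 0 1 y) \<in> borel_measurable lborel"
      using borel_measurable_times[OF lz o.measurable_f] o.measurable_f by simp
    have "(\<lambda>y. a + r *\<^sub>R y) \<in> borel_measurable borel" by measurable
    from measurable_compose[OF this m]
    show "(\<lambda>y. r\<^sup>2 * (lnsq (a + r *\<^sub>R x, a + r *\<^sub>R y) * disk_dens a r (a + r *\<^sub>R y))) \<in> borel_measurable lborel" by simp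
  qed
  also have "\<dots> = potential (disk_dens 0 1) x + ln (r\<^sup>2) * 1"
    unfolding Bochner_Integration.integral_add[OF o.potential_integrable integrable_mult_right[OF o.integrable_f]] integral_mult_right_zero
      integral_disk_dens[OF zero_less_one] potential_def ..
  finally show ?thesis by simp
qed

text \<open>A reflection moves the dependence on x from the singular kernel to the continuous
  density, after which dominated convergence with a locally integrable logarithm applies.\<close>

lemma continuous_potential_disk_0: "isCont (potential (disk_dens 0 1)) 0"
proof -
  interpret o: csupp_density "disk_dens 0 1" "norm (0::complex) + 1" by (rule disk_dens_csupp) simp
  obtain B where B: "\<forall>z. \<bar>disk_dens 0 1 z\<bar> \<le> B" using o.bounded_f by blast
  have l0: "(\<lambda>w. lnsq (0, w)) \<in> borel_measurable borel" unfolding lnsq_def fst_conv snd_conv by measurable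
  have lx: "(\<lambda>w. lnsq (x, w)) \<in> borel_measurable borel" for x unfolding lnsq_def fst_conv snd_conv by measurable
  have eq: "potential (disk_dens 0 1) x = (LINT y|lborel. lnsq (0, y) * disk_dens 0 1 (x - y))" for x
    unfolding potential_def
    using integral_reflect[of "\<lambda>w. lnsq (x, w) * disk_dens 0 1 w" x, OF borel_measurable_times[OF lx o.measurable_f]]
    by (simp add: lnsq_def norm_minus_commute)
  show ?thesis unfolding isCont_def tendsto_at_iff_sequentially
  proof (intro allI impI)
    fix X :: "nat \<Rightarrow> complex" assume X: "X \<longlonglongrightarrow> 0"
    have dx: "(\<lambda>y. disk_dens 0 1 (x - y)) \<in> borel_measurable borel" for x
    proof -
      have "(\<lambda>y. x - y) \<in> borel_measurable (borel :: complex measure)" by measurable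
      from measurable_compose[OF this o.measurable_f] show ?thesis .
    qed
    obtain M where M: "\<And>i. norm (X i) \<le> M"
    proof -
      have "Bseq X" using X by (intro convergent_imp_Bseq convergentI)
      then show ?thesis using that by (auto simp: Bseq_def)
    qed
    let ?w = "\<lambda>y. B * \<bar>lnsq (0, y) * indicator (cball 0 (M + 1)) y\<bar>"
    have loc: "integrable lborel (\<lambda>y. lnsq (0, y) * indicator (cball 0 (M + 1)) y)"
    proof -
      have ilc: "integrable lborel (\<lambda>w. ln_core (0 - w))" by (rule integrable_reflect[OF ln_core_integrable])
      have ip: "integrable lborel (\<lambda>y. psi0 y * indicator (cball 0 (M + 1)) y)"
        using L2loc_continuous[OF psi0_continuous, THEN loc_int_L2loc] unfolding loc_int_def by (simp add: mult.commute)
      show ?thesis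
      proof (rule Bochner_Integration.integrable_bound[OF Bochner_Integration.integrable_add[OF ilc ip]])
        show "(\<lambda>y. lnsq (0, y) * indicator (cball 0 (M + 1)) y) \<in> borel_measurable lborel"
          using borel_measurable_times[OF l0 borel_measurable_indicator[of "cball 0 (M + 1)"]] by simp
        show "AE y in lborel. norm (lnsq (0, y) * indicator (cball 0 (M + 1)) y) \<le> norm (ln_core (0 - y) + psi0 y * indicator (cball 0 (M + 1)) y)"
        proof (rule AE_I2)
          fix y
          have a: "\<bar>lnsq (0, y)\<bar> \<le> ln_core (0 - y) + psi0 y" using abs_lnsq_le[of 0 y] by (simp add: psi0_def)
          have "0 \<le> ln_core (0 - y)" by (simp add: ln_core_def)
          then show "norm (lnsq (0, y) * indicator (cball 0 (M + 1)) y) \<le> norm (ln_core (0 - y) + psi0 y * indicator (cball 0 (M + 1)) y)"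
            using a psi0_nonneg[of y] by (cases "y \<in> cball 0 (M + 1)") simp_all
        qed
      qed
    qed
    have "(\<lambda>i. LINT y|lborel. lnsq (0, y) * disk_dens 0 1 (X i - y)) \<longlonglongrightarrow> (LINT y|lborel. lnsq (0, y) * disk_dens 0 1 (0 - y))"
    proof (rule integral_dominated_convergence[where w="?w"])
      show "integrable lborel ?w" by (intro integrable_mult_right integrable_abs loc)
      show "(\<lambda>y. lnsq (0, y) * disk_dens 0 1 (X i - y)) \<in> borel_measurable lborel" for i
        using borel_measurable_times[OF l0 dx] by simp
      show "(\<lambda>y. lnsq (0, y) * disk_dens 0 1 (0 - y)) \<in> borel_measurable lborel"
        using borel_measurable_times[OF l0 dx] by simp
      show "AE y in lborel. (\<lambda>i. lnsq (0, y) * disk_dens 0 1 (X i - y)) \<longlonglongrightarrow> lnsq (0, y) * disk_dens 0 1 (0 - y)"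
      proof (intro AE_I2 tendsto_mult tendsto_const)
        fix y :: complex
        have "isCont (disk_dens 0 1) (0 - y)" using o.cont by (simp add: continuous_on_eq_continuous_at)
        moreover have "(\<lambda>i. X i - y) \<longlonglongrightarrow> 0 - y" by (intro tendsto_diff X tendsto_const)
        ultimately show "(\<lambda>i. disk_dens 0 1 (X i - y)) \<longlonglongrightarrow> disk_dens 0 1 (0 - y)" by (rule isCont_tendsto_compose)
      qed
      show "AE y in lborel. norm (lnsq (0, y) * disk_dens 0 1 (X i - y)) \<le> ?w y" for i
      proof (rule AE_I2)
        fix y
        show "norm (lnsq (0, y) * disk_dens 0 1 (X i - y)) \<le> ?w y"
        proof (cases "norm y \<le> M + 1")
          case True
          have "\<bar>lnsq (0, y)\<bar> * \<bar>disk_dens 0 1 (X i - y)\<bar> \<le> \<bar>lnsq (0, y)\<bar> * B"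
            by (rule mult_left_mono[OF B[rule_format] abs_ge_zero])
          moreover have "indicator (cball 0 (M + 1)) y = (1::real)" using True by simp
          ultimately show ?thesis unfolding real_norm_def abs_mult by (simp only: abs_one mult_1_right mult.commute)
        next
          case False
          then have "norm (X i - y) > 1" using M[of i] norm_triangle_ineq2[of y "X i"] by (simp add: norm_minus_commute)
          then have "disk_dens 0 1 (X i - y) = 0" by (intro disk_dens_outside) simp_all
          moreover have "0 \<le> B" using B[rule_format, of 0] by linarith
          ultimately show ?thesis by simp
        qed
      qed
    qed
    then show "(potential (disk_dens 0 1) \<circ> X) \<longlonglongrightarrow> potential (disk_dens 0 1) 0" unfolding o_def eq .
  qed
qed

text \<open>The discrepancy between potential and formula is the same for all radii, and by scaling
  it equals a fixed function \<open>?D\<close> at (z - a)/r. Sending r to infinity shows that it is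
  the constant \<open>?D 0\<close>. One constant common to all radii suffices later, because it
  enters only the bounded terms.\<close>

lemma potential_disk: "\<exists>c. \<forall>r>0. \<forall>z. potential (disk_dens a r) z = disk_pot a r z + c"
proof -
  let ?D = "\<lambda>x. potential (disk_dens 0 1) x - eta ((norm x)\<^sup>2)"
  have D: "potential (disk_dens a r) z - disk_pot a r z = ?D (inverse r *\<^sub>R (z - a))" if r: "r > 0" for r z
  proof -
    have "a + r *\<^sub>R (inverse r *\<^sub>R (z - a)) = z" using r by simp
    then have p1: "potential (disk_dens a r) z = potential (disk_dens 0 1) (inverse r *\<^sub>R (z - a)) + ln (r\<^sup>2)"
      using potential_disk_scale[OF r, of a "inverse r *\<^sub>R (z - a)"] by (simp only:)
    have p2: "(norm (inverse r *\<^sub>R (z - a)))\<^sup>2 = (norm (z - a))\<^sup>2 / r\<^sup>2"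
      using r by (simp add: power_mult_distrib divide_inverse power_inverse mult.commute)
    show ?thesis unfolding disk_pot_def p1 p2 by simp
  qed
  have "potential (disk_dens a r) z = disk_pot a r z + ?D 0" if r: "r > 0" for r z
  proof -
    have "?D (inverse (real (Suc n)) *\<^sub>R (z - a)) = potential (disk_dens a r) z - disk_pot a r z" for n
      using D[of "real (Suc n)" z] potential_disk_diff[OF r, of "real (Suc n)" a z] by simp
    moreover have "(\<lambda>n. ?D (inverse (real (Suc n)) *\<^sub>R (z - a))) \<longlonglongrightarrow> ?D 0"
    proof (rule isCont_tendsto_compose[where g="?D"])
      have "isCont (\<lambda>x::complex. eta ((norm x)\<^sup>2)) 0"
        by (rule isCont_o2[OF _ DERIV_isCont[OF DERIV_eta]]) (intro continuous_intros)
      then show "isCont ?D 0" by (rule isCont_diff[OF continuous_potential_disk_0])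
      have "(\<lambda>n. inverse (real (Suc n)) *\<^sub>R (z - a)) \<longlonglongrightarrow> 0 *\<^sub>R (z - a)"
        by (rule tendsto_scaleR[OF LIMSEQ_inverse_real_of_nat tendsto_const])
      then show "(\<lambda>n. inverse (real (Suc n)) *\<^sub>R (z - a)) \<longlonglongrightarrow> 0" by simp
    qed
    ultimately have "(\<lambda>n::nat. potential (disk_dens a r) z - disk_pot a r z) \<longlonglongrightarrow> ?D 0" by (simp only:)
    then have "potential (disk_dens a r) z - disk_pot a r z = ?D 0" by (simp only: LIMSEQ_const_iff)
    then show ?thesis by linarith
  qed
  then show ?thesis by (intro exI[of _ "?D 0"] allI impI)
qed

section \<open>The pairing with H1\<close>

text \<open>The measures for which every integral of the energy calculus is a convergent real
  integral. The off-diagonal condition excludes atoms, at which \<open>lnsq\<close> would hide an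
  infinite energy.\<close>

definition log_finite :: "complex measure \<Rightarrow> bool" where
  "log_finite \<mu> \<longleftrightarrow> prob_space \<mu> \<and> sets \<mu> = sets borel \<and> (AE p in \<mu> \<Otimes>\<^sub>M \<mu>. fst p \<noteq> snd p) \<and>
     integrable (\<mu> \<Otimes>\<^sub>M \<mu>) lnsq \<and> integrable \<mu> psi0"

lemma log_finite_energy:
  assumes \<mu>: "log_finite \<mu>" and f: "csupp_density f R" "(LINT z|lborel. f z) = 1"
  defines "D \<equiv> - (LINT p|(\<mu> \<Otimes>\<^sub>M \<mu>). lnsq p) + 2 * (LINT z|\<mu>. potential f z) - (LINT z|lborel. potential f z * f z)"
  shows "D \<ge> 0" "D = 0 \<Longrightarrow> (\<And>z. f z \<ge> 0) \<Longrightarrow> \<mu> = density lborel (\<lambda>z. ennreal (f z))" "integrable \<mu> (potential f)"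
proof -
  interpret csupp_density f R by fact
  have m: "prob_space \<mu>" "sets \<mu> = sets borel" "AE p in \<mu> \<Otimes>\<^sub>M \<mu>. fst p \<noteq> snd p" "integrable (\<mu> \<Otimes>\<^sub>M \<mu>) lnsq" "integrable \<mu> psi0"
    using \<mu> unfolding log_finite_def by blast+
  interpret prob_space \<mu> by fact
  have s\<mu>: "sigma_finite_measure \<mu>" by (rule sigma_finite_measure_axioms)
  have one: "integrable \<mu> (\<lambda>_. 1::real)" by simp
  have p1: "integrable \<mu> (\<lambda>z. psi0 z * 1)" using m(5) by simp
  note A = pair_integrable[OF s\<mu> m(2) one p1, unfolded mult_1_left mult_1_right]
  note B = pair_integrable[OF sigma_finite_lborel _ integrable_f integrable_psi0_f, OF sets_lborel]
  note E = energy_nonneg[OF m(1-4) integrable_f f(2) A(1) B(1), unfolded A(3) B(3), folded D_def]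
  show "D \<ge> 0" by (rule E(1))
  show "integrable \<mu> (potential f)" by (rule A(2))
  show "\<mu> = density lborel (\<lambda>z. ennreal (f z))" if "D = 0" "\<And>z. f z \<ge> 0"
    by (rule gauss_determines_measure[OF m(1,2) integrable_f that(2) E(2)[OF that(1)]])
qed

lemma test_function_C2: "test_function v \<Longrightarrow> Ck_on 2 UNIV v" by (simp add: test_function_def)

text \<open>For a test function the classical partial derivative is itself a test function, so
  testing the weak gradient against it gives the integral of (g \<bullet> e) times the partial
  derivative; 2ab \<le> a^2 + b^2 then compares the squares. This avoids uniqueness of weak
  gradients.\<close>

lemma weak_gradient_dirichlet:
  assumes v: "test_function v" and g: "L2_weak_gradient v g"
  shows "- (LINT z|lborel. laplacian v z * v z) \<le> (LINT z|lborel. (norm (g z))\<^sup>2)"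
proof -
  obtain R where R: "\<forall>z. norm z > R \<longrightarrow> v z = 0" using v unfolding test_function_def by blast
  have sm: "smooth v" using v by (simp add: test_function_iff)
  let ?d = "\<lambda>e z. frechet_derivative v (at z) e"
  have sd: "sq_int (?d e)" if "e \<in> Basis" for e
    by (rule sq_int_csupp[OF smooth_continuous[OF smooth_frechet_derivative[OF sm that]]]) (rule frechet_derivative_csupp[OF R[rule_format]])
  have tdd: "test_function (?d e)" if "e \<in> Basis" for e by (rule test_function_frechet_derivative[OF v that])
  have sg: "sq_int (\<lambda>z. g z \<bullet> e)" if "e \<in> Basis" for e by (rule L2_weak_gradientD(1)[OF g that])
  have id: "integrable lborel (\<lambda>z. (?d e z)\<^sup>2)" and ig: "integrable lborel (\<lambda>z. (g z \<bullet> e)\<^sup>2)" if "e \<in> Basis" for e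
    using sd[OF that] sg[OF that] by (auto simp: sq_int_def)
  have igd: "integrable lborel (\<lambda>z. (g z \<bullet> e) * ?d e z)" if "e \<in> Basis" for e
    by (rule loc_int_times_csupp[OF loc_int_L2loc[OF L2loc_sq_int[OF sg[OF that]]] smooth_continuous[OF smooth_frechet_derivative[OF sm that]], of R])
       (rule frechet_derivative_csupp[OF R[rule_format]])
  have "(LINT z|lborel. laplacian v z * v z) = - (LINT z|lborel. (\<Sum>e\<in>Basis. ?d e z * ?d e z))"
    by (rule laplacian_by_parts[OF test_function_C2[OF v] R smooth_Ck[OF sm]])
  also have "(LINT z|lborel. (\<Sum>e\<in>Basis. ?d e z * ?d e z)) = (\<Sum>e\<in>Basis. LINT z|lborel. (?d e z)\<^sup>2)"
    unfolding power2_eq_square[symmetric] by (rule Bochner_Integration.integral_sum[OF id])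
  finally have Q: "- (LINT z|lborel. laplacian v z * v z) = (\<Sum>e\<in>Basis. LINT z|lborel. (?d e z)\<^sup>2)" by linarith
  have "2 * (LINT z|lborel. (?d e z)\<^sup>2) \<le> (LINT z|lborel. (g z \<bullet> e)\<^sup>2) + (LINT z|lborel. (?d e z)\<^sup>2)" if e: "e \<in> Basis" for e
  proof -
    have "(LINT z|lborel. ?d e z * ?d e z) = - (LINT z|lborel. v z * frechet_derivative (?d e) (at z) e)"
      by (rule integration_by_parts_csupp[OF smooth_Ck[OF sm] smooth_Ck[OF smooth_frechet_derivative[OF sm e]] R[rule_format] e])
    also have "\<dots> = (LINT z|lborel. (g z \<bullet> e) * ?d e z)" unfolding L2_weak_gradientD(2)[OF g tdd[OF e] e] by simp
    finally have q: "(LINT z|lborel. (?d e z)\<^sup>2) = (LINT z|lborel. (g z \<bullet> e) * ?d e z)" by (simp only: power2_eq_square)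
    have "2 * (LINT z|lborel. (g z \<bullet> e) * ?d e z) = (LINT z|lborel. 2 * ((g z \<bullet> e) * ?d e z))" by (rule integral_mult_right_zero[symmetric])
    also have "\<dots> \<le> (LINT z|lborel. (g z \<bullet> e)\<^sup>2 + (?d e z)\<^sup>2)"
    proof (rule integral_mono)
      show "integrable lborel (\<lambda>z. 2 * ((g z \<bullet> e) * ?d e z))" by (rule integrable_mult_right[OF igd[OF e]])
      show "integrable lborel (\<lambda>z. (g z \<bullet> e)\<^sup>2 + (?d e z)\<^sup>2)" by (rule Bochner_Integration.integrable_add[OF ig[OF e] id[OF e]])
      show "2 * ((g z \<bullet> e) * ?d e z) \<le> (g z \<bullet> e)\<^sup>2 + (?d e z)\<^sup>2" for z
        using zero_le_power2[of "g z \<bullet> e - ?d e z"] by (simp only: power2_diff)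
    qed
    also have "\<dots> = (LINT z|lborel. (g z \<bullet> e)\<^sup>2) + (LINT z|lborel. (?d e z)\<^sup>2)" by (rule Bochner_Integration.integral_add[OF ig[OF e] id[OF e]])
    finally show ?thesis using q by linarith
  qed
  then have "(LINT z|lborel. (?d e z)\<^sup>2) \<le> (LINT z|lborel. (g z \<bullet> e)\<^sup>2)" if "e \<in> Basis" for e using that by force
  then have "(\<Sum>e\<in>Basis. LINT z|lborel. (?d e z)\<^sup>2) \<le> (\<Sum>e\<in>Basis. LINT z|lborel. (g z \<bullet> e)\<^sup>2)" by (rule sum_mono)
  then show ?thesis unfolding Q by (subst vec_L2(3)[of g, OF sg])
qed

abbreviation ref_dens :: "complex \<Rightarrow> real" where "ref_dens \<equiv> disk_dens 0 1"

text \<open>Positivity of the energy of \<mu> minus a perturbed reference density: as a polynomial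
  in s it has the integral of \<open>v\<close> in its linear term and the Dirichlet energy of
  \<open>v\<close> in its quadratic term. The factor 8\<pi> is twice the 4\<pi> of
  \<open>potential_laplacian\<close>, and \<open>?E\<close> is the energy at s = 0.\<close>

lemma log_finite_test_bound:
  assumes \<mu>: "log_finite \<mu>"
  shows "\<exists>E\<ge>0. \<forall>v g s. test_function v \<longrightarrow> L2_weak_gradient v g \<longrightarrow>
    8 * pi * s * ((LINT z|\<mu>. v z) - (LINT z|lborel. v z * ref_dens z)) \<le> E + 4 * pi * s\<^sup>2 * (LINT z|lborel. (norm (g z))\<^sup>2)"
proof -
  interpret o: csupp_density ref_dens "norm (0::complex) + 1" by (rule disk_dens_csupp) simp
  obtain c where c: "\<And>z. potential ref_dens z = disk_pot 0 1 z + c"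
    using potential_disk[of 0] zero_less_one by blast
  let ?L = "LINT p|(\<mu> \<Otimes>\<^sub>M \<mu>). lnsq p" and ?P = "LINT z|\<mu>. potential ref_dens z" and ?N = "LINT z|lborel. potential ref_dens z * ref_dens z"
  let ?E = "- ?L + 2 * ?P - ?N"
  have od: "csupp_density ref_dens (norm (0::complex) + 1)" by (rule disk_dens_csupp) simp
  note O = log_finite_energy[OF \<mu> od integral_disk_dens[OF zero_less_one]]
  have m: "prob_space \<mu>" "sets \<mu> = sets borel" using \<mu> unfolding log_finite_def by blast+
  interpret prob_space \<mu> by fact
  note [measurable_cong] = m(2)
  show ?thesis
  proof (intro exI[of _ ?E] conjI allI impI)
    show "?E \<ge> 0" by (rule O(1))
    fix v g and s :: real assume v: "test_function v" and g: "L2_weak_gradient v g"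
    obtain R where R: "\<forall>z. norm z > R \<longrightarrow> v z = 0" using v unfolding test_function_def by blast
    have sm: "smooth v" using v by (simp add: test_function_iff)
    have v2: "Ck_on 2 UNIV v" by (rule test_function_C2[OF v])
    have vc: "continuous_on UNIV v" by (rule smooth_continuous[OF sm])
    obtain B where B: "\<forall>z. \<bar>v z\<bar> \<le> B" using bounded_csupp[OF vc, of R] R by blast
    have vm[measurable]: "v \<in> borel_measurable borel" by (rule smooth_measurable[OF sm])
    have vi: "integrable \<mu> v" by (rule integrable_const_bound[where B=B]) (use B in simp_all)
    interpret l: csupp_density "laplacian v" R by (rule Ck2_laplacian_csupp(1)[OF v2 R])
    \<comment> \<open>The perturbation keeps the mass equal to 1, because the Laplacian of
      \<open>v\<close> integrates to 0, and its potential is an explicit multiple of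
      \<open>v\<close>.\<close>
    let ?f = "\<lambda>z. ref_dens z - s * laplacian v z"
    have fd: "csupp_density ?f (max (norm (0::complex) + 1) R)"
    proof
      show "continuous_on UNIV ?f" by (intro continuous_intros o.cont l.cont)
      show "\<forall>z. norm z > max (norm (0::complex) + 1) R \<longrightarrow> ?f z = 0" using o.supp l.supp by simp
    qed
    have ck1: "Ck_on 2 UNIV (\<lambda>z. 1)" by (rule Ck_on_const)
    have lap1: "laplacian (\<lambda>z. 1) z = 0" for z by (simp add: laplacian_def)
    have il0: "(LINT z|lborel. laplacian v z) = 0"
      using laplacian_symmetric[OF v2 R ck1] unfolding lap1 by simp
    have f1: "(LINT z|lborel. ?f z) = 1"
      unfolding Bochner_Integration.integral_diff[OF o.integrable_f integrable_mult_right[OF l.integrable_f]] integral_mult_right_zero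
        il0 integral_disk_dens[OF zero_less_one] by simp
    note F = log_finite_energy[OF \<mu> fd f1]
    have pf: "potential ?f z = potential ref_dens z - s * (4 * pi * v z)" for z
    proof -
      have "potential ?f z = (LINT w|lborel. lnsq (z, w) * ref_dens w - s * (lnsq (z, w) * laplacian v w))"
        unfolding potential_def by (intro Bochner_Integration.integral_cong refl) (simp add: algebra_simps)
      also have "\<dots> = potential ref_dens z - s * potential (laplacian v) z"
        unfolding Bochner_Integration.integral_diff[OF o.potential_integrable integrable_mult_right[OF l.potential_integrable]]
          integral_mult_right_zero potential_def ..
      finally show ?thesis unfolding potential_laplacian[OF v2 R] .
    qed
    have A: "(LINT z|\<mu>. potential ?f z) = ?P - s * (4 * pi * (LINT z|\<mu>. v z))"
      unfolding pf Bochner_Integration.integral_diff[OF O(3) integrable_mult_right[OF integrable_mult_right[OF vi]]] integral_mult_right_zero ..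
    have dc: "continuous_on UNIV (potential ref_dens)" unfolding c[abs_def]
      by (intro continuous_intros Ck_on_imp_continuous_on[OF disk_pot_C2(1)]) simp
    have pc2: "Ck_on 2 UNIV (disk_pot 0 1)" by (rule disk_pot_C2(1)) simp
    have i1: "integrable lborel (\<lambda>z. potential ref_dens z * ref_dens z)"
      by (rule integrable_csupp[of _ "norm (0::complex) + 1"]) (intro continuous_intros dc o.cont, simp add: o.supp[rule_format])
    have i2: "integrable lborel (\<lambda>z. potential ref_dens z * laplacian v z)"
      by (rule integrable_csupp[of _ R]) (intro continuous_intros dc l.cont, simp add: l.supp[rule_format])
    have i3: "integrable lborel (\<lambda>z. v z * ref_dens z)"
      by (rule integrable_csupp[of _ R]) (intro continuous_intros vc o.cont, simp add: R[rule_format])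
    have i4: "integrable lborel (\<lambda>z. laplacian v z * v z)"
      by (rule integrable_csupp[of _ R]) (intro continuous_intros vc l.cont, simp add: R[rule_format])
    have i5: "integrable lborel (\<lambda>z. laplacian v z * disk_pot 0 1 z)"
      by (rule integrable_csupp[of _ R]) (intro continuous_intros Ck_on_imp_continuous_on[OF pc2] l.cont, simp add: l.supp[rule_format])
    have pl: "(LINT z|lborel. potential ref_dens z * laplacian v z) = 4 * pi * (LINT z|lborel. v z * ref_dens z)"
    proof -
      have "(LINT z|lborel. potential ref_dens z * laplacian v z) = (LINT z|lborel. laplacian v z * disk_pot 0 1 z + c * laplacian v z)"
        unfolding c by (intro Bochner_Integration.integral_cong refl) (simp add: algebra_simps)
      also have "\<dots> = (LINT z|lborel. laplacian v z * disk_pot 0 1 z)"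
        unfolding Bochner_Integration.integral_add[OF i5 integrable_mult_right[OF l.integrable_f]] integral_mult_right_zero il0 by simp
      also have "\<dots> = (LINT z|lborel. v z * laplacian (disk_pot 0 1) z)" by (rule laplacian_symmetric[OF v2 R pc2])
      also have "\<dots> = (LINT z|lborel. 4 * pi * (v z * ref_dens z))"
        unfolding disk_pot_C2(2)[OF zero_less_one] by (simp only: mult_ac)
      finally show ?thesis unfolding integral_mult_right_zero .
    qed
    have B: "(LINT z|lborel. potential ?f z * ?f z) = ?N - 8 * pi * s * (LINT z|lborel. v z * ref_dens z) + 4 * pi * s\<^sup>2 * (LINT z|lborel. laplacian v z * v z)"
    proof -
      have e: "potential ?f z * ?f z = potential ref_dens z * ref_dens z - s * (potential ref_dens z * laplacian v z) - (4 * pi * s) * (v z * ref_dens z) + (4 * pi * s\<^sup>2) * (laplacian v z * v z)" for z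
        unfolding pf by (simp add: power2_eq_square algebra_simps)
      show ?thesis unfolding e
        Bochner_Integration.integral_add[OF Bochner_Integration.integrable_diff[OF Bochner_Integration.integrable_diff[OF i1 integrable_mult_right[OF i2]] integrable_mult_right[OF i3]] integrable_mult_right[OF i4]]
        Bochner_Integration.integral_diff[OF Bochner_Integration.integrable_diff[OF i1 integrable_mult_right[OF i2]] integrable_mult_right[OF i3]]
        Bochner_Integration.integral_diff[OF i1 integrable_mult_right[OF i2]] integral_mult_right_zero pl by simp
    qed
    have "0 \<le> - ?L + 2 * (?P - s * (4 * pi * (LINT z|\<mu>. v z))) - (?N - 8 * pi * s * (LINT z|lborel. v z * ref_dens z) + 4 * pi * s\<^sup>2 * (LINT z|lborel. laplacian v z * v z))"
      using F(1) unfolding A B .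
    moreover have "4 * pi * s\<^sup>2 * (- (LINT z|lborel. laplacian v z * v z)) \<le> 4 * pi * s\<^sup>2 * (LINT z|lborel. (norm (g z))\<^sup>2)"
      by (intro mult_left_mono weak_gradient_dirichlet[OF v g]) simp
    ultimately show "8 * pi * s * ((LINT z|\<mu>. v z) - (LINT z|lborel. v z * ref_dens z)) \<le> ?E + 4 * pi * s\<^sup>2 * (LINT z|lborel. (norm (g z))\<^sup>2)"
      by (simp add: algebra_simps)
  qed
qed

text \<open>Continuity at 0 of the functional on test functions. Radius 1 suffices for the local L^2
  part because that part only controls the integral against \<open>ref_dens\<close>, which lives on
  the unit disk.\<close>

lemma log_finite_small:
  assumes \<mu>: "log_finite \<mu>" and eps: "\<epsilon> > 0"
  shows "\<exists>\<delta>>0. \<forall>v. test_function v \<longrightarrow> H1_near 1 \<delta> v (\<lambda>_. 0) \<longrightarrow> \<bar>LINT z|\<mu>. v z\<bar> \<le> \<epsilon>"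
proof -
  obtain E where E: "E \<ge> 0" "\<And>v g s. test_function v \<Longrightarrow> L2_weak_gradient v g \<Longrightarrow>
    8 * pi * s * ((LINT z|\<mu>. v z) - (LINT z|lborel. v z * ref_dens z)) \<le> E + 4 * pi * s\<^sup>2 * (LINT z|lborel. (norm (g z))\<^sup>2)"
    using log_finite_test_bound[OF \<mu>] by blast
  interpret o: csupp_density ref_dens "norm (0::complex) + 1" by (rule disk_dens_csupp) simp
  let ?N = "LINT z|lborel. (ref_dens z)\<^sup>2"
  have os: "sq_int ref_dens" by (rule sq_int_csupp[OF o.cont]) (rule o.supp[rule_format])
  have N: "?N \<ge> 0" by simp
  \<comment> \<open>The parameter s is taken large enough to make E/s small before the gradient is
    made small. The signs s = \<sigma> and s = - \<sigma> give the two-sided bound, and \<theta>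
    balances the square of \<open>ref_dens\<close> against that of \<open>v\<close> in the remaining
    term.\<close>
  define \<sigma> where "\<sigma> = (E + 1) / \<epsilon>"
  define \<theta> where "\<theta> = \<epsilon> / (2 * (?N + 1))"
  have sg: "\<sigma> > 0" using E(1) eps by (simp add: \<sigma>_def)
  have "2 * (?N + 1) > 0" by (intro mult_pos_pos add_nonneg_pos N) simp_all
  then have th: "\<theta> > 0" unfolding \<theta>_def by (rule divide_pos_pos[OF eps])
  define \<delta> where "\<delta> = min (\<epsilon> / (2 * \<sigma>)) (\<epsilon> * \<theta> / 2)"
  have d: "\<delta> > 0" "\<delta> \<le> \<epsilon> / (2 * \<sigma>)" "\<delta> \<le> \<epsilon> * \<theta> / 2" using sg th eps by (simp_all add: \<delta>_def)
  show ?thesis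
  proof (intro exI[of _ \<delta>] conjI allI impI d(1))
    fix v assume v: "test_function v" and near: "H1_near 1 \<delta> v (\<lambda>_. 0)"
    obtain g where g: "L2_weak_gradient v g" "(LINT z|lborel. (norm (g z))\<^sup>2) < \<delta>"
      and l: "(LINT z:cball 0 1|lborel. (v z)\<^sup>2) < \<delta>"
      using near unfolding H1_near_def diff_zero by blast
    let ?b = "LINT z|lborel. v z * ref_dens z"
    let ?a = "(LINT z|\<mu>. v z) - ?b"
    have half: "x \<le> \<epsilon> / 2"
      if x: "8 * pi * (\<sigma> * x) \<le> E + 4 * pi * \<sigma>\<^sup>2 * (LINT z|lborel. (norm (g z))\<^sup>2)" for x
    proof -
      have "4 * pi * \<sigma>\<^sup>2 * (LINT z|lborel. (norm (g z))\<^sup>2) \<le> 4 * pi * \<sigma>\<^sup>2 * (\<epsilon> / (2 * \<sigma>))"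
        using g(2) d(2) by (intro mult_left_mono) simp_all
      also have "\<dots> = 2 * pi * (\<sigma> * \<epsilon>)" using sg by (simp add: power2_eq_square field_simps)
      finally have 1: "8 * pi * (\<sigma> * x) \<le> E + 2 * pi * (\<sigma> * \<epsilon>)" using x by linarith
      have se: "\<sigma> * \<epsilon> = E + 1" using eps by (simp add: \<sigma>_def)
      have "1 * (\<sigma> * \<epsilon>) \<le> 2 * pi * (\<sigma> * \<epsilon>)" using pi_ge_two se E(1) by (intro mult_right_mono) linarith+
      then have "8 * pi * (\<sigma> * x) \<le> 4 * pi * (\<sigma> * \<epsilon>)" using 1 se by linarith
      also have "\<dots> = 8 * pi * (\<sigma> * (\<epsilon> / 2))" by simp
      finally have "\<sigma> * x \<le> \<sigma> * (\<epsilon> / 2)" by (rule mult_left_le_imp_le) simp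
      then show ?thesis by (rule mult_left_le_imp_le) (rule sg)
    qed
    have "8 * pi * (\<sigma> * ?a) = 8 * pi * \<sigma> * ?a" by simp
    then have a1: "?a \<le> \<epsilon> / 2" using E(2)[OF v g(1), of \<sigma>] by (intro half) linarith
    have "8 * pi * (\<sigma> * (- ?a)) = 8 * pi * (-\<sigma>) * ?a" by (simp only: mult_minus_left mult_minus_right mult.assoc)
    then have a2: "- ?a \<le> \<epsilon> / 2" using E(2)[OF v g(1), of "-\<sigma>"] unfolding power2_minus by (intro half) linarith
    have vc: "continuous_on UNIV v" using v by (auto simp: test_function_iff smooth_continuous)
    obtain R where R: "\<forall>z. norm z > R \<longrightarrow> v z = 0" using v unfolding test_function_def by blast
    have i1: "integrable lborel (\<lambda>z. v z * ref_dens z)"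
      by (rule integrable_csupp[of _ R]) (intro continuous_intros vc o.cont, simp add: R[rule_format])
    have i2: "integrable lborel (\<lambda>z. (ref_dens z)\<^sup>2)" using os by (simp add: sq_int_def)
    have i3: "integrable lborel (\<lambda>z. indicator (cball 0 1) z * (v z)\<^sup>2)"
      using L2loc_continuous[OF vc] unfolding L2loc_def set_integrable_def real_scaleR_def by blast
    have l3: "(LINT z|lborel. indicator (cball 0 1) z * (v z)\<^sup>2) < \<delta>"
      using l unfolding set_lebesgue_integral_def real_scaleR_def .
    have pw: "2 * \<bar>v z * ref_dens z\<bar> \<le> \<theta> * (ref_dens z)\<^sup>2 + (1 / \<theta>) * (indicator (cball 0 1) z * (v z)\<^sup>2)" for z
    proof (cases "norm z \<le> 1")
      case False
      then have "ref_dens z = 0" by (intro o.supp[rule_format]) simp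
      then show ?thesis using th by simp
    next
      case True
      have "0 \<le> (\<theta> * \<bar>ref_dens z\<bar> - \<bar>v z\<bar>)\<^sup>2 / \<theta>" using th by simp
      also have "\<dots> = \<theta> * (ref_dens z)\<^sup>2 + (1 / \<theta>) * (v z)\<^sup>2 - 2 * \<bar>v z * ref_dens z\<bar>"
        using th by (simp add: power2_diff power_mult_distrib abs_mult field_simps power2_eq_square)
      finally show ?thesis using True by simp
    qed
    have "2 * \<bar>?b\<bar> \<le> 2 * (LINT z|lborel. \<bar>v z * ref_dens z\<bar>)" by (simp add: integral_abs_bound)
    also have "\<dots> = (LINT z|lborel. 2 * \<bar>v z * ref_dens z\<bar>)" by simp
    also have "\<dots> \<le> (LINT z|lborel. \<theta> * (ref_dens z)\<^sup>2 + (1 / \<theta>) * (indicator (cball 0 1) z * (v z)\<^sup>2))"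
      by (rule integral_mono[OF integrable_mult_right[OF integrable_abs[OF i1]] Bochner_Integration.integrable_add[OF integrable_mult_right[OF i2] integrable_mult_right[OF i3]] pw])
    also have "\<dots> = \<theta> * ?N + (1 / \<theta>) * (LINT z|lborel. indicator (cball 0 1) z * (v z)\<^sup>2)"
      unfolding Bochner_Integration.integral_add[OF integrable_mult_right[OF i2] integrable_mult_right[OF i3]] integral_mult_right_zero ..
    also have "\<dots> \<le> \<epsilon> / 2 + \<epsilon> / 2"
    proof (rule add_mono)
      have h: "\<epsilon> / (2 * n) * n = \<epsilon> / 2" if "n > 0" for n using that by simp
      have "\<theta> * ?N \<le> \<theta> * (?N + 1)" using th by (intro mult_left_mono) simp_all
      also have "\<dots> = \<epsilon> / 2" unfolding \<theta>_def by (rule h) (intro add_nonneg_pos N zero_less_one)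
      finally show "\<theta> * ?N \<le> \<epsilon> / 2" .
      have "(1 / \<theta>) * (LINT z|lborel. indicator (cball 0 1) z * (v z)\<^sup>2) \<le> (1 / \<theta>) * (\<epsilon> * \<theta> / 2)"
        using l3 d(3) th by (intro mult_left_mono) simp_all
      then show "(1 / \<theta>) * (LINT z|lborel. indicator (cball 0 1) z * (v z)\<^sup>2) \<le> \<epsilon> / 2" using th by simp
    qed
    finally have "\<bar>?b\<bar> \<le> \<epsilon> / 2" by linarith
    then show "\<bar>LINT z|\<mu>. v z\<bar> \<le> \<epsilon>" using a1 a2 by linarith
  qed
qed

section \<open>The unique continuous extension to H1\<close>

lemma test_function_diff:
  assumes "test_function v" "test_function w" shows "test_function (\<lambda>z. v z - w z)"
proof -
  obtain R S where "\<forall>z. norm z > R \<longrightarrow> v z = 0" "\<forall>z. norm z > S \<longrightarrow> w z = 0" using assms unfolding test_function_def by blast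
  then have "\<forall>z. norm z > max R S \<longrightarrow> v z - w z = 0" by simp
  moreover have "Ck_on k UNIV (\<lambda>z. v z - w z)" for k using assms by (intro Ck_on_diff) (simp_all add: test_function_def)
  ultimately show ?thesis unfolding test_function_def by blast
qed

lemma integrable_prob_csupp:
  fixes v :: "complex \<Rightarrow> real"
  assumes "prob_space \<mu>" "sets \<mu> = sets borel" "continuous_on UNIV v" "\<forall>z. norm z > R \<longrightarrow> v z = 0"
  shows "integrable \<mu> v"
proof -
  interpret prob_space \<mu> by fact
  obtain B where "\<forall>z. \<bar>v z\<bar> \<le> B" using bounded_csupp[OF assms(3), of R] assms(4) by blast
  moreover have "v \<in> borel_measurable \<mu>"
    unfolding measurable_cong_sets[OF assms(2) refl] by (rule borel_measurable_continuous_onI[OF assms(3)])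
  ultimately show ?thesis by (intro integrable_const_bound[where B=B]) simp_all
qed

lemma test_function_prob_integrable:
  assumes "prob_space \<mu>" "sets \<mu> = sets borel" "test_function v" shows "integrable \<mu> v"
proof -
  obtain R where "smooth v" "\<forall>z. norm z > R \<longrightarrow> v z = 0" using assms(3) unfolding test_function_iff by blast
  then show ?thesis using integrable_prob_csupp[OF assms(1,2) smooth_continuous] by blast
qed

text \<open>Extension in uniform form: \<delta> may not depend on \<open>u\<close>. Agreement with
  the integral on test functions and continuity on \<open>H1\<close> both follow from this one
  property.\<close>

definition near_extension :: "complex measure \<Rightarrow> ((complex \<Rightarrow> real) \<Rightarrow> real) \<Rightarrow> bool" where
  "near_extension \<mu> T \<longleftrightarrow> (\<forall>\<epsilon>>0. \<exists>\<delta>>0. \<forall>u\<in>H1. \<forall>v. test_function v \<longrightarrow> H1_near 1 \<delta> v u \<longrightarrow> \<bar>(LINT z|\<mu>. v z) - T u\<bar> \<le> \<epsilon>)"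

lemma H1_near_mono:
  assumes "H1_near R \<epsilon> u v" "S \<le> R" "\<epsilon> \<le> \<delta>" "L2loc u" "L2loc v"
  shows "H1_near S \<delta> u v"
proof -
  have "(LINT z:cball 0 S|lborel. (u z - v z)\<^sup>2) \<le> (LINT z:cball 0 R|lborel. (u z - v z)\<^sup>2)"
    by (rule set_integral_cball_mono[OF L2loc_diff[OF assms(4,5)] assms(2)])
  then show ?thesis using assms(1,3) unfolding H1_near_def by force
qed

text \<open>\<open>T u\<close> is the limit of the integrals along one chosen approximating
  sequence. That they form a Cauchy sequence, and that the limit does not depend on the choice, both
  come from \<open>small\<close>, applied to two test functions near the same \<open>u\<close>;
  going through \<open>u\<close> explains \<delta>/4.\<close>

lemma near_extension_exists:
  assumes \<mu>: "log_finite \<mu>" shows "\<exists>T. near_extension \<mu> T"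
proof -
  have m: "prob_space \<mu>" "sets \<mu> = sets borel" using \<mu> unfolding log_finite_def by blast+
  have small: "\<exists>\<delta>>0. \<forall>v w. test_function v \<longrightarrow> test_function w \<longrightarrow> H1_near 1 \<delta> v w \<longrightarrow> \<bar>(LINT z|\<mu>. v z) - (LINT z|\<mu>. w z)\<bar> \<le> \<epsilon>"
    if eps: "\<epsilon> > 0" for \<epsilon>
  proof -
    obtain \<delta> where d: "\<delta> > 0" "\<And>v. test_function v \<Longrightarrow> H1_near 1 \<delta> v (\<lambda>_. 0) \<Longrightarrow> \<bar>LINT z|\<mu>. v z\<bar> \<le> \<epsilon>"
      using log_finite_small[OF \<mu> eps] by blast
    show ?thesis
    proof (intro exI[of _ \<delta>] conjI allI impI d(1))
      fix v w assume v: "test_function v" and w: "test_function w" and n: "H1_near 1 \<delta> v w"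
      have "H1_near 1 \<delta> (\<lambda>z. v z - w z) (\<lambda>_. 0)" using n unfolding H1_near_def diff_zero .
      from d(2)[OF test_function_diff[OF v w] this]
      show "\<bar>(LINT z|\<mu>. v z) - (LINT z|\<mu>. w z)\<bar> \<le> \<epsilon>"
        unfolding Bochner_Integration.integral_diff[OF test_function_prob_integrable[OF m v] test_function_prob_integrable[OF m w]] .
    qed
  qed
  have "\<forall>u\<in>H1. \<forall>n::nat. \<exists>v. test_function v \<and> H1_near n (1 / Suc n) v u"
    by (intro ballI allI H1_approx_test_function) simp_all
  then obtain V where V: "\<And>u n. u \<in> H1 \<Longrightarrow> test_function (V u n)" "\<And>u n. u \<in> H1 \<Longrightarrow> H1_near (real n) (1 / Suc n) (V u n) u"
    by metis
  define T where "T u = lim (\<lambda>n. LINT z|\<mu>. V u n z)" for u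
  have ev: "\<forall>\<^sub>F n in sequentially. \<forall>u\<in>H1. H1_near 1 \<delta> (V u n) u" if "\<delta> > 0" for \<delta>
  proof -
    have "\<forall>\<^sub>F n in sequentially. inverse (real (Suc n)) < \<delta>" by (rule order_tendstoD(2)[OF LIMSEQ_inverse_real_of_nat that])
    then show ?thesis using eventually_ge_at_top[of "1::nat"]
    proof eventually_elim
      case (elim n)
      show ?case
      proof
        fix u assume u: "u \<in> H1"
        show "H1_near 1 \<delta> (V u n) u"
          by (rule H1_near_mono[OF V(2)[OF u, of n] _ _ test_function_L2loc[OF V(1)[OF u]] H1_L2loc[OF u]])
             (use elim in \<open>simp_all add: inverse_eq_divide\<close>)
      qed
    qed
  qed
  have key: "\<bar>(LINT z|\<mu>. v z) - (LINT z|\<mu>. V u n z)\<bar> \<le> \<epsilon>"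
    if "u \<in> H1" "test_function v" "H1_near 1 (\<delta> / 4) v u" "H1_near 1 (\<delta> / 4) (V u n) u"
      and d: "\<And>v w. test_function v \<Longrightarrow> test_function w \<Longrightarrow> H1_near 1 \<delta> v w \<Longrightarrow> \<bar>(LINT z|\<mu>. v z) - (LINT z|\<mu>. w z)\<bar> \<le> \<epsilon>"
    for u v n \<epsilon> \<delta>
  proof (rule d[OF that(2) V(1)[OF that(1)]])
    show "H1_near 1 \<delta> v (V u n)"
      using H1_near_triangle[OF that(3,4) test_function_L2loc[OF that(2)] H1_L2loc[OF that(1)] test_function_L2loc[OF V(1)[OF that(1)]]] by simp
  qed
  have conv: "(\<lambda>n. LINT z|\<mu>. V u n z) \<longlonglongrightarrow> T u" if u: "u \<in> H1" for u
  proof -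
    have "Cauchy (\<lambda>n. LINT z|\<mu>. V u n z)"
    proof (rule metric_CauchyI)
      fix e :: real assume "e > 0"
      then have e2: "e / 2 > 0" by simp
      obtain \<delta> where d: "\<delta> > 0" "\<And>v w. test_function v \<Longrightarrow> test_function w \<Longrightarrow> H1_near 1 \<delta> v w \<Longrightarrow> \<bar>(LINT z|\<mu>. v z) - (LINT z|\<mu>. w z)\<bar> \<le> e / 2"
        using small[OF e2] by blast
      obtain M where M: "\<And>n. n \<ge> M \<Longrightarrow> H1_near 1 (\<delta> / 4) (V u n) u"
        using ev[of "\<delta> / 4"] d(1) u unfolding eventually_sequentially by auto
      show "\<exists>M. \<forall>m\<ge>M. \<forall>n\<ge>M. dist (LINT z|\<mu>. V u m z) (LINT z|\<mu>. V u n z) < e"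
      proof (intro exI[of _ M] allI impI)
        fix m n assume "M \<le> m" "M \<le> n"
        have "\<bar>(LINT z|\<mu>. V u m z) - (LINT z|\<mu>. V u n z)\<bar> \<le> e / 2"
          by (rule key[OF u V(1)[OF u] M[OF \<open>M \<le> m\<close>] M[OF \<open>M \<le> n\<close>] d(2)])
        then show "dist (LINT z|\<mu>. V u m z) (LINT z|\<mu>. V u n z) < e" using \<open>e > 0\<close> unfolding dist_real_def by linarith
      qed
    qed
    then show ?thesis unfolding T_def by (intro convergent_LIMSEQ_iff[THEN iffD1] Cauchy_convergent)
  qed
  show ?thesis unfolding near_extension_def
  proof (intro exI[of _ T] allI impI)
    fix \<epsilon> :: real assume "\<epsilon> > 0"
    then obtain \<delta> where d: "\<delta> > 0" "\<And>v w. test_function v \<Longrightarrow> test_function w \<Longrightarrow> H1_near 1 \<delta> v w \<Longrightarrow> \<bar>(LINT z|\<mu>. v z) - (LINT z|\<mu>. w z)\<bar> \<le> \<epsilon>"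
      using small by blast
    have d4: "\<delta> / 4 > 0" using d(1) by simp
    show "\<exists>\<delta>>0. \<forall>u\<in>H1. \<forall>v. test_function v \<longrightarrow> H1_near 1 \<delta> v u \<longrightarrow> \<bar>(LINT z|\<mu>. v z) - T u\<bar> \<le> \<epsilon>"
    proof (intro exI[of _ "\<delta> / 4"] conjI ballI allI impI d4)
      fix u v assume u: "u \<in> H1" and v: "test_function v" "H1_near 1 (\<delta> / 4) v u"
      have "(\<lambda>n. \<bar>(LINT z|\<mu>. v z) - (LINT z|\<mu>. V u n z)\<bar>) \<longlonglongrightarrow> \<bar>(LINT z|\<mu>. v z) - T u\<bar>"
        by (intro tendsto_intros conv[OF u])
      moreover have "\<forall>\<^sub>F n in sequentially. \<bar>(LINT z|\<mu>. v z) - (LINT z|\<mu>. V u n z)\<bar> \<le> \<epsilon>"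
      proof (rule eventually_mono[OF ev[OF d4]])
        fix n assume "\<forall>u\<in>H1. H1_near 1 (\<delta> / 4) (V u n) u"
        then have n: "H1_near 1 (\<delta> / 4) (V u n) u" using u by (rule bspec)
        show "\<bar>(LINT z|\<mu>. v z) - (LINT z|\<mu>. V u n z)\<bar> \<le> \<epsilon>" by (rule key[OF u v n d(2)])
      qed
      ultimately show "\<bar>(LINT z|\<mu>. v z) - T u\<bar> \<le> \<epsilon>" by (rule tendsto_upperbound) simp
    qed
  qed
qed

lemma real_le_all_eps: "(\<And>\<epsilon>::real. \<epsilon> > 0 \<Longrightarrow> \<bar>x - y\<bar> \<le> 2 * \<epsilon>) \<Longrightarrow> x = y" for x y :: real
proof (rule ccontr)
  assume h: "\<And>\<epsilon>::real. \<epsilon> > 0 \<Longrightarrow> \<bar>x - y\<bar> \<le> 2 * \<epsilon>" and "x \<noteq> y"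
  define d where "d = \<bar>x - y\<bar>"
  have d: "d > 0" using \<open>x \<noteq> y\<close> by (simp add: d_def)
  have "d \<le> 2 * (d / 4)" unfolding d_def using d by (intro h) (simp add: d_def)
  then show False using d by simp
qed

lemma test_function_H1: assumes "test_function v" shows "v \<in> H1"
proof -
  obtain R where R: "smooth v" "\<forall>z. norm z > R \<longrightarrow> v z = 0" using assms unfolding test_function_iff by blast
  have "sq_int (\<lambda>z. frechet_derivative v (at z) e)" if "e \<in> Basis" for e
    by (rule sq_int_csupp[OF smooth_continuous[OF smooth_frechet_derivative[OF R(1) that]]]) (rule frechet_derivative_csupp[OF R(2)[rule_format]])
  from L2_weak_gradient_C1[OF smooth_Ck[OF R(1)] this] show ?thesis
    unfolding H1_def using test_function_L2loc[OF assms] by blast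
qed

lemma near_extension_test_function:
  assumes T: "near_extension \<mu> T" and v: "test_function v" shows "T v = (LINT z|\<mu>. v z)"
proof (rule real_le_all_eps)
  fix \<epsilon> :: real assume e: "\<epsilon> > 0"
  obtain \<delta> where d: "\<delta> > 0" "\<forall>u\<in>H1. \<forall>v. test_function v \<longrightarrow> H1_near 1 \<delta> v u \<longrightarrow> \<bar>(LINT z|\<mu>. v z) - T u\<bar> \<le> \<epsilon>"
    using T e unfolding near_extension_def by blast
  have d4: "\<delta> / 4 > 0" using d(1) by simp
  obtain w where w: "test_function w" "H1_near 1 (\<delta> / 4) w v" using H1_approx_test_function[OF test_function_H1[OF v] d4] by blast
  \<comment> \<open>Reflexivity is obtained by going to an approximant \<open>w\<close> and back;
    the property of \<open>T\<close> can then be used with \<open>v\<close> in both roles.\<close>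
  have "H1_near 1 \<delta> v v"
    using H1_near_triangle[OF H1_near_sym[OF w(2)] H1_near_sym[OF w(2)] test_function_L2loc[OF v] test_function_L2loc[OF w(1)] test_function_L2loc[OF v]] by simp
  then show "\<bar>T v - (LINT z|\<mu>. v z)\<bar> \<le> 2 * \<epsilon>" using d(2)[rule_format, OF test_function_H1[OF v] v] e by linarith
qed

lemma near_extension_continuous:
  assumes T: "near_extension \<mu> T" and vu: "\<And>n. v n \<in> H1" "u \<in> H1" "H1_tendsto v u"
  shows "(\<lambda>n. T (v n)) \<longlonglongrightarrow> T u"
proof (rule tendstoI)
  fix e :: real assume e: "e > 0"
  then have "e / 3 > 0" by simp
  then obtain \<delta> where d: "\<delta> > 0" "\<forall>u\<in>H1. \<forall>v. test_function v \<longrightarrow> H1_near 1 \<delta> v u \<longrightarrow> \<bar>(LINT z|\<mu>. v z) - T u\<bar> \<le> e / 3"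
    using T unfolding near_extension_def by blast
  have d4: "\<delta> / 4 > 0" using d(1) by simp
  show "\<forall>\<^sub>F n in sequentially. dist (T (v n)) (T u) < e"
  proof (rule eventually_mono[OF H1_tendsto_near[OF vu(3) d4, of 1]])
    fix n assume n: "H1_near 1 (\<delta> / 4) (v n) u"
    obtain w where w: "test_function w" "H1_near 1 (\<delta> / 4) w (v n)" using H1_approx_test_function[OF vu(1) d4] by blast
    note L = test_function_L2loc[OF w(1)] H1_L2loc[OF vu(1)[of n]] H1_L2loc[OF vu(2)]
    have "H1_near 1 \<delta> w u" using H1_near_triangle[OF w(2) H1_near_sym[OF n] L] by simp
    then have "\<bar>(LINT z|\<mu>. w z) - T u\<bar> \<le> e / 3" using d(2)[rule_format, OF vu(2) w(1)] by blast
    moreover have "H1_near 1 \<delta> w (v n)" by (rule H1_near_mono[OF w(2) _ _ L(1,2)]) (use d(1) in simp_all)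
    then have "\<bar>(LINT z|\<mu>. w z) - T (v n)\<bar> \<le> e / 3" using d(2)[rule_format, OF vu(1) w(1)] by blast
    ultimately show "dist (T (v n)) (T u) < e" using e unfolding dist_real_def by linarith
  qed
qed

text \<open>Resolves the definite description. Two continuous functionals that agree on test
  functions agree on \<open>H1\<close> by density, and \<open>restrict\<close> settles the values
  outside \<open>H1\<close>.\<close>

lemma pairing_near_extension:
  assumes T: "near_extension \<mu> T" and u: "u \<in> H1" shows "pairing \<mu> u = T u"
proof -
  have "(THE T. T \<in> extensional H1 \<and> H1_continuous T \<and> (\<forall>v. test_function v \<longrightarrow> T v = (LINT z|\<mu>. v z))) = restrict T H1"
  proof (rule the_equality, intro conjI allI impI)
    show "restrict T H1 \<in> extensional H1" by simp
    show "H1_continuous (restrict T H1)"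
      unfolding H1_continuous_def using near_extension_continuous[OF T] by simp
    show "restrict T H1 v = (LINT z|\<mu>. v z)" if "test_function v" for v
      using near_extension_test_function[OF T that] test_function_H1[OF that] by simp
  next
    fix S assume S: "S \<in> extensional H1 \<and> H1_continuous S \<and> (\<forall>v. test_function v \<longrightarrow> S v = (LINT z|\<mu>. v z))"
    show "S = restrict T H1"
    proof
      fix w show "S w = restrict T H1 w"
      proof (cases "w \<in> H1")
        case False then show ?thesis using S by (simp add: extensional_def)
      next
        case True
        have "\<forall>n::nat. \<exists>v. test_function v \<and> H1_near n (1 / Suc n) v w"
          by (intro allI H1_approx_test_function[OF True]) simp
        then obtain V where V: "\<And>n::nat. test_function (V n)" "\<And>n::nat. H1_near (real n) (1 / real (Suc n)) (V n) w"
          by metis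
        have lim: "H1_tendsto V w" by (rule H1_near_tendsto[OF V(2) test_function_L2loc[OF V(1)] H1_L2loc[OF True]])
        have "(\<lambda>n. T (V n)) \<longlonglongrightarrow> T w" by (rule near_extension_continuous[OF T test_function_H1[OF V(1)] True lim])
        moreover have "(\<lambda>n. S (V n)) \<longlonglongrightarrow> S w"
          using S test_function_H1[OF V(1)] True lim unfolding H1_continuous_def by blast
        moreover have "S (V n) = T (V n)" for n using S V(1)[of n] near_extension_test_function[OF T V(1)] by simp
        ultimately have "S w = T w" by (simp add: LIMSEQ_unique)
        then show ?thesis using True by simp
      qed
    qed
  qed
  then show ?thesis unfolding pairing_def using u by simp
qed

text \<open>Mollifications of \<open>u\<close> are test functions converging to \<open>u\<close>
  both in \<open>H1\<close> and uniformly. The first convergence identifies the limit of the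
  integrals with the pairing, the second with the integral of \<open>u\<close>.\<close>

lemma pairing_csupp:
  assumes \<mu>: "log_finite \<mu>" and u: "u \<in> H1" "continuous_on UNIV u" "\<forall>z. norm z > R \<longrightarrow> u z = 0"
  shows "pairing \<mu> u = (LINT z|\<mu>. u z)"
proof -
  have m: "prob_space \<mu>" "sets \<mu> = sets borel" using \<mu> unfolding log_finite_def by blast+
  interpret prob_space \<mu> by fact
  obtain T where T: "near_extension \<mu> T" using near_extension_exists[OF \<mu>] by blast
  obtain g where g: "L2_weak_gradient u g" using u(1) unfolding H1_def by blast
  have iu: "integrable \<mu> u" by (rule integrable_prob_csupp[OF m u(2,3)])
  have tc: "test_function (conv u (moll n))" for n by (rule test_function_conv[OF u(2) u(3)[rule_format]])
  have "T u = (LINT z|\<mu>. u z)"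
  proof (rule real_le_all_eps)
    fix \<epsilon> :: real assume e: "\<epsilon> > 0"
    then obtain \<delta> where d: "\<delta> > 0" "\<forall>u\<in>H1. \<forall>v. test_function v \<longrightarrow> H1_near 1 \<delta> v u \<longrightarrow> \<bar>(LINT z|\<mu>. v z) - T u\<bar> \<le> \<epsilon>"
      using T unfolding near_extension_def by blast
    have "\<forall>\<^sub>F n in sequentially. H1_near 1 \<delta> (conv u (moll n)) u \<and> (\<forall>z. \<bar>conv u (moll n) z - u z\<bar> \<le> \<epsilon>)"
    proof (rule eventually_conj)
      show "\<forall>\<^sub>F n in sequentially. H1_near 1 \<delta> (conv u (moll n)) u"
        by (rule eventually_mono[OF conv_moll_H1[OF H1_L2loc[OF u(1)] g d(1), of 1]]) blast
      show "\<forall>\<^sub>F n in sequentially. \<forall>z. \<bar>conv u (moll n) z - u z\<bar> \<le> \<epsilon>"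
        by (rule moll_uniform[OF u(2) _ e, of R]) (rule u(3)[rule_format])
    qed
    then obtain n where n: "H1_near 1 \<delta> (conv u (moll n)) u" "\<And>z. \<bar>conv u (moll n) z - u z\<bar> \<le> \<epsilon>"
      unfolding eventually_sequentially by blast
    have 1: "\<bar>(LINT z|\<mu>. conv u (moll n) z) - T u\<bar> \<le> \<epsilon>" using d(2)[rule_format, OF u(1) tc n(1)] .
    have ic: "integrable \<mu> (conv u (moll n))" by (rule test_function_prob_integrable[OF m tc])
    have "\<bar>(LINT z|\<mu>. conv u (moll n) z) - (LINT z|\<mu>. u z)\<bar> = \<bar>LINT z|\<mu>. conv u (moll n) z - u z\<bar>"
      unfolding Bochner_Integration.integral_diff[OF ic iu] ..
    also have "\<dots> \<le> (LINT z|\<mu>. \<bar>conv u (moll n) z - u z\<bar>)" by (rule integral_abs_bound)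
    also have "\<dots> \<le> (LINT z|\<mu>. \<epsilon>)"
      by (rule integral_mono[OF integrable_abs[OF Bochner_Integration.integrable_diff[OF ic iu]]]) (simp_all add: n(2))
    also have "\<dots> = \<epsilon>" by (simp add: prob_space)
    finally show "\<bar>T u - (LINT z|\<mu>. u z)\<bar> \<le> 2 * \<epsilon>" using 1 by linarith
  qed
  then show ?thesis using pairing_near_extension[OF T u(1)] by simp
qed

section \<open>Energies and equilibrium measures\<close>

lemma ereal_integral_eq:
  assumes g: "integrable M g" and f: "AE x in M. f x = ereal (g x)"
  shows "ereal_integral M f = ereal (LINT x|M. g x)"
proof -
  have p: "(\<integral>\<^sup>+ x. e2ennreal (f x) \<partial>M) = (\<integral>\<^sup>+ x. ennreal (g x) \<partial>M)"
    by (rule nn_integral_cong_AE) (use f in eventually_elim, simp)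
  have m: "(\<integral>\<^sup>+ x. e2ennreal (- f x) \<partial>M) = (\<integral>\<^sup>+ x. ennreal (- g x) \<partial>M)"
    by (rule nn_integral_cong_AE) (use f in eventually_elim, simp)
  have fin: "(\<integral>\<^sup>+ x. ennreal (g x) \<partial>M) < top" "(\<integral>\<^sup>+ x. ennreal (- g x) \<partial>M) < top"
    using g unfolding real_integrable_def by (simp_all add: top.not_eq_extremum)
  have e: "enn2ereal x = ereal (enn2real x)" if "x < top" for x
    using that by (metis enn2ereal_ennreal enn2real_nonneg ennreal_enn2real)
  show ?thesis unfolding ereal_integral_def p m e[OF fin(1)] e[OF fin(2)] real_lebesgue_integral_def[OF g] by simp
qed

lemma log_ereal_norm: "log_ereal (ereal ((norm (z - w))\<^sup>2)) = (if z = w then -\<infinity> else ereal (lnsq (z, w)))"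
  by (simp add: log_ereal_def lnsq_def)

lemma lnsq_prob_integrals:
  assumes p: "prob_space \<mu>" and g: "integrable \<mu> (g :: complex \<Rightarrow> real)"
  shows "integrable (\<mu> \<Otimes>\<^sub>M \<mu>) (\<lambda>p. g (fst p) + g (snd p))" "(LINT p|(\<mu> \<Otimes>\<^sub>M \<mu>). g (fst p) + g (snd p)) = 2 * (LINT z|\<mu>. g z)"
proof -
  interpret prob_space \<mu> by fact
  have s: "sigma_finite_measure \<mu>" by (rule sigma_finite_measure_axioms)
  have one: "integrable \<mu> (\<lambda>_. 1::real)" by simp
  note A = integrable_pair_mult[OF s s g one, unfolded mult_1_right] and B = integrable_pair_mult[OF s s one g, unfolded mult_1_left]
  show "integrable (\<mu> \<Otimes>\<^sub>M \<mu>) (\<lambda>p. g (fst p) + g (snd p))" by (rule Bochner_Integration.integrable_add[OF A(1) B(1)])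
  show "(LINT p|(\<mu> \<Otimes>\<^sub>M \<mu>). g (fst p) + g (snd p)) = 2 * (LINT z|\<mu>. g z)"
    unfolding Bochner_Integration.integral_add[OF A(1) B(1)] A(2) B(2) by (simp add: prob_space)
qed

lemma log_energy_eq:
  assumes "log_finite \<mu>"
  shows "log_energy \<mu> = ereal (- (1/2) * (LINT p|(\<mu> \<Otimes>\<^sub>M \<mu>). lnsq p))"
proof -
  have m: "AE p in \<mu> \<Otimes>\<^sub>M \<mu>. fst p \<noteq> snd p" "integrable (\<mu> \<Otimes>\<^sub>M \<mu>) lnsq"
    using assms unfolding log_finite_def by blast+
  have "ereal_integral (\<mu> \<Otimes>\<^sub>M \<mu>) (\<lambda>(z, w). log_ereal (ereal ((norm (z - w))\<^sup>2))) = ereal (LINT p|(\<mu> \<Otimes>\<^sub>M \<mu>). lnsq p)"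
  proof (rule ereal_integral_eq[OF m(2)])
    show "AE p in \<mu> \<Otimes>\<^sub>M \<mu>. (case p of (z, w) \<Rightarrow> log_ereal (ereal ((norm (z - w))\<^sup>2))) = ereal (lnsq p)"
      using m(1) by eventually_elim (auto simp: log_ereal_norm split_beta)
  qed
  then show ?thesis unfolding log_energy_def by simp
qed

lemma weighted_energy_eq:
  assumes \<mu>: "log_finite \<mu>" and \<phi>: "AE z in \<mu>. \<phi> z = ereal (h z)" "integrable \<mu> h"
  shows "weighted_energy \<phi> \<mu> = ereal (- (1/2) * (LINT p|(\<mu> \<Otimes>\<^sub>M \<mu>). lnsq p) + (LINT z|\<mu>. h z))"
proof -
  have m: "prob_space \<mu>" "AE p in \<mu> \<Otimes>\<^sub>M \<mu>. fst p \<noteq> snd p" "integrable (\<mu> \<Otimes>\<^sub>M \<mu>) lnsq" "integrable \<mu> psi0"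
    using \<mu> unfolding log_finite_def by blast+
  note P = lnsq_prob_integrals[OF m(1,4)]
  have 1: "ereal_integral (\<mu> \<Otimes>\<^sub>M \<mu>) (\<lambda>(z, w). log_ereal (ereal ((norm (z - w))\<^sup>2)) - ereal (psi0 z) - ereal (psi0 w))
     = ereal (LINT p|(\<mu> \<Otimes>\<^sub>M \<mu>). lnsq p - (psi0 (fst p) + psi0 (snd p)))"
  proof (rule ereal_integral_eq[OF Bochner_Integration.integrable_diff[OF m(3) P(1)]])
    show "AE p in \<mu> \<Otimes>\<^sub>M \<mu>. (case p of (z, w) \<Rightarrow> log_ereal (ereal ((norm (z - w))\<^sup>2)) - ereal (psi0 z) - ereal (psi0 w)) = ereal (lnsq p - (psi0 (fst p) + psi0 (snd p)))"
      using m(2) by eventually_elim (auto simp: log_ereal_norm split_beta)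
  qed
  have 2: "ereal_integral \<mu> (\<lambda>z. \<phi> z - ereal (psi0 z)) = ereal (LINT z|\<mu>. h z - psi0 z)"
    by (rule ereal_integral_eq[OF Bochner_Integration.integrable_diff[OF \<phi>(2) m(4)]]) (use \<phi>(1) in eventually_elim, simp)
  show ?thesis unfolding weighted_energy_def 1 2 Bochner_Integration.integral_diff[OF m(3) P(1)]
      Bochner_Integration.integral_diff[OF \<phi>(2) m(4)] P(2) by (simp add: algebra_simps)
qed

section \<open>Measures of finite weighted energy\<close>

lemma lower_semicontinuous_measurable:
  assumes "lower_semicontinuous \<phi>" shows "\<phi> \<in> borel_measurable borel"
proof (rule borel_measurableI_greater)
  fix t have "\<phi> -` {t<..} \<inter> space borel = {z. \<phi> z > t}" by auto
  then show "{x \<in> space borel. t < \<phi> x} \<in> sets borel" using assms by (simp add: lower_semicontinuous_def)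
qed

text \<open>The \<open>psi0\<close>-corrected kernel has a sign and \<phi> - psi0 is bounded below,
  so no \<infinity> - \<infinity> can occur and a finite energy makes both integrals finite.
  Together with strict growth this yields all the integrability that \<open>log_finite\<close> asks
  for.\<close>

lemma finite_energy_measureD:
  assumes \<mu>: "\<mu> \<in> finite_energy_measures \<phi>" and lsc: "lower_semicontinuous \<phi>"
    and gr: "\<epsilon> > 0" "\<And>z. \<phi> z \<ge> ereal ((1 + \<epsilon>) * psi0 z - C)"
  shows "log_finite \<mu>" "AE z in \<mu>. \<phi> z = ereal (real_of_ereal (\<phi> z))" "integrable \<mu> (\<lambda>z. real_of_ereal (\<phi> z))"
proof -
  have m: "prob_space \<mu>" "sets \<mu> = sets borel" and we: "weighted_energy \<phi> \<mu> < \<infinity>"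
    using \<mu> unfolding finite_energy_measures_def borel_prob_def by blast+
  interpret prob_space \<mu> by fact
  interpret pp: pair_prob_space \<mu> \<mu> by unfold_locales
  note [measurable_cong] = m(2)
  have \<phi>m[measurable]: "\<phi> \<in> borel_measurable borel" by (rule lower_semicontinuous_measurable[OF lsc])
  define F where "F = (\<lambda>(z, w). log_ereal (ereal ((norm (z - w))\<^sup>2)) - ereal (psi0 z) - ereal (psi0 w))"
  \<comment> \<open>Minus the corrected kernel as a nonnegative function, with the value \<infinity>
    on the diagonal as dictated by \<open>log_ereal\<close>; its finite integral makes the diagonal
    a null set.\<close>
  define G :: "complex \<times> complex \<Rightarrow> ennreal" where "G p = (if fst p = snd p then \<infinity> else ennreal (psi0 (fst p) + psi0 (snd p) - lnsq p))" for p
  have Gm[measurable]: "G \<in> borel_measurable (borel \<Otimes>\<^sub>M borel)" unfolding G_def[abs_def] by measurable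
  have FG: "e2ennreal (- F p) = G p" for p
    by (cases p) (simp add: F_def G_def log_ereal_norm algebra_simps)
  have F0: "e2ennreal (F p) = 0" for p
  proof (rule e2ennreal_neg)
    show "F p \<le> 0"
    proof (cases "fst p = snd p")
      case True then show ?thesis by (cases p) (simp add: F_def log_ereal_norm)
    next
      case False
      then have "lnsq p \<le> psi0 (fst p) + psi0 (snd p)" using lnsq_le[of "fst p" "snd p"] by simp
      then show ?thesis using False by (cases p) (simp add: F_def log_ereal_norm)
    qed
  qed
  let ?P = "\<integral>\<^sup>+ p. G p \<partial>(\<mu> \<Otimes>\<^sub>M \<mu>)" and ?P2 = "\<integral>\<^sup>+ z. e2ennreal (\<phi> z - ereal (psi0 z)) \<partial>\<mu>" and ?Q2 = "\<integral>\<^sup>+ z. e2ennreal (- (\<phi> z - ereal (psi0 z))) \<partial>\<mu>"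
  have lb: "ereal (\<epsilon> * psi0 z - C) \<le> \<phi> z - ereal (psi0 z)" for z
    using gr(2)[of z] by (cases "\<phi> z") (simp_all add: algebra_simps)
  have ub: "- (\<phi> z - ereal (psi0 z)) \<le> ereal \<bar>C\<bar>" for z
  proof -
    have "\<epsilon> * psi0 z \<ge> 0" using gr(1) psi0_nonneg by simp
    then have "ereal (- \<bar>C\<bar>) \<le> ereal (\<epsilon> * psi0 z - C)" by (simp only: ereal_less_eq)
    also note lb[of z]
    finally show ?thesis by (cases "\<phi> z") simp_all
  qed
  have "?Q2 \<le> (\<integral>\<^sup>+ z. ennreal \<bar>C\<bar> \<partial>\<mu>)"
    by (rule nn_integral_mono) (use e2ennreal_mono[OF ub] in simp)
  also have "\<dots> < top" by (simp add: emeasure_space_1)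
  finally have Q2: "?Q2 < top" .
  have w: "weighted_energy \<phi> \<mu> = ereal (- 1/2) * (0 - enn2ereal ?P) + (enn2ereal ?P2 - enn2ereal ?Q2)"
    unfolding weighted_energy_def ereal_integral_def F_def[symmetric] FG F0 by (simp add: zero_ennreal.rep_eq)
  have q: "enn2ereal ?Q2 = ereal (enn2real ?Q2)"
    using Q2 by (metis enn2ereal_ennreal enn2real_nonneg ennreal_enn2real)
  \<comment> \<open>The negative part \<open>?Q2\<close> of the potential term is finite, so an
    infinite kernel term could not be compensated.\<close>
  have P: "?P \<noteq> \<infinity>"
  proof
    assume "?P = \<infinity>"
    then have "weighted_energy \<phi> \<mu> = \<infinity>" unfolding w q by (cases "enn2ereal ?P2") simp_all
    then show False using we by simp
  qed
  then have "enn2ereal ?P = ereal (enn2real ?P)"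
    by (metis enn2ereal_ennreal enn2real_nonneg ennreal_enn2real infinity_ennreal_def top.not_eq_extremum)
  then have P2: "?P2 \<noteq> \<infinity>" using we unfolding w q by auto
  have "AE p in \<mu> \<Otimes>\<^sub>M \<mu>. G p \<noteq> \<infinity>" by (rule nn_integral_noteq_infinite[OF _ P]) simp
  then have od: "AE p in \<mu> \<Otimes>\<^sub>M \<mu>. fst p \<noteq> snd p" by eventually_elim (auto simp: G_def)
  have \<phi>f: "AE z in \<mu>. \<phi> z = ereal (real_of_ereal (\<phi> z))"
  proof -
    have "AE z in \<mu>. e2ennreal (\<phi> z - ereal (psi0 z)) \<noteq> \<infinity>" by (rule nn_integral_noteq_infinite[OF _ P2]) simp
    then show ?thesis
    proof eventually_elim
      case (elim z)
      have "\<phi> z \<noteq> -\<infinity>" using gr(2)[of z] by auto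
      then show ?case using elim by (cases "\<phi> z") simp_all
    qed
  qed
  let ?h = "\<lambda>z. real_of_ereal (\<phi> z)"
  have e0: "\<epsilon> * psi0 z \<ge> 0" for z using gr(1) psi0_nonneg by simp
  \<comment> \<open>Strictness of the growth enters here: \<epsilon> psi0 is at most \<phi> - psi0 +
    |C|, so a finite potential term makes \<open>psi0\<close> integrable.\<close>
  have ip0: "integrable \<mu> (\<lambda>z. \<epsilon> * psi0 z)"
  proof (rule integrableI_nonneg)
    have "(\<integral>\<^sup>+ z. ennreal (\<epsilon> * psi0 z) \<partial>\<mu>) \<le> (\<integral>\<^sup>+ z. e2ennreal (\<phi> z - ereal (psi0 z)) + ennreal \<bar>C\<bar> \<partial>\<mu>)"
    proof (rule nn_integral_mono)
      fix z
      have "ennreal (\<epsilon> * psi0 z) \<le> ennreal (max 0 (\<epsilon> * psi0 z - C) + \<bar>C\<bar>)" by (rule ennreal_leI) linarith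
      also have "\<dots> = ennreal (\<epsilon> * psi0 z - C) + ennreal \<bar>C\<bar>" by (subst ennreal_plus) (simp_all add: max_def ennreal_neg)
      also have "ennreal (\<epsilon> * psi0 z - C) \<le> e2ennreal (\<phi> z - ereal (psi0 z))" using e2ennreal_mono[OF lb[of z]] by simp
      finally show "ennreal (\<epsilon> * psi0 z) \<le> e2ennreal (\<phi> z - ereal (psi0 z)) + ennreal \<bar>C\<bar>" by (simp add: add_right_mono)
    qed
    also have "\<dots> = ?P2 + ennreal \<bar>C\<bar>" by (simp add: nn_integral_add emeasure_space_1)
    also have "\<dots> < \<infinity>" using P2 by (simp add: top.not_eq_extremum)
    finally show "(\<integral>\<^sup>+ z. ennreal (\<epsilon> * psi0 z) \<partial>\<mu>) < \<infinity>" .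
  qed (use e0 in simp_all)
  have ip: "integrable \<mu> psi0" using integrable_mult_right[OF ip0, of "1 / \<epsilon>"] gr(1) by simp
  note PI = lnsq_prob_integrals[OF m(1) ip]
  have "integrable (\<mu> \<Otimes>\<^sub>M \<mu>) (\<lambda>p. psi0 (fst p) + psi0 (snd p) - lnsq p)"
  proof (rule integrableI_nonneg)
    show "AE p in \<mu> \<Otimes>\<^sub>M \<mu>. 0 \<le> psi0 (fst p) + psi0 (snd p) - lnsq p"
      using od
    proof eventually_elim
      case (elim p) then show ?case using lnsq_le[of "fst p" "snd p"] by simp
    qed
    have "(\<integral>\<^sup>+ p. ennreal (psi0 (fst p) + psi0 (snd p) - lnsq p) \<partial>(\<mu> \<Otimes>\<^sub>M \<mu>)) = ?P"
      by (rule nn_integral_cong_AE) (use od in eventually_elim, simp add: G_def)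
    then show "(\<integral>\<^sup>+ p. ennreal (psi0 (fst p) + psi0 (snd p) - lnsq p) \<partial>(\<mu> \<Otimes>\<^sub>M \<mu>)) < \<infinity>"
      using P by (simp add: top.not_eq_extremum)
  qed measurable
  from Bochner_Integration.integrable_diff[OF PI(1) this] have "integrable (\<mu> \<Otimes>\<^sub>M \<mu>) lnsq" by simp
  then show "log_finite \<mu>" unfolding log_finite_def using m od ip by blast
  show "AE z in \<mu>. \<phi> z = ereal (real_of_ereal (\<phi> z))" by (rule \<phi>f)
  have h1: "ennreal (real_of_ereal x - y) = e2ennreal (x - ereal y)"
    and h2: "ennreal (- (real_of_ereal x - y)) = e2ennreal (- (x - ereal y))" if "x = ereal (real_of_ereal x)" for x y
    using that by (cases x; simp)+
  have "integrable \<mu> (\<lambda>z. ?h z - psi0 z)"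
    unfolding real_integrable_def
  proof (intro conjI)
    have "(\<integral>\<^sup>+ z. ennreal (?h z - psi0 z) \<partial>\<mu>) = ?P2"
      by (rule nn_integral_cong_AE) (use \<phi>f in eventually_elim, rule h1)
    then show "(\<integral>\<^sup>+ z. ennreal (?h z - psi0 z) \<partial>\<mu>) \<noteq> \<infinity>" using P2 by simp
    have "(\<integral>\<^sup>+ z. ennreal (- (?h z - psi0 z)) \<partial>\<mu>) = ?Q2"
      by (rule nn_integral_cong_AE) (use \<phi>f in eventually_elim, rule h2)
    then show "(\<integral>\<^sup>+ z. ennreal (- (?h z - psi0 z)) \<partial>\<mu>) \<noteq> \<infinity>" using Q2 by simp
  qed measurable
  from Bochner_Integration.integrable_add[OF this ip] show "integrable \<mu> ?h" by simp
qed

section \<open>The disk measure as equilibrium measure\<close>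

definition disk_measure :: "complex \<Rightarrow> real \<Rightarrow> complex measure" where
  "disk_measure a r = density lborel (\<lambda>z. ennreal (disk_dens a r z))"

lemma disk_measure_log_finite:
  assumes r: "r > 0"
  shows "log_finite (disk_measure a r)" "sets (disk_measure a r) = sets borel" "prob_space (disk_measure a r)"
    "(LINT p|(disk_measure a r \<Otimes>\<^sub>M disk_measure a r). lnsq p) = (LINT z|lborel. potential (disk_dens a r) z * disk_dens a r z)"
    "AE z in disk_measure a r. norm (z - a) < r"
proof -
  interpret csupp_density "disk_dens a r" "norm a + r" by (rule disk_dens_csupp[OF r])
  let ?f = "disk_dens a r" and ?\<mu> = "disk_measure a r"
  show s: "sets ?\<mu> = sets borel" by (simp add: disk_measure_def)
  have "emeasure ?\<mu> (space ?\<mu>) = (\<integral>\<^sup>+ z. ennreal (?f z) \<partial>lborel)" by (simp add: disk_measure_def emeasure_density)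
  also have "\<dots> = ennreal (LINT z|lborel. ?f z)" by (rule nn_integral_eq_integral[OF integrable_f]) (simp add: disk_dens_nonneg)
  finally show p: "prob_space ?\<mu>" using integral_disk_dens[OF r] by (intro prob_spaceI) simp
  interpret prob_space ?\<mu> by (rule p)
  have pd: "?\<mu> \<Otimes>\<^sub>M ?\<mu> = density (lborel \<Otimes>\<^sub>M lborel) (\<lambda>p. ennreal (?f (fst p) * ?f (snd p)))"
  proof -
    have "?\<mu> \<Otimes>\<^sub>M ?\<mu> = density (lborel \<Otimes>\<^sub>M lborel) (\<lambda>(x, y). ennreal (?f x) * ennreal (?f y))"
      using sigma_finite_measure_axioms unfolding disk_measure_def by (intro pair_measure_density sigma_finite_lborel) simp_all
    then show ?thesis by (simp add: case_prod_unfold ennreal_mult disk_dens_nonneg)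
  qed
  note B = pair_integrable[OF sigma_finite_lborel sets_lborel integrable_f integrable_psi0_f]
  have m: "(\<lambda>p. ?f (fst p) * ?f (snd p)) \<in> borel_measurable (lborel \<Otimes>\<^sub>M lborel)" by measurable
  have nn: "AE p in lborel \<Otimes>\<^sub>M lborel. 0 \<le> ?f (fst p) * ?f (snd p)" by (simp add: disk_dens_nonneg)
  have lm: "lnsq \<in> borel_measurable (lborel \<Otimes>\<^sub>M lborel)" by measurable
  have il: "integrable (?\<mu> \<Otimes>\<^sub>M ?\<mu>) lnsq"
    unfolding pd integrable_density[OF lm m nn] using B(1) by (simp add: mult.commute)
  show "(LINT p|(?\<mu> \<Otimes>\<^sub>M ?\<mu>). lnsq p) = (LINT z|lborel. potential ?f z * ?f z)"
    unfolding pd integral_density[OF lm m nn] B(3)[symmetric] by (simp add: mult.commute)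
  have od: "AE p in ?\<mu> \<Otimes>\<^sub>M ?\<mu>. fst p \<noteq> snd p"
    unfolding pd by (subst AE_density) (use AE_off_diagonal_lborel[OF sigma_finite_lborel sets_lborel] in \<open>measurable, eventually_elim, simp\<close>)
  have ip: "integrable ?\<mu> psi0" unfolding disk_measure_def
    by (subst integrable_density) (use integrable_psi0_f disk_dens_nonneg in \<open>simp_all add: mult.commute\<close>)
  show "log_finite ?\<mu>" unfolding log_finite_def using p s od il ip by blast
  show "AE z in ?\<mu>. norm (z - a) < r"
    unfolding disk_measure_def
  proof (subst AE_density, measurable, rule AE_I2, rule impI)
    fix z assume "0 < ennreal (?f z)"
    then show "norm (z - a) < r" using disk_dens_outside[OF r, of z a] by force
  qed
qed

lemma disk_measure_integral:
  assumes r: "r > 0" and g: "g \<in> borel_measurable borel"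
  shows "(LINT z|disk_measure a r. g z) = (LINT z|lborel. disk_dens a r z * g z)"
proof -
  interpret csupp_density "disk_dens a r" "norm a + r" by (rule disk_dens_csupp[OF r])
  show ?thesis unfolding disk_measure_def by (subst integral_density) (use g disk_dens_nonneg in simp_all)
qed

text \<open>Let P be the potential of the disk density, so that \<phi> + u \<ge> P - c - M with
  equality on the disk. Integrating against \<mu> reduces the functional to minus half the double
  integral of log |z - w|^2 plus the integral of P, and positivity of the energy of \<mu> minus the
  disk measure bounds this below by L/2. Equality forces that energy to vanish, hence \<mu> to be
  the disk measure, for which both steps are equalities.\<close>

lemma equilibrium_disk:
  assumes lsc: "lower_semicontinuous \<phi>"
    and gr: "\<epsilon> > 0" "\<And>z. \<phi> z \<ge> ereal ((1 + \<epsilon>) * psi0 z - C)"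
    and u: "u \<in> H1" "continuous_on UNIV u" "\<forall>z. norm z > R \<longrightarrow> u z = 0"
    and r: "r > 0"
    and ge: "\<And>z. \<phi> z \<ge> ereal (disk_pot a r z - M - u z)"
    and eq: "\<And>z. norm (z - a) < r \<Longrightarrow> \<phi> z = ereal (disk_pot a r z - M - u z)"
    and c: "\<And>z. potential (disk_dens a r) z = disk_pot a r z + c"
  defines "L \<equiv> LINT z|lborel. potential (disk_dens a r) z * disk_dens a r z"
  shows "free_energy \<phi> u = ereal (L / 2 - c - M)" "equilibrium_measure \<phi> u = disk_measure a r"
    "disk_measure a r \<in> finite_energy_measures \<phi>" "log_energy (disk_measure a r) = ereal (- (1/2) * L)"
proof -
  interpret csupp_density "disk_dens a r" "norm a + r" by (rule disk_dens_csupp[OF r])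
  let ?d = "disk_measure a r" and ?f = "disk_dens a r"
  note D = disk_measure_log_finite[OF r, of a, folded L_def]
  show "log_energy ?d = ereal (- (1/2) * L)" unfolding log_energy_eq[OF D(1)] D(4) ..
  note LE = log_finite_energy[OF _ csupp_density_axioms integral_disk_dens[OF r], folded L_def]
  have fe: "\<And>\<mu>. \<mu> \<in> finite_energy_measures \<phi> \<Longrightarrow> log_finite \<mu>" by (rule finite_energy_measureD(1)[OF _ lsc gr])
  have key: "\<exists>x. weighted_energy \<phi> \<mu> + ereal (pairing \<mu> u) = ereal x \<and> L / 2 - c - M \<le> x \<and> (x = L / 2 - c - M \<longrightarrow> \<mu> = ?d)"
    if \<mu>: "\<mu> \<in> finite_energy_measures \<phi>" for \<mu>
  proof -
    let ?h = "\<lambda>z. real_of_ereal (\<phi> z)"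
    note F = finite_energy_measureD[OF \<mu> lsc gr]
    have m: "prob_space \<mu>" "sets \<mu> = sets borel" using F(1) unfolding log_finite_def by blast+
    interpret prob_space \<mu> by fact
    have iu: "integrable \<mu> u" by (rule integrable_prob_csupp[OF m u(2,3)])
    have ip: "integrable \<mu> (potential ?f)" by (rule LE(3)[OF F(1)])
    let ?L = "LINT p|(\<mu> \<Otimes>\<^sub>M \<mu>). lnsq p" and ?I = "LINT z|\<mu>. potential ?f z"
    have "weighted_energy \<phi> \<mu> + ereal (pairing \<mu> u) = ereal (- (1/2) * ?L + (LINT z|\<mu>. ?h z) + (LINT z|\<mu>. u z))"
      unfolding weighted_energy_eq[OF F] pairing_csupp[OF F(1) u] by simp
    moreover have "?I - (c + M) \<le> (LINT z|\<mu>. ?h z) + (LINT z|\<mu>. u z)"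
    proof -
      have "?I - (c + M) = (LINT z|\<mu>. potential ?f z - (c + M))"
        by (subst Bochner_Integration.integral_diff[OF ip]) (simp_all add: prob_space)
      also have "\<dots> \<le> (LINT z|\<mu>. ?h z + u z)"
      proof (rule integral_mono_AE)
        show "integrable \<mu> (\<lambda>z. potential ?f z - (c + M))" by (intro Bochner_Integration.integrable_diff ip) simp
        show "integrable \<mu> (\<lambda>z. ?h z + u z)" by (intro Bochner_Integration.integrable_add F(3) iu)
        show "AE z in \<mu>. potential ?f z - (c + M) \<le> ?h z + u z" using F(2)
        proof eventually_elim
          case (elim z)
          have "ereal (disk_pot a r z - M - u z) \<le> ereal (?h z)" using ge[of z] elim by simp
          then show ?case unfolding c by simp
        qed
      qed
      finally show ?thesis unfolding Bochner_Integration.integral_add[OF F(3) iu] .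
    qed
    moreover have "0 \<le> - ?L + 2 * ?I - L" by (rule LE(1)[OF F(1)])
    moreover have "\<mu> = ?d" if "- ?L + 2 * ?I - L = 0" unfolding disk_measure_def
      by (rule LE(2)[OF F(1) that disk_dens_nonneg])
    ultimately show ?thesis
      by (intro exI[of _ "- (1/2) * ?L + (LINT z|\<mu>. ?h z) + (LINT z|\<mu>. u z)"]) fastforce
  qed
  let ?k = "\<lambda>z. disk_pot a r z - M - u z"
  have pc: "continuous_on UNIV (disk_pot a r)" by (rule Ck_on_imp_continuous_on[OF disk_pot_C2(1)[OF r]])
  have km[measurable]: "?k \<in> borel_measurable borel" by (intro borel_measurable_continuous_onI continuous_intros pc u(2))
  interpret d: prob_space ?d by (rule D(3))
  have id: "integrable ?d (potential ?f)" by (rule LE(3)[OF D(1)])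
  have iu: "integrable ?d u" by (rule integrable_prob_csupp[OF D(3,2) u(2,3)])
  have kd: "?k z = potential ?f z - (c + M) - u z" for z unfolding c by simp
  have ik: "integrable ?d ?k" unfolding kd by (intro Bochner_Integration.integrable_diff id iu) simp
  have \<phi>k: "AE z in ?d. \<phi> z = ereal (?k z)" using D(5) by eventually_elim (rule eq)
  note W = weighted_energy_eq[OF D(1) \<phi>k ik, unfolded D(4)]
  show mem: "?d \<in> finite_energy_measures \<phi>" unfolding finite_energy_measures_def borel_prob_def using D W by simp
  have pm: "potential ?f \<in> borel_measurable borel"
    unfolding c[abs_def] by (intro borel_measurable_continuous_onI continuous_intros pc)
  have "(LINT z|?d. potential ?f z) = L"
    unfolding L_def disk_measure_integral[OF r pm] by (simp only: mult.commute)
  moreover have "(LINT z|?d. ?k z) = (LINT z|?d. potential ?f z) - (c + M) - (LINT z|?d. u z)"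
    unfolding kd by (subst Bochner_Integration.integral_diff[OF _ iu] , intro Bochner_Integration.integrable_diff id, simp,
       subst Bochner_Integration.integral_diff[OF id]) (simp_all add: d.prob_space)
  ultimately have val: "weighted_energy \<phi> ?d + ereal (pairing ?d u) = ereal (L / 2 - c - M)"
    unfolding W pairing_csupp[OF D(1) u] by simp
  show fr: "free_energy \<phi> u = ereal (L / 2 - c - M)" unfolding free_energy_def
  proof (rule antisym)
    show "(INF \<mu>\<in>finite_energy_measures \<phi>. weighted_energy \<phi> \<mu> + ereal (pairing \<mu> u)) \<le> ereal (L / 2 - c - M)"
      by (rule INF_lower2[OF mem]) (simp add: val)
    show "ereal (L / 2 - c - M) \<le> (INF \<mu>\<in>finite_energy_measures \<phi>. weighted_energy \<phi> \<mu> + ereal (pairing \<mu> u))"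
    proof (rule INF_greatest)
      fix \<mu> assume "\<mu> \<in> finite_energy_measures \<phi>"
      from key[OF this] show "ereal (L / 2 - c - M) \<le> weighted_energy \<phi> \<mu> + ereal (pairing \<mu> u)" by force
    qed
  qed
  show "equilibrium_measure \<phi> u = ?d" unfolding equilibrium_measure_def fr
  proof (rule the_equality)
    show "?d \<in> finite_energy_measures \<phi> \<and> weighted_energy \<phi> ?d + ereal (pairing ?d u) = ereal (L / 2 - c - M)" using mem val by blast
    fix \<mu> assume \<mu>: "\<mu> \<in> finite_energy_measures \<phi> \<and> weighted_energy \<phi> \<mu> + ereal (pairing \<mu> u) = ereal (L / 2 - c - M)"
    then show "\<mu> = ?d" using key[of \<mu>] by auto
  qed
qed

section \<open>The Coulomb gas\<close>

lemma eta_le_0: "s \<le> 1 \<Longrightarrow> eta s \<le> 0"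
proof -
  assume s: "s \<le> 1"
  have "eta s = - ((1 - s) * (3 - s)) / 2" using s by (simp add: eta_def power2_eq_square field_simps)
  moreover have "(1 - s) * (3 - s) \<ge> 0" using s by (intro mult_nonneg_nonneg) simp_all
  ultimately show ?thesis by linarith
qed

lemma eta_ge: "0 \<le> s \<Longrightarrow> s \<le> 1 \<Longrightarrow> eta s \<ge> - 3 / 2"
proof -
  assume s: "0 \<le> s" "s \<le> 1"
  have "s\<^sup>2 \<le> s * 1" unfolding power2_eq_square using s by (intro mult_left_mono)
  then show ?thesis using s by (simp add: eta_def)
qed

lemma eta_le_ln: "s \<ge> 0 \<Longrightarrow> eta s \<le> ln (1 + s)"
proof (cases "s \<le> 1")
  case True
  assume "s \<ge> 0"
  then have "ln (1 + s) \<ge> 0" by simp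
  then show ?thesis using eta_le_0[OF True] by linarith
qed (simp add: eta_def)

lemma disk_pot_inside:
  assumes r: "r > 0" and z: "norm (z - a) < r"
  shows "disk_pot a r z \<le> 2 * ln r" "2 * ln r - 3 / 2 \<le> disk_pot a r z"
proof -
  have "(norm (z - a))\<^sup>2 \<le> r\<^sup>2" using z by (intro power_mono) auto
  then have s: "(norm (z - a))\<^sup>2 / r\<^sup>2 \<le> 1" "0 \<le> (norm (z - a))\<^sup>2 / r\<^sup>2" using r by simp_all
  have l: "ln (r\<^sup>2) = 2 * ln r" using r by (simp add: ln_realpow)
  show "disk_pot a r z \<le> 2 * ln r" "2 * ln r - 3 / 2 \<le> disk_pot a r z"
    using eta_le_0[OF s(1)] eta_ge[OF s(2,1)] unfolding disk_pot_def l by linarith+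
qed

text \<open>From r^2 + |z - a|^2 \<le> 2 (1 + |z|^2) (1 + |a|^2) for r \<le> 1. The bound is uniform
  in r, so a single shift \<open>M\<close> puts the growing potential above all the disk
  potentials.\<close>

lemma disk_pot_le_psi0:
  assumes r: "0 < r" "r \<le> 1"
  shows "disk_pot a r z \<le> ln 2 + psi0 z + psi0 a"
proof -
  let ?s = "(norm (z - a))\<^sup>2"
  have r2: "r\<^sup>2 > 0" "r\<^sup>2 \<le> 1" using r by (simp_all add: power_le_one)
  have p: "1 + ?s / r\<^sup>2 > 0" by (simp add: add_pos_nonneg)
  have "disk_pot a r z \<le> ln (1 + ?s / r\<^sup>2) + ln (r\<^sup>2)" unfolding disk_pot_def by (intro add_right_mono eta_le_ln) simp
  also have "\<dots> = ln ((1 + ?s / r\<^sup>2) * r\<^sup>2)" using p r2 by (intro ln_mult_pos[symmetric])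
  also have "(1 + ?s / r\<^sup>2) * r\<^sup>2 = r\<^sup>2 + ?s" using r by (simp add: field_simps)
  also have "ln (r\<^sup>2 + ?s) \<le> ln (2 * ((1 + (norm z)\<^sup>2) * (1 + (norm a)\<^sup>2)))"
  proof (rule ln_mono)
    show "0 < r\<^sup>2 + ?s" using r2 by (simp add: add_pos_nonneg)
    have "1 * 1 \<le> (1 + (norm z)\<^sup>2) * (1 + (norm a)\<^sup>2)" by (intro mult_mono) simp_all
    then show "r\<^sup>2 + ?s \<le> 2 * ((1 + (norm z)\<^sup>2) * (1 + (norm a)\<^sup>2))" using norm_diff_sq_le[of z a] r2 by linarith
  qed
  also have "\<dots> = ln 2 + (psi0 z + psi0 a)" unfolding psi0_add
    by (rule ln_mult_pos) (simp_all add: add_pos_nonneg)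
  finally show ?thesis by simp
qed

lemma C1_csupp_H1:
  assumes u: "Ck_on (Suc 0) UNIV u" and supp: "\<forall>z. norm z > R \<longrightarrow> u z = 0"
  shows "u \<in> H1"
proof -
  have "sq_int (\<lambda>z. frechet_derivative u (at z) e)" if "e \<in> Basis" for e
  proof (rule sq_int_csupp)
    show "continuous_on UNIV (\<lambda>z. frechet_derivative u (at z) e)" using u that by simp
  qed (rule frechet_derivative_csupp[OF supp[rule_format]])
  from L2_weak_gradient_C1[OF u this] show ?thesis
    unfolding H1_def using L2loc_continuous[OF Ck_on_imp_continuous_on[OF u]] by blast
qed

text \<open>Take u = \<chi> (disk_pot - M - \<phi>) with a smooth cutoff \<chi>. Then \<phi> + u is
  the convex combination of \<phi> and disk_pot - M with weights 1 - \<chi> and \<chi>; both are at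
  least disk_pot - M, and \<chi> = 1 on the ball of radius R/2.\<close>

lemma local_perturbation:
  fixes a :: complex and R r M :: real
  assumes U: "open U" "cball a R \<subseteq> U" and R: "R > 0" and r: "r > 0"
    and h: "Ck_on 2 U h" "\<And>z. z \<in> U \<Longrightarrow> \<phi> z = ereal (h z)"
    and ge: "\<And>z. \<phi> z \<ge> ereal (disk_pot a r z - M)"
  obtains u where "u \<in> H1" "continuous_on UNIV u" "\<forall>z. norm z > norm a + R \<longrightarrow> u z = 0"
    "\<And>z. \<phi> z \<ge> ereal (disk_pot a r z - M - u z)"
    "\<And>z. norm (z - a) \<le> R / 2 \<Longrightarrow> \<phi> z = ereal (disk_pot a r z - M - u z)"
proof -
  let ?v = "\<lambda>z. smooth_step a R z * (disk_pot a r z - h z - M)"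
  define u where "u z = (if z \<in> U then ?v z else 0)" for z
  have ball: "z \<in> U" if "norm (z - a) \<le> R" for z
    using U(2) that by (auto simp: dist_norm norm_minus_commute)
  have out: "u z = 0" if "norm (z - a) \<ge> R" for z using smooth_step(3)[OF R that] by (simp add: u_def)
  have "Ck_on 2 U ?v"
    by (intro Ck_on_mult Ck_on_diff U(1) h(1) Ck_on_const Ck_on_subset[OF smooth_step(1)[OF R]] Ck_on_subset[OF disk_pot_C2(1)[OF r]]) simp_all
  then have 1: "Ck_on 2 U u" using Ck_on_cong[OF U(1), of u ?v 2] by (simp add: u_def)
  \<comment> \<open>\<open>u\<close> is C^2 on \<open>U\<close> by its formula and vanishes on the
    complement of the closed ball; these two open sets cover the plane, so the regularity is
    glued.\<close>
  have o2: "open (- cball a R)" by (simp add: open_Compl)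
  have "Ck_on 2 (- cball a R) (\<lambda>z. 0)" by (rule Ck_on_const)
  then have 2: "Ck_on 2 (- cball a R) u"
    using Ck_on_cong[OF o2, of u "\<lambda>z. 0" 2] out by (simp add: dist_norm norm_minus_commute)
  have "U \<union> - cball a R = UNIV" using U(2) by blast
  with Ck_on_Un[OF U(1) o2 1 2] have C2: "Ck_on 2 UNIV u" by simp
  have supp: "\<forall>z. norm z > norm a + R \<longrightarrow> u z = 0"
  proof (intro allI impI out)
    fix z :: complex assume "norm z > norm a + R"
    then show "norm (z - a) \<ge> R" using norm_triangle_ineq2[of z a] by linarith
  qed
  have uH: "u \<in> H1" by (rule C1_csupp_H1[OF Ck_on_mono[OF C2] supp]) simp
  have uc: "continuous_on UNIV u" by (rule Ck_on_imp_continuous_on[OF C2])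
  have ug: "\<phi> z \<ge> ereal (disk_pot a r z - M - u z)" for z
  proof (cases "z \<in> U")
    case False then show ?thesis using ge[of z] by (simp add: u_def)
  next
    case True
    have "disk_pot a r z - M \<le> h z" using ge[of z] h(2)[OF True] by simp
    then have "0 \<le> (1 - smooth_step a R z) * (h z - (disk_pot a r z - M))"
      using smooth_step(5)[OF R, of a z] by (intro mult_nonneg_nonneg) linarith+
    then have "disk_pot a r z - M - u z \<le> h z" using True by (simp add: u_def algebra_simps)
    then show ?thesis using h(2)[OF True] by simp
  qed
  have ue: "\<phi> z = ereal (disk_pot a r z - M - u z)" if "norm (z - a) \<le> R / 2" for z
  proof -
    have zU: "z \<in> U" by (rule ball) (use that R in linarith)
    show ?thesis unfolding h(2)[OF zU] by (simp add: u_def zU smooth_step(2)[OF R that])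
  qed
  show thesis by (rule that[OF uH uc supp ug ue])
qed

lemma nn_integral_psi0: "(\<integral>\<^sup>+ z. ennreal (exp (- 2 * psi0 z)) \<partial>lborel) < \<infinity>"
proof -
  have e: "exp (- 2 * psi0 z) = inverse ((1 + (norm z)\<^sup>2)\<^sup>2)" for z
  proof -
    have "exp (psi0 z) = 1 + (norm z)\<^sup>2" unfolding psi0_def by (rule exp_ln) (simp add: add_pos_nonneg)
    then show ?thesis by (simp add: exp_minus exp_double)
  qed
  have lim: "((\<lambda>s::real. - inverse (1 + s)) \<longlongrightarrow> 0) at_top" by real_asymp
  have "(\<integral>\<^sup>+s. ennreal (inverse ((1 + s)\<^sup>2)) * indicator {0..} s \<partial>lborel) = ennreal (0 - - inverse (1 + 0))"
    by (rule nn_integral_FTC_atLeast[OF _ _ _ lim])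
       (auto intro!: derivative_eq_intros simp: power2_eq_square field_simps)
  then have "(\<integral>\<^sup>+ z. ennreal (exp (- 2 * psi0 z)) \<partial>lborel) = ennreal pi * ennreal 1"
    unfolding e by (subst nn_integral_radial[of "\<lambda>s. ennreal (inverse ((1 + s)\<^sup>2))"]) simp_all
  then show ?thesis by (simp add: ennreal_mult_less_top)
qed

section \<open>Finiteness of the partition function\<close>

interpretation cprod: product_sigma_finite "\<lambda>_::nat. lborel :: complex measure"
  by (simp add: product_sigma_finite_def sigma_finite_lborel)

lemma coordinate_measurable:
  assumes f: "f \<in> measurable borel M" and i: "i < N"
  shows "(\<lambda>z. f (z i)) \<in> measurable (\<Pi>\<^sub>M i\<in>{..<N}. lborel :: complex measure) M"
proof (rule measurable_compose[OF _ f])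
  show "(\<lambda>z. z i) \<in> measurable (\<Pi>\<^sub>M i\<in>{..<N}. lborel :: complex measure) borel"
    using measurable_component_singleton[of i "{..<N}" "\<lambda>_. lborel :: complex measure"] i by simp
qed

lemma gas_weight_measurable:
  assumes [measurable]: "V \<in> borel_measurable borel"
  shows "gas_weight N \<beta> V \<in> borel_measurable (\<Pi>\<^sub>M i\<in>{..<N}. lborel)"
proof -
  have c: "(\<lambda>z. z i) \<in> measurable (\<Pi>\<^sub>M i\<in>{..<N}. lborel) borel" if "i < N" for i
    using measurable_component_singleton[of i "{..<N}" "\<lambda>_. lborel :: complex measure"] that by simp
  have [measurable]: "boltzmann_factor \<beta> \<in> borel_measurable borel" unfolding boltzmann_factor_def[abs_def] by measurable
  have b: "(\<lambda>w. boltzmann_factor \<beta> (V w)) \<in> borel_measurable borel" by measurable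
  have p: "(\<lambda>z. norm (z i - z j) powr (2 * \<beta>)) \<in> borel_measurable (\<Pi>\<^sub>M i\<in>{..<N}. lborel)" if "i < N" "j < N" for i j
  proof -
    note [measurable] = c[OF that(1)] c[OF that(2)]
    show ?thesis by measurable
  qed
  show ?thesis unfolding gas_weight_def[abs_def]
  proof (intro borel_measurable_times borel_measurable_prod)
    show "(\<lambda>z. norm (z i - z j) powr (2 * \<beta>)) \<in> borel_measurable (\<Pi>\<^sub>M i\<in>{..<N}. lborel)" if "j \<in> {..<N}" "i \<in> {..<j}" for i j
      using that by (intro p) simp_all
    show "(\<lambda>z. boltzmann_factor \<beta> (V (z i))) \<in> borel_measurable (\<Pi>\<^sub>M i\<in>{..<N}. lborel)" if "i \<in> {..<N}" for i
      using measurable_compose[OF c b] that by simp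
  qed
qed

lemma gas_weight_nonneg: "gas_weight N \<beta> V z \<ge> 0"
  unfolding gas_weight_def boltzmann_factor_def by (intro mult_nonneg_nonneg prod_nonneg ballI) auto

text \<open>Each index occurs in N - 1 pairs; the exponent N is allowed because all factors are at
  least 1.\<close>

lemma prod_pairs_le:
  fixes q :: "nat \<Rightarrow> real"
  assumes "\<And>i. q i \<ge> 1"
  shows "(\<Prod>j<N. \<Prod>i<j. q i * q j) \<le> (\<Prod>i<N. q i ^ N)"
proof (induction N)
  case (Suc N)
  have q0: "q i \<ge> 0" for i using assms[of i] by linarith
  have "(\<Prod>j<Suc N. \<Prod>i<j. q i * q j) = (\<Prod>j<N. \<Prod>i<j. q i * q j) * ((\<Prod>i<N. q i) * q N ^ N)"
    by (simp add: prod.distrib)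
  also have "\<dots> \<le> (\<Prod>i<N. q i ^ N) * ((\<Prod>i<N. q i) * q N ^ Suc N)"
  proof (intro mult_mono Suc.IH)
    show "q N ^ N \<le> q N ^ Suc N" using assms[of N] by (intro power_increasing) simp_all
  qed (auto intro!: mult_nonneg_nonneg prod_nonneg zero_le_power q0)
  also have "\<dots> = (\<Prod>i<Suc N. q i ^ Suc N)" by (simp add: prod.distrib mult_ac)
  finally show ?case .
qed simp

text \<open>Distributing the interaction over the particles by \<open>lnsq_le\<close> leaves at most
  exp (\<beta> N (psi0 - \<phi>)) for each of them. Strict growth makes this a constant times exp (-
  \<beta> N \<epsilon> psi0), and \<beta> \<epsilon> N \<ge> 2 is enough for integrability over the
  plane.\<close>

lemma partition_function_finite:
  assumes \<beta>: "\<beta> > 0" and gr: "\<epsilon> > 0" "\<And>z. \<phi> z \<ge> ereal ((1 + \<epsilon>) * psi0 z - C)" and N: "\<beta> * \<epsilon> * real N \<ge> 2"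
  shows "partition_function N \<beta> (\<lambda>z. ereal (real N) * \<phi> z) < \<infinity>"
proof -
  have N0: "N > 0" using N by (cases N) auto
  let ?V = "\<lambda>z. ereal (real N) * \<phi> z"
  let ?q = "\<lambda>z :: complex. exp (\<beta> * psi0 z)"
  define K where "K = exp (\<beta> * real N * C)"
  let ?g = "\<lambda>z. K * exp (- 2 * psi0 z)"
  have q1: "?q z \<ge> 1" for z using \<beta> psi0_nonneg[of z] by simp
  have b: "?q z ^ N * boltzmann_factor \<beta> (?V z) \<le> ?g z" for z
  proof (cases "\<phi> z")
    case PInf
    then show ?thesis using N0 by (simp add: boltzmann_factor_def K_def)
  next
    case MInf then show ?thesis using gr(2)[of z] by simp
  next
    case (real h)
    have h: "(1 + \<epsilon>) * psi0 z - C \<le> h" using gr(2)[of z] real by simp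
    have "?q z ^ N * boltzmann_factor \<beta> (?V z) = exp (\<beta> * real N * (psi0 z - h))"
      using real by (simp add: boltzmann_factor_def exp_of_nat_mult[symmetric] exp_add[symmetric] algebra_simps)
    also have "\<dots> \<le> exp (\<beta> * real N * (C - \<epsilon> * psi0 z))"
      using h \<beta> by (intro exp_le_cancel_iff[THEN iffD2] mult_left_mono) (simp_all add: algebra_simps)
    also have "\<dots> \<le> exp (\<beta> * real N * C - 2 * psi0 z)"
      using mult_right_mono[OF N psi0_nonneg[of z]] by (simp add: algebra_simps)
    also have "\<dots> = ?g z" unfolding K_def by (simp add: exp_diff exp_minus divide_inverse)
    finally show ?thesis .
  qed
  have pair: "norm (z - w) powr (2 * \<beta>) \<le> ?q z * ?q w" for z w :: complex
  proof (cases "z = w")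
    case True then show ?thesis using \<beta> by simp
  next
    case False
    have "norm (z - w) powr (2 * \<beta>) = exp (\<beta> * lnsq (z, w))"
      using False by (simp add: powr_def lnsq_def ln_realpow)
    also have "\<dots> \<le> exp (\<beta> * (psi0 z + psi0 w))" using lnsq_le[OF False] \<beta> by simp
    finally show ?thesis by (simp add: exp_add distrib_left)
  qed
  have W: "gas_weight N \<beta> ?V z \<le> (\<Prod>i<N. ?g (z i))" for z
  proof -
    have bz: "boltzmann_factor \<beta> v \<ge> 0" for v by (simp add: boltzmann_factor_def)
    have "gas_weight N \<beta> ?V z \<le> (\<Prod>j<N. \<Prod>i<j. ?q (z i) * ?q (z j)) * (\<Prod>i<N. boltzmann_factor \<beta> (?V (z i)))"
      unfolding gas_weight_def by (intro mult_right_mono prod_mono conjI prod_nonneg pair ballI bz) auto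
    also have "\<dots> \<le> (\<Prod>i<N. ?q (z i) ^ N) * (\<Prod>i<N. boltzmann_factor \<beta> (?V (z i)))"
      by (intro mult_right_mono prod_pairs_le prod_nonneg bz q1)
    also have "\<dots> = (\<Prod>i<N. ?q (z i) ^ N * boltzmann_factor \<beta> (?V (z i)))" by (rule prod.distrib[symmetric])
    also have "\<dots> \<le> (\<Prod>i<N. ?g (z i))" by (intro prod_mono conjI b mult_nonneg_nonneg bz) simp
    finally show ?thesis .
  qed
  have gm: "(\<lambda>z. ennreal (?g z)) \<in> borel_measurable lborel" by simp
  have "(\<integral>\<^sup>+ z. ennreal (?g z) \<partial>lborel) = ennreal K * (\<integral>\<^sup>+ z. ennreal (exp (- 2 * psi0 z)) \<partial>lborel)"
    by (subst nn_integral_cmult[symmetric]) (simp_all add: ennreal_mult K_def)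
  then have g: "(\<integral>\<^sup>+ z. ennreal (?g z) \<partial>lborel) < \<infinity>" using nn_integral_psi0 by (simp add: ennreal_mult_less_top)
  have "partition_function N \<beta> ?V \<le> (\<integral>\<^sup>+ z. (\<Prod>i<N. ennreal (?g (z i))) \<partial>(\<Pi>\<^sub>M i\<in>{..<N}. lborel))"
    unfolding partition_function_def
  proof (rule nn_integral_mono)
    fix z have "ennreal (gas_weight N \<beta> ?V z) \<le> ennreal (\<Prod>i<N. ?g (z i))" by (rule ennreal_leI[OF W])
    also have "\<dots> = (\<Prod>i<N. ennreal (?g (z i)))" by (rule prod_ennreal[symmetric]) (simp add: K_def)
    finally show "ennreal (gas_weight N \<beta> ?V z) \<le> (\<Prod>i<N. ennreal (?g (z i)))" .
  qed
  also have "\<dots> = (\<Prod>i<N. \<integral>\<^sup>+ z. ennreal (?g z) \<partial>lborel)" by (rule cprod.product_nn_integral_prod) (use gm in simp_all)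
  also have "\<dots> < \<infinity>" using g by (simp add: power_less_top_ennreal)
  finally show ?thesis .
qed

lemma prod_pairs_const: "(\<Prod>j<N. \<Prod>i<j. exp x) = exp (x * (real N * (real N - 1) / 2))" for x :: real
proof (induction N)
  case (Suc N)
  then show ?case by (simp add: exp_of_nat_mult[symmetric] exp_add[symmetric] field_simps)
qed simp

text \<open>N small disks along one radius of the large disk: the centers are r/(2N) apart, which is
  four radii, so points in different slots stay at least a slot radius apart.\<close>

definition slot :: "complex \<Rightarrow> real \<Rightarrow> nat \<Rightarrow> nat \<Rightarrow> complex set" where
  "slot a r N i = ball (a + of_real (r * (real i / (2 * real N)))) (r / (8 * real N))"

lemma slot_subset:
  assumes "r > 0" "i < N" "z \<in> slot a r N i" shows "norm (z - a) < r"
proof -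
  have "norm (z - a) \<le> norm (z - (a + of_real (r * (real i / (2 * real N))))) + norm (of_real (r * (real i / (2 * real N))) :: complex)"
    using norm_triangle_ineq[of "z - (a + of_real (r * (real i / (2 * real N))))" "of_real (r * (real i / (2 * real N)))"] by simp
  also have "\<dots> < r / (8 * real N) + r * (real i / (2 * real N))"
    using assms by (intro add_less_le_mono) (simp_all add: slot_def dist_norm norm_minus_commute norm_mult norm_divide)
  also have "\<dots> \<le> r / 8 + r * (1 / 2)"
    using assms by (intro add_mono mult_left_mono) (simp_all add: field_simps)
  also have "\<dots> < r" using assms(1) by simp
  finally show ?thesis .
qed

lemma slot_distance:
  assumes "r > 0" "i < j" "j < N" "z \<in> slot a r N i" "w \<in> slot a r N j"
  shows "r / (8 * real N) \<le> norm (z - w)"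
proof -
  let ?c = "\<lambda>i. a + of_real (r * (real i / (2 * real N))) :: complex"
  let ?\<rho> = "r / (8 * real N)"
  have N: "real N > 0" using assms by simp
  have "?c j - ?c i = of_real (r * (real (j - i) / (2 * real N)))"
    using assms(2) by (simp add: of_nat_diff diff_divide_distrib right_diff_distrib)
  then have "norm (?c j - ?c i) = r * (real (j - i) / (2 * real N))" using assms(1) by (simp only: norm_of_real) simp
  also have "\<dots> \<ge> r * (1 / (2 * real N))" using assms N by (intro mult_left_mono divide_right_mono) simp_all
  also have "r * (1 / (2 * real N)) = 4 * ?\<rho>" by simp
  finally have "4 * ?\<rho> \<le> norm (?c j - ?c i)" .
  also have "\<dots> \<le> norm (?c j - w) + norm (w - z) + norm (z - ?c i)"
    using dist_triangle[of "?c j" "?c i" w] dist_triangle[of w "?c i" z] unfolding dist_norm by linarith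
  also have "norm (?c j - w) < ?\<rho>" using assms(5) by (simp add: slot_def dist_norm)
  also have "norm (z - ?c i) < ?\<rho>" using assms(4) by (simp add: slot_def dist_norm norm_minus_commute)
  finally have "2 * ?\<rho> \<le> norm (w - z)" by linarith
  moreover have "?\<rho> > 0" using assms(1) N by simp
  ultimately show ?thesis by (simp only: norm_minus_commute)
qed

text \<open>Only configurations with particle i in slot i are kept. There each of the N(N-1)/2 pairs
  contributes at least the slot radius to the power 2\<beta>, the exponential weights are controlled
  by \<open>K\<close>, and the volume is the N-th power of the area of a slot.\<close>

lemma gas_lower_bound:
  assumes \<beta>: "\<beta> > 0" and N: "N \<ge> 1" and r: "r > 0"
    and \<phi>: "\<And>z. norm (z - a) < r \<Longrightarrow> \<phi> z = ereal (g z)" "\<And>z. norm (z - a) < r \<Longrightarrow> g z + u z \<le> K"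
  shows "(\<integral>\<^sup>+ z. ennreal (gas_weight N \<beta> (\<lambda>z. ereal (real N) * \<phi> z) z) * ennreal (exp (- \<beta> * (real N)\<^sup>2 * linear_statistic N u z)) \<partial>(\<Pi>\<^sub>M i\<in>{..<N}. lborel))
    \<ge> ennreal (exp (\<beta> * real N * (real N - 1) * ln (r / (8 * real N)) - \<beta> * (real N)\<^sup>2 * K + real N * ln (pi * (r / (8 * real N))\<^sup>2)))"
proof -
  let ?V = "\<lambda>z. ereal (real N) * \<phi> z" and ?\<rho> = "r / (8 * real N)"
  have rho: "?\<rho> > 0" using r N by simp
  define E where "E = \<beta> * real N * (real N - 1) * ln ?\<rho> - \<beta> * (real N)\<^sup>2 * K"
  \<comment> \<open>A pointwise comparison with the indicator of the product of the slots, so that a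
    single integration yields the bound.\<close>
  have pw: "ennreal (exp E) * (\<Prod>i<N. indicator (slot a r N i) (z i)) \<le>
      ennreal (gas_weight N \<beta> ?V z) * ennreal (exp (- \<beta> * (real N)\<^sup>2 * linear_statistic N u z))" for z
  proof (cases "\<forall>i<N. z i \<in> slot a r N i")
    case False
    then obtain i where "i < N" "z i \<notin> slot a r N i" by blast
    then have z0: "(\<Prod>i<N. indicator (slot a r N i) (z i)) = (0::ennreal)"
      by (intro prod_zero bexI[of _ i]) simp_all
    show ?thesis unfolding z0 mult_zero_right by (rule zero_le)
  next
    case True
    have in_disk: "norm (z i - a) < r" if "i < N" for i using slot_subset[OF r that] True that by blast
    have b: "boltzmann_factor \<beta> (?V (z i)) = exp (- \<beta> * real N * g (z i))" if "i < N" for i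
      using \<phi>(1)[OF in_disk[OF that]] by (simp add: boltzmann_factor_def)
    have "exp (2 * \<beta> * ln x) = x powr (2 * \<beta>)" if "x > 0" for x :: real using that by (simp add: powr_def)
    from this[OF rho] have "exp (2 * \<beta> * ln ?\<rho> * (real N * (real N - 1) / 2)) = (\<Prod>j<N. \<Prod>i<j. ?\<rho> powr (2 * \<beta>))"
      unfolding prod_pairs_const[symmetric] by simp
    also have "\<dots> \<le> (\<Prod>j<N. \<Prod>i<j. norm (z i - z j) powr (2 * \<beta>))"
      using True \<beta> rho by (intro prod_mono conjI prod_nonneg ballI powr_mono2 slot_distance[OF r, of _ _ N _ a]) auto
    finally have 1: "exp (2 * \<beta> * ln ?\<rho> * (real N * (real N - 1) / 2)) \<le> (\<Prod>j<N. \<Prod>i<j. norm (z i - z j) powr (2 * \<beta>))" .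
    have "(\<Prod>i<N. boltzmann_factor \<beta> (?V (z i))) = exp (\<Sum>i<N. - \<beta> * real N * g (z i))"
      unfolding exp_sum[OF finite_lessThan] by (intro prod.cong refl b) simp
    moreover have "\<beta> * (real N)\<^sup>2 * linear_statistic N u z = (\<Sum>i<N. \<beta> * real N * u (z i))"
      using N by (simp add: linear_statistic_def power2_eq_square sum_distrib_left[symmetric])
    then have "exp (- \<beta> * (real N)\<^sup>2 * linear_statistic N u z) = exp (- (\<Sum>i<N. \<beta> * real N * u (z i)))" by simp
    ultimately have "(\<Prod>i<N. boltzmann_factor \<beta> (?V (z i))) * exp (- \<beta> * (real N)\<^sup>2 * linear_statistic N u z)
       = exp (- (\<Sum>i<N. \<beta> * real N * (g (z i) + u (z i))))"
      by (simp add: exp_add[symmetric] sum.distrib distrib_left sum_negf)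
    also have "\<dots> \<ge> exp (- (\<Sum>i<N. \<beta> * real N * K))"
      unfolding exp_le_cancel_iff neg_le_iff_le
      using \<beta> in_disk by (intro sum_mono mult_left_mono \<phi>(2)) simp_all
    also have "(\<Sum>i<N. \<beta> * real N * K) = \<beta> * (real N)\<^sup>2 * K" by (simp add: power2_eq_square)
    finally have 2: "exp (- (\<beta> * (real N)\<^sup>2 * K)) \<le> (\<Prod>i<N. boltzmann_factor \<beta> (?V (z i))) * exp (- \<beta> * (real N)\<^sup>2 * linear_statistic N u z)" .
    have "exp E = exp (2 * \<beta> * ln ?\<rho> * (real N * (real N - 1) / 2)) * exp (- (\<beta> * (real N)\<^sup>2 * K))"
      unfolding exp_add[symmetric] E_def by (simp add: algebra_simps)
    also have "\<dots> \<le> (\<Prod>j<N. \<Prod>i<j. norm (z i - z j) powr (2 * \<beta>)) * ((\<Prod>i<N. boltzmann_factor \<beta> (?V (z i))) * exp (- \<beta> * (real N)\<^sup>2 * linear_statistic N u z))"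
      by (intro mult_mono 1 2 prod_nonneg ballI) auto
    finally have "exp E \<le> gas_weight N \<beta> ?V z * exp (- \<beta> * (real N)\<^sup>2 * linear_statistic N u z)"
      unfolding gas_weight_def by (simp only: mult.assoc)
    then have "ennreal (exp E) \<le> ennreal (gas_weight N \<beta> ?V z) * ennreal (exp (- \<beta> * (real N)\<^sup>2 * linear_statistic N u z))"
      unfolding ennreal_mult[OF gas_weight_nonneg exp_ge_zero, symmetric] by (rule ennreal_leI)
    moreover have "(\<Prod>i<N. indicator (slot a r N i) (z i)) = (1::ennreal)" using True by (intro prod.neutral) simp
    ultimately show ?thesis by simp
  qed
  have sl: "slot a r N i \<in> sets lborel" for i by (simp add: slot_def)
  have im: "(\<lambda>x. indicator (slot a r N i) x :: ennreal) \<in> borel_measurable lborel" for i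
    by (rule borel_measurable_indicator) (rule sl)
  have v: "emeasure lborel (slot a r N i) = ennreal (pi * ?\<rho>\<^sup>2)" for i
    unfolding slot_def using rho by (subst emeasure_ball) (simp_all add: unit_ball_vol_2)
  have mm: "(\<lambda>z. \<Prod>i<N. indicator (slot a r N i) (z i) :: ennreal) \<in> borel_measurable (\<Pi>\<^sub>M i\<in>{..<N}. lborel)"
    by (intro borel_measurable_prod_ennreal coordinate_measurable borel_measurable_indicator) (simp_all add: slot_def)
  have pv: "pi * ?\<rho>\<^sup>2 > 0" using rho by (intro mult_pos_pos pi_gt_zero zero_less_power)
  have "exp (E + real N * ln (pi * ?\<rho>\<^sup>2)) = exp E * (pi * ?\<rho>\<^sup>2) ^ N"
    using pv by (simp only: exp_add exp_of_nat_mult exp_ln)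
  then have "ennreal (exp (E + real N * ln (pi * ?\<rho>\<^sup>2))) = ennreal (exp E) * (\<Prod>i<N. emeasure lborel (slot a r N i))"
    unfolding v using pv by (simp only: prod_constant card_lessThan ennreal_mult ennreal_power less_imp_le exp_ge_zero zero_le_power)
  also have "(\<Prod>i<N. emeasure lborel (slot a r N i)) = (\<integral>\<^sup>+ z. (\<Prod>i<N. indicator (slot a r N i) (z i)) \<partial>(\<Pi>\<^sub>M i\<in>{..<N}. lborel))"
    by (subst cprod.product_nn_integral_prod[OF finite_lessThan im]) (intro prod.cong refl nn_integral_indicator[OF sl, symmetric])
  also have "ennreal (exp E) * \<dots> = (\<integral>\<^sup>+ z. ennreal (exp E) * (\<Prod>i<N. indicator (slot a r N i) (z i)) \<partial>(\<Pi>\<^sub>M i\<in>{..<N}. lborel))"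
    by (rule nn_integral_cmult[OF mm, symmetric])
  also have "\<dots> \<le> (\<integral>\<^sup>+ z. ennreal (gas_weight N \<beta> ?V z) * ennreal (exp (- \<beta> * (real N)\<^sup>2 * linear_statistic N u z)) \<partial>(\<Pi>\<^sub>M i\<in>{..<N}. lborel))"
    by (rule nn_integral_mono) (rule pw)
  finally show ?thesis unfolding E_def .
qed

lemma linear_statistic_measurable:
  assumes u: "u \<in> borel_measurable borel"
  shows "linear_statistic N u \<in> borel_measurable (\<Pi>\<^sub>M i\<in>{..<N}. lborel)"
  unfolding linear_statistic_def[abs_def]
  by (intro borel_measurable_times borel_measurable_sum borel_measurable_const coordinate_measurable u) simp

lemma laplace_transform_eq:
  assumes [measurable]: "V \<in> borel_measurable borel" "u \<in> borel_measurable borel"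
  shows "laplace_transform N \<beta> V u = (\<integral>\<^sup>+ z. ennreal (gas_weight N \<beta> V z) * ennreal (exp (- \<beta> * (real N)\<^sup>2 * linear_statistic N u z)) \<partial>(\<Pi>\<^sub>M i\<in>{..<N}. lborel)) / partition_function N \<beta> V"
proof -
  note [measurable] = gas_weight_measurable[OF assms(1)] linear_statistic_measurable[OF assms(2)]
  have "laplace_transform N \<beta> V u = (\<integral>\<^sup>+ z. ennreal (gas_weight N \<beta> V z) / partition_function N \<beta> V * ennreal (exp (- \<beta> * (real N)\<^sup>2 * linear_statistic N u z)) \<partial>(\<Pi>\<^sub>M i\<in>{..<N}. lborel))"
    unfolding laplace_transform_def coulomb_gas_def by (rule nn_integral_density) measurable
  also have "\<dots> = (\<integral>\<^sup>+ z. ennreal (gas_weight N \<beta> V z) * ennreal (exp (- \<beta> * (real N)\<^sup>2 * linear_statistic N u z)) / partition_function N \<beta> V \<partial>(\<Pi>\<^sub>M i\<in>{..<N}. lborel))"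
    by (intro nn_integral_cong) (simp only: divide_ennreal_def mult_ac)
  also have "\<dots> = (\<integral>\<^sup>+ z. ennreal (gas_weight N \<beta> V z) * ennreal (exp (- \<beta> * (real N)\<^sup>2 * linear_statistic N u z)) \<partial>(\<Pi>\<^sub>M i\<in>{..<N}. lborel)) / partition_function N \<beta> V"
    by (rule nn_integral_divide) measurable
  finally show ?thesis .
qed

text \<open>Covers an infinite argument as well, so finiteness of the Laplace transform need not be
  established.\<close>

lemma log_ereal_ge:
  assumes "ennreal (exp x) \<le> y" shows "ereal x \<le> log_ereal (enn2ereal y)"
proof (cases y)
  case top then show ?thesis by (simp add: log_ereal_def)
next
  case (real t)
  then have "exp x \<le> t" using assms by simp
  moreover have "t > 0" using \<open>exp x \<le> t\<close> exp_gt_zero[of x] by linarith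
  ultimately have "x \<le> ln t" by (simp add: ln_ge_iff)
  then show ?thesis using real \<open>t > 0\<close> by (simp add: log_ereal_def)
qed

lemma gas_laplace_lower_bound:
  assumes \<beta>: "\<beta> > 0" and N: "N \<ge> 1" and r: "r > 0" and V: "\<phi> \<in> borel_measurable borel" and u: "u \<in> borel_measurable borel"
    and \<phi>: "\<And>z. norm (z - a) < r \<Longrightarrow> \<phi> z = ereal (g z)" "\<And>z. norm (z - a) < r \<Longrightarrow> g z + u z \<le> K"
    and fin: "partition_function N \<beta> (\<lambda>z. ereal (real N) * \<phi> z) < \<infinity>"
  defines "Z \<equiv> enn2real (partition_function N \<beta> (\<lambda>z. ereal (real N) * \<phi> z))"
  shows "prob_space (coulomb_gas N \<beta> (\<lambda>z. ereal (real N) * \<phi> z))"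
    "log_ereal (enn2ereal (laplace_transform N \<beta> (\<lambda>z. ereal (real N) * \<phi> z) u))
       \<ge> ereal (\<beta> * real N * (real N - 1) * ln (r / (8 * real N)) - \<beta> * (real N)\<^sup>2 * K + real N * ln (pi * (r / (8 * real N))\<^sup>2) - ln Z)"
proof -
  let ?V = "\<lambda>z. ereal (real N) * \<phi> z" and ?M = "\<Pi>\<^sub>M i\<in>{..<N}. lborel :: complex measure"
  let ?P = "partition_function N \<beta> ?V"
  have Vm: "?V \<in> borel_measurable borel" using V by measurable
  note wm[measurable] = gas_weight_measurable[OF Vm, of N \<beta>]
  let ?I = "\<integral>\<^sup>+ z. ennreal (gas_weight N \<beta> ?V z) * ennreal (exp (- \<beta> * (real N)\<^sup>2 * linear_statistic N u z)) \<partial>?M"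
  let ?E = "\<beta> * real N * (real N - 1) * ln (r / (8 * real N)) - \<beta> * (real N)\<^sup>2 * K + real N * ln (pi * (r / (8 * real N))\<^sup>2)"
  have I: "ennreal (exp ?E) \<le> ?I" by (rule gas_lower_bound[OF \<beta> N r \<phi>])
  \<comment> \<open>A vanishing partition function would make the weight vanish almost everywhere,
    and with it the integral just bounded below by an exponential.\<close>
  have P0: "?P \<noteq> 0"
  proof
    assume "?P = 0"
    then have "AE z in ?M. ennreal (gas_weight N \<beta> ?V z) = 0"
      unfolding partition_function_def by (subst (asm) nn_integral_0_iff_AE) simp_all
    then have "AE z in ?M. ennreal (gas_weight N \<beta> ?V z) * ennreal (exp (- \<beta> * (real N)\<^sup>2 * linear_statistic N u z)) = 0"
      by eventually_elim simp
    then have "?I = 0" by (subst nn_integral_cong_AE[of _ "\<lambda>_. 0"]) simp_all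
    then show False using I by (simp add: ennreal_eq_0_iff)
  qed
  have PZ: "?P = ennreal Z" using fin unfolding Z_def by (simp add: ennreal_enn2real)
  have Z: "Z > 0" using P0 unfolding PZ by (simp add: ennreal_eq_0_iff)
  show "prob_space (coulomb_gas N \<beta> ?V)"
  proof (rule prob_spaceI)
    have "emeasure (coulomb_gas N \<beta> ?V) (space (coulomb_gas N \<beta> ?V)) = (\<integral>\<^sup>+ z. ennreal (gas_weight N \<beta> ?V z) / ?P \<partial>?M)"
      unfolding coulomb_gas_def by (subst emeasure_density) (auto intro!: nn_integral_cong)
    also have "\<dots> = ?P / ?P" unfolding partition_function_def by (rule nn_integral_divide) measurable
    also have "\<dots> = 1" using P0 fin by (intro ennreal_divide_self) simp_all
    finally show "emeasure (coulomb_gas N \<beta> ?V) (space (coulomb_gas N \<beta> ?V)) = 1" .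
  qed
  show "log_ereal (enn2ereal (laplace_transform N \<beta> ?V u)) \<ge> ereal (?E - ln Z)"
  proof (rule log_ereal_ge)
    have "ennreal (exp (?E - ln Z)) = ennreal (exp ?E) / ennreal Z"
      using Z by (subst divide_ennreal) (simp_all only: exp_diff exp_ln exp_ge_zero)
    also have "\<dots> \<le> ?I / ennreal Z" by (rule divide_right_mono_ennreal[OF I])
    finally show "ennreal (exp (?E - ln Z)) \<le> laplace_transform N \<beta> ?V u"
      unfolding laplace_transform_eq[OF Vm u] PZ .
  qed
qed

section \<open>The limit of small disks\<close>

text \<open>On the disk the potential lies between 2 ln r - 3/2 + c and 2 ln r + c, and the
  self-energy is its average against a density of mass 1.\<close>

lemma disk_self_energy:
  assumes r: "r > 0" and c: "\<And>z. potential (disk_dens a r) z = disk_pot a r z + c"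
  shows "2 * ln r - 3 / 2 + c \<le> (LINT z|lborel. potential (disk_dens a r) z * disk_dens a r z)"
    "(LINT z|lborel. potential (disk_dens a r) z * disk_dens a r z) \<le> 2 * ln r + c"
proof -
  interpret csupp_density "disk_dens a r" "norm a + r" by (rule disk_dens_csupp[OF r])
  let ?f = "disk_dens a r"
  have i: "integrable lborel (\<lambda>z. potential ?f z * ?f z)"
    by (rule pair_integrable(2)[OF sigma_finite_lborel sets_lborel integrable_f integrable_psi0_f])
  have k: "(LINT z|lborel. x * ?f z) = x" for x by (simp add: integral_disk_dens[OF r])
  have b: "(2 * ln r - 3 / 2 + c) * ?f z \<le> potential ?f z * ?f z \<and> potential ?f z * ?f z \<le> (2 * ln r + c) * ?f z" for z
  proof (cases "norm (z - a) < r")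
    case True
    then show ?thesis unfolding c using disk_pot_inside[OF r True]
      by (intro conjI mult_right_mono disk_dens_nonneg) linarith+
  next
    case False then show ?thesis using disk_dens_outside[OF r, of z a] by simp
  qed
  have "(LINT z|lborel. (2 * ln r - 3 / 2 + c) * ?f z) \<le> (LINT z|lborel. potential ?f z * ?f z)"
    by (rule integral_mono[OF integrable_mult_right[OF integrable_f] i]) (use b in blast)
  then show "2 * ln r - 3 / 2 + c \<le> (LINT z|lborel. potential ?f z * ?f z)" unfolding k .
  have "(LINT z|lborel. potential ?f z * ?f z) \<le> (LINT z|lborel. (2 * ln r + c) * ?f z)"
    by (rule integral_mono[OF i integrable_mult_right[OF integrable_f]]) (use b in blast)
  then show "(LINT z|lborel. potential ?f z * ?f z) \<le> 2 * ln r + c" unfolding k .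
qed

lemma slope_le_0:
  fixes k K l0 :: real
  assumes "\<And>l. l \<ge> l0 \<Longrightarrow> k * l \<le> K" shows "k \<le> 0"
proof (rule ccontr)
  assume "\<not> k \<le> 0"
  then have k: "k > 0" by simp
  have "k * max l0 (K / k + 1) \<le> K" by (rule assms) simp
  moreover have "k * (K / k + 1) \<le> k * max l0 (K / k + 1)" using k by (intro mult_left_mono) simp_all
  moreover have "k * (K / k + 1) = K + k" using k by (simp add: field_simps)
  ultimately show False using k by linarith
qed

theorem proposition6p2:
  fixes \<beta> p A C :: real and \<phi> :: "complex \<Rightarrow> ereal"
  assumes "0 < \<beta>" and "\<beta> < 2" and "p = 2 / \<beta> - 1"
    and "\<And>z. \<phi> z \<noteq> -\<infinity>"
    and "lower_semicontinuous \<phi>"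
    and "strictly_super_log_growth \<phi>"
    and "\<not> polar {z. \<phi> z < \<infinity>}"
    and "regularity_assumption \<phi>"
    and "\<And>N u. \<lbrakk>N \<ge> 1; prob_space (coulomb_gas N \<beta> (\<lambda>z. ereal (real N) * \<phi> z)); u \<in> H1\<rbrakk> \<Longrightarrow>
      ereal (1 / (\<beta> * (real N)\<^sup>2)) *
        log_ereal (enn2ereal (laplace_transform N \<beta> (\<lambda>z. ereal (real N) * \<phi> z) u))
      \<le> - free_energy \<phi> u + free_energy \<phi> (\<lambda>_. 0)
        + ereal (1 / real N) *
          (- ereal A * log_energy (equilibrium_measure \<phi> u) + ereal C)"
  shows "A \<le> p"
proof (rule ccontr)
  assume "\<not> A \<le> p"
  then have Ap: "A > 2 / \<beta> - 1" using assms(3) by simp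
  \<comment> \<open>Here \<beta> < 2 is used. A positive \<open>A\<close> lets the upper bound on
    \<open>L r\<close> be inserted into the error term of the hypothesis at the end.\<close>
  have "2 / \<beta> > 1" using assms(1,2) by simp
  with Ap have A: "A > 0" by linarith
  note \<beta> = assms(1) and lsc = assms(5)
  obtain \<epsilon> C0 where gr: "\<epsilon> > 0" "\<And>z. \<phi> z \<ge> ereal ((1 + \<epsilon>) * psi0 z - C0)"
    using assms(6) unfolding strictly_super_log_growth_def by blast
  obtain U where U: "open U" "measure_support (equilibrium_measure \<phi> (\<lambda>_. 0)) \<subseteq> U" "\<forall>z\<in>U. \<phi> z < \<infinity>"
      "Ck_on 5 U (\<lambda>z. real_of_ereal (\<phi> z))" "C1_boundary_closed_domain (measure_support (equilibrium_measure \<phi> (\<lambda>_. 0)))"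
    using assms(8) unfolding regularity_assumption_def Let_def by blast
  \<comment> \<open>The regularity assumption serves to locate a point near which \<phi> is finite
    and C^5: the support is the closure of a nonempty domain, so \<open>U\<close> is
    nonempty.\<close>
  obtain D where "D \<noteq> {}" "measure_support (equilibrium_measure \<phi> (\<lambda>_. 0)) = closure D"
    using U(5) unfolding C1_boundary_closed_domain_def C1_boundary_domain_def by blast
  then obtain a where a: "a \<in> U" using U(2) closure_subset[of D] by blast
  obtain R where R: "R > 0" "cball a R \<subseteq> U" using U(1) a unfolding open_contains_cball by blast
  let ?h = "\<lambda>z. real_of_ereal (\<phi> z)"
  have h2: "Ck_on 2 U ?h" by (rule Ck_on_mono[OF U(4)]) simp
  have \<phi>h: "\<phi> z = ereal (?h z)" if "z \<in> U" for z
    using U(3) assms(4)[of z] that by (cases "\<phi> z") auto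
  obtain c where c: "\<And>r z. r > 0 \<Longrightarrow> potential (disk_dens a r) z = disk_pot a r z + c"
    using potential_disk[of a] by blast
  \<comment> \<open>Collects the constants of \<open>disk_pot_le_psi0\<close> and of the growth
    condition, so that disk_pot - M stays below \<phi> for every r \<le> 1.\<close>
  define M where "M = ln 2 + psi0 a + C0"
  have ge: "\<phi> z \<ge> ereal (disk_pot a r z - M)" if "0 < r" "r \<le> 1" for r z
  proof -
    have "\<epsilon> * psi0 z \<ge> 0" using gr(1) psi0_nonneg by simp
    then have "disk_pot a r z - M \<le> (1 + \<epsilon>) * psi0 z - C0"
      using disk_pot_le_psi0[OF that, of a z] by (simp add: M_def algebra_simps)
    then have "ereal (disk_pot a r z - M) \<le> ereal ((1 + \<epsilon>) * psi0 z - C0)" by simp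
    then show ?thesis using gr(2)[of z] by (rule order_trans)
  qed
  \<comment> \<open>Below 1 for the uniform bound with \<open>M\<close>, and below R/2 so that the
    disk lies where the cutoff equals 1.\<close>
  define r0 where "r0 = min 1 (R / 2)"
  have r0: "r0 > 0" using R(1) by (simp add: r0_def)
  \<comment> \<open>N stays fixed from here on and only r varies; this size gives \<beta> \<epsilon>
    N \<ge> 2, so the gas is a probability measure and the hypothesis applies.\<close>
  define N where "N = nat \<lceil>2 / (\<beta> * \<epsilon>)\<rceil> + 1"
  have N: "N \<ge> 1" "real N > 0" by (simp_all add: N_def)
  have "2 / (\<beta> * \<epsilon>) \<le> real N" unfolding N_def by linarith
  then have N2: "\<beta> * \<epsilon> * real N \<ge> 2" using \<beta> gr(1) by (simp add: pos_divide_le_eq mult.commute)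
  let ?V = "\<lambda>z. ereal (real N) * \<phi> z"
  have fin: "partition_function N \<beta> ?V < \<infinity>" by (rule partition_function_finite[OF \<beta> gr N2])
  define Z where "Z = enn2real (partition_function N \<beta> ?V)"
  define s where "s = 1 / (8 * real N)"
  have s: "s > 0" using N by (simp add: s_def)
  have \<phi>m: "\<phi> \<in> borel_measurable borel" by (rule lower_semicontinuous_measurable[OF lsc])
  \<comment> \<open>The lower bound of \<open>gas_laplace_lower_bound\<close> with K = 2 ln r - M,
    which bounds \<phi> + u = disk_pot - M on the disk.\<close>
  define Q where "Q = (\<lambda>r. \<beta> * real N * (real N - 1) * ln (r / (8 * real N)) - \<beta> * (real N)\<^sup>2 * (2 * ln r - M) + real N * ln (pi * (r / (8 * real N))\<^sup>2) - ln Z)"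
  define L where "L r = (LINT z|lborel. potential (disk_dens a r) z * disk_dens a r z)" for r
  have main: "ereal (Q r / (\<beta> * (real N)\<^sup>2))
      \<le> - ereal (L r / 2 - c - M) + free_energy \<phi> (\<lambda>_. 0) + ereal (1 / real N) * (- ereal A * ereal (- (1/2) * L r) + ereal C)"
    and F0: "free_energy \<phi> (\<lambda>_. 0) < \<infinity>" if r: "0 < r" "r \<le> r0" for r
  proof -
    have r1: "r \<le> 1" "r \<le> R / 2" using r(2) by (simp_all add: r0_def)
    obtain u where u: "u \<in> H1" "continuous_on UNIV u" "\<forall>z. norm z > norm a + R \<longrightarrow> u z = 0"
      "\<And>z. \<phi> z \<ge> ereal (disk_pot a r z - M - u z)"
      "\<And>z. norm (z - a) \<le> R / 2 \<Longrightarrow> \<phi> z = ereal (disk_pot a r z - M - u z)"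
      by (rule local_perturbation[OF U(1) R(2,1) r(1) h2 \<phi>h ge[OF r(1) r1(1)]]) (assumption, rule that)
    have eq: "\<phi> z = ereal (disk_pot a r z - M - u z)" if "norm (z - a) < r" for z
      by (rule u(5)) (use that r1(2) in linarith)
    have E: "free_energy \<phi> u = ereal (L r / 2 - c - M)" "equilibrium_measure \<phi> u = disk_measure a r"
      "disk_measure a r \<in> finite_energy_measures \<phi>" "log_energy (disk_measure a r) = ereal (- (1/2) * L r)"
      unfolding L_def by (rule equilibrium_disk[OF lsc gr u(1-3) r(1) u(4) _ c[OF r(1)]], rule eq, assumption)+
    have "weighted_energy \<phi> (disk_measure a r) < \<infinity>" using E(3) unfolding finite_energy_measures_def by blast
    \<comment> \<open>\<open>pairing\<close> is real-valued, so the disk measure is a competitor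
      with finite value for the unperturbed problem and its infimum is below \<infinity>.\<close>
    then have wf: "weighted_energy \<phi> (disk_measure a r) + ereal (pairing (disk_measure a r) (\<lambda>_. 0)) < \<infinity>"
      by (cases "weighted_energy \<phi> (disk_measure a r)") simp_all
    have "free_energy \<phi> (\<lambda>_. 0) \<le> weighted_energy \<phi> (disk_measure a r) + ereal (pairing (disk_measure a r) (\<lambda>_. 0))"
      unfolding free_energy_def by (rule INF_lower[OF E(3)])
    then show "free_energy \<phi> (\<lambda>_. 0) < \<infinity>" using wf by (rule le_less_trans)
    have up: "disk_pot a r z - M - u z + u z \<le> 2 * ln r - M" if "norm (z - a) < r" for z
      using disk_pot_inside(1)[OF r(1) that] by simp
    have um: "u \<in> borel_measurable borel" by (rule borel_measurable_continuous_onI[OF u(2)])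
    note g = gas_laplace_lower_bound[where a = a and g = "\<lambda>z. disk_pot a r z - M - u z" and K = "2 * ln r - M", OF \<beta> N(1) r(1) \<phi>m um _ _ fin]
    have G: "prob_space (coulomb_gas N \<beta> ?V)" "ereal (Q r) \<le> log_ereal (enn2ereal (laplace_transform N \<beta> ?V u))"
      unfolding Q_def Z_def by (rule g, erule eq, erule up)+
    have cpos: "0 \<le> 1 / (\<beta> * (real N)\<^sup>2)" using \<beta> by (intro divide_nonneg_nonneg mult_nonneg_nonneg) simp_all
    have cp: "0 \<le> ereal (1 / (\<beta> * (real N)\<^sup>2))" unfolding zero_ereal_def ereal_less_eq(3) by (rule cpos)
    have "ereal (1 / (\<beta> * (real N)\<^sup>2)) * ereal (Q r)
        \<le> ereal (1 / (\<beta> * (real N)\<^sup>2)) * log_ereal (enn2ereal (laplace_transform N \<beta> ?V u))"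
      by (rule ereal_mult_left_mono[OF G(2) cp])
    also note assms(9)[OF N(1) G(1) u(1)]
    finally show "ereal (Q r / (\<beta> * (real N)\<^sup>2))
      \<le> - ereal (L r / 2 - c - M) + free_energy \<phi> (\<lambda>_. 0) + ereal (1 / real N) * (- ereal A * ereal (- (1/2) * L r) + ereal C)"
      unfolding E(1,2,4) by simp
  qed
  \<comment> \<open>The value -\<infinity> would make the right-hand side of \<open>main\<close>
    equal to -\<infinity>, although the left-hand side is real.\<close>
  have "free_energy \<phi> (\<lambda>_. 0) \<noteq> -\<infinity>" using main[OF r0 order_refl] by auto
  then obtain f0 where f0: "free_energy \<phi> (\<lambda>_. 0) = ereal f0"
    using F0[OF r0 order_refl] by (cases "free_energy \<phi> (\<lambda>_. 0)") auto
  let ?n = "real N"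
  \<comment> \<open>\<open>R0\<close> and \<open>X0\<close> gather the terms that do not depend on l
    = - ln r, on the right and on the left of the inequality respectively.\<close>
  define R0 where "R0 = \<beta> * ?n\<^sup>2 * (3 / 4 + c / 2 + M + f0) + \<beta> * ?n * (A * (c / 2) + C)"
  define X0 where "X0 = \<beta> * ?n * (?n - 1) * ln s + \<beta> * ?n\<^sup>2 * M + ?n * (ln pi + 2 * ln s) - ln Z"
  \<comment> \<open>In terms of l = - ln r both sides of the hypothesis, multiplied by \<beta> N^2,
    are affine up to bounded errors, with slopes \<beta> N^2 + \<beta> N - 2N and \<beta> N^2 -
    \<beta> N A. Since l is unbounded, the slopes must be ordered.\<close>
  have "?n * (\<beta> + \<beta> * A - 2) \<le> 0"
  proof (rule slope_le_0)
    fix l assume l: "l \<ge> - ln r0"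
    define r where "r = exp (- l)"
    have r: "r > 0" "ln r = - l" by (simp_all add: r_def)
    have "r \<le> exp (ln r0)" unfolding r_def exp_le_cancel_iff using l by linarith
    then have r': "r \<le> r0" using r0 by simp
    have rs: "r / (8 * ?n) = r * s" by (simp add: s_def)
    have lrs: "ln (r * s) = - l + ln s" using r s by (simp add: ln_mult_pos)
    have lp: "ln (pi * (r * s)\<^sup>2) = ln pi + 2 * (- l + ln s)" unfolding lrs[symmetric] using r s by (simp add: ln_mult_pos ln_realpow)
    have q: "Q r = l * (\<beta> * ?n\<^sup>2 + \<beta> * ?n - 2 * ?n) + X0"
      unfolding Q_def rs r(2) X0_def lp lrs by (simp add: power2_eq_square algebra_simps)
    note L = disk_self_energy[OF r(1) c[OF r(1)], folded L_def, unfolded r(2)]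
    have "Q r / (\<beta> * ?n\<^sup>2) \<le> - (L r / 2 - c - M) + f0 + 1 / ?n * (A * (L r / 2) + C)"
      using main[OF r(1) r'] unfolding f0 by simp
    \<comment> \<open>The lower bound on the self-energy serves the free energy and the upper bound
      serves the error term, where \<open>A\<close> is positive.\<close>
    also have "\<dots> \<le> (l + 3 / 4 - c / 2 + c + M + f0) + 1 / ?n * (A * (- l + c / 2) + C)"
    proof (rule add_mono)
      show "- (L r / 2 - c - M) + f0 \<le> l + 3 / 4 - c / 2 + c + M + f0" using L(1) by linarith
      show "1 / ?n * (A * (L r / 2) + C) \<le> 1 / ?n * (A * (- l + c / 2) + C)"
        using L(2) A by (intro mult_left_mono add_right_mono) simp_all
    qed
    finally have "Q r \<le> ((l + 3 / 4 - c / 2 + c + M + f0) + 1 / ?n * (A * (- l + c / 2) + C)) * (\<beta> * ?n\<^sup>2)"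
      using \<beta> N(2) by (subst (asm) pos_divide_le_eq) simp_all
    also have "\<dots> = l * (\<beta> * ?n\<^sup>2 - \<beta> * ?n * A) + R0"
      unfolding R0_def using N(2) by (simp add: power2_eq_square field_simps)
    finally show "?n * (\<beta> + \<beta> * A - 2) * l \<le> R0 - X0" unfolding q by (simp add: algebra_simps)
  qed
  then have "\<beta> + \<beta> * A \<le> 2" using N(2) by (simp add: mult_le_0_iff)
  moreover have "2 < \<beta> + \<beta> * A" using Ap \<beta> by (simp add: field_simps)
  ultimately show False by simp
qed

end
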